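(* Let $\omega\subset\mathbb{R}^2$ be one of the following two domains: (i) $\omega=\omega^\lozenge=\{(y,z)\in\mathbb{R}^2 : |y|+|z|<1/2\}$, in which case put $\alpha=2/3$; or (ii) $\omega=\omega^\circ=\{(y,z)\in\mathbb{R}^2 : |y|^2+|z|^2<1/4\}$, in which case put $\alpha=1/2$. For $H>0$ let $Q^H=Q^H_1\cup Q^H_2\subset\mathbb{R}^3$ with $Q^H_j=\{x=(x_1,x_2,x_3)\in\mathbb{R}^3 : (x_{3-j},H^{-1}x_3)\in\omega\}$, $j=1,2$, and let $\mathcal{A}^H$ be the Dirichlet Laplacian ($-\Delta$ with zero Dirichlet condition on $\partial Q^H$) in $L^2(Q^H)$. Then in each of the cases (i), (ii), for any $N\in\mathbb{N}=\{1,2,3,\dots\}$ there exist positive numbers $H_N$ and $C_N$ such that for every $H>H_N$ the total multiplicity $\#\sigma_d^H$ of the discrete spectrum of $\mathcal{A}^H$ satisfies $\#\sigma_d^H\ge N$, and $$\lambda_N^H<\Lambda_\Pi+C_NH^{-\alpha}<\pi^2<\lambda_\dagger^H .$$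
   Context: The operator $\mathcal{A}^H$ is the positive definite self-adjoint operator in $L^2(Q^H)$ generated by the closed form $(\nabla u,\nabla v)_{L^2(Q^H)}$ on $H^1_0(Q^H)$. Its continuous spectrum is $[\lambda_\dagger^H,+\infty)$, where $\lambda_\dagger^H$ is the first eigenvalue of the Dirichlet Laplacian on the cross-section $\omega^H=\{(y,z)\in\mathbb{R}^2 : (y,H^{-1}z)\in\omega\}$. The discrete spectrum $\sigma_d^H$ consists of the eigenvalues of $\mathcal{A}^H$ in $(0,\lambda_\dagger^H)$, listed with multiplicity as $0<\lambda_1^H<\lambda_2^H\le\dots\le\lambda^H_{\#\sigma_d^H}<\lambda_\dagger^H$; $\#\sigma_d^H$ denotes its total multiplicity. $\Pi=\{(x_1,x_2)\in\mathbb{R}^2 : |x_1|<1/2 \text{ or } |x_2|<1/2\}$ is the planar cruciform waveguide of unit width. The continuous spectrum of the Dirichlet Laplacian on $\Pi$ is $[\pi^2,+\infty)$, and it is known that its discrete spectrum consists of exactly one (simple) eigenvalue, denoted $\Lambda_\Pi\in(0,\pi^2)$. *)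

theory Defs
  imports "HOL-Analysis.Analysis"
begin

section \<open>Sobolev spaces\<close>

text \<open>
  Elements of \<open>L\<^sup>2(\<Omega>)\<close> are represented by complex-valued functions on the whole space, of which
  only the restriction to \<open>\<Omega>\<close> matters; equality in \<open>L\<^sup>2(\<Omega>)\<close> is equality almost everywhere on \<open>\<Omega>\<close>.
\<close>

definition L2 :: "'a::euclidean_space set \<Rightarrow> ('a \<Rightarrow> complex) set" where
  "L2 \<Omega> = {u \<in> borel_measurable (lebesgue_on \<Omega>). integrable (lebesgue_on \<Omega>) (\<lambda>x. (cmod (u x))\<^sup>2)}"

definition L2_inner :: "'a::euclidean_space set \<Rightarrow> ('a \<Rightarrow> complex) \<Rightarrow> ('a \<Rightarrow> complex) \<Rightarrow> complex" where
  "L2_inner \<Omega> u v = integral\<^sup>L (lebesgue_on \<Omega>) (\<lambda>x. u x * cnj (v x))"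

definition partial_deriv :: "'a::euclidean_space \<Rightarrow> ('a \<Rightarrow> complex) \<Rightarrow> 'a \<Rightarrow> complex" where
  "partial_deriv b f x = frechet_derivative f (at x) b"

fun C_k :: "nat \<Rightarrow> ('a::euclidean_space \<Rightarrow> complex) \<Rightarrow> bool" where
  "C_k 0 f \<longleftrightarrow> continuous_on UNIV f"
| "C_k (Suc k) f \<longleftrightarrow> (\<forall>x. f differentiable (at x)) \<and> (\<forall>b\<in>Basis. C_k k (partial_deriv b f))"

definition test_functions :: "'a::euclidean_space set \<Rightarrow> ('a \<Rightarrow> complex) set" where
  "test_functions \<Omega> = {\<phi>. (\<forall>k. C_k k \<phi>) \<and> compact (closure {x. \<phi> x \<noteq> 0}) \<and> closure {x. \<phi> x \<noteq> 0} \<subseteq> \<Omega>}"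

definition is_weak_partial_deriv ::
    "'a::euclidean_space set \<Rightarrow> 'a \<Rightarrow> ('a \<Rightarrow> complex) \<Rightarrow> ('a \<Rightarrow> complex) \<Rightarrow> bool" where
  "is_weak_partial_deriv \<Omega> b u g \<longleftrightarrow>
     (\<forall>\<phi>\<in>test_functions \<Omega>.
        integral\<^sup>L (lebesgue_on \<Omega>) (\<lambda>x. u x * partial_deriv b \<phi> x)
        = - integral\<^sup>L (lebesgue_on \<Omega>) (\<lambda>x. g x * \<phi> x))"

definition H1 :: "'a::euclidean_space set \<Rightarrow> ('a \<Rightarrow> complex) set" where
  "H1 \<Omega> = {u \<in> L2 \<Omega>. \<forall>b\<in>Basis. \<exists>g\<in>L2 \<Omega>. is_weak_partial_deriv \<Omega> b u g}"

text \<open>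
  For \<open>u\<close> in \<open>H1 \<Omega>\<close> (\<open>\<Omega>\<close> open) the weak derivative is determined up to null sets, so the choice of
  representative below does not affect the integrals in which it is used.
\<close>

definition weak_partial_deriv ::
    "'a::euclidean_space set \<Rightarrow> 'a \<Rightarrow> ('a \<Rightarrow> complex) \<Rightarrow> 'a \<Rightarrow> complex" where
  "weak_partial_deriv \<Omega> b u = (SOME g. g \<in> L2 \<Omega> \<and> is_weak_partial_deriv \<Omega> b u g)"

definition grad_form :: "'a::euclidean_space set \<Rightarrow> ('a \<Rightarrow> complex) \<Rightarrow> ('a \<Rightarrow> complex) \<Rightarrow> complex" where
  "grad_form \<Omega> u v = (\<Sum>b\<in>Basis. L2_inner \<Omega> (weak_partial_deriv \<Omega> b u) (weak_partial_deriv \<Omega> b v))"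

definition H1_norm :: "'a::euclidean_space set \<Rightarrow> ('a \<Rightarrow> complex) \<Rightarrow> real" where
  "H1_norm \<Omega> u = sqrt (Re (L2_inner \<Omega> u u) + Re (grad_form \<Omega> u u))"

definition H1_0 :: "'a::euclidean_space set \<Rightarrow> ('a \<Rightarrow> complex) set" where
  "H1_0 \<Omega> = {u \<in> H1 \<Omega>. \<exists>\<phi>. (\<forall>n. \<phi> n \<in> test_functions \<Omega>) \<and>
                          (\<lambda>n. H1_norm \<Omega> (\<lambda>x. \<phi> n x - u x)) \<longlonglongrightarrow> 0}"

section \<open>The Dirichlet Laplacian and its eigenvalues\<close>

text \<open>
  The graph of the self-adjoint operator in \<open>L\<^sup>2(\<Omega>)\<close> generated by the closed form \<open>grad_form \<Omega>\<close> on
  \<open>H1_0 \<Omega>\<close>: \<open>(u, f)\<close> belongs to it iff \<open>u\<close> is in the operator domain and \<open>f\<close> is the image of \<open>u\<close>.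
\<close>

definition dirichlet_laplacian ::
    "'a::euclidean_space set \<Rightarrow> (('a \<Rightarrow> complex) \<times> ('a \<Rightarrow> complex)) set" where
  "dirichlet_laplacian \<Omega> =
     {(u, f). u \<in> H1_0 \<Omega> \<and> f \<in> L2 \<Omega> \<and> (\<forall>v\<in>H1_0 \<Omega>. grad_form \<Omega> u v = L2_inner \<Omega> f v)}"

definition eigenspace :: "'a::euclidean_space set \<Rightarrow> real \<Rightarrow> ('a \<Rightarrow> complex) set" where
  "eigenspace \<Omega> \<mu> = {u. (u, \<lambda>x. of_real \<mu> * u x) \<in> dirichlet_laplacian \<Omega>}"

text \<open>Only real \<open>\<mu>\<close> are considered, the operator being self-adjoint.\<close>

definition is_eigenvalue :: "'a::euclidean_space set \<Rightarrow> real \<Rightarrow> bool" where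
  "is_eigenvalue \<Omega> \<mu> \<longleftrightarrow> (\<exists>u\<in>eigenspace \<Omega> \<mu>. \<not> (AE x in lebesgue_on \<Omega>. u x = 0))"

definition first_eigenvalue :: "'a::euclidean_space set \<Rightarrow> real" where
  "first_eigenvalue \<Omega> = (LEAST \<mu>. is_eigenvalue \<Omega> \<mu>)"

text \<open>
  The multiplicity is the dimension of the eigenspace in \<open>L\<^sup>2(\<Omega>)\<close>, i.e. the supremum of the lengths
  of families of eigenfunctions that are linearly independent modulo null functions.
\<close>

definition multiplicity_of :: "'a::euclidean_space set \<Rightarrow> real \<Rightarrow> enat" where
  "multiplicity_of \<Omega> \<mu> =
     Sup {enat n | n. \<exists>u :: nat \<Rightarrow> 'a \<Rightarrow> complex.
            (\<forall>i<n. u i \<in> eigenspace \<Omega> \<mu>) \<and>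
            (\<forall>c :: nat \<Rightarrow> complex.
               (AE x in lebesgue_on \<Omega>. (\<Sum>i<n. c i * u i x) = 0) \<longrightarrow> (\<forall>i<n. c i = 0))}"

text \<open>
  In the definitions below \<open>\<theta>\<close> is the lower bound of the continuous spectrum; the discrete spectrum
  consists of the eigenvalues below it.
\<close>

definition discrete_spectrum :: "'a::euclidean_space set \<Rightarrow> real \<Rightarrow> real set" where
  "discrete_spectrum \<Omega> \<theta> = {\<mu>. 0 < \<mu> \<and> \<mu> < \<theta> \<and> is_eigenvalue \<Omega> \<mu>}"

definition total_multiplicity :: "'a::euclidean_space set \<Rightarrow> real set \<Rightarrow> enat" where
  "total_multiplicity \<Omega> S = infsum (multiplicity_of \<Omega>) S"

text \<open>
  The \<open>k\<close>-th entry (\<open>k \<ge> 1\<close>) in the nondecreasing listing of the discrete spectrum, each eigenvalue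
  being repeated according to its multiplicity: \<open>\<mu>\<close> occupies exactly the positions \<open>k\<close> with
  \<open>m(\<nu> < \<mu>) < k \<le> m(\<nu> \<le> \<mu>)\<close>, where \<open>m\<close> is the total multiplicity.
\<close>

definition nth_discrete_eigenvalue :: "'a::euclidean_space set \<Rightarrow> real \<Rightarrow> nat \<Rightarrow> real" where
  "nth_discrete_eigenvalue \<Omega> \<theta> k =
     (THE \<mu>. \<mu> \<in> discrete_spectrum \<Omega> \<theta> \<and>
        total_multiplicity \<Omega> {\<nu> \<in> discrete_spectrum \<Omega> \<theta>. \<nu> < \<mu>} < enat k \<and>
        enat k \<le> total_multiplicity \<Omega> {\<nu> \<in> discrete_spectrum \<Omega> \<theta>. \<nu> \<le> \<mu>})"

section \<open>The waveguides\<close>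

definition omega_rhombus :: "(real^2) set" where
  "omega_rhombus = {p. \<bar>p$1\<bar> + \<bar>p$2\<bar> < 1/2}"

definition omega_disc :: "(real^2) set" where
  "omega_disc = {p. \<bar>p$1\<bar>\<^sup>2 + \<bar>p$2\<bar>\<^sup>2 < 1/4}"

definition stretched_section :: "(real^2) set \<Rightarrow> real \<Rightarrow> (real^2) set" where
  "stretched_section \<omega> H = {p. vector [p$1, inverse H * p$2] \<in> \<omega>}"

definition waveguide_1 :: "(real^2) set \<Rightarrow> real \<Rightarrow> (real^3) set" where
  "waveguide_1 \<omega> H = {x. vector [x$2, inverse H * x$3] \<in> \<omega>}"

definition waveguide_2 :: "(real^2) set \<Rightarrow> real \<Rightarrow> (real^3) set" where
  "waveguide_2 \<omega> H = {x. vector [x$1, inverse H * x$3] \<in> \<omega>}"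

definition cross_waveguide :: "(real^2) set \<Rightarrow> real \<Rightarrow> (real^3) set" where
  "cross_waveguide \<omega> H = waveguide_1 \<omega> H \<union> waveguide_2 \<omega> H"

definition lambda_dagger :: "(real^2) set \<Rightarrow> real \<Rightarrow> real" where
  "lambda_dagger \<omega> H = first_eigenvalue (stretched_section \<omega> H)"

definition number_discrete :: "(real^2) set \<Rightarrow> real \<Rightarrow> enat" where
  "number_discrete \<omega> H =
     total_multiplicity (cross_waveguide \<omega> H)
       (discrete_spectrum (cross_waveguide \<omega> H) (lambda_dagger \<omega> H))"

definition lambda_H :: "(real^2) set \<Rightarrow> real \<Rightarrow> nat \<Rightarrow> real" where
  "lambda_H \<omega> H k = nth_discrete_eigenvalue (cross_waveguide \<omega> H) (lambda_dagger \<omega> H) k"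

definition planar_cross :: "(real^2) set" where
  "planar_cross = {x. \<bar>x$1\<bar> < 1/2 \<or> \<bar>x$2\<bar> < 1/2}"

text \<open>
  The continuous spectrum on the planar cross is \<open>[\<pi>\<^sup>2, \<infinity>)\<close>, and there is exactly one eigenvalue below
  it, so the definite description is meaningful.
\<close>

definition Lambda_Pi :: real where
  "Lambda_Pi = (THE \<Lambda>. \<Lambda> \<in> discrete_spectrum planar_cross (pi\<^sup>2))"

end

theory Submission
  imports Defs
begin

text \<open>
  On test functions the form of \<open>Q\<^sup>H\<close>, plus finitely many squared functionals, dominates
  \<open>\<lambda>\<^sub>\<dagger>\<^sup>H\<close> times the squared norm: in the arms this is the Poincare inequality of the cross-section
  applied to slices, and in the bounded junction it is the Neumann-Poincare inequality on small cubes.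
  Minimizing the Rayleigh quotient therefore produces eigenfunctions below \<open>\<lambda>\<^sub>\<dagger>\<^sup>H\<close>, and \<open>N\<close> of them
  (with multiplicity) not exceeding \<open>m < \<lambda>\<^sub>\<dagger>\<^sup>H\<close> as soon as the quotient is at most \<open>m\<close> on an
  \<open>N\<close>-dimensional space. The trial space is spanned by products of a near-eigenfunction of the planar
  cross, shrunk to width \<open>w = 1 - 2 L / H\<close>, with \<open>N\<close> bumps in \<open>x\<^sub>3\<close> supported in disjoint subintervals of
  \<open>[0, L]\<close>; both sections contain the rhombus, so these vanish outside \<open>Q\<^sup>H\<close>. Their quotient exceeds
  \<open>\<Lambda>\<^sub>\<Pi>\<close> by \<open>O (L / H + 1 / L\<^sup>2)\<close>, and \<open>L = H powr (1/3)\<close> balances the two errors. On the planar cross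
  the same scheme with a single functional gives at most one eigenvalue below \<open>\<pi>\<^sup>2\<close>, and an explicit
  trial function gives one.
\<close>

section \<open>Smooth functions\<close>

text \<open>The statement speaks of objects that need not exist by themselves:
  \<open>Lambda_Pi\<close> and \<open>nth_discrete_eigenvalue\<close> are definite descriptions and
  \<open>first_eigenvalue\<close> is a \<open>LEAST\<close>. All three are made to denote by one
  finiteness argument: of more than k eigenfunctions below \<theta>, some combination is annihilated
  by k functionals, which contradicts the domination inequality. For the spatial cross any finite
  number of functionals will do. For the planar cross a single one must suffice, and it does because
  the unit square has Neumann constant pi^2, the same as the Dirichlet constant of the strips. The
  rate 2/3 is reached for both sections, as L / H = 1 / L^2; for the disc it implies the weaker rate
  1/2. Weak derivatives are confined to the abstract part: every estimate is made for test functions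
  and carried to the form domain by density, and even the planar eigenfunction is replaced by a test
  function whose quotient is within 1 / L^2 of \<open>Lambda_Pi\<close>.\<close>

lemma partial_deriv_eqI:
  assumes "(f has_derivative f') (at x)"
  shows "partial_deriv b f x = f' b"
  unfolding partial_deriv_def using frechet_derivative_at[OF assms] by simp

lemma partial_deriv_real:
  fixes f :: "real \<Rightarrow> complex"
  assumes "(f has_vector_derivative d) (at x)"
  shows "partial_deriv b f x = of_real b * d"
  using partial_deriv_eqI[OF assms[unfolded has_vector_derivative_def], of b] by (simp add: scaleR_conv_of_real)

lemma C_k_Suc_imp: "C_k (Suc k) f \<Longrightarrow> C_k k f"
proof (induction k arbitrary: f)
  case 0
  then show ?case
    by (auto simp: continuous_on_eq_continuous_at intro!: differentiable_imp_continuous_within)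
next
  case (Suc k)
  from Suc.prems have "\<forall>x. f differentiable (at x)" "\<forall>b\<in>Basis. C_k (Suc k) (partial_deriv b f)"
    by (subst (asm) C_k.simps(2), blast)+
  then show ?case using Suc.IH by (subst C_k.simps(2)) blast
qed

lemma C_k_const [simp]: "C_k k (\<lambda>x. c)"
proof (induction k arbitrary: c)
  case (Suc k)
  have "partial_deriv b (\<lambda>x. c) = (\<lambda>x. 0)" for b :: 'a
    by (rule ext, rule partial_deriv_eqI) (rule has_derivative_const)
  then show ?case using Suc by simp
qed simp

lemma partial_deriv_add:
  assumes "f differentiable (at x)" "g differentiable (at x)"
  shows "partial_deriv b (\<lambda>x. f x + g x) x = partial_deriv b f x + partial_deriv b g x"
  unfolding partial_deriv_def using assms
  by (intro fun_cong[OF frechet_derivative_at[symmetric], THEN trans])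
     (auto intro!: derivative_eq_intros simp: frechet_derivative_works)

lemma partial_deriv_mult:
  assumes "f differentiable (at x)" "g differentiable (at x)"
  shows "partial_deriv b (\<lambda>x. f x * g x) x = f x * partial_deriv b g x + partial_deriv b f x * g x"
  unfolding partial_deriv_def using assms
  by (intro fun_cong[OF frechet_derivative_at[symmetric], THEN trans])
     (auto intro!: derivative_eq_intros simp: frechet_derivative_works)

lemma C_k_add:
  "C_k k f \<Longrightarrow> C_k k g \<Longrightarrow> C_k k (\<lambda>x. f x + g x)"
proof (induction k arbitrary: f g)
  case 0 then show ?case by (auto intro!: continuous_intros)
next
  case (Suc k)
  have "partial_deriv b (\<lambda>x. f x + g x) = (\<lambda>x. partial_deriv b f x + partial_deriv b g x)" for b
    using Suc.prems by (intro ext partial_deriv_add) auto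
  then show ?case using Suc by auto
qed

lemma C_k_mult:
  "C_k k f \<Longrightarrow> C_k k g \<Longrightarrow> C_k k (\<lambda>x. f x * g x)"
proof (induction k arbitrary: f g)
  case 0 then show ?case by (auto intro!: continuous_intros)
next
  case (Suc k)
  have *: "partial_deriv b (\<lambda>x. f x * g x) = (\<lambda>x. f x * partial_deriv b g x + partial_deriv b f x * g x)" for b
    using Suc.prems by (intro ext partial_deriv_mult) auto
  have "C_k k f" "C_k k g" using Suc.prems C_k_Suc_imp by blast+
  then show ?case using Suc unfolding C_k.simps * by (auto intro!: C_k_add)
qed

lemma C_k_sum: "(\<And>i. i \<in> I \<Longrightarrow> C_k k (f i)) \<Longrightarrow> C_k k (\<lambda>x. \<Sum>i\<in>I. f i x)"
  by (induction I rule: infinite_finite_induct) (auto intro!: C_k_add)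

lemma C_k_prod: "(\<And>i. i \<in> I \<Longrightarrow> C_k k (f i)) \<Longrightarrow> C_k k (\<lambda>x. \<Prod>i\<in>I. f i x)"
  by (induction I rule: infinite_finite_induct) (auto intro!: C_k_mult)

lemma partial_deriv_inverse:
  fixes f :: "'a::euclidean_space \<Rightarrow> complex"
  assumes "f differentiable (at x)" "f x \<noteq> 0"
  shows "partial_deriv b (\<lambda>x. inverse (f x)) x = (-1) * (partial_deriv b f x * (inverse (f x) * inverse (f x)))"
  unfolding partial_deriv_def using assms
  by (intro fun_cong[OF frechet_derivative_at[symmetric], THEN trans])
     (auto intro!: derivative_eq_intros simp: frechet_derivative_works)

lemma C_k_inverse:
  fixes f :: "'a::euclidean_space \<Rightarrow> complex"
  shows "C_k k f \<Longrightarrow> (\<And>x. f x \<noteq> 0) \<Longrightarrow> C_k k (\<lambda>x. inverse (f x))"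
proof (induction k arbitrary: f)
  case 0 then show ?case by (auto intro!: continuous_intros)
next
  case (Suc k)
  have *: "partial_deriv b (\<lambda>x. inverse (f x)) = (\<lambda>x. (-1) * (partial_deriv b f x * (inverse (f x) * inverse (f x))))" for b
    using Suc.prems by (intro ext partial_deriv_inverse) auto
  have "C_k k (\<lambda>x. inverse (f x))" using Suc C_k_Suc_imp by blast
  then have "C_k k (\<lambda>x. (-1) * (partial_deriv b f x * (inverse (f x) * inverse (f x))))" if "b \<in> Basis" for b
    using Suc.prems that by (intro C_k_mult C_k_const) auto
  moreover have "(\<lambda>x. inverse (f x)) differentiable (at x)" for x
    using Suc.prems by (intro differentiable_inverse) auto
  ultimately show ?case unfolding C_k.simps * by blast
qed

lemma has_derivative_comp_affine:
  fixes f :: "'a::euclidean_space \<Rightarrow> complex" and l :: "'b::euclidean_space \<Rightarrow> 'a"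
  assumes "f differentiable (at (c + l x))" "linear l"
  shows "((\<lambda>x. f (c + l x)) has_derivative (\<lambda>h. \<Sum>d\<in>Basis. of_real (l h \<bullet> d) * partial_deriv d f (c + l x))) (at x)"
proof -
  let ?D = "frechet_derivative f (at (c + l x))"
  have D: "(f has_derivative ?D) (at (c + l x))" using assms(1) frechet_derivative_works by blast
  have bl: "bounded_linear l" using assms(2) by (rule linear_conv_bounded_linear[THEN iffD1])
  have "((\<lambda>x. c + l x) has_derivative l) (at x)"
    using bounded_linear.has_derivative[OF bl has_derivative_ident] by (auto intro!: derivative_eq_intros)
  then have "((\<lambda>x. f (c + l x)) has_derivative (\<lambda>h. ?D (l h))) (at x)"
    using has_derivative_compose[of "\<lambda>x. c + l x" l x UNIV f ?D] D by simp
  moreover have "?D (l h) = (\<Sum>d\<in>Basis. of_real (l h \<bullet> d) * partial_deriv d f (c + l x))" for h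
  proof -
    interpret D: bounded_linear ?D using D by (rule has_derivative_bounded_linear)
    have "?D (l h) = ?D (\<Sum>d\<in>Basis. (l h \<bullet> d) *\<^sub>R d)" by (simp add: euclidean_representation)
    also have "\<dots> = (\<Sum>d\<in>Basis. (l h \<bullet> d) *\<^sub>R ?D d)" by (simp add: D.sum D.scaleR)
    finally show ?thesis by (simp add: partial_deriv_def scaleR_conv_of_real)
  qed
  ultimately show ?thesis by simp
qed

lemma partial_deriv_comp_affine:
  fixes f :: "'a::euclidean_space \<Rightarrow> complex" and l :: "'b::euclidean_space \<Rightarrow> 'a"
  assumes "f differentiable (at (c + l x))" "linear l"
  shows "partial_deriv b (\<lambda>x. f (c + l x)) x = (\<Sum>d\<in>Basis. of_real (l b \<bullet> d) * partial_deriv d f (c + l x))"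
  by (rule partial_deriv_eqI[OF has_derivative_comp_affine[OF assms]])

lemma C_k_comp_affine:
  fixes f :: "'a::euclidean_space \<Rightarrow> complex" and l :: "'b::euclidean_space \<Rightarrow> 'a"
  shows "C_k k f \<Longrightarrow> linear l \<Longrightarrow> C_k k (\<lambda>x. f (c + l x))"
proof (induction k arbitrary: f)
  case 0
  have "continuous_on UNIV l" using 0 linear_continuous_on linear_conv_bounded_linear by blast
  then show ?case using 0 by (auto intro!: continuous_intros continuous_on_compose2[of UNIV f])
next
  case (Suc k)
  have d: "f differentiable (at y)" for y using Suc.prems by simp
  have "(\<lambda>x. f (c + l x)) differentiable (at x)" for x
    using has_derivative_comp_affine[OF d Suc.prems(2)] differentiable_def by blast
  moreover have "partial_deriv b (\<lambda>x. f (c + l x)) = (\<lambda>x. \<Sum>d\<in>Basis. of_real (l b \<bullet> d) * partial_deriv d f (c + l x))" for b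
    by (intro ext partial_deriv_comp_affine d Suc.prems)
  moreover have "C_k k (\<lambda>x. \<Sum>d\<in>Basis. of_real (l b \<bullet> d) * partial_deriv d f (c + l x))" for b
    using Suc by (intro C_k_sum C_k_mult C_k_const) auto
  ultimately show ?case by auto
qed

lemma C_k_comp_linear:
  fixes f :: "'a::euclidean_space \<Rightarrow> complex" and l :: "'b::euclidean_space \<Rightarrow> 'a"
  shows "C_k k f \<Longrightarrow> linear l \<Longrightarrow> C_k k (\<lambda>x. f (l x))"
  using C_k_comp_affine[of k f l 0] by simp

lemma C_k_Suc_realI:
  fixes f :: "real \<Rightarrow> complex"
  assumes "\<And>x. (f has_vector_derivative f' x) (at x)" "C_k k f'"
  shows "C_k (Suc k) f"
proof -
  have "partial_deriv 1 f = f'" using partial_deriv_real[OF assms(1), of 1] by auto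
  then show ?thesis using assms differentiableI_vector by auto
qed

lemma C_k_exp: "C_k k (\<lambda>t::real. exp (c * of_real t))"
proof (induction k)
  case 0 show ?case by (auto intro!: continuous_intros)
next
  case (Suc k)
  show ?case
    by (rule C_k_Suc_realI[where f' = "\<lambda>t. c * exp (c * of_real t)"])
      (auto intro!: derivative_eq_intros C_k_mult Suc has_vector_derivative_real_field)
qed

lemma C_k_cos: "C_k k (\<lambda>t::real. of_real (cos (a * t)))"
proof -
  have "of_real (cos (a * t)) = (1/2) * (exp ((\<i> * of_real a) * of_real t) + exp ((- \<i> * of_real a) * of_real t))" for t
    by (simp add: cos_of_real[symmetric] cos_exp_eq mult.assoc field_simps del: cos_of_real)
  then show ?thesis by (simp only:) (intro C_k_mult C_k_const C_k_add C_k_exp)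
qed

text \<open>The derivatives of \<open>exp (- 1 / t)\<close> have the form \<open>p (1 / t) * exp (- 1 / t)\<close>, \<open>p\<close> a polynomial.\<close>

definition flat_fn :: "real poly \<Rightarrow> real \<Rightarrow> real" where
  "flat_fn p t = (if t \<le> 0 then 0 else poly p (1/t) * exp (- (1/t)))"

text \<open>With s = 1 / t this is the decay of s^i / exp s at infinity, coefficient by
  coefficient.\<close>

lemma flat_fn_lim: "((\<lambda>t. poly p (1/t) * exp (- (1/t))) \<longlongrightarrow> 0) (at_right (0::real))"
proof -
  have "((\<lambda>s::real. poly p s * exp (- s)) \<longlongrightarrow> 0) at_top"
  proof (induction p)
    case (pCons a p)
    have 1: "((\<lambda>s::real. \<Sum>i\<le>degree q. coeff q i * (s ^ i / exp s)) \<longlongrightarrow> (\<Sum>i\<le>degree q. coeff q i * 0)) at_top" for q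
      by (intro tendsto_intros tendsto_power_div_exp_0)
    have 2: "(\<Sum>i\<le>degree q. coeff q i * (s ^ i / exp s)) = poly q s * exp (- s)" for q and s :: real
      by (simp add: poly_altdef sum_distrib_right exp_minus divide_inverse mult.assoc)
    show ?case using 1[of "pCons a p"] unfolding 2 by simp
  qed simp
  then show ?thesis
    by (subst (asm) filterlim_at_right_to_top[symmetric, unfolded inverse_eq_divide, of "\<lambda>t. poly p (1/t) * exp (- (1/t))", simplified])
qed

text \<open>In the variable s = 1 / t the derivative is -s^2 d/ds, which sends p(s) exp(-s) to s^2
  (p - p')(s) exp(-s); this is the polynomial \<open>[:0,0,1:] * (p - pderiv p)\<close>. At t = 0
  the right difference quotient is again of this form, with s p(s) in place of p, so
  \<open>flat_fn_lim\<close> applies.\<close>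

lemma flat_fn_deriv: "(flat_fn p has_real_derivative flat_fn ([:0,0,1:] * (p - pderiv p)) t) (at t)"
proof (cases "t = 0")
  case True
  have r: "((\<lambda>h. flat_fn p h / h) \<longlongrightarrow> 0) (at_right 0)"
  proof (rule Lim_transform_eventually[OF flat_fn_lim[of "[:0,1:] * p"]])
    show "\<forall>\<^sub>F h in at_right 0. poly ([:0,1:] * p) (1/h) * exp (- (1/h)) = flat_fn p h / h"
      by (auto simp: flat_fn_def eventually_at intro!: exI[of _ 1])
  qed
  have l: "((\<lambda>h. flat_fn p h / h) \<longlongrightarrow> 0) (at_left 0)"
    by (rule tendsto_eventually) (auto simp: flat_fn_def eventually_at intro!: exI[of _ 1])
  have "((\<lambda>h. flat_fn p h / h) \<longlongrightarrow> 0) (at 0)" using l r filterlim_split_at by blast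
  then show ?thesis using True by (simp add: DERIV_def flat_fn_def)
next
  case False
  show ?thesis
  proof (cases "t < 0")
    case True
    have "((\<lambda>_. 0) has_real_derivative 0) (at t)" by simp
    then have "(flat_fn p has_real_derivative 0) (at t)"
      by (rule DERIV_cong_ev[OF refl _ refl, THEN iffD1, rotated])
        (use True in \<open>auto simp: flat_fn_def eventually_at_filter intro!: eventually_nhds_in_open[of "{..<0}", THEN eventually_mono]\<close>)
    then show ?thesis using True by (simp add: flat_fn_def)
  next
    case F: False
    then have t: "t > 0" using False by simp
    have "((\<lambda>t. poly p (1/t) * exp (- (1/t))) has_real_derivative
       (poly (pderiv p) (1/t) * (- (1/t^2)) * exp (- (1/t)) + poly p (1/t) * (exp (- (1/t)) * (1/t^2)))) (at t)"
      using t by (auto intro!: derivative_eq_intros DERIV_chain2[OF poly_DERIV] simp: power2_eq_square field_simps)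
    moreover have "(poly (pderiv p) (1/t) * (- (1/t^2)) * exp (- (1/t)) + poly p (1/t) * (exp (- (1/t)) * (1/t^2)))
       = flat_fn ([:0,0,1:] * (p - pderiv p)) t"
      using t by (simp add: flat_fn_def field_simps power2_eq_square)
    ultimately have "((\<lambda>t. poly p (1/t) * exp (- (1/t))) has_real_derivative flat_fn ([:0,0,1:] * (p - pderiv p)) t) (at t)" by simp
    then show ?thesis
      by (rule DERIV_cong_ev[OF refl _ refl, THEN iffD1, rotated])
        (use t in \<open>auto simp: flat_fn_def eventually_at_filter intro!: eventually_nhds_in_open[of "{0<..}", THEN eventually_mono]\<close>)
  qed
qed

lemma C_k_flat_fn: "C_k k (\<lambda>t. of_real (flat_fn p t))"
proof (induction k arbitrary: p)
  case 0
  have "continuous_on UNIV (flat_fn p)"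
    by (intro continuous_at_imp_continuous_on ballI DERIV_isCont) (rule flat_fn_deriv)
  then show ?case by (auto intro!: continuous_intros)
next
  case (Suc k)
  show ?case
    by (rule C_k_Suc_realI[OF _ Suc[of "[:0,0,1:] * (p - pderiv p)"]])
      (intro has_vector_derivative_of_real flat_fn_deriv)
qed

text \<open>\<open>flat_fn 1\<close> is exp (-1 / t) extended by zero. The numbers t and 1 - t are
  never both nonpositive, so the denominator is positive everywhere and smoothness survives the
  division.\<close>

definition smooth_step :: "real \<Rightarrow> real" where
  "smooth_step t = flat_fn 1 t / (flat_fn 1 t + flat_fn 1 (1 - t))"

lemma flat_fn_one_pos: "t > 0 \<Longrightarrow> flat_fn 1 t > 0" and flat_fn_one_nonneg: "flat_fn 1 t \<ge> 0"
  and flat_fn_one_zero: "t \<le> 0 \<Longrightarrow> flat_fn 1 t = 0"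
  by (auto simp: flat_fn_def)

lemma flat_fn_sum_pos: "flat_fn 1 t + flat_fn 1 (1 - t) > 0"
  using flat_fn_one_pos[of t] flat_fn_one_pos[of "1 - t"] flat_fn_one_nonneg[of t] flat_fn_one_nonneg[of "1 - t"]
  by (cases "t > 0") (auto simp: flat_fn_one_zero intro: add_pos_nonneg)

lemma smooth_step_zero: "t \<le> 0 \<Longrightarrow> smooth_step t = 0"
  by (simp add: smooth_step_def flat_fn_one_zero)

lemma smooth_step_one: "t \<ge> 1 \<Longrightarrow> smooth_step t = 1"
  using flat_fn_sum_pos[of t] by (simp add: smooth_step_def flat_fn_one_zero)

lemma smooth_step_pos: "t > 0 \<Longrightarrow> smooth_step t > 0"
  using flat_fn_sum_pos[of t] by (simp add: smooth_step_def flat_fn_one_pos)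

lemma smooth_step_nonneg: "smooth_step t \<ge> 0"
  using flat_fn_sum_pos[of t] by (simp add: smooth_step_def flat_fn_one_nonneg)

lemma smooth_step_le_one: "smooth_step t \<le> 1"
  using flat_fn_sum_pos[of t] flat_fn_one_nonneg[of "1 - t"] by (simp add: smooth_step_def divide_le_eq)

lemma C_k_smooth_step: "C_k k (\<lambda>t. of_real (smooth_step t))"
proof -
  have l: "linear (\<lambda>t::real. - t)" by (simp add: linear_iff)
  have "C_k k (\<lambda>t. of_real (flat_fn 1 (1 + - t)))"
    by (rule C_k_comp_affine[OF C_k_flat_fn l])
  then have 1: "C_k k (\<lambda>t. of_real (flat_fn 1 (1 - t)))" by simp
  have "of_real (flat_fn 1 t) + of_real (flat_fn 1 (1 - t)) \<noteq> (0::complex)" for t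
    using flat_fn_sum_pos[of t] by (metis of_real_add of_real_eq_0_iff less_irrefl)
  then have "C_k k (\<lambda>t. of_real (flat_fn 1 t) * inverse (of_real (flat_fn 1 t) + of_real (flat_fn 1 (1 - t))))"
    by (intro C_k_mult C_k_inverse C_k_add C_k_flat_fn 1)
  then show ?thesis by (simp add: smooth_step_def divide_inverse)
qed

lemma C_k_inner_fn:
  assumes "C_k k (\<lambda>t::real. of_real (g t) :: complex)"
  shows "C_k k (\<lambda>x::'a::euclidean_space. of_real (g (c + a * (x \<bullet> b))))"
proof -
  have "linear (\<lambda>x. a * (x \<bullet> b))" by (simp add: linear_iff inner_add_left algebra_simps)
  from C_k_comp_affine[OF assms this] show ?thesis by simp
qed

section \<open>Test functions\<close>

lemma test_functionsI:
  assumes "\<And>k. C_k k \<phi>" "compact K" "K \<subseteq> \<Omega>" "\<And>x. x \<notin> K \<Longrightarrow> \<phi> x = 0"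
  shows "\<phi> \<in> test_functions \<Omega>"
proof -
  have "closure {x. \<phi> x \<noteq> 0} \<subseteq> K" using assms compact_imp_closed by (intro closure_minimal) auto
  moreover from this have "compact (closure {x. \<phi> x \<noteq> 0})"
    using assms(2) compact_Int_closed[of K "closure {x. \<phi> x \<noteq> 0}"] by (simp add: inf.absorb2)
  ultimately show ?thesis using assms by (auto simp: test_functions_def)
qed

lemma test_functionsE:
  assumes "\<phi> \<in> test_functions \<Omega>"
  obtains K where "compact K" "K \<subseteq> \<Omega>" "\<And>x. x \<notin> K \<Longrightarrow> \<phi> x = 0"
    "\<And>b x. x \<notin> K \<Longrightarrow> partial_deriv b \<phi> x = 0"
proof -
  let ?K = "closure {x. \<phi> x \<noteq> 0}"
  have 0: "\<phi> x = 0" if "x \<notin> ?K" for x using that closure_subset[of "{x. \<phi> x \<noteq> 0}"] by blast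
  have 1: "partial_deriv b \<phi> x = 0" if "x \<notin> ?K" for b x
  proof -
    have "((\<lambda>_. 0) has_derivative (\<lambda>_. 0)) (at x)" by (rule has_derivative_const)
    moreover have "open (- ?K)" "x \<in> - ?K" using that by auto
    moreover have "0 = \<phi> y" if "y \<in> - ?K" for y using 0[of y] that by (metis ComplD)
    ultimately have "(\<phi> has_derivative (\<lambda>_. 0)) (at x)"
      by (rule has_derivative_transform_within_open)
    then show ?thesis by (rule partial_deriv_eqI)
  qed
  have "compact ?K" "?K \<subseteq> \<Omega>" using assms by (simp_all add: test_functions_def)
  then show ?thesis using 0 1 by (rule that)
qed

lemma test_functions_C_k: "\<phi> \<in> test_functions \<Omega> \<Longrightarrow> C_k k \<phi>"
  by (simp add: test_functions_def)

lemma test_functions_differentiable: "\<phi> \<in> test_functions \<Omega> \<Longrightarrow> \<phi> differentiable (at x)"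
  using test_functions_C_k[of \<phi> \<Omega> "Suc 0"] by simp

lemma test_functions_continuous: "\<phi> \<in> test_functions \<Omega> \<Longrightarrow> continuous_on UNIV \<phi>"
  using test_functions_C_k[of \<phi> \<Omega> 0] by simp

lemma test_functions_vanish: "\<phi> \<in> test_functions \<Omega> \<Longrightarrow> x \<notin> \<Omega> \<Longrightarrow> \<phi> x = 0"
  by (rule test_functionsE) blast+

lemma test_functions_mono: "\<Omega> \<subseteq> \<Omega>' \<Longrightarrow> test_functions \<Omega> \<subseteq> test_functions \<Omega>'"
  by (auto simp: test_functions_def)

lemma test_functions_partial_deriv:
  assumes "\<phi> \<in> test_functions \<Omega>" "b \<in> Basis"
  shows "partial_deriv b \<phi> \<in> test_functions \<Omega>"
proof -
  obtain K where K: "compact K" "K \<subseteq> \<Omega>" "\<And>b x. x \<notin> K \<Longrightarrow> partial_deriv b \<phi> x = 0"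
    by (rule test_functionsE[OF assms(1)]) blast
  have "C_k k (partial_deriv b \<phi>)" for k using test_functions_C_k[OF assms(1), of "Suc k"] assms(2) by simp
  then show ?thesis using K by (intro test_functionsI) auto
qed

lemma test_functions_mult:
  assumes "\<phi> \<in> test_functions \<Omega>" "\<And>k. C_k k \<psi>"
  shows "(\<lambda>x. \<phi> x * \<psi> x) \<in> test_functions \<Omega>"
proof -
  obtain K where "compact K" "K \<subseteq> \<Omega>" "\<And>x. x \<notin> K \<Longrightarrow> \<phi> x = 0"
    by (rule test_functionsE[OF assms(1)]) blast
  then show ?thesis using assms test_functions_C_k by (intro test_functionsI[of _ K] C_k_mult) auto
qed

lemma test_functions_lin:
  assumes "\<phi> \<in> test_functions \<Omega>" "\<psi> \<in> test_functions \<Omega>"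
  shows "(\<lambda>x. c * \<phi> x + d * \<psi> x) \<in> test_functions \<Omega>"
proof -
  obtain K where K: "compact K" "K \<subseteq> \<Omega>" "\<And>x. x \<notin> K \<Longrightarrow> \<phi> x = 0"
    by (rule test_functionsE[OF assms(1)]) blast
  obtain L where L: "compact L" "L \<subseteq> \<Omega>" "\<And>x. x \<notin> L \<Longrightarrow> \<psi> x = 0"
    by (rule test_functionsE[OF assms(2)]) blast
  show ?thesis using assms test_functions_C_k K L
    by (intro test_functionsI[of _ "K \<union> L"] C_k_add C_k_mult C_k_const) auto
qed

text \<open>The parameter n is a steepness: the two factors climb from 0 to 1 in layers of width 1 /
  n next to the ends of [a, b]. Large n approximates an indicator; n = 1 / L gives the long flat
  ramps of the plateau on the planar cross.\<close>

definition smooth_bump :: "real \<Rightarrow> real \<Rightarrow> real \<Rightarrow> real \<Rightarrow> real" where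
  "smooth_bump n a b t = smooth_step (n * (t - a)) * smooth_step (n * (b - t))"

lemma smooth_bump_C_k: "C_k k (\<lambda>x::'a::euclidean_space. of_real (smooth_bump n a b (x \<bullet> i)))"
proof -
  have "C_k k (\<lambda>x::'a. of_real (smooth_step (- n * a + n * (x \<bullet> i))) * of_real (smooth_step (n * b + (- n) * (x \<bullet> i))))"
    by (intro C_k_mult C_k_inner_fn C_k_smooth_step)
  then show ?thesis by (simp add: smooth_bump_def algebra_simps)
qed

lemma smooth_bump_range: "0 \<le> smooth_bump n a b t" "smooth_bump n a b t \<le> 1"
  using smooth_step_nonneg smooth_step_le_one by (auto simp: smooth_bump_def intro!: mult_le_one)

lemma smooth_bump_zero: "n \<ge> 0 \<Longrightarrow> t \<notin> {a<..<b} \<Longrightarrow> smooth_bump n a b t = 0"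
  by (auto simp: smooth_bump_def not_less mult_nonneg_nonpos intro!: smooth_step_zero)

lemma smooth_bump_one: "n > 0 \<Longrightarrow> a + 1/n \<le> t \<Longrightarrow> t \<le> b - 1/n \<Longrightarrow> smooth_bump n a b t = 1"
  by (simp add: smooth_bump_def smooth_step_one field_simps)

lemma smooth_bump_tendsto:
  "(\<lambda>n. smooth_bump (real n) a b t) \<longlonglongrightarrow> indicator {a<..<b} t"
proof (cases "t \<in> {a<..<b}")
  case True
  obtain N :: nat where N: "1 / min (t - a) (b - t) < real N" using reals_Archimedean2 by blast
  have "smooth_bump (real n) a b t = 1" if "n \<ge> N" for n
  proof -
    have m: "min (t - a) (b - t) > 0" using True by auto
    then have n: "1 / min (t - a) (b - t) < real n" using N that by linarith
    then have "1 < real n * min (t - a) (b - t)" using m by (simp add: field_simps)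
    moreover have n0: "real n > 0" using n m by (meson divide_pos_pos less_trans zero_less_one)
    ultimately have "1 \<le> real n * (t - a)" "1 \<le> real n * (b - t)"
      by (smt (verit) mult_left_mono min.cobounded1 min.cobounded2)+
    then show ?thesis by (simp add: smooth_bump_def smooth_step_one)
  qed
  then have "\<forall>\<^sub>F n in sequentially. smooth_bump (real n) a b t = indicator {a<..<b} t"
    using True by (auto simp: eventually_sequentially)
  then show ?thesis by (rule tendsto_eventually)
next
  case False
  then show ?thesis by (simp add: smooth_bump_zero)
qed

section \<open>Hermitian forms\<close>

lemma tendsto_one_over_Suc: "(\<lambda>n. 1 / real (Suc n)) \<longlonglongrightarrow> 0"
  using LIMSEQ_inverse_real_of_nat by (simp add: inverse_eq_divide)

text \<open>The domain is a set of functions with pointwise operations, as \<open>L2\<close>,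
  \<open>H1\<close> and \<open>H1_0\<close> are sets of representatives. For the same reason the
  form is only semidefinite: functions that vanish almost everywhere have \<open>q\<close> equal to
  zero.\<close>

locale herm_form =
  fixes D :: "('a \<Rightarrow> complex) set" and s :: "('a \<Rightarrow> complex) \<Rightarrow> ('a \<Rightarrow> complex) \<Rightarrow> complex"
  assumes lin_closed: "u \<in> D \<Longrightarrow> v \<in> D \<Longrightarrow> (\<lambda>x. c * u x + d * v x) \<in> D"
    and zero_closed: "(\<lambda>x. 0) \<in> D"
    and lin_left: "u \<in> D \<Longrightarrow> v \<in> D \<Longrightarrow> w \<in> D \<Longrightarrow> s (\<lambda>x. c * u x + d * v x) w = c * s u w + d * s v w"
    and herm: "u \<in> D \<Longrightarrow> v \<in> D \<Longrightarrow> s v u = cnj (s u v)"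
    and psd: "u \<in> D \<Longrightarrow> 0 \<le> Re (s u u)"
begin

definition q where "q u = Re (s u u)"

lemma q_nonneg: "u \<in> D \<Longrightarrow> 0 \<le> q u"
  by (simp add: q_def psd)

lemma diff_closed: "u \<in> D \<Longrightarrow> v \<in> D \<Longrightarrow> (\<lambda>x. u x - v x) \<in> D"
  using lin_closed[of u v 1 "-1"] by simp

lemma scale_closed: "u \<in> D \<Longrightarrow> (\<lambda>x. c * u x) \<in> D"
  using lin_closed[of u u c 0] by simp

lemma s_self: "u \<in> D \<Longrightarrow> s u u = of_real (q u)"
  using herm[of u u] by (simp add: q_def complex_eq_iff)

lemma lin_right:
  "u \<in> D \<Longrightarrow> v \<in> D \<Longrightarrow> w \<in> D \<Longrightarrow> s w (\<lambda>x. c * u x + d * v x) = cnj c * s w u + cnj d * s w v"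
  using herm[of "\<lambda>x. c * u x + d * v x" w] herm[of u w] herm[of v w] lin_left[of u v w c d] lin_closed[of u v c d]
  by simp

lemma diff_left: "u \<in> D \<Longrightarrow> v \<in> D \<Longrightarrow> w \<in> D \<Longrightarrow> s (\<lambda>x. u x - v x) w = s u w - s v w"
  using lin_left[of u v w 1 "-1"] by simp

lemma scale_left: "u \<in> D \<Longrightarrow> w \<in> D \<Longrightarrow> s (\<lambda>x. c * u x) w = c * s u w"
  using lin_left[of u u w c 0] by simp

lemma q_lin:
  assumes "u \<in> D" "v \<in> D"
  shows "q (\<lambda>x. c * u x + d * v x) = (cmod c)\<^sup>2 * q u + (cmod d)\<^sup>2 * q v + 2 * Re (c * cnj d * s u v)"
proof -
  have "s (\<lambda>x. c * u x + d * v x) (\<lambda>x. c * u x + d * v x)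
     = c * (cnj c * s u u + cnj d * s u v) + d * (cnj c * s v u + cnj d * s v v)"
    using assms by (simp add: lin_left lin_right lin_closed)
  also have "\<dots> = (c * cnj c) * s u u + (d * cnj d) * s v v + (c * cnj d * s u v + cnj (c * cnj d * s u v))"
    using herm[OF assms] by (simp add: algebra_simps)
  also have "\<dots> = of_real ((cmod c)\<^sup>2) * s u u + of_real ((cmod d)\<^sup>2) * s v v + of_real (2 * Re (c * cnj d * s u v))"
    by (simp only: complex_norm_square complex_add_cnj)
  finally show ?thesis unfolding q_def by (simp del: of_real_power)
qed

lemma q_scale: "u \<in> D \<Longrightarrow> q (\<lambda>x. c * u x) = (cmod c)\<^sup>2 * q u"
  using q_lin[of u u c 0] by simp

lemma q_add: "u \<in> D \<Longrightarrow> v \<in> D \<Longrightarrow> q (\<lambda>x. u x + v x) = q u + q v + 2 * Re (s u v)"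
  using q_lin[of u v 1 1] by simp

lemma q_diff: "u \<in> D \<Longrightarrow> v \<in> D \<Longrightarrow> q (\<lambda>x. u x - v x) = q u + q v - 2 * Re (s u v)"
  using q_lin[of u v 1 "-1"] by simp

lemma q_add_le: "u \<in> D \<Longrightarrow> v \<in> D \<Longrightarrow> q (\<lambda>x. u x + v x) \<le> 2 * q u + 2 * q v"
  using q_add[of u v] q_diff[of u v] q_nonneg[OF diff_closed[of u v]] by simp

lemma cauchy_schwarz:
  assumes "u \<in> D" "v \<in> D"
  shows "(cmod (s u v))\<^sup>2 \<le> q u * q v"
proof -
  \<comment> \<open>Positivity at u - r s(u, v) v: the phase is absorbed in the coefficient, so that
    only the real parameter r is left to choose.\<close>
  have *: "0 \<le> q u - 2 * r * (cmod (s u v))\<^sup>2 + r\<^sup>2 * (cmod (s u v))\<^sup>2 * q v" for r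
  proof -
    have "0 \<le> q (\<lambda>x. 1 * u x + (- of_real r * s u v) * v x)"
      by (intro q_nonneg lin_closed assms)
    also have "\<dots> = q u + r\<^sup>2 * (cmod (s u v))\<^sup>2 * q v + 2 * Re (- of_real r * (s u v * cnj (s u v)))"
      by (simp only: q_lin[OF assms]) (simp add: norm_mult power_mult_distrib mult_ac)
    also have "\<dots> = q u + r\<^sup>2 * (cmod (s u v))\<^sup>2 * q v - 2 * r * (cmod (s u v))\<^sup>2"
      by (simp only: complex_norm_square[symmetric]) (simp del: of_real_power)
    finally show ?thesis by simp
  qed
  show ?thesis
  proof (cases "q v = 0")
    case True
    have "(cmod (s u v))\<^sup>2 = 0"
    proof (rule ccontr)
      assume "(cmod (s u v))\<^sup>2 \<noteq> 0"
      \<comment> \<open>For q v = 0 the parabola in r degenerates to a line of negative slope; this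
        r brings it to - q u - 2.\<close>
      then show False using *[of "(q u + 1) / (cmod (s u v))\<^sup>2"] True q_nonneg[OF assms(1)] by simp
    qed
    then show ?thesis using True by simp
  next
    case False
    then have "q v > 0" using q_nonneg[OF assms(2)] by simp
    then show ?thesis using *[of "1 / q v"] by (simp add: field_simps power2_eq_square)
  qed
qed

lemma sum_closed: "(\<And>i. i \<in> I \<Longrightarrow> u i \<in> D) \<Longrightarrow> (\<lambda>x. \<Sum>i\<in>I. c i * u i x) \<in> D"
proof (induction I rule: infinite_finite_induct)
  case (insert i I)
  then show ?case using lin_closed[of "u i" "\<lambda>x. \<Sum>i\<in>I. c i * u i x" "c i" 1] by simp
qed (auto simp: zero_closed)

lemma s_zero_left: "w \<in> D \<Longrightarrow> s (\<lambda>x. 0) w = 0"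
  using scale_left[OF zero_closed, of w 0] by simp

lemma s_sum_left:
  "(\<And>i. i \<in> I \<Longrightarrow> u i \<in> D) \<Longrightarrow> w \<in> D \<Longrightarrow> s (\<lambda>x. \<Sum>i\<in>I. c i * u i x) w = (\<Sum>i\<in>I. c i * s (u i) w)"
proof (induction I rule: infinite_finite_induct)
  case (insert i I)
  then show ?case
    using lin_left[of "u i" "\<lambda>x. \<Sum>i\<in>I. c i * u i x" w "c i" 1] sum_closed[of I u c] by simp
qed (auto simp: s_zero_left)

lemma s_sum_right:
  assumes "\<And>i. i \<in> I \<Longrightarrow> u i \<in> D" "w \<in> D"
  shows "s w (\<lambda>x. \<Sum>i\<in>I. c i * u i x) = (\<Sum>i\<in>I. cnj (c i) * s w (u i))"
proof -
  have "s w (\<lambda>x. \<Sum>i\<in>I. c i * u i x) = cnj (\<Sum>i\<in>I. c i * s (u i) w)"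
    by (subst herm[OF sum_closed[OF assms(1)] assms(2)]) (simp_all add: s_sum_left[OF assms])
  also have "\<dots> = (\<Sum>i\<in>I. cnj (c i) * s w (u i))"
    unfolding cnj_sum by (intro sum.cong refl) (simp add: herm[OF assms(1) assms(2)])
  finally show ?thesis .
qed

lemma q_sum_orthogonal:
  assumes "finite I" "\<And>i. i \<in> I \<Longrightarrow> u i \<in> D" "\<And>i j. i \<in> I \<Longrightarrow> j \<in> I \<Longrightarrow> i \<noteq> j \<Longrightarrow> s (u i) (u j) = 0"
  shows "q (\<lambda>x. \<Sum>i\<in>I. c i * u i x) = (\<Sum>i\<in>I. (cmod (c i))\<^sup>2 * q (u i))"
proof -
  have "s (\<lambda>x. \<Sum>i\<in>I. c i * u i x) (\<lambda>x. \<Sum>i\<in>I. c i * u i x) = (\<Sum>i\<in>I. c i * (\<Sum>j\<in>I. cnj (c j) * s (u i) (u j)))"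
    using assms by (subst s_sum_left) (auto intro!: sum_closed simp: s_sum_right)
  also have "\<dots> = (\<Sum>i\<in>I. c i * (cnj (c i) * s (u i) (u i)))"
  proof (intro sum.cong refl)
    fix i assume i: "i \<in> I"
    have "(\<Sum>j\<in>I. cnj (c j) * s (u i) (u j)) = (\<Sum>j\<in>I. if j = i then cnj (c i) * s (u i) (u i) else 0)"
      using assms(3)[OF i] by (intro sum.cong) auto
    then show "c i * (\<Sum>j\<in>I. cnj (c j) * s (u i) (u j)) = c i * (cnj (c i) * s (u i) (u i))"
      using i assms(1) by simp
  qed
  also have "\<dots> = of_real (\<Sum>i\<in>I. (cmod (c i))\<^sup>2 * q (u i))"
    unfolding of_real_sum
    by (intro sum.cong refl) (use assms(2) in \<open>simp add: s_self mult.assoc[symmetric] complex_norm_square[symmetric] del: of_real_power\<close>)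
  finally show ?thesis by (simp add: q_def)
qed

lemma tendsto_s:
  assumes "\<And>n. u n \<in> D" "v \<in> D" "w \<in> D" "(\<lambda>n. q (\<lambda>x. u n x - v x)) \<longlonglongrightarrow> 0"
  shows "(\<lambda>n. s (u n) w) \<longlonglongrightarrow> s v w"
proof -
  have "(\<lambda>n. (cmod (s (u n) w - s v w))\<^sup>2) \<longlonglongrightarrow> 0"
  proof (rule tendsto_sandwich[OF _ _ tendsto_const])
    show "(\<lambda>n. q (\<lambda>x. u n x - v x) * q w) \<longlonglongrightarrow> 0" using tendsto_mult[OF assms(4) tendsto_const[of "q w"]] by simp
    show "\<forall>\<^sub>F n in sequentially. (cmod (s (u n) w - s v w))\<^sup>2 \<le> q (\<lambda>x. u n x - v x) * q w"
      using cauchy_schwarz[OF diff_closed[OF assms(1,2)] assms(3)] assms(1-3) by (simp add: diff_left)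
  qed simp
  then have "(\<lambda>n. sqrt ((cmod (s (u n) w - s v w))\<^sup>2)) \<longlonglongrightarrow> sqrt 0" by (rule tendsto_real_sqrt)
  then have "(\<lambda>n. cmod (s (u n) w - s v w)) \<longlonglongrightarrow> 0" by simp
  then show ?thesis by (rule LIM_zero_cancel[OF tendsto_norm_zero_cancel])
qed

lemma tendsto_q:
  assumes "\<And>n. u n \<in> D" "v \<in> D" "(\<lambda>n. q (\<lambda>x. u n x - v x)) \<longlonglongrightarrow> 0"
  shows "(\<lambda>n. q (u n)) \<longlonglongrightarrow> q v"
proof -
  have *: "q (u n) = q (\<lambda>x. u n x - v x) + 2 * Re (s (u n) v) - q v" for n
    using q_diff[OF assms(1,2)] by simp
  have "(\<lambda>n. q (\<lambda>x. u n x - v x) + 2 * Re (s (u n) v) - q v) \<longlonglongrightarrow> 0 + 2 * Re (s v v) - q v"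
    by (intro tendsto_intros assms tendsto_s)
  then show ?thesis unfolding *[symmetric] by (simp add: q_def)
qed

end

section \<open>Discrete spectrum of a form\<close>

text \<open>Elimination of one unknown per equation. This dimension count is used in two directions:
  to find in a trial space a vector orthogonal to fewer given eigenvectors, and to find a
  combination of eigenvectors that is annihilated by fewer functionals.\<close>

lemma homogeneous_system:
  fixes A :: "nat \<Rightarrow> nat \<Rightarrow> complex"
  assumes "k < r"
  shows "\<exists>c. (\<exists>j<r. c j \<noteq> 0) \<and> (\<forall>i<k. (\<Sum>j<r. A i j * c j) = 0)"
  using assms
proof (induction k arbitrary: A r)
  case 0
  then show ?case by (intro exI[of _ "\<lambda>_. 1"]) auto
next
  case (Suc k)
  then obtain r' where r: "r = Suc r'" "k < r'" by (cases r) auto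
  show ?case
  proof (cases "\<forall>j<r. A k j = 0")
    case True
    obtain c where "\<exists>j<r. c j \<noteq> 0" "\<forall>i<k. (\<Sum>j<r. A i j * c j) = 0"
      using Suc.IH[of r A] Suc.prems by auto
    then show ?thesis using True by (intro exI[of _ c]) (auto simp: less_Suc_eq)
  next
    case False
    then obtain p where p: "p < r" "A k p \<noteq> 0" by blast
    \<comment> \<open>The transposition of p and r' moves the pivot column to the last place, where
      the sum over \<open>{..<Suc r'}\<close> splits off its last term.\<close>
    define t where "t j = (if j = p then r' else if j = r' then p else j)" for j
    have tr: "t (t j) = j" "j < r \<Longrightarrow> t j < r" for j using p(1) r by (auto simp: t_def)
    have bij: "bij_betw t {..<r} {..<r}" by (rule bij_betw_byWitness[where f' = t]) (use tr in auto)
    define B where "B i j = A i (t j)" for i j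
    have Bp: "B k r' \<noteq> 0" using p by (simp add: B_def t_def)
    obtain c where c: "\<exists>j<r'. c j \<noteq> 0" "\<forall>i<k. (\<Sum>j<r'. (B i j - B i r' * B k j / B k r') * c j) = 0"
      using Suc.IH[of r' "\<lambda>i j. B i j - B i r' * B k j / B k r'"] r(2) by blast
    \<comment> \<open>The last unknown is solved from equation k; substituting it turns row i into
      the reduced row, which vanishes identically for i = k.\<close>
    define d where "d j = (if j < r' then c j else - (\<Sum>j<r'. B k j * c j) / B k r')" for j
    have s: "(\<Sum>j<r. B i j * d j) = (\<Sum>j<r'. (B i j - B i r' * B k j / B k r') * c j)" for i
      using r(1) by (simp add: d_def left_diff_distrib sum_subtractf sum_distrib_left sum_divide_distrib mult_ac right_diff_distrib)
    have "(\<Sum>j<r. B i j * d j) = 0" if "i < Suc k" for i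
      using that c(2) Bp unfolding s by (cases "i = k") auto
    moreover have "(\<Sum>j<r. A i j * d (inv_into {..<r} t j)) = (\<Sum>j<r. B i j * d j)" for i
      unfolding B_def
      by (subst sum.reindex_bij_betw[OF bij, symmetric])
         (intro sum.cong refl, use bij in \<open>simp add: bij_betw_def inv_into_f_f\<close>)
    moreover have "\<exists>j<r. d (inv_into {..<r} t j) \<noteq> 0"
    proof -
      obtain j where "j < r'" "c j \<noteq> 0" using c(1) by blast
      moreover from this have "t j < r" using bij r unfolding bij_betw_def by auto
      ultimately show ?thesis using r(1) bij by (intro exI[of _ "t j"]) (auto simp: bij_betw_def inv_into_f_f d_def)
    qed
    ultimately show ?thesis by (intro exI[of _ "\<lambda>j. d (inv_into {..<r} t j)"]) auto
  qed
qed

lemma simultaneous_convergent_subseq: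
  fixes x :: "nat \<Rightarrow> nat \<Rightarrow> complex"
  assumes "\<And>i. i < k \<Longrightarrow> bounded (range (x i))"
  shows "\<exists>\<rho>. strict_mono \<rho> \<and> (\<forall>i<k. convergent (x i \<circ> \<rho>))"
  using assms
proof (induction k)
  case 0
  then show ?case by (intro exI[of _ id]) (auto simp: strict_mono_def)
next
  case (Suc k)
  have "\<exists>\<rho>. strict_mono \<rho> \<and> (\<forall>i<k. convergent (x i \<circ> \<rho>))" by (rule Suc.IH) (use Suc.prems in auto)
  then obtain \<rho> where \<rho>: "strict_mono \<rho>" "\<forall>i<k. convergent (x i \<circ> \<rho>)" by blast
  have "bounded (range (x k \<circ> \<rho>))" by (rule bounded_subset[OF Suc.prems[of k]]) auto
  then obtain l \<sigma> where \<sigma>: "strict_mono \<sigma>" "(x k \<circ> \<rho> \<circ> \<sigma>) \<longlonglongrightarrow> l"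
    using bounded_imp_convergent_subsequence by (metis comp_assoc)
  have "convergent (x i \<circ> (\<rho> \<circ> \<sigma>))" if "i < Suc k" for i
  proof (cases "i = k")
    case True then show ?thesis using \<sigma>(2) by (auto simp: convergent_def comp_assoc)
  next
    case False
    then show ?thesis using \<rho>(2) \<sigma>(1) that convergent_subseq_convergent[of "x i \<circ> \<rho>" \<sigma>] by (auto simp: comp_assoc)
  qed
  then show ?case using strict_mono_o[OF \<rho>(1) \<sigma>(1)] by blast
qed

text \<open>\<open>a\<close> is the energy and \<open>b\<close> the mass. By \<open>garding\<close>
  the quotient is at least \<theta> on the common kernel of the k functionals, so below \<theta> the
  problem behaves as in dimension k. \<open>complete\<close> is the closedness of the form, in terms
  of sequences and of the squared norm.\<close>

locale spectral_form = A: herm_form D a + B: herm_form D b for D and a b :: "('a \<Rightarrow> complex) \<Rightarrow> ('a \<Rightarrow> complex) \<Rightarrow> complex" +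
  fixes k :: nat and l :: "nat \<Rightarrow> ('a \<Rightarrow> complex) \<Rightarrow> complex" and \<theta> c0 C :: real
  assumes l_lin: "i < k \<Longrightarrow> u \<in> D \<Longrightarrow> v \<in> D \<Longrightarrow> l i (\<lambda>x. c * u x + d * v x) = c * l i u + d * l i v"
    and l_bdd: "i < k \<Longrightarrow> u \<in> D \<Longrightarrow> (cmod (l i u))\<^sup>2 \<le> C * B.q u"
    and c0_pos: "c0 > 0"
    and coercive: "u \<in> D \<Longrightarrow> c0 * B.q u \<le> A.q u"
    and garding: "u \<in> D \<Longrightarrow> \<theta> * B.q u \<le> A.q u + (\<Sum>i<k. (cmod (l i u))\<^sup>2)"
    and complete: "(\<And>n. w n \<in> D) \<Longrightarrow>
      (\<And>e. e > 0 \<Longrightarrow> \<exists>N. \<forall>m\<ge>N. \<forall>n\<ge>N. A.q (\<lambda>x. w m x - w n x) + B.q (\<lambda>x. w m x - w n x) < e) \<Longrightarrow>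
      \<exists>v\<in>D. (\<lambda>n. A.q (\<lambda>x. w n x - v x) + B.q (\<lambda>x. w n x - v x)) \<longlonglongrightarrow> 0"
begin

definition is_eigen :: "real \<Rightarrow> ('a \<Rightarrow> complex) \<Rightarrow> bool" where
  "is_eigen \<mu> u \<longleftrightarrow> u \<in> D \<and> (\<forall>v\<in>D. a u v = of_real \<mu> * b u v)"

text \<open>The parallelogram law makes every minimizing sequence on which the functionals \<open>l\<close> converge a
  Cauchy sequence for the full form norm, so no weak compactness is needed.\<close>

lemma minimizer:
  assumes e: "\<And>i. i < r \<Longrightarrow> e i \<in> D"
    and v: "v \<in> D" "\<And>i. i < r \<Longrightarrow> b v (e i) = 0" "B.q v > 0" "A.q v \<le> m * B.q v" and m: "m < \<theta>"
  obtains u \<mu> where "u \<in> D" "\<And>i. i < r \<Longrightarrow> b u (e i) = 0" "B.q u = 1" "A.q u = \<mu>" "0 < \<mu>" "\<mu> \<le> m"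
    "\<And>w. w \<in> D \<Longrightarrow> (\<And>i. i < r \<Longrightarrow> b w (e i) = 0) \<Longrightarrow> \<mu> * B.q w \<le> A.q w"
proof -
  define M where "M = {w \<in> D. \<forall>i<r. b w (e i) = 0}"
  have M_lin: "(\<lambda>x. c * u x + d * w x) \<in> M" if "u \<in> M" "w \<in> M" for u w c d
    using that e by (auto simp: M_def B.lin_closed B.lin_left)
  have M_D: "w \<in> D" if "w \<in> M" for w using that by (simp add: M_def)
  have M_scale: "(\<lambda>x. c * u x) \<in> M" if "u \<in> M" for u c using M_lin[OF that that, of c 0] by simp
  define S where "S = {A.q w | w. w \<in> M \<and> B.q w = 1}"
  have normalize: "A.q w / B.q w \<in> S" if "w \<in> M" "B.q w > 0" for w
  proof -
    define c where "c = complex_of_real (1 / sqrt (B.q w))"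
    have c: "(cmod c)\<^sup>2 = 1 / B.q w" using that(2) by (simp add: c_def norm_divide power_divide)
    have "B.q (\<lambda>x. c * w x) = 1" "A.q (\<lambda>x. c * w x) = A.q w / B.q w"
      using B.q_scale[OF M_D[OF that(1)], of c] A.q_scale[OF M_D[OF that(1)], of c] c that(2) by auto
    then show ?thesis unfolding S_def using M_scale[OF that(1), of c] by force
  qed
  have S_ne: "S \<noteq> {}" using normalize[of v] v by (auto simp: M_def)
  have S_lb: "c0 \<le> y" if "y \<in> S" for y using that coercive M_D unfolding S_def by fastforce
  have bdd: "bdd_below S" by (rule bdd_belowI[of _ c0]) (rule S_lb)
  define \<mu> where "\<mu> = Inf S"
  have \<mu>_lb: "c0 \<le> \<mu>" unfolding \<mu>_def using S_ne S_lb by (intro cInf_greatest)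
  have \<mu>_le: "\<mu> \<le> m"
  proof -
    have "\<mu> \<le> A.q v / B.q v" unfolding \<mu>_def using v by (intro cInf_lower normalize bdd) (auto simp: M_def)
    also have "\<dots> \<le> m" using v by (simp add: divide_le_eq)
    finally show ?thesis .
  qed
  have \<mu>_min: "\<mu> * B.q w \<le> A.q w" if "w \<in> M" for w
  proof (cases "B.q w = 0")
    case True then show ?thesis using A.q_nonneg[OF M_D[OF that]] by simp
  next
    case False
    then have "B.q w > 0" using B.q_nonneg[OF M_D[OF that]] by simp
    moreover from this have "\<mu> \<le> A.q w / B.q w" unfolding \<mu>_def using that by (intro cInf_lower normalize bdd)
    ultimately show ?thesis by (simp add: pos_le_divide_eq)
  qed
  have "\<exists>w. w \<in> M \<and> B.q w = 1 \<and> A.q w < \<mu> + 1 / real (Suc n)" for n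
  proof -
    have "Inf S < \<mu> + 1 / real (Suc n)" by (simp add: \<mu>_def)
    then obtain y where "y \<in> S" "y < \<mu> + 1 / real (Suc n)" using S_ne cInf_lessD by blast
    then show ?thesis unfolding S_def by blast
  qed
  then obtain u where u: "\<And>n. u n \<in> M" "\<And>n. B.q (u n) = 1" "\<And>n. A.q (u n) < \<mu> + 1 / real (Suc n)" by metis
  have "bounded (range (\<lambda>n. l i (u n)))" if "i < k" for i
  proof (rule boundedI[where B = "sqrt C"])
    fix y assume "y \<in> range (\<lambda>n. l i (u n))"
    then obtain n where "y = l i (u n)" by blast
    then have "(cmod y)\<^sup>2 \<le> C" using l_bdd[OF that M_D[OF u(1)[of n]]] u(2)[of n] by simp
    then show "cmod y \<le> sqrt C" by (rule real_le_rsqrt)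
  qed
  then obtain \<rho> where \<rho>: "strict_mono \<rho>" "\<forall>i<k. convergent ((\<lambda>n. l i (u n)) \<circ> \<rho>)"
    using simultaneous_convergent_subseq[of k "\<lambda>i n. l i (u n)"] by blast
  define w where "w n = u (\<rho> n)" for n
  have w: "w n \<in> M" "w n \<in> D" "B.q (w n) = 1" "A.q (w n) \<le> \<mu> + 1 / real (Suc n)" for n
  proof -
    show "w n \<in> M" "B.q (w n) = 1" using u by (auto simp: w_def)
    then show "w n \<in> D" using M_D by blast
    have "1 / real (Suc (\<rho> n)) \<le> 1 / real (Suc n)" using seq_suble[OF \<rho>(1), of n] by (intro divide_left_mono) auto
    then show "A.q (w n) \<le> \<mu> + 1 / real (Suc n)" using u(3)[of "\<rho> n"] by (simp add: w_def)
  qed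
  from \<rho>(2) have "\<forall>i<k. \<exists>L. (\<lambda>n. l i (w n)) \<longlonglongrightarrow> L" by (simp add: convergent_def o_def w_def)
  then obtain L where L: "\<And>i. i < k \<Longrightarrow> (\<lambda>n. l i (w n)) \<longlonglongrightarrow> L i" by metis
  \<comment> \<open>One null sequence for both errors: the defect of minimality of
    \<open>w n\<close> and the distance of the functionals from their limits. The factors 2 come
    from the parallelogram law and from (s + t)^2 \<le> 2 s^2 + 2 t^2.\<close>
  define \<tau> where "\<tau> n = 2 * (1 / real (Suc n)) + 2 * (\<Sum>i<k. (cmod (l i (w n) - L i))\<^sup>2)" for n
  have "\<tau> \<longlonglongrightarrow> 2 * 0 + 2 * (\<Sum>i<k. 0)" unfolding \<tau>_def
  proof (intro tendsto_intros tendsto_one_over_Suc)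
    fix i assume "i \<in> {..<k}"
    then have "(\<lambda>n. (cmod (l i (w n) - L i))\<^sup>2) \<longlonglongrightarrow> (cmod (L i - L i))\<^sup>2" by (intro tendsto_intros L) simp
    then show "(\<lambda>n. (cmod (l i (w n) - L i))\<^sup>2) \<longlonglongrightarrow> 0" by simp
  qed
  then have \<tau>0: "\<tau> \<longlonglongrightarrow> 0" by simp
  \<comment> \<open>The difference of two members has mass at most (\<tau> i + \<tau> j) / (\<theta>
    - \<mu>) and energy at most \<mu> times its mass plus \<tau> i + \<tau> j; \<open>K\<close>
    collects the two bounds.\<close>
  define K where "K = (\<mu> + 1) / (\<theta> - \<mu>) + 1"
  have K: "K > 0" using \<mu>_lb \<mu>_le m c0_pos by (auto simp: K_def intro!: add_pos_pos divide_pos_pos)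
  have key: "A.q (\<lambda>x. w i x - w j x) + B.q (\<lambda>x. w i x - w j x) \<le> K * (\<tau> i + \<tau> j)" for i j
  proof -
    let ?d = "\<lambda>x. w i x - w j x" and ?s = "\<lambda>x. w i x + w j x"
    have dD: "?d \<in> D" using w by (intro A.diff_closed)
    have "?s \<in> M" using M_lin[OF w(1)[of i] w(1)[of j], of 1 1] by simp
    then have 1: "\<mu> * B.q ?s \<le> A.q ?s" by (rule \<mu>_min)
    have 2: "B.q ?s = 4 - B.q ?d" using B.q_add[OF w(2)[of i] w(2)[of j]] B.q_diff[OF w(2)[of i] w(2)[of j]] w(3) by simp
    have 3: "A.q ?s = 2 * A.q (w i) + 2 * A.q (w j) - A.q ?d"
      using A.q_add[OF w(2)[of i] w(2)[of j]] A.q_diff[OF w(2)[of i] w(2)[of j]] by simp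
    define \<delta> where "\<delta> = 2 * (1 / real (Suc i)) + 2 * (1 / real (Suc j))"
    \<comment> \<open>Minimality at the sum bounds the energy of the difference from above by about
      \<mu> times its mass, while \<open>garding\<close> bounds it from below by about \<theta>
      times its mass. As \<mu> < \<theta>, the mass must be small.\<close>
    have 4: "A.q ?d \<le> \<mu> * B.q ?d + \<delta>"
      using 1 w(4)[of i] w(4)[of j] unfolding 2 3 \<delta>_def by (simp only: algebra_simps)
    have l_d: "l n ?d = l n (w i) - l n (w j)" if "n < k" for n
      using l_lin[OF that w(2)[of i] w(2)[of j], of 1 "-1"] by simp
    have 5: "(\<Sum>n<k. (cmod (l n ?d))\<^sup>2) \<le> (\<Sum>n<k. 2 * (cmod (l n (w i) - L n))\<^sup>2 + 2 * (cmod (l n (w j) - L n))\<^sup>2)"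
    proof (intro sum_mono)
      fix n assume "n \<in> {..<k}"
      then have "l n ?d = (l n (w i) - L n) - (l n (w j) - L n)" by (simp add: l_d)
      then have "cmod (l n ?d) \<le> cmod (l n (w i) - L n) + cmod (l n (w j) - L n)" by (metis norm_triangle_ineq4)
      then have "(cmod (l n ?d))\<^sup>2 \<le> (cmod (l n (w i) - L n) + cmod (l n (w j) - L n))\<^sup>2" by (intro power_mono) auto
      also have "\<dots> \<le> 2 * (cmod (l n (w i) - L n))\<^sup>2 + 2 * (cmod (l n (w j) - L n))\<^sup>2"
        using sum_squares_bound[of "cmod (l n (w i) - L n)" "cmod (l n (w j) - L n)"] by (simp add: power2_sum)
      finally show "(cmod (l n ?d))\<^sup>2 \<le> 2 * (cmod (l n (w i) - L n))\<^sup>2 + 2 * (cmod (l n (w j) - L n))\<^sup>2" .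
    qed
    define \<Lambda> where "\<Lambda> = (\<Sum>n<k. (cmod (l n ?d))\<^sup>2)"
    have 6: "\<delta> + \<Lambda> \<le> \<tau> i + \<tau> j"
      using 5 by (simp add: \<delta>_def \<tau>_def \<Lambda>_def sum.distrib sum_distrib_left[symmetric] distrib_left)
    have \<Lambda>0: "\<Lambda> \<ge> 0" by (simp add: \<Lambda>_def sum_nonneg)
    have "\<theta> * B.q ?d \<le> A.q ?d + \<Lambda>" using garding[OF dD] by (simp add: \<Lambda>_def)
    then have "(\<theta> - \<mu>) * B.q ?d \<le> \<tau> i + \<tau> j" using 4 6 by (simp add: algebra_simps)
    then have 7: "B.q ?d \<le> (\<tau> i + \<tau> j) / (\<theta> - \<mu>)" using \<mu>_le m by (simp add: pos_le_divide_eq mult.commute)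
    have "A.q ?d + B.q ?d \<le> (\<mu> + 1) * B.q ?d + (\<tau> i + \<tau> j)" using 4 6 \<Lambda>0 by (simp add: algebra_simps)
    also have "\<dots> \<le> (\<mu> + 1) * ((\<tau> i + \<tau> j) / (\<theta> - \<mu>)) + (\<tau> i + \<tau> j)"
      using 7 \<mu>_lb c0_pos by (intro add_right_mono mult_left_mono) auto
    also have "\<dots> = K * (\<tau> i + \<tau> j)" by (simp add: K_def algebra_simps)
    finally show ?thesis .
  qed
  have "\<exists>N. \<forall>i\<ge>N. \<forall>j\<ge>N. A.q (\<lambda>x. w i x - w j x) + B.q (\<lambda>x. w i x - w j x) < \<epsilon>" if "\<epsilon> > 0" for \<epsilon>
  proof -
    have "\<epsilon> / (2 * K) > 0" using that K by simp
    then obtain N where N: "\<And>n. n \<ge> N \<Longrightarrow> \<tau> n < \<epsilon> / (2 * K)"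
      using order_tendstoD(2)[OF \<tau>0] by (auto simp: eventually_sequentially)
    have "K * (\<tau> i + \<tau> j) < \<epsilon>" if "i \<ge> N" "j \<ge> N" for i j
    proof -
      have "\<tau> i + \<tau> j < \<epsilon> / K" using N[OF that(1)] N[OF that(2)] by (simp add: field_simps)
      then show ?thesis using K by (simp add: pos_less_divide_eq mult.commute)
    qed
    then show ?thesis using key le_less_trans by blast
  qed
  from complete[OF w(2) this] obtain f where f: "f \<in> D"
    "(\<lambda>n. A.q (\<lambda>x. w n x - f x) + B.q (\<lambda>x. w n x - f x)) \<longlonglongrightarrow> 0" by blast
  have nn: "0 \<le> A.q (\<lambda>x. w n x - f x)" "0 \<le> B.q (\<lambda>x. w n x - f x)" for n
    using A.q_nonneg[OF A.diff_closed[OF w(2) f(1)]] B.q_nonneg[OF B.diff_closed[OF w(2) f(1)]] by auto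
  have fA: "(\<lambda>n. A.q (\<lambda>x. w n x - f x)) \<longlonglongrightarrow> 0"
    by (rule tendsto_sandwich[OF _ _ tendsto_const f(2)]) (use nn in auto)
  have fB: "(\<lambda>n. B.q (\<lambda>x. w n x - f x)) \<longlonglongrightarrow> 0"
    by (rule tendsto_sandwich[OF _ _ tendsto_const f(2)]) (use nn in auto)
  have B1: "B.q f = 1" using B.tendsto_q[OF w(2) f(1) fB] w(3) by (simp add: LIMSEQ_const_iff)
  have be: "b f (e i) = 0" if "i < r" for i
    using B.tendsto_s[OF w(2) f(1) e[OF that] fB] w(1) that by (simp add: M_def LIMSEQ_const_iff)
  have fM: "f \<in> M" using f(1) be by (simp add: M_def)
  have "(\<lambda>n. \<mu> + 1 / real (Suc n)) \<longlonglongrightarrow> \<mu> + 0" by (intro tendsto_intros tendsto_one_over_Suc)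
  then have "A.q f \<le> \<mu> + 0"
    using A.tendsto_q[OF w(2) f(1) fA] w(4) by (intro LIMSEQ_le[where X = "\<lambda>n. A.q (w n)"]) auto
  then have "A.q f = \<mu>" using \<mu>_min[OF fM] B1 by simp
  then show thesis using that[of f \<mu>] f(1) be B1 \<mu>_lb c0_pos \<mu>_le \<mu>_min by (auto simp: M_def)
qed

definition eigenlist :: "nat \<Rightarrow> (nat \<Rightarrow> 'a \<Rightarrow> complex) \<Rightarrow> (nat \<Rightarrow> real) \<Rightarrow> bool" where
  "eigenlist r e \<nu> \<longleftrightarrow> (\<forall>i<r. is_eigen (\<nu> i) (e i)) \<and> (\<forall>i<r. \<forall>j<r. b (e i) (e j) = (if i = j then 1 else 0))"

text \<open>On the complement M of the list the form a - \<mu> b is nonnegative and vanishes at the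
  minimizer u. Cauchy-Schwarz for this semidefinite form gives the eigenvalue equation against all
  of M, without differentiating the quotient. It extends to the whole domain because u is orthogonal
  to the list for \<open>b\<close>, and hence also for \<open>a\<close>.\<close>

lemma eigenlist_extend:
  assumes el: "eigenlist r e \<nu>"
    and v: "v \<in> D" "\<And>i. i < r \<Longrightarrow> b v (e i) = 0" "B.q v > 0" "A.q v \<le> m * B.q v" and m: "m < \<theta>"
  shows "\<exists>u \<mu>. 0 < \<mu> \<and> \<mu> \<le> m \<and> eigenlist (Suc r) (e(r := u)) (\<nu>(r := \<mu>))"
proof -
  have eD: "e i \<in> D" if "i < r" for i using el that by (simp add: eigenlist_def is_eigen_def)
  obtain u \<mu> where u: "u \<in> D" "\<And>i. i < r \<Longrightarrow> b u (e i) = 0" "B.q u = 1" "A.q u = \<mu>" "0 < \<mu>" "\<mu> \<le> m"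
    and min: "\<And>w. w \<in> D \<Longrightarrow> (\<And>i. i < r \<Longrightarrow> b w (e i) = 0) \<Longrightarrow> \<mu> * B.q w \<le> A.q w"
    using minimizer[of r e v m] eD v m by blast
  define M where "M = {w \<in> D. \<forall>i<r. b w (e i) = 0}"
  interpret Q: herm_form M "\<lambda>u v. a u v - of_real \<mu> * b u v"
  proof
    show "0 \<le> Re (a w w - complex_of_real \<mu> * b w w)" if "w \<in> M" for w
      using min[of w] that by (auto simp: M_def A.q_def B.q_def)
    show "a w v - complex_of_real \<mu> * b w v = cnj (a v w - complex_of_real \<mu> * b v w)" if "v \<in> M" "w \<in> M" for v w
      using that A.herm[of v w] B.herm[of v w] by (simp add: M_def)
  qed (auto simp: M_def A.lin_closed A.zero_closed A.lin_left B.lin_left eD algebra_simps B.s_zero_left)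
  have uM: "u \<in> M" using u by (simp add: M_def)
  have "Q.q u = 0" using u by (simp add: Q.q_def A.q_def B.q_def)
  then have on_M: "a u w = of_real \<mu> * b u w" if "w \<in> M" for w
    using Q.cauchy_schwarz[OF uM that] by simp
  have "a u w = of_real \<mu> * b u w" if w: "w \<in> D" for w
  proof -
    let ?p = "\<lambda>x. \<Sum>i<r. b w (e i) * e i x"
    let ?w = "\<lambda>x. w x - ?p x"
    have pD: "?p \<in> D" using eD by (intro A.sum_closed) auto
    have "b ?w (e j) = 0" if j: "j < r" for j
    proof -
      have "b ?p (e j) = (\<Sum>i<r. b w (e i) * (if i = j then 1 else 0))"
        using el j eD by (subst B.s_sum_left) (auto simp: eigenlist_def intro!: sum.cong)
      then have "b ?p (e j) = b w (e j)" using j by (simp add: if_distrib[of "(*) _"] cong: if_cong)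
      then show ?thesis using B.diff_left[OF w pD eD[OF j]] by simp
    qed
    then have "?w \<in> M" using A.diff_closed[OF w pD] by (simp add: M_def)
    then have 1: "a u ?w = of_real \<mu> * b u ?w" by (rule on_M)
    have 2: "b u ?p = 0" using u eD by (subst B.s_sum_right) auto
    have "a u (e i) = 0" if "i < r" for i
    proof -
      have "a (e i) u = of_real (\<nu> i) * b (e i) u" using el that u(1) by (auto simp: eigenlist_def is_eigen_def)
      also have "b (e i) u = 0" using B.herm[OF u(1) eD[OF that]] u(2)[OF that] by simp
      finally show ?thesis using A.herm[OF eD[OF that] u(1)] by simp
    qed
    then have 3: "a u ?p = 0" using u eD by (subst A.s_sum_right) auto
    have wD: "?w \<in> D" by (rule A.diff_closed[OF w pD])
    have "a u w = a u ?w + a u ?p" "b u w = b u ?w + b u ?p"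
      using A.lin_right[OF wD pD u(1), of 1 1] B.lin_right[OF wD pD u(1), of 1 1] by simp_all
    then show ?thesis using 1 2 3 by simp
  qed
  then have eig: "is_eigen \<mu> u" using u(1) by (simp add: is_eigen_def)
  have "b (e i) u = 0" if "i < r" for i using B.herm[OF u(1) eD[OF that]] u(2)[OF that] by simp
  then have "eigenlist (Suc r) (e(r := u)) (\<nu>(r := \<mu>))"
    using el eig u B.s_self[OF u(1)] by (auto simp: eigenlist_def less_Suc_eq)
  then show ?thesis using u by blast
qed

text \<open>As long as r < N, the trial space contains a nonzero vector orthogonal to the r
  eigenvectors already found. Its quotient is at most m, so the next minimum is too.\<close>

lemma min_max:
  assumes V: "\<And>j. j < N \<Longrightarrow> v j \<in> D"
    and pos: "\<And>c. \<exists>j<N. c j \<noteq> 0 \<Longrightarrow> B.q (\<lambda>x. \<Sum>j<N. c j * v j x) > 0"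
    and le: "\<And>c. A.q (\<lambda>x. \<Sum>j<N. c j * v j x) \<le> m * B.q (\<lambda>x. \<Sum>j<N. c j * v j x)"
    and m: "m < \<theta>"
  shows "\<exists>e \<nu>. eigenlist N e \<nu> \<and> (\<forall>i<N. 0 < \<nu> i \<and> \<nu> i \<le> m)"
proof -
  have "\<exists>e \<nu>. eigenlist r e \<nu> \<and> (\<forall>i<r. 0 < \<nu> i \<and> \<nu> i \<le> m)" if "r \<le> N" for r
    using that
  proof (induction r)
    case 0 then show ?case by (simp add: eigenlist_def)
  next
    case (Suc r)
    then obtain e \<nu> where el: "eigenlist r e \<nu>" "\<forall>i<r. 0 < \<nu> i \<and> \<nu> i \<le> m" by auto
    obtain c where c: "\<exists>j<N. c j \<noteq> 0" "\<forall>i<r. (\<Sum>j<N. b (v j) (e i) * c j) = 0"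
      using homogeneous_system[of r N "\<lambda>i j. b (v j) (e i)"] Suc.prems by auto
    let ?v = "\<lambda>x. \<Sum>j<N. c j * v j x"
    have "?v \<in> D" using V by (intro A.sum_closed) auto
    moreover have "b ?v (e i) = 0" if "i < r" for i
    proof -
      have "e i \<in> D" using el that by (simp add: eigenlist_def is_eigen_def)
      then have "b ?v (e i) = (\<Sum>j<N. b (v j) (e i) * c j)"
        using V by (subst B.s_sum_left) (auto simp: mult.commute)
      then show ?thesis using c(2) that by simp
    qed
    ultimately obtain u \<mu> where "0 < \<mu>" "\<mu> \<le> m" "eigenlist (Suc r) (e(r := u)) (\<nu>(r := \<mu>))"
      using eigenlist_extend[OF el(1), of ?v m] pos[OF c(1)] le[of c] m by blast
    then have "eigenlist (Suc r) (e(r := u)) (\<nu>(r := \<mu>)) \<and> (\<forall>i<Suc r. 0 < (\<nu>(r := \<mu>)) i \<and> (\<nu>(r := \<mu>)) i \<le> m)"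
      using el(2) by (simp add: less_Suc_eq)
    then show ?case by blast
  qed
  then show ?thesis by blast
qed

text \<open>For r > k some nontrivial combination is annihilated by all functionals and has quotient
  at least \<theta> by \<open>garding\<close>. But its quotient is a weighted mean of the \<nu> i,
  all below \<theta>.\<close>

lemma eigenlist_length:
  assumes el: "eigenlist r e \<nu>" and lt: "\<And>i. i < r \<Longrightarrow> \<nu> i < \<theta>"
  shows "r \<le> k"
proof (rule ccontr)
  assume "\<not> r \<le> k"
  then obtain c where c: "\<exists>j<r. c j \<noteq> 0" "\<forall>i<k. (\<Sum>j<r. l i (e j) * c j) = 0"
    using homogeneous_system[of k r "\<lambda>i j. l i (e j)"] by auto
  have eD: "e i \<in> D" if "i < r" for i using el that by (simp add: eigenlist_def is_eigen_def)
  let ?u = "\<lambda>x. \<Sum>j<r. c j * e j x"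
  have uD: "?u \<in> D" using eD by (intro A.sum_closed) auto
  have ae: "a (e i) (e j) = (if i = j then of_real (\<nu> i) else 0)" if "i < r" "j < r" for i j
    using el that eD by (auto simp: eigenlist_def is_eigen_def)
  have be: "b (e i) (e j) = (if i = j then 1 else 0)" if "i < r" "j < r" for i j
    using el that by (auto simp: eigenlist_def)
  have "B.q ?u = (\<Sum>j<r. (cmod (c j))\<^sup>2 * B.q (e j))"
    using eD be by (intro B.q_sum_orthogonal) auto
  also have "\<dots> = (\<Sum>j<r. (cmod (c j))\<^sup>2)" using be by (intro sum.cong) (auto simp: B.q_def)
  finally have Bu: "B.q ?u = (\<Sum>j<r. (cmod (c j))\<^sup>2)" .
  have "A.q ?u = (\<Sum>j<r. (cmod (c j))\<^sup>2 * A.q (e j))"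
    using eD ae by (intro A.q_sum_orthogonal) auto
  also have "\<dots> = (\<Sum>j<r. (cmod (c j))\<^sup>2 * \<nu> j)" using ae by (intro sum.cong) (auto simp: A.q_def)
  also have "\<dots> < (\<Sum>j<r. (cmod (c j))\<^sup>2 * \<theta>)"
  proof (rule sum_strict_mono_ex1)
    show "\<exists>j\<in>{..<r}. (cmod (c j))\<^sup>2 * \<nu> j < (cmod (c j))\<^sup>2 * \<theta>"
    proof -
      obtain j where "j < r" "c j \<noteq> 0" using c(1) by blast
      then show ?thesis using lt[of j] by (intro bexI[of _ j] mult_strict_left_mono) auto
    qed
    show "\<forall>j\<in>{..<r}. (cmod (c j))\<^sup>2 * \<nu> j \<le> (cmod (c j))\<^sup>2 * \<theta>" using lt by (intro ballI mult_left_mono) (auto intro: less_imp_le)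
  qed simp
  finally have Au: "A.q ?u < \<theta> * B.q ?u" using Bu by (simp add: sum_distrib_left mult.commute)
  have l_sum: "l i (\<lambda>x. \<Sum>j\<in>J. c j * e j x) = (\<Sum>j\<in>J. c j * l i (e j))" if "i < k" "J \<subseteq> {..<r}" for i J
  proof -
    have "finite J" using that(2) finite_subset by blast
    then show ?thesis using that(2)
    proof (induction J)
      case empty
      show ?case using l_lin[OF that(1) A.zero_closed A.zero_closed, of 0 0] by simp
    next
      case (insert j J)
      have "(\<lambda>x. \<Sum>j\<in>J. c j * e j x) \<in> D" using insert.prems eD by (intro A.sum_closed) auto
      then show ?case using insert l_lin[OF that(1) eD[of j], of "\<lambda>x. \<Sum>j\<in>J. c j * e j x" "c j" 1] by simp
    qed
  qed
  have "l i ?u = 0" if "i < k" for i using l_sum[OF that, of "{..<r}"] c(2) that by (simp add: mult.commute)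
  then show False using garding[OF uD] Au by simp
qed

lemma eigen_orthogonal:
  assumes "is_eigen \<mu> u" "is_eigen \<nu> v" "\<mu> \<noteq> \<nu>"
  shows "b u v = 0"
proof -
  have D: "u \<in> D" "v \<in> D" using assms by (auto simp: is_eigen_def)
  have "of_real \<mu> * b u v = a u v" "of_real \<nu> * b v u = a v u" using assms by (auto simp: is_eigen_def)
  moreover have "a v u = cnj (a u v)" "b v u = cnj (b u v)" using D by (auto intro: A.herm B.herm)
  ultimately have "of_real \<nu> * cnj (b u v) = cnj (of_real \<mu> * b u v)" by simp
  then have "(\<nu> - \<mu>) *\<^sub>R cnj (b u v) = 0" by (simp add: scaleR_conv_of_real algebra_simps)
  then show ?thesis using assms(3) by simp
qed

lemma eigen_pos:
  assumes "is_eigen \<mu> u" "B.q u > 0"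
  shows "c0 \<le> \<mu>"
proof -
  have u: "u \<in> D" "a u u = of_real \<mu> * b u u" using assms by (auto simp: is_eigen_def)
  then have "A.q u = \<mu> * B.q u" by (simp add: A.q_def B.q_def)
  then show ?thesis using coercive[OF u(1)] assms(2) by simp
qed

definition eigenvalues where "eigenvalues = {\<mu>. \<mu> < \<theta> \<and> (\<exists>u. is_eigen \<mu> u \<and> B.q u > 0)}"

lemma is_eigen_scale: "is_eigen \<mu> u \<Longrightarrow> is_eigen \<mu> (\<lambda>x. c * u x)"
  by (auto simp: is_eigen_def A.scale_closed A.scale_left B.scale_left)

text \<open>Distinct eigenvalues have orthogonal eigenvectors, so one normalized eigenvector for
  each turns a finite set of eigenvalues into an eigenlist of the same length.\<close>

lemma eigenvalues_finite: "finite eigenvalues \<and> card eigenvalues \<le> k"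
proof -
  have "card F \<le> k" if F: "F \<subseteq> eigenvalues" "finite F" for F
  proof -
    have "\<exists>u. is_eigen \<mu> u \<and> B.q u = 1" if \<mu>: "\<mu> \<in> F" for \<mu>
    proof -
      obtain u where u: "is_eigen \<mu> u" "B.q u > 0" using \<mu> F by (auto simp: eigenvalues_def)
      then have "B.q (\<lambda>x. of_real (1 / sqrt (B.q u)) * u x) = 1"
        by (subst B.q_scale) (auto simp: is_eigen_def norm_divide power_divide)
      then show ?thesis using is_eigen_scale[OF u(1)] by blast
    qed
    then obtain u where u: "\<And>\<mu>. \<mu> \<in> F \<Longrightarrow> is_eigen \<mu> (u \<mu>)" "\<And>\<mu>. \<mu> \<in> F \<Longrightarrow> B.q (u \<mu>) = 1" by metis
    obtain h where h: "bij_betw h {..<card F} F" using ex_bij_betw_nat_finite[OF F(2)] by (auto simp: atLeast0LessThan)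
    have hF: "h i \<in> F" if "i < card F" for i using h that by (auto simp: bij_betw_def)
    have "eigenlist (card F) (\<lambda>i. u (h i)) h"
      unfolding eigenlist_def
    proof (intro conjI allI impI)
      fix i assume i: "i < card F"
      show "is_eigen (h i) (u (h i))" using hF[OF i] u by blast
      fix j assume j: "j < card F"
      show "b (u (h i)) (u (h j)) = (if i = j then 1 else 0)"
      proof (cases "i = j")
        case True
        then show ?thesis using u[OF hF[OF i]] B.s_self[of "u (h i)"] by (simp add: is_eigen_def)
      next
        case False
        then have "h i \<noteq> h j" using h i j by (auto simp: bij_betw_def inj_on_def)
        then show ?thesis using False eigen_orthogonal[OF u(1)[OF hF[OF i]] u(1)[OF hF[OF j]]] by simp
      qed
    qed
    then show ?thesis using hF F by (intro eigenlist_length) (auto simp: eigenvalues_def)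
  qed
  then show ?thesis
    by (metis finite_subset infinite_arbitrarily_large lessI not_le order_refl)
qed

end

section \<open>Integration of compactly supported functions\<close>

definition compactly_supported :: "'a::euclidean_space set \<Rightarrow> ('a \<Rightarrow> 'b::real_normed_vector) \<Rightarrow> bool" where
  "compactly_supported \<Omega> f \<longleftrightarrow> continuous_on UNIV f \<and> (\<exists>K. compact K \<and> K \<subseteq> \<Omega> \<and> (\<forall>x. x \<notin> K \<longrightarrow> f x = 0))"

lemma compactly_supported_integrable:
  fixes f :: "'a::euclidean_space \<Rightarrow> 'b::euclidean_space"
  assumes "compactly_supported \<Omega> f"
  shows "integrable lborel f"
proof -
  obtain K where K: "compact K" "\<And>x. x \<notin> K \<Longrightarrow> f x = 0" "continuous_on UNIV f"
    using assms unfolding compactly_supported_def by blast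
  have "integrable lborel (\<lambda>x. indicator K x *\<^sub>R f x)"
    using K by (intro borel_integrable_compact) (auto intro: continuous_on_subset)
  moreover have "(\<lambda>x. indicator K x *\<^sub>R f x) = f"
    by (rule ext) (use K(2) in \<open>auto simp: indicator_def\<close>)
  ultimately show ?thesis by simp
qed

text \<open>The definitions integrate over \<open>lebesgue_on \<Omega>\<close>, the estimates over
  \<open>lborel\<close> on the whole space, where translation invariance and Fubini are at hand.
  Extension by zero makes the two agree.\<close>

lemma compactly_supported_lebesgue_on:
  fixes f :: "'a::euclidean_space \<Rightarrow> 'b::euclidean_space"
  assumes "compactly_supported \<Omega> f" "open \<Omega>"
  shows "integrable (lebesgue_on \<Omega>) f" "integral\<^sup>L (lebesgue_on \<Omega>) f = integral\<^sup>L lborel f"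
proof -
  have \<Omega>: "\<Omega> \<inter> space lebesgue \<in> sets lebesgue" using assms(2) by simp
  have m: "f \<in> borel_measurable lborel"
    using assms(1) borel_measurable_continuous_onI unfolding compactly_supported_def by (simp add: borel_measurable_continuous_onI)
  have e: "(\<lambda>x. indicator \<Omega> x *\<^sub>R f x) = f"
    by (rule ext) (use assms(1) in \<open>auto simp: indicator_def compactly_supported_def\<close>)
  have "integrable lebesgue f" using compactly_supported_integrable[OF assms(1)] integrable_completion[OF m] by simp
  then show "integrable (lebesgue_on \<Omega>) f" unfolding integrable_restrict_space[OF \<Omega>] e .
  show "integral\<^sup>L (lebesgue_on \<Omega>) f = integral\<^sup>L lborel f"
    unfolding integral_restrict_space[OF \<Omega>] e using integral_completion[OF m] .
qed

lemma borel_measurable_cnj [measurable]: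
  "f \<in> borel_measurable M \<Longrightarrow> (\<lambda>x. cnj (f x)) \<in> borel_measurable M"
  by (rule measurable_compose[OF _ borel_measurable_continuous_onI[OF continuous_on_cnj[OF continuous_on_id]]])

lemma test_functions_zero: "(\<lambda>x. 0) \<in> test_functions \<Omega>"
  by (rule test_functionsI[of _ "{}"]) auto

lemma test_functions_compactly_supported: "\<phi> \<in> test_functions \<Omega> \<Longrightarrow> compactly_supported \<Omega> \<phi>"
  unfolding compactly_supported_def using test_functions_continuous
  by (metis test_functionsE)

lemma compactly_supported_mult_left:
  fixes f g :: "'a::euclidean_space \<Rightarrow> complex"
  assumes "compactly_supported \<Omega> f" "continuous_on UNIV g"
  shows "compactly_supported \<Omega> (\<lambda>x. f x * g x)"
proof -
  obtain K where "compact K" "K \<subseteq> \<Omega>" "\<forall>x. x \<notin> K \<longrightarrow> f x = 0" "continuous_on UNIV f"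
    using assms(1) unfolding compactly_supported_def by blast
  then show ?thesis unfolding compactly_supported_def using assms(2)
    by (intro conjI exI[of _ K]) (auto intro!: continuous_intros)
qed

lemma compactly_supported_norm_sq:
  fixes f :: "'a::euclidean_space \<Rightarrow> complex"
  assumes "compactly_supported \<Omega> f"
  shows "compactly_supported \<Omega> (\<lambda>x. (cmod (f x))\<^sup>2)"
proof -
  obtain K where "compact K" "K \<subseteq> \<Omega>" "\<forall>x. x \<notin> K \<longrightarrow> f x = 0" "continuous_on UNIV f"
    using assms(1) unfolding compactly_supported_def by blast
  then show ?thesis unfolding compactly_supported_def
    by (intro conjI exI[of _ K]) (auto intro!: continuous_intros)
qed

lemma integral_lborel_translate:
  fixes f :: "'a::euclidean_space \<Rightarrow> 'b::{banach, second_countable_topology}"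
  assumes "f \<in> borel_measurable borel"
  shows "(LINT x|lborel. f (x + c)) = integral\<^sup>L lborel f"
    "integrable lborel f \<Longrightarrow> integrable lborel (\<lambda>x. f (x + c))"
proof -
  have m: "(\<lambda>x. c + x) \<in> measurable lborel borel" by simp
  have e: "distr lborel borel (\<lambda>x. c + x) = lborel" by (rule lborel_distr_plus)
  show "(LINT x|lborel. f (x + c)) = integral\<^sup>L lborel f"
    using integral_distr[OF m assms] unfolding e by (simp add: add.commute)
  show "integrable lborel (\<lambda>x. f (x + c))" if "integrable lborel f"
    using integrable_distr_eq[OF m assms] that unfolding e by (simp add: add.commute)
qed

text \<open>Difference quotients of an integrable function have integral zero by translation
  invariance, and the mean value theorem dominates them. Differentiability is asked for along lines
  in direction b only, so F may be discontinuous in other directions: the functions inserted later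
  contain indicators of unions of such lines.\<close>

lemma integral_directional_derivative:
  fixes F G :: "'a::euclidean_space \<Rightarrow> real"
  assumes b: "norm b = 1"
    and deriv: "\<And>x. ((\<lambda>t. F (x + t *\<^sub>R b)) has_real_derivative G x) (at 0)"
    and F: "integrable lborel F" and G: "G \<in> borel_measurable borel"
    and bnd: "\<And>x. \<bar>G x\<bar> \<le> K" and supp: "\<And>x. norm x > R \<Longrightarrow> G x = 0"
  shows "integral\<^sup>L lborel G = 0"
proof -
  define h where "h n = 1 / real (Suc n)" for n
  have h: "0 < h n" "h n \<le> 1" for n by (auto simp: h_def)
  have h0: "h \<longlonglongrightarrow> 0" unfolding h_def by (rule tendsto_one_over_Suc)
  define q where "q n x = (F (x + h n *\<^sub>R b) - F x) / h n" for n x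
  have Fm: "F \<in> borel_measurable borel" using F by auto
  have deriv': "((\<lambda>t. F (x + t *\<^sub>R b)) has_real_derivative G (x + s *\<^sub>R b)) (at s)" for x s
  proof -
    have "((\<lambda>t. F (x + s *\<^sub>R b + t *\<^sub>R b)) has_real_derivative G (x + s *\<^sub>R b)) (at (s + - s))"
      using deriv[of "x + s *\<^sub>R b"] by simp
    then have "((\<lambda>t. F (x + s *\<^sub>R b + (t + - s) *\<^sub>R b)) has_real_derivative G (x + s *\<^sub>R b)) (at s)"
      by (rule DERIV_shift[THEN iffD1])
    then show ?thesis by (simp add: algebra_simps)
  qed
  have lim: "(\<lambda>n. q n x) \<longlonglongrightarrow> G x" for x
  proof -
    have "((\<lambda>t. (F (x + t *\<^sub>R b) - F x) / t) \<longlongrightarrow> G x) (at 0)"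
      using deriv[of x] by (simp add: DERIV_def)
    then show ?thesis unfolding q_def
    proof (rule filterlim_compose)
      have "h n \<noteq> 0" for n using h(1)[of n] by simp
      then show "filterlim h (at 0) sequentially" by (simp add: filterlim_at h0)
    qed
  qed
  \<comment> \<open>The intermediate point x + z b has 0 < z < h n \<le> 1 and G vanishes outside
    radius R, so the quotient vanishes outside radius R + 1.\<close>
  have bound: "\<bar>q n x\<bar> \<le> K * indicator (cball 0 (R + 1)) x" for n x
  proof -
    obtain z where z: "0 < z" "z < h n" "F (x + h n *\<^sub>R b) - F (x + 0 *\<^sub>R b) = (h n - 0) * G (x + z *\<^sub>R b)"
      using MVT2[OF h(1)[of n], of "\<lambda>t. F (x + t *\<^sub>R b)" "\<lambda>s. G (x + s *\<^sub>R b)"] deriv' by auto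
    have q: "q n x = G (x + z *\<^sub>R b)" using z(3) h(1)[of n] by (simp add: q_def)
    show ?thesis
    proof (cases "norm x \<le> R + 1")
      case True then show ?thesis using bnd by (simp add: q)
    next
      case False
      have "norm x \<le> norm (x + z *\<^sub>R b) + norm (z *\<^sub>R b)" using norm_triangle_ineq4[of "x + z *\<^sub>R b" "z *\<^sub>R b"] by simp
      also have "norm (z *\<^sub>R b) \<le> 1" using z h(2)[of n] b by simp
      finally have "norm (x + z *\<^sub>R b) > R" using False by simp
      then show ?thesis using supp False by (simp add: q)
    qed
  qed
  have int0: "(LINT x|lborel. q n x) = 0" for n
  proof -
    have "(LINT x|lborel. q n x) = ((LINT x|lborel. F (x + h n *\<^sub>R b)) - integral\<^sup>L lborel F) / h n"
      unfolding q_def using integral_lborel_translate(2)[OF Fm F] F by simp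
    then show ?thesis by (simp add: integral_lborel_translate(1)[OF Fm])
  qed
  have "(\<lambda>n. LINT x|lborel. q n x) \<longlonglongrightarrow> integral\<^sup>L lborel G"
  proof (rule integral_dominated_convergence)
    show "integrable lborel (\<lambda>x::'a. K * indicator (cball 0 (R + 1)) x)"
      by (intro integrable_mult_right integrable_real_indicator) (use emeasure_bounded_finite[OF bounded_cball[of "0::'a" "R + 1"]] in auto)
    show "(\<lambda>x. q n x) \<in> borel_measurable lborel" for n unfolding q_def using Fm by measurable
  qed (use G lim bound in auto)
  then show ?thesis by (simp add: int0 LIMSEQ_const_iff)
qed

lemma has_derivative_partial_line:
  fixes f :: "'a::euclidean_space \<Rightarrow> complex"
  assumes "f differentiable (at x)"
  shows "((\<lambda>t. f (x + t *\<^sub>R b)) has_vector_derivative partial_deriv b f x) (at 0)"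
proof -
  let ?D = "frechet_derivative f (at x)"
  have D: "(f has_derivative ?D) (at (x + 0 *\<^sub>R b))" using assms by (simp add: frechet_derivative_works)
  have "((\<lambda>t. x + t *\<^sub>R b) has_derivative (\<lambda>t. t *\<^sub>R b)) (at 0)" by (auto intro!: derivative_eq_intros)
  from has_derivative_compose[OF this D] have "((\<lambda>t. f (x + t *\<^sub>R b)) has_derivative (\<lambda>t. ?D (t *\<^sub>R b))) (at 0)" .
  moreover have "?D (t *\<^sub>R b) = t *\<^sub>R ?D b" for t
    using D by (intro linear_cmul has_derivative_linear)
  ultimately show ?thesis by (simp add: has_vector_derivative_def partial_deriv_def)
qed

lemma compactly_supported_bounds:
  fixes f :: "'a::euclidean_space \<Rightarrow> 'b::euclidean_space"
  assumes "compactly_supported \<Omega> f"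
  obtains K R where "\<And>x. norm (f x) \<le> K" "\<And>x. norm x > R \<Longrightarrow> f x = 0"
proof -
  obtain S where S: "compact S" "\<And>x. x \<notin> S \<Longrightarrow> f x = 0" "continuous_on UNIV f"
    using assms unfolding compactly_supported_def by blast
  have "compact (f ` S)" using S by (intro compact_continuous_image) (auto intro: continuous_on_subset)
  then obtain K where K: "\<And>y. y \<in> f ` S \<Longrightarrow> norm y \<le> K" using compact_imp_bounded bounded_iff by metis
  obtain R where R: "\<And>x. x \<in> S \<Longrightarrow> norm x \<le> R" using S(1) compact_imp_bounded bounded_iff by metis
  have "norm (f x) \<le> max K 0" for x by (cases "x \<in> S") (use K S(2)[of x] in \<open>auto simp: le_max_iff_disj\<close>)
  moreover have "f x = 0" if "norm x > R" for x using R[of x] S(2)[of x] that by fastforce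
  ultimately show ?thesis by (rule that)
qed

lemma integral_partial_deriv:
  fixes f :: "'a::euclidean_space \<Rightarrow> complex"
  assumes f: "f \<in> test_functions UNIV" and b: "b \<in> Basis"
  shows "integral\<^sup>L lborel (partial_deriv b f) = 0"
proof -
  have d: "((\<lambda>t. f (x + t *\<^sub>R b)) has_vector_derivative partial_deriv b f x) (at 0)" for x
    by (rule has_derivative_partial_line[OF test_functions_differentiable[OF f]])
  have cf: "compactly_supported UNIV f" and cg: "compactly_supported UNIV (partial_deriv b f)"
    using f test_functions_partial_deriv[OF f b] by (auto intro: test_functions_compactly_supported)
  obtain K R where KR: "\<And>x. norm (partial_deriv b f x) \<le> K" "\<And>x. norm x > R \<Longrightarrow> partial_deriv b f x = 0"
    using compactly_supported_bounds[OF cg] by metis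
  have fi: "integrable lborel f" and gi: "integrable lborel (partial_deriv b f)"
    by (rule compactly_supported_integrable[OF cf], rule compactly_supported_integrable[OF cg])
  have "(LINT x|lborel. Re (partial_deriv b f x)) = 0"
  proof (rule integral_directional_derivative[of b "\<lambda>x. Re (f x)" _ K R])
    show "((\<lambda>t. Re (f (x + t *\<^sub>R b))) has_real_derivative Re (partial_deriv b f x)) (at 0)" for x
      using bounded_linear.has_vector_derivative[OF bounded_linear_Re d[of x]]
      by (simp add: has_real_derivative_iff_has_vector_derivative)
    show "\<bar>Re (partial_deriv b f x)\<bar> \<le> K" for x using KR(1)[of x] abs_Re_le_cmod order_trans by blast
    show "(\<lambda>x. Re (partial_deriv b f x)) \<in> borel_measurable borel" using gi by auto
  qed (use b fi KR in auto)
  moreover have "(LINT x|lborel. Im (partial_deriv b f x)) = 0"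
  proof (rule integral_directional_derivative[of b "\<lambda>x. Im (f x)" _ K R])
    show "((\<lambda>t. Im (f (x + t *\<^sub>R b))) has_real_derivative Im (partial_deriv b f x)) (at 0)" for x
      using bounded_linear.has_vector_derivative[OF bounded_linear_Im d[of x]]
      by (simp add: has_real_derivative_iff_has_vector_derivative)
    show "\<bar>Im (partial_deriv b f x)\<bar> \<le> K" for x using KR(1)[of x] abs_Im_le_cmod order_trans by blast
    show "(\<lambda>x. Im (partial_deriv b f x)) \<in> borel_measurable borel" using gi by auto
  qed (use b fi KR in auto)
  ultimately show ?thesis using gi by (simp add: complex_eq_iff)
qed

section \<open>Weak derivatives\<close>

lemma test_functions_weak_deriv:
  assumes \<phi>: "\<phi> \<in> test_functions \<Omega>" and b: "b \<in> Basis" and \<Omega>: "open \<Omega>"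
  shows "is_weak_partial_deriv \<Omega> b \<phi> (partial_deriv b \<phi>)"
  unfolding is_weak_partial_deriv_def
proof
  fix \<psi> assume \<psi>: "\<psi> \<in> test_functions \<Omega>"
  have UN: "test_functions \<Omega> \<subseteq> test_functions UNIV" by (rule test_functions_mono) simp
  have p: "(\<lambda>x. \<phi> x * \<psi> x) \<in> test_functions UNIV"
    using UN \<phi> test_functions_C_k[OF \<psi>] by (intro test_functions_mult) auto
  have e: "partial_deriv b (\<lambda>x. \<phi> x * \<psi> x) = (\<lambda>x. \<phi> x * partial_deriv b \<psi> x + partial_deriv b \<phi> x * \<psi> x)"
    by (intro ext partial_deriv_mult test_functions_differentiable[OF \<phi>] test_functions_differentiable[OF \<psi>])
  have c1: "compactly_supported \<Omega> (\<lambda>x. \<phi> x * partial_deriv b \<psi> x)"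
    by (intro compactly_supported_mult_left test_functions_compactly_supported \<phi>
        test_functions_continuous[OF test_functions_partial_deriv[OF \<psi> b]])
  have c2: "compactly_supported \<Omega> (\<lambda>x. partial_deriv b \<phi> x * \<psi> x)"
    by (intro compactly_supported_mult_left test_functions_compactly_supported test_functions_partial_deriv \<phi> b
        test_functions_continuous[OF \<psi>])
  have "(LINT x|lborel. \<phi> x * partial_deriv b \<psi> x) + (LINT x|lborel. partial_deriv b \<phi> x * \<psi> x) = 0"
    using integral_partial_deriv[OF p b] compactly_supported_integrable[OF c1] compactly_supported_integrable[OF c2]
    unfolding e by simp
  then show "(LINT x|lebesgue_on \<Omega>. \<phi> x * partial_deriv b \<psi> x) = - (LINT x|lebesgue_on \<Omega>. partial_deriv b \<phi> x * \<psi> x)"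
    using compactly_supported_lebesgue_on(2)[OF c1 \<Omega>] compactly_supported_lebesgue_on(2)[OF c2 \<Omega>]
    by (simp add: add_eq_0_iff)
qed

section \<open>Square integrable functions as a hermitian form\<close>

lemma L2_D: "u \<in> L2 \<Omega> \<Longrightarrow> u \<in> borel_measurable (lebesgue_on \<Omega>)"
  "u \<in> L2 \<Omega> \<Longrightarrow> integrable (lebesgue_on \<Omega>) (\<lambda>x. (cmod (u x))\<^sup>2)"
  by (auto simp: L2_def)

lemma test_functions_L2:
  assumes "\<phi> \<in> test_functions \<Omega>" "open \<Omega>"
  shows "\<phi> \<in> L2 \<Omega>"
  using test_functions_compactly_supported[OF assms(1)] assms(2)
    compactly_supported_lebesgue_on(1)[of \<Omega> \<phi>] compactly_supported_lebesgue_on(1)[of \<Omega> "\<lambda>x. (cmod (\<phi> x))\<^sup>2"]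
    compactly_supported_norm_sq[of \<Omega> \<phi>]
  by (auto simp: L2_def)

lemma L2_mult_integrable:
  assumes "u \<in> L2 \<Omega>" "v \<in> L2 \<Omega>"
  shows "integrable (lebesgue_on \<Omega>) (\<lambda>x. u x * v x)" "integrable (lebesgue_on \<Omega>) (\<lambda>x. u x * cnj (v x))"
proof -
  note m [measurable] = L2_D(1)[OF assms(1)] L2_D(1)[OF assms(2)]
  have i: "integrable (lebesgue_on \<Omega>) (\<lambda>x. (cmod (u x))\<^sup>2 + (cmod (v x))\<^sup>2)"
    using assms by (auto simp: L2_def)
  have le: "cmod (u x) * cmod (v x) \<le> (cmod (u x))\<^sup>2 + (cmod (v x))\<^sup>2" for x
  proof -
    have "0 \<le> cmod (u x) * cmod (v x)" by simp
    then show ?thesis using sum_squares_bound[of "cmod (u x)" "cmod (v x)"] by linarith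
  qed
  show "integrable (lebesgue_on \<Omega>) (\<lambda>x. u x * v x)"
    by (rule Bochner_Integration.integrable_bound[OF i]) (use le in \<open>auto simp: norm_mult\<close>)
  show "integrable (lebesgue_on \<Omega>) (\<lambda>x. u x * cnj (v x))"
    by (rule Bochner_Integration.integrable_bound[OF i]) (use le in \<open>auto simp: norm_mult\<close>)
qed

lemma cmod_lin_sq_le: "(cmod (c * u + d * v))\<^sup>2 \<le> 2 * (cmod c)\<^sup>2 * (cmod u)\<^sup>2 + 2 * (cmod d)\<^sup>2 * (cmod v)\<^sup>2"
proof -
  have "(cmod (c * u + d * v))\<^sup>2 \<le> (cmod c * cmod u + cmod d * cmod v)\<^sup>2"
    by (intro power_mono order_trans[OF norm_triangle_ineq]) (auto simp: norm_mult)
  also have "\<dots> \<le> 2 * (cmod c)\<^sup>2 * (cmod u)\<^sup>2 + 2 * (cmod d)\<^sup>2 * (cmod v)\<^sup>2"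
    using sum_squares_bound[of "cmod c * cmod u" "cmod d * cmod v"] by (simp add: power2_sum power_mult_distrib)
  finally show ?thesis .
qed

lemma L2_lin:
  assumes "u \<in> L2 \<Omega>" "v \<in> L2 \<Omega>"
  shows "(\<lambda>x. c * u x + d * v x) \<in> L2 \<Omega>"
proof -
  note m [measurable] = L2_D(1)[OF assms(1)] L2_D(1)[OF assms(2)]
  have i: "integrable (lebesgue_on \<Omega>) (\<lambda>x. 2 * (cmod c)\<^sup>2 * (cmod (u x))\<^sup>2 + 2 * (cmod d)\<^sup>2 * (cmod (v x))\<^sup>2)"
    using assms by (auto simp: L2_def)
  have "integrable (lebesgue_on \<Omega>) (\<lambda>x. (cmod (c * u x + d * v x))\<^sup>2)"
    by (rule Bochner_Integration.integrable_bound[OF i]) (use cmod_lin_sq_le in \<open>auto intro!: AE_I2\<close>)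
  then show ?thesis by (simp add: L2_def)
qed

lemma L2_diff: "u \<in> L2 \<Omega> \<Longrightarrow> v \<in> L2 \<Omega> \<Longrightarrow> (\<lambda>x. u x - v x) \<in> L2 \<Omega>"
  using L2_lin[of u \<Omega> v 1 "-1"] by simp

lemma L2_zero: "(\<lambda>x. 0) \<in> L2 \<Omega>"
  by (simp add: L2_def)

lemma L2_inner_self: "u \<in> L2 \<Omega> \<Longrightarrow> L2_inner \<Omega> u u = of_real (LINT x|lebesgue_on \<Omega>. (cmod (u x))\<^sup>2)"
  unfolding L2_inner_def by (simp add: complex_norm_square[symmetric] del: of_real_power)

lemma L2_herm_form: "herm_form (L2 \<Omega>) (L2_inner \<Omega>)"
proof
  show "L2_inner \<Omega> (\<lambda>x. c * u x + d * v x) w = c * L2_inner \<Omega> u w + d * L2_inner \<Omega> v w"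
    if "u \<in> L2 \<Omega>" "v \<in> L2 \<Omega>" "w \<in> L2 \<Omega>" for u v w c d
    using L2_mult_integrable(2)[OF that(1,3)] L2_mult_integrable(2)[OF that(2,3)]
    by (simp add: L2_inner_def distrib_right mult.assoc)
  show "L2_inner \<Omega> v u = cnj (L2_inner \<Omega> u v)" for u v
    unfolding L2_inner_def by (subst Bochner_Integration.integral_cnj[symmetric]) (simp add: mult.commute)
  show "0 \<le> Re (L2_inner \<Omega> u u)" if "u \<in> L2 \<Omega>" for u
    using L2_inner_self[OF that] by simp
qed (auto intro: L2_lin simp: L2_zero)

interpretation L2: herm_form "L2 \<Omega>" "L2_inner \<Omega>" for \<Omega> :: "'a::euclidean_space set"
  by (rule L2_herm_form)

lemma L2_q: "u \<in> L2 \<Omega> \<Longrightarrow> L2.q \<Omega> u = (LINT x|lebesgue_on \<Omega>. (cmod (u x))\<^sup>2)"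
  by (simp add: L2.q_def L2_inner_self)

lemma L2_q_zero_iff:
  assumes "u \<in> L2 \<Omega>"
  shows "L2.q \<Omega> u = 0 \<longleftrightarrow> (AE x in lebesgue_on \<Omega>. u x = 0)"
  unfolding L2_q[OF assms]
  by (subst integral_nonneg_eq_0_iff_AE) (use L2_D(2)[OF assms] in auto)

section \<open>The fundamental lemma of the calculus of variations\<close>

definition box_bump :: "real \<Rightarrow> 'a \<Rightarrow> 'a \<Rightarrow> 'a::euclidean_space \<Rightarrow> complex" where
  "box_bump n c d x = (\<Prod>i\<in>Basis. of_real (smooth_bump n (c \<bullet> i) (d \<bullet> i) (x \<bullet> i)))"

lemma box_bump_test:
  assumes "cbox c d \<subseteq> \<Omega>" "n \<ge> 0"
  shows "box_bump n c d \<in> test_functions \<Omega>"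
proof (rule test_functionsI[of _ "cbox c d"])
  show "C_k k (box_bump n c d)" for k
    unfolding box_bump_def by (intro C_k_prod smooth_bump_C_k)
  show "box_bump n c d x = 0" if "x \<notin> cbox c d" for x
  proof -
    have "\<exists>i\<in>Basis. x \<bullet> i \<notin> {c \<bullet> i<..<d \<bullet> i}" using that by (auto simp: mem_box not_le less_le)
    then obtain i where "i \<in> Basis" "smooth_bump n (c \<bullet> i) (d \<bullet> i) (x \<bullet> i) = 0"
      using smooth_bump_zero[OF assms(2)] by blast
    then show ?thesis by (auto simp: box_bump_def)
  qed
qed (use assms in auto)

lemma box_bump_norm: "cmod (box_bump n c d x) \<le> 1"
  unfolding box_bump_def prod_norm[symmetric]
  using smooth_bump_range by (intro prod_le_1) auto

lemma box_bump_tendsto: "(\<lambda>n. box_bump (real n) c d x) \<longlonglongrightarrow> indicator (box c d) x"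
proof -
  have "(\<lambda>n. box_bump (real n) c d x) \<longlonglongrightarrow> (\<Prod>i\<in>Basis. of_real (indicator {c \<bullet> i<..<d \<bullet> i} (x \<bullet> i)))"
    unfolding box_bump_def by (intro tendsto_prod tendsto_of_real smooth_bump_tendsto)
  moreover have "(\<Prod>i\<in>Basis. of_real (indicator {c \<bullet> i<..<d \<bullet> i} (x \<bullet> i)) :: complex) = indicator (box c d) x"
  proof (cases "x \<in> box c d")
    case True then show ?thesis by (auto simp: mem_box intro!: prod.neutral)
  next
    case False
    then have "\<exists>i\<in>Basis. x \<bullet> i \<notin> {c \<bullet> i<..<d \<bullet> i}" by (auto simp: mem_box)
    then obtain i where "i \<in> Basis" "(indicator {c \<bullet> i<..<d \<bullet> i} (x \<bullet> i) :: real) = 0"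
      by (meson indicator_eq_0_iff)
    then show ?thesis using False by auto
  qed
  ultimately show ?thesis by simp
qed

lemma indicator_L2:
  assumes "S \<in> lmeasurable" "\<Omega> \<in> sets lebesgue"
  shows "(\<lambda>x. indicator S x) \<in> L2 \<Omega>"
proof -
  have S: "S \<in> sets lebesgue" using assms by (simp add: fmeasurable_def)
  have "S \<inter> \<Omega> \<in> lmeasurable" using assms by (intro fmeasurable_Int_fmeasurable)
  then have 1: "integrable lebesgue (indicator (S \<inter> \<Omega>) :: 'a \<Rightarrow> real)"
    by (intro integrable_real_indicator) (auto simp: fmeasurable_def)
  have e: "(cmod (indicator S x))\<^sup>2 = (indicator S x :: real)" for x by (simp add: indicator_def)
  have "(\<lambda>x. indicator \<Omega> x *\<^sub>R (indicator S x :: real)) = indicator (S \<inter> \<Omega>)"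
    by (auto simp: indicator_def fun_eq_iff)
  then have "integrable (lebesgue_on \<Omega>) (indicator S :: 'a \<Rightarrow> real)"
    using 1 assms(2) by (simp add: integrable_restrict_space)
  moreover have "(\<lambda>x. indicator S x :: complex) \<in> borel_measurable (lebesgue_on \<Omega>)"
    using S by (intro measurable_restrict_space1) auto
  ultimately show ?thesis by (simp add: L2_def e)
qed

text \<open>The smooth bumps converge to the indicator of the open box, dominated by that of the
  closed one; the boundary of a box is a null set.\<close>

lemma L2_box_integral_eq_0:
  assumes g: "g \<in> L2 \<Omega>" and \<Omega>: "open \<Omega>" and cd: "cbox c d \<subseteq> \<Omega>"
    and z: "\<And>\<phi>. \<phi> \<in> test_functions \<Omega> \<Longrightarrow> (LINT x|lebesgue_on \<Omega>. g x * \<phi> x) = 0"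
  shows "(LINT x|lebesgue_on \<Omega>. g x * indicator (cbox c d) x) = 0"
proof -
  have \<Omega>s: "\<Omega> \<in> sets lebesgue" using \<Omega> by simp
  have i: "integrable (lebesgue_on \<Omega>) (\<lambda>x. g x * indicator (cbox c d) x)"
    by (intro L2_mult_integrable(1) g indicator_L2 \<Omega>s) simp
  note [measurable] = L2_D(1)[OF g]
  have "(\<lambda>n. LINT x|lebesgue_on \<Omega>. g x * box_bump (real n) c d x)
      \<longlonglongrightarrow> (LINT x|lebesgue_on \<Omega>. g x * indicator (box c d) x)"
  proof (rule integral_dominated_convergence[where w = "\<lambda>x. cmod (g x * indicator (cbox c d) x)"])
    show "(\<lambda>x. g x * indicator (box c d) x) \<in> borel_measurable (lebesgue_on \<Omega>)"
      by (rule borel_measurable_integrable[OF L2_mult_integrable(1)[OF g indicator_L2[OF _ \<Omega>s]]]) simp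
    show "(\<lambda>x. g x * box_bump (real n) c d x) \<in> borel_measurable (lebesgue_on \<Omega>)" for n
      by (rule borel_measurable_integrable[OF L2_mult_integrable(1)[OF g test_functions_L2[OF box_bump_test[OF cd] \<Omega>]]]) simp
    show "AE x in lebesgue_on \<Omega>. cmod (g x * box_bump (real n) c d x) \<le> cmod (g x * indicator (cbox c d) x)" for n
    proof (rule AE_I2)
      fix x
      show "cmod (g x * box_bump (real n) c d x) \<le> cmod (g x * indicator (cbox c d) x)"
      proof (cases "x \<in> cbox c d")
        case True then show ?thesis using box_bump_norm[of "real n" c d x] by (simp add: norm_mult mult_left_le)
      next
        case False
        then have "box_bump (real n) c d x = 0"
          using test_functions_vanish[OF box_bump_test[of c d "cbox c d" "real n"]] by simp
        then show ?thesis by simp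
      qed
    qed
    show "integrable (lebesgue_on \<Omega>) (\<lambda>x. cmod (g x * indicator (cbox c d) x))" using i by simp
  qed (auto intro!: tendsto_intros box_bump_tendsto)
  moreover have "(LINT x|lebesgue_on \<Omega>. g x * box_bump (real n) c d x) = 0" for n
    by (intro z box_bump_test cd) simp
  ultimately have 0: "(LINT x|lebesgue_on \<Omega>. g x * indicator (box c d) x) = 0"
    by (simp add: LIMSEQ_const_iff)
  have "AE x in lebesgue_on \<Omega>. g x * indicator (cbox c d) x = g x * indicator (box c d) x"
  proof -
    have "cbox c d - box c d \<in> null_sets lebesgue"
      using negligible_frontier_interval negligible_iff_null_sets by blast
    then have "AE x in lebesgue. x \<notin> cbox c d - box c d" by (rule AE_not_in)
    then have "AE x in lebesgue_on \<Omega>. x \<notin> cbox c d - box c d"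
      using \<Omega>s by (subst AE_restrict_space_iff) auto
    then show ?thesis
    proof eventually_elim
      fix x assume "x \<notin> cbox c d - box c d"
      then show "g x * indicator (cbox c d) x = g x * indicator (box c d) x"
        using box_subset_cbox[of c d] by (auto simp: indicator_def)
    qed
  qed
  then have "(LINT x|lebesgue_on \<Omega>. g x * indicator (cbox c d) x) = (LINT x|lebesgue_on \<Omega>. g x * indicator (box c d) x)"
    by (intro integral_cong_AE borel_measurable_integrable L2_mult_integrable(1) g indicator_L2 \<Omega>s) auto
  with 0 show ?thesis by simp
qed

text \<open>On a box inside \<Omega> the cut-off g has vanishing averages over all cubes, and almost
  everywhere these converge to its values by Lebesgue differentiation. An open set is a countable
  union of such boxes.\<close>

lemma fundamental_lemma:
  fixes g :: "'a::euclidean_space \<Rightarrow> complex"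
  assumes g: "g \<in> L2 \<Omega>" and \<Omega>: "open \<Omega>"
    and z: "\<And>\<phi>. \<phi> \<in> test_functions \<Omega> \<Longrightarrow> (LINT x|lebesgue_on \<Omega>. g x * \<phi> x) = 0"
  shows "AE x in lebesgue_on \<Omega>. g x = 0"
proof -
  have \<Omega>s: "\<Omega> \<in> sets lebesgue" using \<Omega> by simp
  have neg: "negligible {x \<in> cbox a b. g x \<noteq> 0}" if ab: "cbox a b \<subseteq> \<Omega>" for a b
  proof -
    \<comment> \<open>Cutting g to one box makes it absolutely integrable on the whole space, so its
      averages over all cubes are defined, and each of them is again an integral of g over a box
      inside \<Omega>.\<close>
    define f where "f x = indicator (cbox a b) x *\<^sub>R g x" for x
    have f_Om: "f x = indicator \<Omega> x *\<^sub>R (g x * indicator (cbox a b) x)" for x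
      using ab by (auto simp: f_def indicator_def)
    have i: "integrable (lebesgue_on \<Omega>) (\<lambda>x. g x * indicator S x)" if "S \<in> lmeasurable" for S
      by (intro L2_mult_integrable(1) g indicator_L2 \<Omega>s that)
    have "integrable lebesgue f"
      using i[of "cbox a b"] \<Omega>s unfolding f_Om by (simp add: integrable_restrict_space)
    then have fi: "f absolutely_integrable_on UNIV" by (simp add: set_integrable_def)
    then have fi': "f absolutely_integrable_on cbox c d" for c d
      by (rule set_integrable_subset) auto
    have int0: "integral (cbox c d) f = 0" for c d
    proof -
      obtain p q where pq: "cbox a b \<inter> cbox c d = cbox p q" using Int_interval by blast
      have "integral (cbox c d) f = (LINT x:cbox c d|lebesgue. f x)"
        using set_lebesgue_integral_eq_integral(2)[OF fi'] by simp
      also have "\<dots> = (LINT x|lebesgue. indicator \<Omega> x *\<^sub>R (g x * indicator (cbox p q) x))"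
        unfolding set_lebesgue_integral_def pq[symmetric]
        by (intro Bochner_Integration.integral_cong refl) (use ab in \<open>auto simp: f_def indicator_def\<close>)
      also have "\<dots> = (LINT x|lebesgue_on \<Omega>. g x * indicator (cbox p q) x)"
        using \<Omega>s by (subst integral_restrict_space) auto
      also have "\<dots> = 0" using ab pq by (intro L2_box_integral_eq_0[OF g \<Omega> _ z]) auto
      finally show ?thesis .
    qed
    have fint: "f integrable_on cbox c d" for c d
      using set_lebesgue_integral_eq_integral(1)[OF fi'] .
    obtain N where N: "negligible N" "\<And>x e. \<lbrakk>x \<notin> N; 0 < e\<rbrakk> \<Longrightarrow>
        \<exists>d>0. \<forall>h. 0 < h \<and> h < d \<longrightarrow> norm (integral (cbox x (x + h *\<^sub>R One)) f /\<^sub>R h ^ DIM('a) - f x) < e"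
      using integrable_ccontinuous_explicit[OF fint] by metis
    have "f x = 0" if x: "x \<notin> N" for x
    proof (rule ccontr)
      assume "f x \<noteq> 0"
      then obtain d where "d > 0" "\<forall>h. 0 < h \<and> h < d \<longrightarrow> norm (integral (cbox x (x + h *\<^sub>R One)) f /\<^sub>R h ^ DIM('a) - f x) < norm (f x)"
        using N(2)[OF x, of "norm (f x)"] by auto
      from this(2)[rule_format, of "d/2"] \<open>d > 0\<close> show False by (simp add: int0)
    qed
    then have "{x \<in> cbox a b. g x \<noteq> 0} \<subseteq> N" by (force simp: f_def)
    then show ?thesis using N(1) negligible_subset by blast
  qed
  obtain \<D> where D: "countable \<D>" "\<D> \<subseteq> Pow \<Omega>" "\<And>X. X \<in> \<D> \<Longrightarrow> \<exists>a b. X = cbox a b" "\<Union>\<D> = \<Omega>"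
    using open_countable_Union_open_cbox[OF \<Omega>] by metis
  have "negligible (\<Union>X\<in>\<D>. {x \<in> X. g x \<noteq> 0})"
  proof (rule negligible_countable_Union)
    show "countable ((\<lambda>X. {x \<in> X. g x \<noteq> 0}) ` \<D>)" using D(1) by simp
    show "negligible T" if T: "T \<in> (\<lambda>X. {x \<in> X. g x \<noteq> 0}) ` \<D>" for T
    proof -
      obtain X where X: "X \<in> \<D>" "T = {x \<in> X. g x \<noteq> 0}" using T by blast
      moreover obtain a b where "X = cbox a b" using D(3)[OF X(1)] by blast
      moreover have "X \<subseteq> \<Omega>" using D(2) X(1) by blast
      ultimately show ?thesis using neg[of a b] by simp
    qed
  qed
  moreover have "(\<Union>X\<in>\<D>. {x \<in> X. g x \<noteq> 0}) = {x \<in> \<Omega>. g x \<noteq> 0}" using D(4) by blast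
  ultimately have "{x \<in> \<Omega>. g x \<noteq> 0} \<in> null_sets lebesgue" using negligible_iff_null_sets by metis
  then have "AE x in lebesgue. x \<notin> {x \<in> \<Omega>. g x \<noteq> 0}" by (rule AE_not_in)
  then show ?thesis using \<Omega>s by (subst AE_restrict_space_iff) auto
qed

section \<open>Uniqueness and linearity of weak derivatives, and the gradient form\<close>

lemma weak_deriv_unique:
  assumes "open \<Omega>" "g \<in> L2 \<Omega>" "h \<in> L2 \<Omega>" "is_weak_partial_deriv \<Omega> b u g" "is_weak_partial_deriv \<Omega> b u h"
  shows "AE x in lebesgue_on \<Omega>. g x = h x"
proof -
  have "AE x in lebesgue_on \<Omega>. g x - h x = 0"
  proof (rule fundamental_lemma[OF L2_diff[OF assms(2,3)] assms(1)])
    fix \<phi> assume p: "\<phi> \<in> test_functions \<Omega>"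
    have "(LINT x|lebesgue_on \<Omega>. g x * \<phi> x) = (LINT x|lebesgue_on \<Omega>. h x * \<phi> x)"
      using assms(4,5) p unfolding is_weak_partial_deriv_def by (metis neg_equal_iff_equal)
    then show "(LINT x|lebesgue_on \<Omega>. (g x - h x) * \<phi> x) = 0"
      using L2_mult_integrable(1)[OF assms(2) test_functions_L2[OF p assms(1)]]
        L2_mult_integrable(1)[OF assms(3) test_functions_L2[OF p assms(1)]]
      by (simp add: left_diff_distrib)
  qed
  then show ?thesis by simp
qed

lemma weak_deriv_lin:
  assumes \<Omega>: "open \<Omega>" and b: "b \<in> Basis" and L: "u \<in> L2 \<Omega>" "v \<in> L2 \<Omega>" "g \<in> L2 \<Omega>" "h \<in> L2 \<Omega>"
    and w: "is_weak_partial_deriv \<Omega> b u g" "is_weak_partial_deriv \<Omega> b v h"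
  shows "is_weak_partial_deriv \<Omega> b (\<lambda>x. c * u x + d * v x) (\<lambda>x. c * g x + d * h x)"
  unfolding is_weak_partial_deriv_def
proof
  fix \<phi> assume p: "\<phi> \<in> test_functions \<Omega>"
  have pL: "\<phi> \<in> L2 \<Omega>" "partial_deriv b \<phi> \<in> L2 \<Omega>"
    using test_functions_L2[OF p \<Omega>] test_functions_L2[OF test_functions_partial_deriv[OF p b] \<Omega>] by auto
  have "(LINT x|lebesgue_on \<Omega>. (c * u x + d * v x) * partial_deriv b \<phi> x)
      = c * (LINT x|lebesgue_on \<Omega>. u x * partial_deriv b \<phi> x) + d * (LINT x|lebesgue_on \<Omega>. v x * partial_deriv b \<phi> x)"
    using L2_mult_integrable(1)[OF L(1) pL(2)] L2_mult_integrable(1)[OF L(2) pL(2)]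
    by (simp add: distrib_right mult.assoc)
  also have "\<dots> = - (c * (LINT x|lebesgue_on \<Omega>. g x * \<phi> x) + d * (LINT x|lebesgue_on \<Omega>. h x * \<phi> x))"
    using w p by (simp add: is_weak_partial_deriv_def)
  also have "\<dots> = - (LINT x|lebesgue_on \<Omega>. (c * g x + d * h x) * \<phi> x)"
    using L2_mult_integrable(1)[OF L(3) pL(1)] L2_mult_integrable(1)[OF L(4) pL(1)]
    by (simp add: distrib_right mult.assoc)
  finally show "(LINT x|lebesgue_on \<Omega>. (c * u x + d * v x) * partial_deriv b \<phi> x) = - (LINT x|lebesgue_on \<Omega>. (c * g x + d * h x) * \<phi> x)" .
qed

lemma H1_weak_deriv:
  assumes "u \<in> H1 \<Omega>" "b \<in> Basis"
  shows "weak_partial_deriv \<Omega> b u \<in> L2 \<Omega>" "is_weak_partial_deriv \<Omega> b u (weak_partial_deriv \<Omega> b u)"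
proof -
  have "\<exists>g. g \<in> L2 \<Omega> \<and> is_weak_partial_deriv \<Omega> b u g" using assms by (auto simp: H1_def)
  from someI_ex[OF this] show "weak_partial_deriv \<Omega> b u \<in> L2 \<Omega>" "is_weak_partial_deriv \<Omega> b u (weak_partial_deriv \<Omega> b u)"
    by (simp_all add: weak_partial_deriv_def)
qed

lemma H1_L2: "u \<in> H1 \<Omega> \<Longrightarrow> u \<in> L2 \<Omega>"
  by (simp add: H1_def)

text \<open>The representative comes from \<open>SOME\<close>, so nothing is known of its single
  values; it is identified through test functions, and therefore only almost everywhere.\<close>

lemma weak_partial_deriv_AE:
  assumes "open \<Omega>" "u \<in> H1 \<Omega>" "b \<in> Basis" "g \<in> L2 \<Omega>" "is_weak_partial_deriv \<Omega> b u g"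
  shows "AE x in lebesgue_on \<Omega>. weak_partial_deriv \<Omega> b u x = g x"
  using weak_deriv_unique[OF assms(1) H1_weak_deriv(1)[OF assms(2,3)] assms(4) H1_weak_deriv(2)[OF assms(2,3)] assms(5)] .

lemma L2_inner_cong_AE:
  assumes "AE x in lebesgue_on \<Omega>. u x = u' x" "AE x in lebesgue_on \<Omega>. v x = v' x"
    "u \<in> L2 \<Omega>" "u' \<in> L2 \<Omega>" "v \<in> L2 \<Omega>" "v' \<in> L2 \<Omega>"
  shows "L2_inner \<Omega> u v = L2_inner \<Omega> u' v'"
  unfolding L2_inner_def
proof (rule integral_cong_AE)
  show "AE x in lebesgue_on \<Omega>. u x * cnj (v x) = u' x * cnj (v' x)" using assms(1,2) by eventually_elim simp
qed (use L2_mult_integrable(2)[OF assms(3,5)] L2_mult_integrable(2)[OF assms(4,6)] in auto)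

lemma H1_lin:
  assumes "open \<Omega>" "u \<in> H1 \<Omega>" "v \<in> H1 \<Omega>"
  shows "(\<lambda>x. c * u x + d * v x) \<in> H1 \<Omega>"
    and "b \<in> Basis \<Longrightarrow> AE x in lebesgue_on \<Omega>. weak_partial_deriv \<Omega> b (\<lambda>x. c * u x + d * v x) x
      = c * weak_partial_deriv \<Omega> b u x + d * weak_partial_deriv \<Omega> b v x"
proof -
  note D = H1_weak_deriv[OF assms(2)] H1_weak_deriv[OF assms(3)]
  have w: "is_weak_partial_deriv \<Omega> b (\<lambda>x. c * u x + d * v x) (\<lambda>x. c * weak_partial_deriv \<Omega> b u x + d * weak_partial_deriv \<Omega> b v x)"
    "(\<lambda>x. c * weak_partial_deriv \<Omega> b u x + d * weak_partial_deriv \<Omega> b v x) \<in> L2 \<Omega>" if "b \<in> Basis" for b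
    using D[OF that] by (auto intro!: weak_deriv_lin[OF assms(1) that H1_L2[OF assms(2)] H1_L2[OF assms(3)]] L2_lin)
  then show H: "(\<lambda>x. c * u x + d * v x) \<in> H1 \<Omega>"
    using assms L2_lin by (auto simp: H1_def)
  show "AE x in lebesgue_on \<Omega>. weak_partial_deriv \<Omega> b (\<lambda>x. c * u x + d * v x) x
      = c * weak_partial_deriv \<Omega> b u x + d * weak_partial_deriv \<Omega> b v x" if "b \<in> Basis"
    by (rule weak_partial_deriv_AE[OF assms(1) H that w(2,1)[OF that]])
qed

lemma test_functions_H1:
  assumes "\<phi> \<in> test_functions \<Omega>" "open \<Omega>"
  shows "\<phi> \<in> H1 \<Omega>"
  using assms test_functions_L2 test_functions_weak_deriv test_functions_partial_deriv by (fastforce simp: H1_def)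

lemma grad_herm_form:
  assumes "open \<Omega>"
  shows "herm_form (H1 \<Omega>) (grad_form \<Omega>)"
proof
  show "grad_form \<Omega> (\<lambda>x. c * u x + d * v x) w = c * grad_form \<Omega> u w + d * grad_form \<Omega> v w"
    if H: "u \<in> H1 \<Omega>" "v \<in> H1 \<Omega>" "w \<in> H1 \<Omega>" for u v w c d
  proof -
    have "L2_inner \<Omega> (weak_partial_deriv \<Omega> b (\<lambda>x. c * u x + d * v x)) (weak_partial_deriv \<Omega> b w)
        = c * L2_inner \<Omega> (weak_partial_deriv \<Omega> b u) (weak_partial_deriv \<Omega> b w)
          + d * L2_inner \<Omega> (weak_partial_deriv \<Omega> b v) (weak_partial_deriv \<Omega> b w)" if b: "b \<in> Basis" for b
    proof -
      have "L2_inner \<Omega> (weak_partial_deriv \<Omega> b (\<lambda>x. c * u x + d * v x)) (weak_partial_deriv \<Omega> b w)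
         = L2_inner \<Omega> (\<lambda>x. c * weak_partial_deriv \<Omega> b u x + d * weak_partial_deriv \<Omega> b v x) (weak_partial_deriv \<Omega> b w)"
        by (rule L2_inner_cong_AE[OF H1_lin(2)[OF assms H(1,2) b]])
           (auto intro!: L2_lin H1_weak_deriv H1_lin(1) assms H b)
      then show ?thesis using H1_weak_deriv(1)[OF _ b] H by (simp add: L2.lin_left)
    qed
    then show ?thesis by (simp add: grad_form_def sum.distrib sum_distrib_left)
  qed
  show "grad_form \<Omega> v u = cnj (grad_form \<Omega> u v)" if "u \<in> H1 \<Omega>" "v \<in> H1 \<Omega>" for u v
    unfolding grad_form_def cnj_sum using that by (intro sum.cong refl L2.herm H1_weak_deriv)
  show "0 \<le> Re (grad_form \<Omega> u u)" if "u \<in> H1 \<Omega>" for u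
    unfolding grad_form_def Re_sum using that by (intro sum_nonneg L2.psd H1_weak_deriv)
  show "(\<lambda>x. 0) \<in> H1 \<Omega>" by (rule test_functions_H1[OF test_functions_zero assms])
qed (rule H1_lin(1)[OF assms])

lemma grad_form_self:
  assumes "u \<in> H1 \<Omega>"
  shows "Re (grad_form \<Omega> u u) = (\<Sum>b\<in>Basis. L2.q \<Omega> (weak_partial_deriv \<Omega> b u))"
  by (simp add: grad_form_def L2.q_def)

text \<open>The classical energy over the whole space. Unlike \<open>grad_form\<close> it mentions
  neither \<Omega> nor a choice of weak derivative; for test functions of an open set the two agree,
  and the estimates are made with this one.\<close>

definition dirichlet_energy :: "('a::euclidean_space \<Rightarrow> complex) \<Rightarrow> real" where
  "dirichlet_energy \<phi> = (\<Sum>b\<in>Basis. LINT x|lborel. (cmod (partial_deriv b \<phi> x))\<^sup>2)"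

definition L2_mass :: "('a::euclidean_space \<Rightarrow> complex) \<Rightarrow> real" where
  "L2_mass \<phi> = (LINT x|lborel. (cmod (\<phi> x))\<^sup>2)"

lemma test_functions_L2_q:
  assumes "\<phi> \<in> test_functions \<Omega>" "open \<Omega>"
  shows "L2.q \<Omega> \<phi> = L2_mass \<phi>"
  using L2_q[OF test_functions_L2[OF assms]]
    compactly_supported_lebesgue_on(2)[OF compactly_supported_norm_sq[OF test_functions_compactly_supported[OF assms(1)]] assms(2)]
  by (simp add: L2_mass_def)

lemma test_functions_weak_partial_deriv_AE:
  assumes "\<phi> \<in> test_functions \<Omega>" "open \<Omega>" "b \<in> Basis"
  shows "AE x in lebesgue_on \<Omega>. weak_partial_deriv \<Omega> b \<phi> x = partial_deriv b \<phi> x"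
  using assms by (intro weak_partial_deriv_AE test_functions_H1 test_functions_L2 test_functions_partial_deriv
      test_functions_weak_deriv)

lemma test_functions_grad_form:
  assumes "\<phi> \<in> test_functions \<Omega>" "open \<Omega>"
  shows "Re (grad_form \<Omega> \<phi> \<phi>) = dirichlet_energy \<phi>"
proof -
  have "L2.q \<Omega> (weak_partial_deriv \<Omega> b \<phi>) = L2_mass (partial_deriv b \<phi>)" if b: "b \<in> Basis" for b
  proof -
    have d: "partial_deriv b \<phi> \<in> test_functions \<Omega>" by (rule test_functions_partial_deriv[OF assms(1) b])
    have "L2.q \<Omega> (weak_partial_deriv \<Omega> b \<phi>) = L2.q \<Omega> (partial_deriv b \<phi>)"
      unfolding L2.q_def using test_functions_weak_partial_deriv_AE[OF assms b] b
      by (intro arg_cong[where f = Re] L2_inner_cong_AE H1_weak_deriv test_functions_H1 test_functions_L2 assms d)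
    then show ?thesis using test_functions_L2_q[OF d assms(2)] by simp
  qed
  then show ?thesis
    by (simp add: grad_form_self[OF test_functions_H1[OF assms]] dirichlet_energy_def L2_mass_def)
qed

section \<open>Completeness\<close>

text \<open>Riesz-Fischer. A subsequence with squared distances below (1/4)^k converges almost
  everywhere, and Fatou's lemma turns the Cauchy bound into a bound for the distance to its
  limit.\<close>

lemma square_integrable_complete:
  fixes u :: "nat \<Rightarrow> 'a \<Rightarrow> complex"
  assumes meas: "\<And>n. u n \<in> borel_measurable M" and int: "\<And>n. integrable M (\<lambda>x. (cmod (u n x))\<^sup>2)"
    and cauchy: "\<And>e. e > 0 \<Longrightarrow> \<exists>N. \<forall>m\<ge>N. \<forall>n\<ge>N. (LINT x|M. (cmod (u m x - u n x))\<^sup>2) < e"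
  obtains v where "v \<in> borel_measurable M" "integrable M (\<lambda>x. (cmod (v x))\<^sup>2)"
    "(\<lambda>n. LINT x|M. (cmod (u n x - v x))\<^sup>2) \<longlonglongrightarrow> 0"
proof -
  note [measurable] = meas
  have int_d: "integrable M (\<lambda>x. (cmod (u m x - u n x))\<^sup>2)" for m n
  proof (rule Bochner_Integration.integrable_bound)
    show "integrable M (\<lambda>x. 2 * (cmod (u m x))\<^sup>2 + 2 * (cmod (u n x))\<^sup>2)" using int by auto
    show "AE x in M. norm ((cmod (u m x - u n x))\<^sup>2) \<le> norm (2 * (cmod (u m x))\<^sup>2 + 2 * (cmod (u n x))\<^sup>2)"
      using cmod_lin_sq_le[of 1 _ "-1"] by (intro AE_I2) simp
  qed auto
  have nn: "(\<integral>\<^sup>+x. ennreal ((cmod (u m x - u n x))\<^sup>2) \<partial>M) = ennreal (LINT x|M. (cmod (u m x - u n x))\<^sup>2)" for m n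
    by (rule nn_integral_eq_integral[OF int_d]) simp
  have "\<exists>r. strict_mono r \<and> (\<forall>k. \<forall>m\<ge>r k. \<forall>n\<ge>r k. (LINT x|M. (cmod (u m x - u n x))\<^sup>2) < (1/4)^k)"
  proof -
    define N where "N k = (SOME N. \<forall>m\<ge>N. \<forall>n\<ge>N. (LINT x|M. (cmod (u m x - u n x))\<^sup>2) < (1/4)^k)" for k
    have N: "\<forall>m\<ge>N k. \<forall>n\<ge>N k. (LINT x|M. (cmod (u m x - u n x))\<^sup>2) < (1/4)^k" for k
      unfolding N_def by (rule someI_ex) (rule cauchy, simp)
    define r where "r k = (\<Sum>j\<le>k. N j) + k" for k
    have "strict_mono r" by (auto simp: strict_mono_Suc_iff r_def)
    moreover have "N k \<le> r k" for k
      using member_le_sum[of k "{..k}" N] by (simp add: r_def)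
    ultimately show ?thesis using N by (intro exI[of _ r]) (meson order_trans)
  qed
  then obtain r where r: "strict_mono r" "\<And>k m n. m \<ge> r k \<Longrightarrow> n \<ge> r k \<Longrightarrow> (LINT x|M. (cmod (u m x - u n x))\<^sup>2) < (1/4)^k"
    by blast
  define s where "s k = u (r k)" for k
  have [measurable]: "s k \<in> borel_measurable M" for k by (simp add: s_def)
  define a where "a k x = s (Suc k) x - s k x" for k x
  have [measurable]: "a k \<in> borel_measurable M" for k unfolding a_def by measurable
  have "(\<integral>\<^sup>+x. (\<Sum>k. ennreal (2^k * (cmod (a k x))\<^sup>2)) \<partial>M) = (\<Sum>k. \<integral>\<^sup>+x. ennreal (2^k * (cmod (a k x))\<^sup>2) \<partial>M)"
    by (rule nn_integral_suminf) measurable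
  also have "\<dots> \<le> (\<Sum>k. ennreal ((1/2)^k))"
  proof (rule suminf_le)
    fix k
    have "r k \<le> r (Suc k)" using r(1) by (simp add: strict_mono_less_eq)
    then have "(LINT x|M. (cmod (a k x))\<^sup>2) \<le> (1/4)^k" unfolding a_def s_def using r(2)[of k "r (Suc k)" "r k"] by simp
    then have "2^k * (LINT x|M. (cmod (a k x))\<^sup>2) \<le> 2^k * (1/4)^k" by (intro mult_left_mono) auto
    also have "2^k * (1/4)^k = ((1/2)^k :: real)" by (simp add: power_mult_distrib[symmetric])
    finally have "2^k * (LINT x|M. (cmod (a k x))\<^sup>2) \<le> (1/2)^k" .
    moreover have "(\<integral>\<^sup>+x. ennreal (2^k * (cmod (a k x))\<^sup>2) \<partial>M) = ennreal (LINT x|M. 2^k * (cmod (a k x))\<^sup>2)"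
      using int_d unfolding a_def s_def by (intro nn_integral_eq_integral) auto
    ultimately show "(\<integral>\<^sup>+x. ennreal (2^k * (cmod (a k x))\<^sup>2) \<partial>M) \<le> ennreal ((1/2)^k)"
      by (simp add: ennreal_leI)
  qed auto
  also have "\<dots> = ennreal (\<Sum>k. (1/2)^k)" by (rule suminf_ennreal2) (auto intro: summable_geometric)
  also have "\<dots> < \<infinity>" by simp
  finally have "AE x in M. (\<Sum>k. ennreal (2^k * (cmod (a k x))\<^sup>2)) \<noteq> \<infinity>"
    by (intro nn_integral_noteq_infinite) auto
  then have conv: "AE x in M. convergent (\<lambda>k. s k x)"
  proof eventually_elim
    fix x assume "(\<Sum>k. ennreal (2^k * (cmod (a k x))\<^sup>2)) \<noteq> \<infinity>"
    then have "summable (\<lambda>k. 2^k * (cmod (a k x))\<^sup>2)" by (intro summable_suminf_not_top) auto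
    then have "summable (\<lambda>k. 2^k * (cmod (a k x))\<^sup>2 + (1/2)^k)" by (intro summable_add summable_geometric) auto
    then have "summable (\<lambda>k. a k x)"
    \<comment> \<open>The weight 2^k lies between the two requirements: against (1/4)^k it still
      sums, and the mean inequality 2 |a| \<le> 2^k |a|^2 + (1/2)^k bounds the increments by a
      summable sequence.\<close>
    proof (rule summable_comparison_test')
      fix k
      have "0 \<le> (2^k * cmod (a k x) - 1)\<^sup>2 * (1/2)^k" by simp
      also have "\<dots> = 2^k * (cmod (a k x))\<^sup>2 - 2 * cmod (a k x) + (1/2)^k"
        by (simp add: power2_eq_square algebra_simps power_divide)
      finally have "2 * cmod (a k x) \<le> 2^k * (cmod (a k x))\<^sup>2 + (1/2)^k" by simp
      moreover have "0 \<le> cmod (a k x)" by simp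
      ultimately show "norm (a k x) \<le> 2^k * (cmod (a k x))\<^sup>2 + (1/2)^k" by linarith
    qed
    then have "convergent (\<lambda>n. \<Sum>k<n. a k x)" by (simp add: summable_iff_convergent)
    then have "convergent (\<lambda>n. s 0 x + (\<Sum>k<n. a k x))" by (intro convergent_add convergent_const)
    moreover have "s 0 x + (\<Sum>k<n. a k x) = s n x" for n
      using sum_lessThan_telescope[of "\<lambda>k. s k x" n] by (simp add: a_def)
    ultimately show "convergent (\<lambda>k. s k x)" by simp
  qed
  define v where "v x = lim (\<lambda>k. s k x)" for x
  have [measurable]: "v \<in> borel_measurable M" unfolding v_def by (rule borel_measurable_lim_metric) measurable
  have lim: "AE x in M. (\<lambda>k. s k x) \<longlonglongrightarrow> v x"
    using conv by eventually_elim (simp add: v_def convergent_LIMSEQ_iff)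
  have fatou: "(\<integral>\<^sup>+x. ennreal ((cmod (u n x - v x))\<^sup>2) \<partial>M) \<le> ennreal ((1/4)^k)" if n: "n \<ge> r k" for n k
  proof -
    have "(\<integral>\<^sup>+x. ennreal ((cmod (u n x - v x))\<^sup>2) \<partial>M) = (\<integral>\<^sup>+x. liminf (\<lambda>j. ennreal ((cmod (u n x - s j x))\<^sup>2)) \<partial>M)"
    proof (rule nn_integral_cong_AE)
      show "AE x in M. ennreal ((cmod (u n x - v x))\<^sup>2) = liminf (\<lambda>j. ennreal ((cmod (u n x - s j x))\<^sup>2))"
        using lim
      proof eventually_elim
        fix x assume "(\<lambda>k. s k x) \<longlonglongrightarrow> v x"
        then have "(\<lambda>j. ennreal ((cmod (u n x - s j x))\<^sup>2)) \<longlonglongrightarrow> ennreal ((cmod (u n x - v x))\<^sup>2)"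
          by (intro tendsto_intros)
        then show "ennreal ((cmod (u n x - v x))\<^sup>2) = liminf (\<lambda>j. ennreal ((cmod (u n x - s j x))\<^sup>2))"
          using lim_imp_Liminf[OF trivial_limit_sequentially] by metis
      qed
    qed
    also have "\<dots> \<le> liminf (\<lambda>j. \<integral>\<^sup>+x. ennreal ((cmod (u n x - s j x))\<^sup>2) \<partial>M)"
      by (rule nn_integral_liminf) measurable
    also have "\<dots> \<le> liminf (\<lambda>j. ennreal ((1/4)^k))"
    proof (rule Liminf_mono)
      show "\<forall>\<^sub>F j in sequentially. (\<integral>\<^sup>+x. ennreal ((cmod (u n x - s j x))\<^sup>2) \<partial>M) \<le> ennreal ((1/4)^k)"
        unfolding eventually_sequentially
      proof (intro exI[of _ k] allI impI)
        fix j assume "k \<le> j"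
        then have "r k \<le> r j" using r(1) by (simp add: strict_mono_less_eq)
        then show "(\<integral>\<^sup>+x. ennreal ((cmod (u n x - s j x))\<^sup>2) \<partial>M) \<le> ennreal ((1/4)^k)"
          unfolding s_def nn using r(2)[OF n, of "r j"] by (intro ennreal_leI) simp
      qed
    qed
    also have "\<dots> = ennreal ((1/4)^k)" by (simp add: Liminf_const)
    finally show ?thesis .
  qed
  have fin: "integrable M (\<lambda>x. (cmod (u n x - v x))\<^sup>2)" if "n \<ge> r 0" for n
    using fatou[OF that] by (intro integrableI_nonneg) (auto simp: less_top[symmetric] top_unique)
  have le: "(LINT x|M. (cmod (u n x - v x))\<^sup>2) \<le> (1/4)^k" if "n \<ge> r k" for n k
  proof -
    have "n \<ge> r 0" using that r(1) by (meson le0 order_trans strict_mono_less_eq)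
    then have "ennreal (LINT x|M. (cmod (u n x - v x))\<^sup>2) = (\<integral>\<^sup>+x. ennreal ((cmod (u n x - v x))\<^sup>2) \<partial>M)"
      by (intro nn_integral_eq_integral[symmetric] fin) auto
    also have "\<dots> \<le> ennreal ((1/4)^k)" by (rule fatou[OF that])
    finally show ?thesis by (simp add: ennreal_le_iff)
  qed
  show thesis
  proof (rule that)
    show "integrable M (\<lambda>x. (cmod (v x))\<^sup>2)"
    proof (rule Bochner_Integration.integrable_bound)
      show "integrable M (\<lambda>x. 2 * (cmod (u (r 0) x))\<^sup>2 + 2 * (cmod (u (r 0) x - v x))\<^sup>2)" using int fin by auto
      show "AE x in M. norm ((cmod (v x))\<^sup>2) \<le> norm (2 * (cmod (u (r 0) x))\<^sup>2 + 2 * (cmod (u (r 0) x - v x))\<^sup>2)"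
      proof (rule AE_I2)
        fix x
        show "norm ((cmod (v x))\<^sup>2) \<le> norm (2 * (cmod (u (r 0) x))\<^sup>2 + 2 * (cmod (u (r 0) x - v x))\<^sup>2)"
          using cmod_lin_sq_le[of 1 "u (r 0) x" "-1" "u (r 0) x - v x"] by simp
      qed
    qed auto
    show "(\<lambda>n. LINT x|M. (cmod (u n x - v x))\<^sup>2) \<longlonglongrightarrow> 0"
    proof (rule LIMSEQ_I)
      fix e :: real assume "e > 0"
      then obtain k where k: "(1/4)^k < e" using real_arch_pow_inv[of e "1/4"] by auto
      have "norm ((LINT x|M. (cmod (u n x - v x))\<^sup>2) - 0) < e" if "n \<ge> r k" for n
        using le[OF that] k by simp
      then show "\<exists>N. \<forall>n\<ge>N. norm ((LINT x|M. (cmod (u n x - v x))\<^sup>2) - 0) < e" by blast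
    qed
  qed measurable
qed

lemma L2_complete:
  assumes "\<And>n. u n \<in> L2 \<Omega>"
    and "\<And>e. e > 0 \<Longrightarrow> \<exists>N. \<forall>m\<ge>N. \<forall>n\<ge>N. L2.q \<Omega> (\<lambda>x. u m x - u n x) < e"
  obtains v where "v \<in> L2 \<Omega>" "(\<lambda>n. L2.q \<Omega> (\<lambda>x. u n x - v x)) \<longlonglongrightarrow> 0"
proof -
  obtain v where v: "v \<in> borel_measurable (lebesgue_on \<Omega>)" "integrable (lebesgue_on \<Omega>) (\<lambda>x. (cmod (v x))\<^sup>2)"
    "(\<lambda>n. LINT x|lebesgue_on \<Omega>. (cmod (u n x - v x))\<^sup>2) \<longlonglongrightarrow> 0"
  proof (rule square_integrable_complete[of u "lebesgue_on \<Omega>"])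
    show "\<exists>N. \<forall>m\<ge>N. \<forall>n\<ge>N. (LINT x|lebesgue_on \<Omega>. (cmod (u m x - u n x))\<^sup>2) < e" if "e > 0" for e
      using assms(2)[OF that] by (simp add: L2_q[OF L2_diff[OF assms(1) assms(1)]])
  qed (use assms(1) in \<open>auto simp: L2_def\<close>)
  then have "v \<in> L2 \<Omega>" by (simp add: L2_def)
  then show thesis using v(3) that by (simp add: L2_q[OF L2_diff[OF assms(1)]])
qed

section \<open>The form domain\<close>

context
  fixes \<Omega> :: "'a::euclidean_space set"
  assumes \<Omega>: "open \<Omega>"
begin

interpretation G: herm_form "H1 \<Omega>" "grad_form \<Omega>" by (rule grad_herm_form[OF \<Omega>])

lemma grad_q: "u \<in> H1 \<Omega> \<Longrightarrow> herm_form.q (grad_form \<Omega>) u = (\<Sum>b\<in>Basis. L2.q \<Omega> (weak_partial_deriv \<Omega> b u))"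
  unfolding G.q_def by (rule grad_form_self)

lemma H1_norm_sq:
  assumes "u \<in> H1 \<Omega>"
  shows "H1_norm \<Omega> u = sqrt (L2.q \<Omega> u + G.q u)"
  by (simp add: H1_norm_def L2.q_def G.q_def)

lemma H1_norm_tendsto_0_iff:
  assumes "\<And>n. u n \<in> H1 \<Omega>"
  shows "(\<lambda>n. H1_norm \<Omega> (u n)) \<longlonglongrightarrow> 0 \<longleftrightarrow> (\<lambda>n. G.q (u n) + L2.q \<Omega> (u n)) \<longlonglongrightarrow> 0"
proof
  have nn: "0 \<le> L2.q \<Omega> (u n) + G.q (u n)" for n
    using L2.q_nonneg[OF H1_L2[OF assms]] G.q_nonneg[OF assms] by (simp add: add_nonneg_nonneg)
  show "(\<lambda>n. G.q (u n) + L2.q \<Omega> (u n)) \<longlonglongrightarrow> 0" if "(\<lambda>n. H1_norm \<Omega> (u n)) \<longlonglongrightarrow> 0"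
    using tendsto_power[OF that, of 2] nn by (simp add: H1_norm_sq[OF assms] add.commute)
  show "(\<lambda>n. H1_norm \<Omega> (u n)) \<longlonglongrightarrow> 0" if "(\<lambda>n. G.q (u n) + L2.q \<Omega> (u n)) \<longlonglongrightarrow> 0"
    using tendsto_real_sqrt[OF that] by (simp add: H1_norm_sq[OF assms] add.commute)
qed

lemma H1_0_iff:
  "u \<in> H1_0 \<Omega> \<longleftrightarrow> u \<in> H1 \<Omega> \<and> (\<exists>\<phi>. (\<forall>n. \<phi> n \<in> test_functions \<Omega>) \<and>
     (\<lambda>n. G.q (\<lambda>x. \<phi> n x - u x) + L2.q \<Omega> (\<lambda>x. \<phi> n x - u x)) \<longlonglongrightarrow> 0)"
proof -
  have "((\<lambda>n. H1_norm \<Omega> (\<lambda>x. \<phi> n x - u x)) \<longlonglongrightarrow> 0)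
      = ((\<lambda>n. G.q (\<lambda>x. \<phi> n x - u x) + L2.q \<Omega> (\<lambda>x. \<phi> n x - u x)) \<longlonglongrightarrow> 0)"
    if "u \<in> H1 \<Omega>" "\<forall>n. \<phi> n \<in> test_functions \<Omega>" for \<phi>
    using that test_functions_H1[OF _ \<Omega>] by (intro H1_norm_tendsto_0_iff G.diff_closed) auto
  then show ?thesis unfolding H1_0_def by blast
qed

lemma H1_0_H1: "u \<in> H1_0 \<Omega> \<Longrightarrow> u \<in> H1 \<Omega>"
  by (simp add: H1_0_def)

lemma test_functions_H1_0: "\<phi> \<in> test_functions \<Omega> \<Longrightarrow> \<phi> \<in> H1_0 \<Omega>"
  unfolding H1_0_iff
  by (intro conjI test_functions_H1 \<Omega> exI[of _ "\<lambda>n. \<phi>"])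
     (auto simp: G.q_def L2.q_def G.s_zero_left L2.s_zero_left G.zero_closed L2_zero)

lemma H1_0_lin:
  assumes "u \<in> H1_0 \<Omega>" "v \<in> H1_0 \<Omega>"
  shows "(\<lambda>x. c * u x + d * v x) \<in> H1_0 \<Omega>"
proof -
  have H: "u \<in> H1 \<Omega>" "v \<in> H1 \<Omega>" using assms H1_0_H1 by auto
  obtain \<phi> where \<phi>: "\<And>n. \<phi> n \<in> test_functions \<Omega>"
    "(\<lambda>n. G.q (\<lambda>x. \<phi> n x - u x) + L2.q \<Omega> (\<lambda>x. \<phi> n x - u x)) \<longlonglongrightarrow> 0" using assms(1) unfolding H1_0_iff by blast
  obtain \<psi> where \<psi>: "\<And>n. \<psi> n \<in> test_functions \<Omega>"
    "(\<lambda>n. G.q (\<lambda>x. \<psi> n x - v x) + L2.q \<Omega> (\<lambda>x. \<psi> n x - v x)) \<longlonglongrightarrow> 0" using assms(2) unfolding H1_0_iff by blast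
  define \<xi> where "\<xi> n x = c * \<phi> n x + d * \<psi> n x" for n x
  have \<xi>: "\<xi> n \<in> test_functions \<Omega>" for n unfolding \<xi>_def by (rule test_functions_lin[OF \<phi>(1) \<psi>(1)])
  have T: "\<phi> n \<in> H1 \<Omega>" "\<psi> n \<in> H1 \<Omega>" for n using \<phi> \<psi> test_functions_H1[OF _ \<Omega>] by auto
  have e: "(\<lambda>x. \<xi> n x - (c * u x + d * v x)) = (\<lambda>x. (\<lambda>x. c * (\<phi> n x - u x)) x + (\<lambda>x. d * (\<psi> n x - v x)) x)" for n
    by (auto simp: \<xi>_def algebra_simps)
  define B where "B n = 2 * (cmod c)\<^sup>2 * (G.q (\<lambda>x. \<phi> n x - u x) + L2.q \<Omega> (\<lambda>x. \<phi> n x - u x))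
     + 2 * (cmod d)\<^sup>2 * (G.q (\<lambda>x. \<psi> n x - v x) + L2.q \<Omega> (\<lambda>x. \<psi> n x - v x))" for n
  have "B \<longlonglongrightarrow> 2 * (cmod c)\<^sup>2 * 0 + 2 * (cmod d)\<^sup>2 * 0" unfolding B_def by (intro tendsto_intros \<phi> \<psi>)
  then have B0: "B \<longlonglongrightarrow> 0" by simp
  have le: "G.q (\<lambda>x. \<xi> n x - (c * u x + d * v x)) + L2.q \<Omega> (\<lambda>x. \<xi> n x - (c * u x + d * v x)) \<le> B n" for n
  proof -
    note D = G.diff_closed[OF T(1)[of n] H(1)] G.diff_closed[OF T(2)[of n] H(2)]
    note D2 = H1_L2[OF D(1)] H1_L2[OF D(2)]
    have 1: "G.q (\<lambda>x. (\<lambda>x. c * (\<phi> n x - u x)) x + (\<lambda>x. d * (\<psi> n x - v x)) x)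
        \<le> 2 * ((cmod c)\<^sup>2 * G.q (\<lambda>x. \<phi> n x - u x)) + 2 * ((cmod d)\<^sup>2 * G.q (\<lambda>x. \<psi> n x - v x))"
      using G.q_add_le[OF G.scale_closed[OF D(1), of c] G.scale_closed[OF D(2), of d]]
      by (simp only: G.q_scale[OF D(1)] G.q_scale[OF D(2)])
    have 2: "L2.q \<Omega> (\<lambda>x. (\<lambda>x. c * (\<phi> n x - u x)) x + (\<lambda>x. d * (\<psi> n x - v x)) x)
        \<le> 2 * ((cmod c)\<^sup>2 * L2.q \<Omega> (\<lambda>x. \<phi> n x - u x)) + 2 * ((cmod d)\<^sup>2 * L2.q \<Omega> (\<lambda>x. \<psi> n x - v x))"
      using L2.q_add_le[OF L2.scale_closed[OF D2(1), of c] L2.scale_closed[OF D2(2), of d]]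
      by (simp only: L2.q_scale[OF D2(1)] L2.q_scale[OF D2(2)])
    show ?thesis unfolding e B_def using 1 2 by (simp only: distrib_left mult.assoc)
  qed
  have CH: "\<xi> n \<in> H1 \<Omega>" for n using \<xi> test_functions_H1[OF _ \<Omega>] by auto
  have UV: "(\<lambda>x. c * u x + d * v x) \<in> H1 \<Omega>" by (rule H1_lin(1)[OF \<Omega> H])
  have nn: "0 \<le> G.q (\<lambda>x. \<xi> n x - (c * u x + d * v x)) + L2.q \<Omega> (\<lambda>x. \<xi> n x - (c * u x + d * v x))" for n
    using G.q_nonneg[OF G.diff_closed[OF CH UV]] L2.q_nonneg[OF H1_L2[OF G.diff_closed[OF CH UV]]] by (simp add: add_nonneg_nonneg)
  have "(\<lambda>n. G.q (\<lambda>x. \<xi> n x - (c * u x + d * v x)) + L2.q \<Omega> (\<lambda>x. \<xi> n x - (c * u x + d * v x))) \<longlonglongrightarrow> 0"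
    by (rule tendsto_sandwich[OF _ _ tendsto_const B0]) (use nn le in auto)
  then show ?thesis unfolding H1_0_iff using UV \<xi> by blast
qed

lemma H1_0_grad_form: "herm_form (H1_0 \<Omega>) (grad_form \<Omega>)"
  using H1_0_lin test_functions_H1_0[OF test_functions_zero]
  by unfold_locales (auto simp: G.lin_left H1_0_H1 G.psd intro: G.herm[OF H1_0_H1 H1_0_H1])

lemma H1_0_L2_form: "herm_form (H1_0 \<Omega>) (L2_inner \<Omega>)"
  using H1_0_lin test_functions_H1_0[OF test_functions_zero]
  by unfold_locales
    (auto simp: L2.lin_left H1_0_H1 H1_L2 L2.psd intro: L2.herm[OF H1_L2[OF H1_0_H1] H1_L2[OF H1_0_H1]])

text \<open>The functions and each of their weak derivatives converge in L2. The defining identity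
  of a weak derivative is continuous in both, so the limits of the derivatives are derivatives of
  the limit, which lies in \<open>H1_0\<close> because the sequence itself approximates it.\<close>

lemma test_functions_cauchy_limit:
  assumes \<phi>: "\<And>n. \<phi> n \<in> test_functions \<Omega>"
    and cauchy: "\<And>e. e > 0 \<Longrightarrow> \<exists>N. \<forall>m\<ge>N. \<forall>n\<ge>N. G.q (\<lambda>x. \<phi> m x - \<phi> n x) + L2.q \<Omega> (\<lambda>x. \<phi> m x - \<phi> n x) < e"
  obtains v where "v \<in> H1_0 \<Omega>" "(\<lambda>n. G.q (\<lambda>x. \<phi> n x - v x) + L2.q \<Omega> (\<lambda>x. \<phi> n x - v x)) \<longlonglongrightarrow> 0"
proof -
  let ?W = "weak_partial_deriv \<Omega>"
  have H: "\<phi> n \<in> H1 \<Omega>" for n using \<phi> test_functions_H1[OF _ \<Omega>] by auto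
  have L: "\<phi> n \<in> L2 \<Omega>" for n using H H1_L2 by auto
  have WL: "?W b (\<phi> n) \<in> L2 \<Omega>" if "b \<in> Basis" for b n using H1_weak_deriv(1)[OF H that] .
  have Wdiff: "L2.q \<Omega> (?W b (\<lambda>x. u x - w x)) = L2.q \<Omega> (\<lambda>x. ?W b u x - ?W b w x)"
    if "u \<in> H1 \<Omega>" "w \<in> H1 \<Omega>" "b \<in> Basis" for u w b
    unfolding L2.q_def
    using H1_lin(2)[OF \<Omega> that(1,2,3), of 1 "-1"] that
    by (intro arg_cong[where f = Re] L2_inner_cong_AE L2_diff H1_weak_deriv G.diff_closed) auto
  have grad_diff: "G.q (\<lambda>x. u x - w x) = (\<Sum>b\<in>Basis. L2.q \<Omega> (\<lambda>x. ?W b u x - ?W b w x))"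
    if "u \<in> H1 \<Omega>" "w \<in> H1 \<Omega>" for u w
    using that by (simp add: grad_q G.diff_closed Wdiff)
  have q_le: "L2.q \<Omega> (\<lambda>x. ?W b (\<phi> m) x - ?W b (\<phi> n) x) \<le> G.q (\<lambda>x. \<phi> m x - \<phi> n x)" if "b \<in> Basis" for b m n
    unfolding grad_diff[OF H H] using WL that
    by (intro member_le_sum L2.q_nonneg L2_diff) auto
  obtain v where v: "v \<in> L2 \<Omega>" "(\<lambda>n. L2.q \<Omega> (\<lambda>x. \<phi> n x - v x)) \<longlonglongrightarrow> 0"
  proof (rule L2_complete[of \<phi>])
    fix e :: real assume "e > 0"
    then obtain N where N: "\<forall>m\<ge>N. \<forall>n\<ge>N. G.q (\<lambda>x. \<phi> m x - \<phi> n x) + L2.q \<Omega> (\<lambda>x. \<phi> m x - \<phi> n x) < e" using cauchy by blast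
    have "0 \<le> G.q (\<lambda>x. \<phi> m x - \<phi> n x)" for m n by (rule G.q_nonneg[OF G.diff_closed[OF H H]])
    then show "\<exists>N. \<forall>m\<ge>N. \<forall>n\<ge>N. L2.q \<Omega> (\<lambda>x. \<phi> m x - \<phi> n x) < e" using N by (intro exI[of _ N]) (smt (verit))
  qed (rule L)
  have "\<exists>g. g \<in> L2 \<Omega> \<and> (\<lambda>n. L2.q \<Omega> (\<lambda>x. ?W b (\<phi> n) x - g x)) \<longlonglongrightarrow> 0" if b: "b \<in> Basis" for b
  proof (rule L2_complete[of "\<lambda>n. ?W b (\<phi> n)"])
    fix e :: real assume "e > 0"
    then obtain N where N: "\<forall>m\<ge>N. \<forall>n\<ge>N. G.q (\<lambda>x. \<phi> m x - \<phi> n x) + L2.q \<Omega> (\<lambda>x. \<phi> m x - \<phi> n x) < e" using cauchy by blast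
    have "0 \<le> L2.q \<Omega> (\<lambda>x. \<phi> m x - \<phi> n x)" for m n by (rule L2.q_nonneg[OF L2_diff[OF L L]])
    then show "\<exists>N. \<forall>m\<ge>N. \<forall>n\<ge>N. L2.q \<Omega> (\<lambda>x. ?W b (\<phi> m) x - ?W b (\<phi> n) x) < e"
      using N q_le[OF b] by (intro exI[of _ N]) (smt (verit))
  qed (use WL[OF b] in auto)
  then obtain g where g: "\<And>b. b \<in> Basis \<Longrightarrow> g b \<in> L2 \<Omega>"
    "\<And>b. b \<in> Basis \<Longrightarrow> (\<lambda>n. L2.q \<Omega> (\<lambda>x. ?W b (\<phi> n) x - g b x)) \<longlonglongrightarrow> 0" by metis
  have lim: "(\<lambda>n. LINT x|lebesgue_on \<Omega>. w n x * \<psi> x) \<longlonglongrightarrow> (LINT x|lebesgue_on \<Omega>. w' x * \<psi> x)"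
    if "\<psi> \<in> L2 \<Omega>" "\<And>n. w n \<in> L2 \<Omega>" "w' \<in> L2 \<Omega>" "(\<lambda>n. L2.q \<Omega> (\<lambda>x. w n x - w' x)) \<longlonglongrightarrow> 0" for \<psi> w w'
  proof -
    note [measurable] = L2_D(1)[OF that(1)]
    have "(\<lambda>x. cnj (\<psi> x)) \<in> borel_measurable (lebesgue_on \<Omega>)" by measurable
    then have "(\<lambda>x. cnj (\<psi> x)) \<in> L2 \<Omega>" using that(1) by (simp add: L2_def)
    from L2.tendsto_s[OF that(2,3) this that(4)] show ?thesis by (simp add: L2_inner_def)
  qed
  have wv: "is_weak_partial_deriv \<Omega> b v (g b)" if b: "b \<in> Basis" for b
    unfolding is_weak_partial_deriv_def
  proof
    fix \<psi> assume p: "\<psi> \<in> test_functions \<Omega>"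
    have pL: "\<psi> \<in> L2 \<Omega>" "partial_deriv b \<psi> \<in> L2 \<Omega>"
      using test_functions_L2[OF p \<Omega>] test_functions_L2[OF test_functions_partial_deriv[OF p b] \<Omega>] by auto
    have 1: "(\<lambda>n. LINT x|lebesgue_on \<Omega>. \<phi> n x * partial_deriv b \<psi> x) \<longlonglongrightarrow> (LINT x|lebesgue_on \<Omega>. v x * partial_deriv b \<psi> x)"
      by (intro lim pL L v)
    have "(\<lambda>n. - (LINT x|lebesgue_on \<Omega>. ?W b (\<phi> n) x * \<psi> x)) \<longlonglongrightarrow> - (LINT x|lebesgue_on \<Omega>. g b x * \<psi> x)"
      by (intro tendsto_minus lim pL WL g b)
    moreover have "(LINT x|lebesgue_on \<Omega>. \<phi> n x * partial_deriv b \<psi> x) = - (LINT x|lebesgue_on \<Omega>. ?W b (\<phi> n) x * \<psi> x)" for n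
      using H1_weak_deriv(2)[OF H b] p by (simp add: is_weak_partial_deriv_def)
    ultimately show "(LINT x|lebesgue_on \<Omega>. v x * partial_deriv b \<psi> x) = - (LINT x|lebesgue_on \<Omega>. g b x * \<psi> x)"
      using 1 LIMSEQ_unique by simp
  qed
  have vH: "v \<in> H1 \<Omega>" using v(1) g(1) wv by (auto simp: H1_def)
  have Wg: "L2.q \<Omega> (\<lambda>x. ?W b (\<phi> n) x - ?W b v x) = L2.q \<Omega> (\<lambda>x. ?W b (\<phi> n) x - g b x)" if b: "b \<in> Basis" for b n
  proof -
    have "AE x in lebesgue_on \<Omega>. ?W b (\<phi> n) x - ?W b v x = ?W b (\<phi> n) x - g b x"
      using weak_partial_deriv_AE[OF \<Omega> vH b g(1)[OF b] wv[OF b]] by eventually_elim simp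
    then show ?thesis unfolding L2.q_def
      by (intro arg_cong[where f = Re] L2_inner_cong_AE L2_diff WL[OF b] H1_weak_deriv(1)[OF vH b] g(1)[OF b])
  qed
  have "(\<lambda>n. (\<Sum>b\<in>Basis. L2.q \<Omega> (\<lambda>x. ?W b (\<phi> n) x - g b x)) + L2.q \<Omega> (\<lambda>x. \<phi> n x - v x)) \<longlonglongrightarrow> (\<Sum>b\<in>(Basis::'a set). 0) + 0"
    by (intro tendsto_intros g v)
  then have lim0: "(\<lambda>n. G.q (\<lambda>x. \<phi> n x - v x) + L2.q \<Omega> (\<lambda>x. \<phi> n x - v x)) \<longlonglongrightarrow> 0"
    by (simp add: grad_diff[OF H vH] Wg)
  then have "v \<in> H1_0 \<Omega>" unfolding H1_0_iff using vH \<phi> by blast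
  then show thesis using lim0 by (rule that)
qed

text \<open>Each member is replaced by a test function at squared distance below 1 / (n + 1); the
  new sequence is again Cauchy, and its limit is also the limit of the old one.\<close>

lemma H1_0_complete:
  assumes u: "\<And>n. u n \<in> H1_0 \<Omega>"
    and cauchy: "\<And>e. e > 0 \<Longrightarrow> \<exists>N. \<forall>m\<ge>N. \<forall>n\<ge>N. G.q (\<lambda>x. u m x - u n x) + L2.q \<Omega> (\<lambda>x. u m x - u n x) < e"
  shows "\<exists>v\<in>H1_0 \<Omega>. (\<lambda>n. G.q (\<lambda>x. u n x - v x) + L2.q \<Omega> (\<lambda>x. u n x - v x)) \<longlonglongrightarrow> 0"
proof -
  define q where "q w = G.q w + L2.q \<Omega> w" for w
  have H: "u n \<in> H1 \<Omega>" for n using u H1_0_H1 by auto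
  have q_add: "q (\<lambda>x. f x + g x) \<le> 2 * q f + 2 * q g" if "f \<in> H1 \<Omega>" "g \<in> H1 \<Omega>" for f g
    using G.q_add_le[OF that] L2.q_add_le[OF H1_L2[OF that(1)] H1_L2[OF that(2)]] by (simp add: q_def)
  have q_sym: "q (\<lambda>x. f x - g x) = q (\<lambda>x. g x - f x)" if "f \<in> H1 \<Omega>" "g \<in> H1 \<Omega>" for f g
    using G.q_scale[OF G.diff_closed[OF that], of "-1"] L2.q_scale[OF H1_L2[OF G.diff_closed[OF that]], of "-1"]
    by (simp add: q_def)
  have q_tri: "q (\<lambda>x. f x - h x) \<le> 2 * q (\<lambda>x. f x - g x) + 2 * q (\<lambda>x. g x - h x)"
    if "f \<in> H1 \<Omega>" "g \<in> H1 \<Omega>" "h \<in> H1 \<Omega>" for f g h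
    using q_add[OF G.diff_closed[OF that(1,2)] G.diff_closed[OF that(2,3)]] by simp
  have "\<exists>\<phi>. \<phi> \<in> test_functions \<Omega> \<and> q (\<lambda>x. \<phi> x - u n x) < 1 / real (Suc n)" for n
  proof -
    obtain \<phi> where \<phi>: "\<And>k. \<phi> k \<in> test_functions \<Omega>" "(\<lambda>k. q (\<lambda>x. \<phi> k x - u n x)) \<longlonglongrightarrow> 0"
      using u[of n] unfolding H1_0_iff q_def by blast
    from order_tendstoD(2)[OF \<phi>(2), of "1 / real (Suc n)"]
    obtain k where "q (\<lambda>x. \<phi> k x - u n x) < 1 / real (Suc n)" by (auto simp: eventually_sequentially)
    then show ?thesis using \<phi>(1) by blast
  qed
  then obtain \<phi> where \<phi>: "\<And>n. \<phi> n \<in> test_functions \<Omega>" "\<And>n. q (\<lambda>x. \<phi> n x - u n x) < 1 / real (Suc n)" by metis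
  have PH: "\<phi> n \<in> H1 \<Omega>" for n using \<phi>(1) test_functions_H1[OF _ \<Omega>] by auto
  have small: "\<exists>N. \<forall>n\<ge>N. q (\<lambda>x. \<phi> n x - u n x) < e" if e: "e > 0" for e
  proof -
    obtain N where "\<forall>n\<ge>N. 1 / real (Suc n) < e"
      using order_tendstoD(2)[OF tendsto_one_over_Suc e] unfolding eventually_sequentially by blast
    then show ?thesis using \<phi>(2) less_trans by blast
  qed
  obtain v where v: "v \<in> H1_0 \<Omega>" "(\<lambda>n. q (\<lambda>x. \<phi> n x - v x)) \<longlonglongrightarrow> 0"
  proof (rule test_functions_cauchy_limit[OF \<phi>(1)])
    fix e :: real assume e: "e > 0"
    \<comment> \<open>\<open>q\<close> is a squared norm, so each use of the triangle inequality
      costs a factor 2: the three distances enter with weights 2, 4 and 4, which add up to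
      10.\<close>
    obtain N1 where N1: "\<forall>n\<ge>N1. q (\<lambda>x. \<phi> n x - u n x) < e / 10" using small[of "e/10"] e by auto
    obtain N2 where N2: "\<forall>m\<ge>N2. \<forall>n\<ge>N2. q (\<lambda>x. u m x - u n x) < e / 10" using cauchy[of "e/10"] e by (auto simp: q_def)
    have "q (\<lambda>x. \<phi> m x - \<phi> n x) < e" if "m \<ge> max N1 N2" "n \<ge> max N1 N2" for m n
    proof -
      have "q (\<lambda>x. \<phi> m x - \<phi> n x) \<le> 2 * q (\<lambda>x. \<phi> m x - u m x) + 2 * (2 * q (\<lambda>x. u m x - u n x) + 2 * q (\<lambda>x. u n x - \<phi> n x))"
        by (rule order_trans[OF q_tri[OF PH[of m] H[of m] PH[of n]] add_left_mono[OF mult_left_mono[OF q_tri[OF H[of m] H[of n] PH[of n]]]]]) simp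
      also have "q (\<lambda>x. u n x - \<phi> n x) = q (\<lambda>x. \<phi> n x - u n x)" by (rule q_sym[OF H PH])
      also have "2 * q (\<lambda>x. \<phi> m x - u m x) + 2 * (2 * q (\<lambda>x. u m x - u n x) + 2 * q (\<lambda>x. \<phi> n x - u n x)) < e"
        using N1[rule_format, of m] N1[rule_format, of n] N2[rule_format, of m n] that by simp
      finally show ?thesis .
    qed
    then show "\<exists>N. \<forall>m\<ge>N. \<forall>n\<ge>N. G.q (\<lambda>x. \<phi> m x - \<phi> n x) + L2.q \<Omega> (\<lambda>x. \<phi> m x - \<phi> n x) < e"
      unfolding q_def by blast
  qed (auto simp: q_def)
  have VH: "v \<in> H1 \<Omega>" using v(1) H1_0_H1 by auto
  have p0: "(\<lambda>n. q (\<lambda>x. \<phi> n x - u n x)) \<longlonglongrightarrow> 0"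
  proof (rule tendsto_sandwich[OF _ _ tendsto_const tendsto_one_over_Suc])
    have "0 \<le> q (\<lambda>x. \<phi> n x - u n x)" for n
      using G.q_nonneg[OF G.diff_closed[OF PH H]] L2.q_nonneg[OF H1_L2[OF G.diff_closed[OF PH H]]] by (simp add: q_def add_nonneg_nonneg)
    then show "\<forall>\<^sub>F n in sequentially. 0 \<le> q (\<lambda>x. \<phi> n x - u n x)" by simp
    show "\<forall>\<^sub>F n in sequentially. q (\<lambda>x. \<phi> n x - u n x) \<le> 1 / real (Suc n)" using \<phi>(2) less_imp_le by (intro always_eventually) blast
  qed
  have "(\<lambda>n. 2 * q (\<lambda>x. \<phi> n x - u n x) + 2 * q (\<lambda>x. \<phi> n x - v x)) \<longlonglongrightarrow> 2 * 0 + 2 * 0"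
    by (intro tendsto_intros p0 v)
  then have lim: "(\<lambda>n. 2 * q (\<lambda>x. \<phi> n x - u n x) + 2 * q (\<lambda>x. \<phi> n x - v x)) \<longlonglongrightarrow> 0" by simp
  have "(\<lambda>n. q (\<lambda>x. u n x - v x)) \<longlonglongrightarrow> 0"
  proof (rule tendsto_sandwich[OF _ _ tendsto_const lim])
    have "0 \<le> q (\<lambda>x. u n x - v x)" for n
      using G.q_nonneg[OF G.diff_closed[OF H VH]] L2.q_nonneg[OF H1_L2[OF G.diff_closed[OF H VH]]] by (simp add: q_def add_nonneg_nonneg)
    then show "\<forall>\<^sub>F n in sequentially. 0 \<le> q (\<lambda>x. u n x - v x)" by simp
    show "\<forall>\<^sub>F n in sequentially. q (\<lambda>x. u n x - v x) \<le> 2 * q (\<lambda>x. \<phi> n x - u n x) + 2 * q (\<lambda>x. \<phi> n x - v x)"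
      using q_tri[OF H PH VH] q_sym[OF H PH] by (intro always_eventually allI) metis
  qed
  then show ?thesis using v(1) unfolding q_def by blast
qed

end

section \<open>Eigenvalues of the Dirichlet Laplacian below a threshold\<close>

text \<open>Both inequalities are asked for test functions only, where energy and mass are plain
  integrals. The number k of functionals becomes the bound for the number of eigenvalues below
  \<theta>, and c0 keeps these away from zero.\<close>

locale dirichlet_domain =
  fixes \<Omega> :: "'a::euclidean_space set" and k :: nat and f :: "nat \<Rightarrow> 'a \<Rightarrow> complex" and \<theta> c0 :: real
  assumes open_domain: "open \<Omega>"
    and f_L2: "i < k \<Longrightarrow> f i \<in> L2 \<Omega>"
    and c0_pos: "c0 > 0"
    and coercive_test: "\<phi> \<in> test_functions \<Omega> \<Longrightarrow> c0 * L2_mass \<phi> \<le> dirichlet_energy \<phi>"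
    and garding_test: "\<phi> \<in> test_functions \<Omega> \<Longrightarrow>
      \<theta> * L2_mass \<phi> \<le> dirichlet_energy \<phi> + (\<Sum>i<k. (cmod (L2_inner \<Omega> \<phi> (f i)))\<^sup>2)"
begin

sublocale A: herm_form "H1_0 \<Omega>" "grad_form \<Omega>" by (rule H1_0_grad_form[OF open_domain])
sublocale B: herm_form "H1_0 \<Omega>" "L2_inner \<Omega>" by (rule H1_0_L2_form[OF open_domain])

lemma H1_0_L2: "u \<in> H1_0 \<Omega> \<Longrightarrow> u \<in> L2 \<Omega>"
  using H1_L2 H1_0_H1[OF open_domain] by blast

lemma test_q:
  assumes "\<phi> \<in> test_functions \<Omega>"
  shows "\<phi> \<in> H1_0 \<Omega>" "A.q \<phi> = dirichlet_energy \<phi>" "B.q \<phi> = L2_mass \<phi>"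
  using test_functions_H1_0[OF open_domain assms] test_functions_grad_form[OF assms open_domain]
    test_functions_L2_q[OF assms open_domain]
  by (auto simp: A.q_def L2.q_def)

lemma H1_0_approx:
  assumes "u \<in> H1_0 \<Omega>"
  obtains \<phi> where "\<And>n. \<phi> n \<in> test_functions \<Omega>" "\<And>n. \<phi> n \<in> H1_0 \<Omega>"
    "(\<lambda>n. A.q (\<lambda>x. \<phi> n x - u x)) \<longlonglongrightarrow> 0" "(\<lambda>n. B.q (\<lambda>x. \<phi> n x - u x)) \<longlonglongrightarrow> 0"
proof -
  obtain \<phi> where \<phi>: "\<And>n. \<phi> n \<in> test_functions \<Omega>"
    "(\<lambda>n. A.q (\<lambda>x. \<phi> n x - u x) + B.q (\<lambda>x. \<phi> n x - u x)) \<longlonglongrightarrow> 0"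
    using assms unfolding H1_0_iff[OF open_domain] by blast
  have H: "\<phi> n \<in> H1_0 \<Omega>" for n using test_q(1)[OF \<phi>(1)] .
  note nn = A.q_nonneg[OF A.diff_closed[OF H assms]] B.q_nonneg[OF B.diff_closed[OF H assms]]
  have "(\<lambda>n. A.q (\<lambda>x. \<phi> n x - u x)) \<longlonglongrightarrow> 0"
    by (rule tendsto_sandwich[OF _ _ tendsto_const \<phi>(2)]) (use nn in auto)
  moreover have "(\<lambda>n. B.q (\<lambda>x. \<phi> n x - u x)) \<longlonglongrightarrow> 0"
    by (rule tendsto_sandwich[OF _ _ tendsto_const \<phi>(2)]) (use nn in auto)
  ultimately show thesis using \<phi>(1) H by (intro that)
qed

text \<open>Energy, mass and functionals are continuous along an approximating sequence of test
  functions, so the inequalities extend to \<open>H1_0\<close>. The sum of the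
  \<open>L2.q \<Omega> (f i)\<close> serves as one bound for all functionals.\<close>

sublocale spectral_form "H1_0 \<Omega>" "grad_form \<Omega>" "L2_inner \<Omega>" k "\<lambda>i u. L2_inner \<Omega> u (f i)" \<theta> c0 "\<Sum>i<k. L2.q \<Omega> (f i)"
proof
  show "L2_inner \<Omega> (\<lambda>x. c * u x + d * v x) (f i) = c * L2_inner \<Omega> u (f i) + d * L2_inner \<Omega> v (f i)"
    if "i < k" "u \<in> H1_0 \<Omega>" "v \<in> H1_0 \<Omega>" for i u v c d
    using that by (intro L2.lin_left H1_0_L2 f_L2)
  show "(cmod (L2_inner \<Omega> u (f i)))\<^sup>2 \<le> (\<Sum>i<k. L2.q \<Omega> (f i)) * B.q u" if "i < k" "u \<in> H1_0 \<Omega>" for i u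
  proof -
    have "(cmod (L2_inner \<Omega> u (f i)))\<^sup>2 \<le> B.q u * L2.q \<Omega> (f i)"
      using that by (intro L2.cauchy_schwarz H1_0_L2 f_L2)
    also have "\<dots> \<le> B.q u * (\<Sum>i<k. L2.q \<Omega> (f i))"
      using that f_L2 by (intro mult_left_mono member_le_sum B.q_nonneg L2.q_nonneg) auto
    finally show ?thesis by (simp add: mult.commute)
  qed
  show "c0 > 0" by (rule c0_pos)
  show "c0 * B.q u \<le> A.q u" if u: "u \<in> H1_0 \<Omega>" for u
  proof -
    obtain \<phi> where \<phi>: "\<And>n. \<phi> n \<in> test_functions \<Omega>" "\<And>n. \<phi> n \<in> H1_0 \<Omega>"
      "(\<lambda>n. A.q (\<lambda>x. \<phi> n x - u x)) \<longlonglongrightarrow> 0" "(\<lambda>n. B.q (\<lambda>x. \<phi> n x - u x)) \<longlonglongrightarrow> 0"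
      using H1_0_approx[OF u] by blast
    have 1: "(\<lambda>n. c0 * B.q (\<phi> n)) \<longlonglongrightarrow> c0 * B.q u"
      by (intro tendsto_mult tendsto_const B.tendsto_q \<phi> u)
    have 2: "(\<lambda>n. A.q (\<phi> n)) \<longlonglongrightarrow> A.q u" by (intro A.tendsto_q \<phi> u)
    show ?thesis
      by (rule LIMSEQ_le[OF 1 2]) (use coercive_test[OF \<phi>(1)] test_q[OF \<phi>(1)] in auto)
  qed
  show "\<theta> * B.q u \<le> A.q u + (\<Sum>i<k. (cmod (L2_inner \<Omega> u (f i)))\<^sup>2)" if u: "u \<in> H1_0 \<Omega>" for u
  proof -
    obtain \<phi> where \<phi>: "\<And>n. \<phi> n \<in> test_functions \<Omega>" "\<And>n. \<phi> n \<in> H1_0 \<Omega>"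
      "(\<lambda>n. A.q (\<lambda>x. \<phi> n x - u x)) \<longlonglongrightarrow> 0" "(\<lambda>n. B.q (\<lambda>x. \<phi> n x - u x)) \<longlonglongrightarrow> 0"
      using H1_0_approx[OF u] by blast
    have 1: "(\<lambda>n. \<theta> * B.q (\<phi> n)) \<longlonglongrightarrow> \<theta> * B.q u"
      by (intro tendsto_mult tendsto_const B.tendsto_q \<phi> u)
    have 3: "(\<lambda>n. L2_inner \<Omega> (\<phi> n) (f i)) \<longlonglongrightarrow> L2_inner \<Omega> u (f i)" if "i < k" for i
      by (rule L2.tendsto_s[OF H1_0_L2[OF \<phi>(2)] H1_0_L2[OF u] f_L2[OF that] \<phi>(4)])
    have 2: "(\<lambda>n. A.q (\<phi> n) + (\<Sum>i<k. (cmod (L2_inner \<Omega> (\<phi> n) (f i)))\<^sup>2)) \<longlonglongrightarrow> A.q u + (\<Sum>i<k. (cmod (L2_inner \<Omega> u (f i)))\<^sup>2)"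
      by (intro tendsto_intros A.tendsto_q \<phi> u 3) auto
    show ?thesis
      by (rule LIMSEQ_le[OF 1 2]) (use garding_test[OF \<phi>(1)] test_q[OF \<phi>(1)] in auto)
  qed
  show "\<exists>v\<in>H1_0 \<Omega>. (\<lambda>n. A.q (\<lambda>x. u n x - v x) + B.q (\<lambda>x. u n x - v x)) \<longlonglongrightarrow> 0"
    if "\<And>n. u n \<in> H1_0 \<Omega>" "\<And>e. e > 0 \<Longrightarrow> \<exists>N. \<forall>m\<ge>N. \<forall>n\<ge>N. A.q (\<lambda>x. u m x - u n x) + B.q (\<lambda>x. u m x - u n x) < e" for u
    using H1_0_complete[OF open_domain that] .
qed

section \<open>Eigenvalues, multiplicities and their listing\<close>

lemma eigenspace_iff: "u \<in> eigenspace \<Omega> \<mu> \<longleftrightarrow> is_eigen \<mu> u"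
proof -
  have "(\<lambda>x. of_real \<mu> * u x) \<in> L2 \<Omega>" if "u \<in> H1_0 \<Omega>" using L2.scale_closed[OF H1_0_L2[OF that]] .
  moreover have "L2_inner \<Omega> (\<lambda>x. of_real \<mu> * u x) v = of_real \<mu> * L2_inner \<Omega> u v"
    if "u \<in> H1_0 \<Omega>" "v \<in> H1_0 \<Omega>" for v using B.scale_left[OF that] .
  ultimately show ?thesis by (auto simp: eigenspace_def dirichlet_laplacian_def is_eigen_def)
qed

lemma is_eigenvalue_iff: "is_eigenvalue \<Omega> \<mu> \<longleftrightarrow> (\<exists>u. is_eigen \<mu> u \<and> B.q u > 0)"
proof -
  have "B.q u > 0 \<longleftrightarrow> \<not> (AE x in lebesgue_on \<Omega>. u x = 0)" if "is_eigen \<mu> u" for u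
  proof -
    have "u \<in> L2 \<Omega>" using that H1_0_L2 by (simp add: is_eigen_def)
    then show ?thesis using L2_q_zero_iff[of u \<Omega>] L2.q_nonneg[of u \<Omega>] by linarith
  qed
  then show ?thesis by (auto simp: is_eigenvalue_def eigenspace_iff)
qed

lemma is_eigenvalue_lower_bound: "is_eigenvalue \<Omega> \<mu> \<Longrightarrow> c0 \<le> \<mu>"
  using eigen_pos by (auto simp: is_eigenvalue_iff)

lemma discrete_spectrum_eq: "discrete_spectrum \<Omega> \<theta> = eigenvalues"
proof -
  have "0 < \<mu>" if "is_eigenvalue \<Omega> \<mu>" for \<mu> using is_eigenvalue_lower_bound[OF that] c0_pos by simp
  then show ?thesis by (auto simp: discrete_spectrum_def eigenvalues_def is_eigenvalue_iff)
qed

lemma discrete_spectrum_finite: "finite (discrete_spectrum \<Omega> \<theta>)" "card (discrete_spectrum \<Omega> \<theta>) \<le> k"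
  using eigenvalues_finite by (simp_all add: discrete_spectrum_eq)

text \<open>A combination that vanishes almost everywhere has zero mass, hence zero product with
  each of the orthonormal eigenfunctions; so orthonormality yields independence modulo null
  functions.\<close>

lemma multiplicity_ge:
  assumes el: "eigenlist N e \<nu>" and I: "I \<subseteq> {..<N}" "\<And>i. i \<in> I \<Longrightarrow> \<nu> i = \<mu>"
  shows "enat (card I) \<le> multiplicity_of \<Omega> \<mu>"
proof -
  have "finite I" using I(1) finite_subset by blast
  then obtain h where h: "bij_betw h {..<card I} I" using ex_bij_betw_nat_finite[of I] by (auto simp: atLeast0LessThan)
  have hI: "h i \<in> I" "h i < N" if "i < card I" for i using h that I(1) by (auto simp: bij_betw_def)
  have h_inj: "h i = h j \<longleftrightarrow> i = j" if "i < card I" "j < card I" for i j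
    using h that by (auto simp: bij_betw_def inj_on_def)
  have eig: "is_eigen \<mu> (e (h i))" if "i < card I" for i
    using el hI[OF that] I(2) by (auto simp: eigenlist_def)
  have H: "e (h i) \<in> H1_0 \<Omega>" if "i < card I" for i using eig[OF that] by (simp add: is_eigen_def)
  have indep: "\<forall>i<card I. c i = 0"
    if AE: "AE x in lebesgue_on \<Omega>. (\<Sum>i<card I. c i * e (h i) x) = 0" for c
  proof (intro allI impI)
    fix j assume j: "j < card I"
    let ?u = "\<lambda>x. \<Sum>i<card I. c i * e (h i) x"
    have uH: "?u \<in> H1_0 \<Omega>" using H by (intro A.sum_closed) auto
    have "B.q ?u = 0" using AE L2_q_zero_iff[OF H1_0_L2[OF uH]] by simp
    then have "L2_inner \<Omega> ?u (e (h j)) = 0" using B.cauchy_schwarz[OF uH H[OF j]] by simp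
    moreover have "L2_inner \<Omega> ?u (e (h j)) = (\<Sum>i<card I. c i * L2_inner \<Omega> (e (h i)) (e (h j)))"
      using H j by (intro B.s_sum_left) auto
    moreover have "\<dots> = (\<Sum>i<card I. if i = j then c j else 0)"
      using el hI h_inj j by (intro sum.cong) (auto simp: eigenlist_def)
    ultimately show "c j = 0" using j by simp
  qed
  show ?thesis unfolding multiplicity_of_def
  proof (rule Sup_upper, intro CollectI exI conjI)
    show "\<forall>i<card I. e (h i) \<in> eigenspace \<Omega> \<mu>" using eig by (simp add: eigenspace_iff)
    show "\<forall>c. (AE x in lebesgue_on \<Omega>. (\<Sum>i<card I. c i * e (h i) x) = 0) \<longrightarrow> (\<forall>i<card I. c i = 0)"
      using indep by blast
  qed simp
qed

text \<open>Finiteness of the discrete spectrum turns the infinite sum of the definition into a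
  finite one.\<close>

lemma total_multiplicity_eq_sum:
  "S \<subseteq> discrete_spectrum \<Omega> \<theta> \<Longrightarrow> total_multiplicity \<Omega> S = (\<Sum>\<mu>\<in>S. multiplicity_of \<Omega> \<mu>)"
  unfolding total_multiplicity_def using discrete_spectrum_finite(1) finite_subset by (intro infsum_finite) blast

lemma total_multiplicity_mono:
  "S \<subseteq> T \<Longrightarrow> T \<subseteq> discrete_spectrum \<Omega> \<theta> \<Longrightarrow> total_multiplicity \<Omega> S \<le> total_multiplicity \<Omega> T"
  using total_multiplicity_eq_sum[of S] total_multiplicity_eq_sum[of T] discrete_spectrum_finite(1)
  by (metis (no_types, lifting) finite_subset order_trans sum_mono2 zero_le)

text \<open>The min-max construction yields N orthonormal eigenfunctions with eigenvalues up to m.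
  Their indices are grouped by eigenvalue, and the size of each group bounds one multiplicity from
  below.\<close>

lemma total_multiplicity_ge:
  assumes V: "\<And>j. j < N \<Longrightarrow> v j \<in> test_functions \<Omega>"
    and pos: "\<And>c. \<exists>j<N. c j \<noteq> 0 \<Longrightarrow> L2_mass (\<lambda>x. \<Sum>j<N. c j * v j x) > 0"
    and le: "\<And>c. dirichlet_energy (\<lambda>x. \<Sum>j<N. c j * v j x) \<le> m * L2_mass (\<lambda>x. \<Sum>j<N. c j * v j x)"
    and m: "m < \<theta>"
  shows "enat N \<le> total_multiplicity \<Omega> {\<nu> \<in> discrete_spectrum \<Omega> \<theta>. \<nu> \<le> m}"
proof -
  have T: "(\<lambda>x. \<Sum>j<n. c j * v j x) \<in> test_functions \<Omega>" if "n \<le> N" for n c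
    using that
  proof (induction n)
    case 0 show ?case using test_functions_zero by simp
  next
    case (Suc n)
    then show ?case using test_functions_lin[of "\<lambda>x. \<Sum>j<n. c j * v j x" \<Omega> "v n" 1 "c n"] V by simp
  qed
  obtain e \<nu> where el: "eigenlist N e \<nu>" "\<forall>i<N. 0 < \<nu> i \<and> \<nu> i \<le> m"
    using min_max[of N v m] test_q(1)[OF V] pos le m test_q(2,3)[OF T[OF order_refl]] by auto
  let ?S = "{\<nu> \<in> discrete_spectrum \<Omega> \<theta>. \<nu> \<le> m}"
  have fin: "finite ?S" using discrete_spectrum_finite(1) by simp
  have \<nu>S: "\<nu> i \<in> ?S" if i: "i < N" for i
  proof -
    have "is_eigen (\<nu> i) (e i)" "B.q (e i) = 1" using el(1) i by (auto simp: eigenlist_def B.q_def)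
    then have "\<exists>u. is_eigen (\<nu> i) u \<and> 0 < B.q u" by (intro exI[of _ "e i"]) auto
    then show ?thesis using el(2) i m by (auto simp: discrete_spectrum_eq eigenvalues_def)
  qed
  have "enat N = enat (\<Sum>\<mu>\<in>?S. card {i \<in> {..<N}. \<nu> i = \<mu>})"
    using card_eq_sum[of "{..<N}"] sum.group[of "{..<N}" ?S \<nu> "\<lambda>_. 1::nat"] fin \<nu>S by (auto simp: image_subset_iff)
  also have "\<dots> = (\<Sum>\<mu>\<in>?S. enat (card {i \<in> {..<N}. \<nu> i = \<mu>}))"
    using fin by (induction rule: finite_induct) (auto simp: zero_enat_def plus_enat_simps(1)[symmetric])
  also have "\<dots> \<le> (\<Sum>\<mu>\<in>?S. multiplicity_of \<Omega> \<mu>)" by (intro sum_mono multiplicity_ge[OF el(1)]) auto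
  also have "\<dots> = total_multiplicity \<Omega> ?S" by (subst total_multiplicity_eq_sum) auto
  finally show ?thesis .
qed

text \<open>The definite description is identified as the least eigenvalue at which the cumulative
  multiplicity reaches N. Cumulative multiplicities are compared by monotonicity alone, so they may
  be infinite; the number of eigenvalues is finite, which gives the minimum and the maxima.\<close>

lemma nth_discrete_eigenvalue_le:
  assumes N: "N \<ge> 1" and le: "enat N \<le> total_multiplicity \<Omega> {\<nu> \<in> discrete_spectrum \<Omega> \<theta>. \<nu> \<le> m}"
  shows "nth_discrete_eigenvalue \<Omega> \<theta> N \<le> m"
proof -
  let ?S = "discrete_spectrum \<Omega> \<theta>"
  define t where "t \<mu> = total_multiplicity \<Omega> {\<nu> \<in> ?S. \<nu> \<le> \<mu>}" for \<mu>
  define t' where "t' \<mu> = total_multiplicity \<Omega> {\<nu> \<in> ?S. \<nu> < \<mu>}" for \<mu>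
  have fin: "finite ?S" by (rule discrete_spectrum_finite)
  have empty: "total_multiplicity \<Omega> {} = 0" by (subst total_multiplicity_eq_sum) auto
  have ne: "F \<noteq> {}" if "enat N \<le> total_multiplicity \<Omega> F" for F
    using that N empty by (auto simp: zero_enat_def)
  have max: "Max {\<nu> \<in> ?S. P \<nu>} \<in> {\<nu> \<in> ?S. P \<nu>}" "{\<nu> \<in> ?S. \<nu> \<le> Max {\<nu> \<in> ?S. P \<nu>}} \<supseteq> {\<nu> \<in> ?S. P \<nu>}"
    if "{\<nu> \<in> ?S. P \<nu>} \<noteq> {}" for P
    using Max_in[OF _ that] fin by auto
  define A where "A = {\<mu> \<in> ?S. enat N \<le> t \<mu>}"
  have finA: "finite A" using fin by (simp add: A_def)
  \<comment> \<open>No eigenvalue lies strictly between this one and m, so the cumulative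
    multiplicity has already reached N here. The set is nonempty because its total multiplicity is
    at least N \<ge> 1.\<close>
  let ?M = "Max {\<nu> \<in> ?S. \<nu> \<le> m}"
  have M: "?M \<in> ?S" "?M \<le> m" using max(1)[OF ne[OF le]] by auto
  have "enat N \<le> t ?M" unfolding t_def
    by (rule order_trans[OF le total_multiplicity_mono[OF max(2)[OF ne[OF le]]]]) auto
  then have MA: "?M \<in> A" using M by (simp add: A_def)
  then have Ain: "Min A \<in> A" using finA by (intro Min_in) auto
  have low: "t' (Min A) < enat N"
  proof (rule ccontr)
    assume "\<not> t' (Min A) < enat N"
    then have l: "enat N \<le> total_multiplicity \<Omega> {\<nu> \<in> ?S. \<nu> < Min A}" by (simp add: t'_def)
    \<comment> \<open>If N were reached strictly below \<open>Min A\<close>, it would be reached at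
      the largest eigenvalue there, against minimality.\<close>
    let ?M' = "Max {\<nu> \<in> ?S. \<nu> < Min A}"
    have M': "?M' \<in> ?S" "?M' < Min A" using max(1)[OF ne[OF l]] by auto
    have "enat N \<le> t ?M'" unfolding t_def
      by (rule order_trans[OF l total_multiplicity_mono[OF max(2)[OF ne[OF l]]]]) auto
    then have "?M' \<in> A" using M' by (simp add: A_def)
    then show False using Min_le[OF finA] M'(2) by fastforce
  qed
  have "nth_discrete_eigenvalue \<Omega> \<theta> N = Min A"
    unfolding nth_discrete_eigenvalue_def t_def[symmetric] t'_def[symmetric]
  proof (rule the_equality)
    show "Min A \<in> ?S \<and> t' (Min A) < enat N \<and> enat N \<le> t (Min A)" using Ain low by (simp add: A_def)
    fix \<mu> assume \<mu>: "\<mu> \<in> ?S \<and> t' \<mu> < enat N \<and> enat N \<le> t \<mu>"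
    have le: "t \<mu>1 \<le> t' \<mu>2" if "\<mu>1 < \<mu>2" for \<mu>1 \<mu>2
      unfolding t_def t'_def using that by (intro total_multiplicity_mono) auto
    show "\<mu> = Min A"
    proof (rule linorder_cases[of \<mu> "Min A"])
      assume "\<mu> < Min A"
      then show ?thesis using le[of \<mu> "Min A"] \<mu> low by (meson order.strict_trans2 order_trans less_le_not_le)
    next
      assume "Min A < \<mu>"
      then show ?thesis using le[of "Min A" \<mu>] \<mu> Ain unfolding A_def by (metis (mono_tags, lifting) mem_Collect_eq not_le order_trans)
    qed
  qed
  also have "Min A \<le> ?M" using Min_le[OF finA MA] .
  finally show ?thesis using M(2) by simp
qed

lemma exists_eigenvalue_le:
  assumes "\<phi> \<in> test_functions \<Omega>" "L2_mass \<phi> > 0" "dirichlet_energy \<phi> \<le> m * L2_mass \<phi>" "m < \<theta>"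
  shows "\<exists>\<mu>\<in>discrete_spectrum \<Omega> \<theta>. \<mu> \<le> m"
proof -
  have scale: "B.q (\<lambda>x. c * \<phi> x) = (cmod c)\<^sup>2 * L2_mass \<phi>" "A.q (\<lambda>x. c * \<phi> x) = (cmod c)\<^sup>2 * dirichlet_energy \<phi>" for c
    using B.q_scale[of \<phi> c] A.q_scale[of \<phi> c] test_q[OF assms(1)] by auto
  obtain e \<nu> where el: "eigenlist 1 e \<nu>" "0 < \<nu> 0" "\<nu> 0 \<le> m"
  proof -
    have "\<exists>e \<nu>. eigenlist 1 e \<nu> \<and> (\<forall>i<(1::nat). 0 < \<nu> i \<and> \<nu> i \<le> m)"
    proof (rule min_max[of 1 "\<lambda>_. \<phi>"])
      show "A.q (\<lambda>x. \<Sum>j<(1::nat). c j * \<phi> x) \<le> m * B.q (\<lambda>x. \<Sum>j<(1::nat). c j * \<phi> x)" for c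
        using mult_left_mono[OF assms(3), of "(cmod (c 0))\<^sup>2"] by (simp add: scale) (simp add: mult_ac)
    qed (use assms test_q scale in auto)
    then show ?thesis using that by auto
  qed
  have "is_eigen (\<nu> 0) (e 0)" "B.q (e 0) = 1" using el by (auto simp: eigenlist_def B.q_def)
  then have "\<exists>u. is_eigen (\<nu> 0) u \<and> 0 < B.q u" by (intro exI[of _ "e 0"]) auto
  then have "\<nu> 0 \<in> discrete_spectrum \<Omega> \<theta>" using el assms(4) by (auto simp: discrete_spectrum_eq eigenvalues_def)
  then show ?thesis using el(3) by blast
qed

text \<open>An eigenfunction is only known as an element of \<open>H1_0\<close>, whereas trial
  functions are built by substitutions and products of smooth functions. It is therefore replaced by
  a test function with almost the same quotient.\<close>

lemma eigenvalue_approx: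
  assumes "is_eigenvalue \<Omega> \<mu>" "\<epsilon> > 0"
  obtains \<phi> where "\<phi> \<in> test_functions \<Omega>" "L2_mass \<phi> > 0" "dirichlet_energy \<phi> \<le> (\<mu> + \<epsilon>) * L2_mass \<phi>"
proof -
  obtain u where u: "is_eigen \<mu> u" "B.q u > 0" using assms(1) by (auto simp: is_eigenvalue_iff)
  then have uH: "u \<in> H1_0 \<Omega>" and Au: "A.q u = \<mu> * B.q u" by (auto simp: is_eigen_def A.q_def B.q_def)
  obtain \<phi> where \<phi>: "\<And>n. \<phi> n \<in> test_functions \<Omega>" "\<And>n. \<phi> n \<in> H1_0 \<Omega>"
    "(\<lambda>n. A.q (\<lambda>x. \<phi> n x - u x)) \<longlonglongrightarrow> 0" "(\<lambda>n. B.q (\<lambda>x. \<phi> n x - u x)) \<longlonglongrightarrow> 0"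
    using H1_0_approx[OF uH] by blast
  have A: "(\<lambda>n. A.q (\<phi> n)) \<longlonglongrightarrow> A.q u" and B: "(\<lambda>n. B.q (\<phi> n)) \<longlonglongrightarrow> B.q u"
    using A.tendsto_q[OF \<phi>(2) uH \<phi>(3)] B.tendsto_q[OF \<phi>(2) uH \<phi>(4)] by auto
  have "(\<lambda>n. (\<mu> + \<epsilon>) * B.q (\<phi> n) - A.q (\<phi> n)) \<longlonglongrightarrow> (\<mu> + \<epsilon>) * B.q u - A.q u"
    by (intro tendsto_intros A B)
  then have "(\<lambda>n. (\<mu> + \<epsilon>) * B.q (\<phi> n) - A.q (\<phi> n)) \<longlonglongrightarrow> \<epsilon> * B.q u" by (simp add: Au algebra_simps)
  then have "\<forall>\<^sub>F n in sequentially. (\<mu> + \<epsilon>) * B.q (\<phi> n) - A.q (\<phi> n) > 0"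
    by (rule order_tendstoD(1)) (use assms(2) u(2) in simp)
  moreover have "\<forall>\<^sub>F n in sequentially. B.q (\<phi> n) > 0" using order_tendstoD(1)[OF B u(2)] .
  ultimately have "\<forall>\<^sub>F n in sequentially. (\<mu> + \<epsilon>) * B.q (\<phi> n) - A.q (\<phi> n) > 0 \<and> B.q (\<phi> n) > 0"
    by (rule eventually_conj)
  then obtain n where "(\<mu> + \<epsilon>) * B.q (\<phi> n) - A.q (\<phi> n) > 0" "B.q (\<phi> n) > 0"
    by (auto simp: eventually_sequentially)
  then show thesis using that[OF \<phi>(1)[of n]] test_q[OF \<phi>(1)[of n]] by simp
qed

end

section \<open>Integral inequalities\<close>

lemma indicator_mult_compactly_supported_integrable:
  fixes f :: "'a::euclidean_space \<Rightarrow> real"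
  assumes "compactly_supported \<Omega> f" "A \<in> sets borel"
  shows "integrable lborel (\<lambda>x. indicator A x * f x)"
  using integrable_mult_indicator[OF _ compactly_supported_integrable[OF assms(1)], of A] assms(2) by simp

text \<open>Picone's argument, with p in the role of h'/h for a positive function h and D the
  derivative of \<phi> along b. In |D - p \<phi>|^2 \<ge> 0 the cross term, completed by p'
  |\<phi>|^2, is the derivative of p |\<phi>|^2 and integrates to zero. A is a union of lines in
  direction b, so its indicator is constant along them. The gap r < r' keeps possible poles of p
  away from the support.\<close>

lemma picone_inequality:
  fixes \<phi> :: "'a::euclidean_space \<Rightarrow> complex" and p p' :: "real \<Rightarrow> real"
  assumes \<phi>: "\<phi> \<in> test_functions UNIV" and b: "b \<in> Basis"
    and A: "A \<in> sets borel" and inv: "\<And>x t. x + t *\<^sub>R b \<in> A \<longleftrightarrow> x \<in> A"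
    and van: "\<And>x. x \<in> A \<Longrightarrow> \<bar>x \<bullet> b\<bar> \<ge> r \<Longrightarrow> \<phi> x = 0" and r: "r < r'"
    and p: "\<And>t. \<bar>t\<bar> < r' \<Longrightarrow> (p has_real_derivative p' t) (at t)"
    and pc: "continuous_on {-r'<..<r'} p'" and pm: "p \<in> borel_measurable borel" "p' \<in> borel_measurable borel"
  shows "- (LINT x|lborel. indicator A x * ((p' (x \<bullet> b) + (p (x \<bullet> b))\<^sup>2) * (cmod (\<phi> x))\<^sup>2))
      \<le> (LINT x|lborel. indicator A x * (cmod (partial_deriv b \<phi> x))\<^sup>2)"
    and "integrable lborel (\<lambda>x. indicator A x * ((p' (x \<bullet> b) + (p (x \<bullet> b))\<^sup>2) * (cmod (\<phi> x))\<^sup>2))"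
proof -
  let ?D = "partial_deriv b \<phi>"
  define F where "F x = indicator A x * (p (x \<bullet> b) * (cmod (\<phi> x))\<^sup>2)" for x
  define G where "G x = indicator A x * (p' (x \<bullet> b) * (cmod (\<phi> x))\<^sup>2 + p (x \<bullet> b) * (2 * (\<phi> x \<bullet> ?D x)))" for x
  have D\<phi>: "?D \<in> test_functions UNIV" by (rule test_functions_partial_deriv[OF \<phi> b])
  have c1: "compactly_supported UNIV (\<lambda>x. (cmod (\<phi> x))\<^sup>2)" and c2: "compactly_supported UNIV (\<lambda>x. (cmod (?D x))\<^sup>2)"
    by (intro compactly_supported_norm_sq test_functions_compactly_supported \<phi> D\<phi>)+
  have cont: "continuous_on UNIV \<phi>" "continuous_on UNIV ?D"
    using \<phi> D\<phi> by (auto intro: test_functions_continuous)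
  have [measurable]: "\<phi> \<in> borel_measurable borel" "?D \<in> borel_measurable borel"
    using cont by (auto intro: borel_measurable_continuous_onI)
  note [measurable] = pm A
  have pcont: "continuous_on {-r'<..<r'} p"
    by (intro continuous_at_imp_continuous_on ballI DERIV_isCont[OF p]) (auto simp: abs_less_iff)
  have sub: "{-r..r} \<subseteq> {-r'<..<r'}" using r by auto
  obtain P where P: "\<And>t. \<bar>t\<bar> \<le> r \<Longrightarrow> \<bar>p t\<bar> \<le> P"
  proof -
    have "compact (p ` {-r..r})" by (intro compact_continuous_image continuous_on_subset[OF pcont sub]) simp
    then obtain P where "\<forall>y\<in>p ` {-r..r}. norm y \<le> P" using compact_imp_bounded bounded_iff by metis
    then show thesis using that[of P] by (auto simp: abs_le_iff)
  qed
  obtain P' where P': "\<And>t. \<bar>t\<bar> \<le> r \<Longrightarrow> \<bar>p' t\<bar> \<le> P'"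
  proof -
    have "compact (p' ` {-r..r})" by (intro compact_continuous_image continuous_on_subset[OF pc sub]) simp
    then obtain P where "\<forall>y\<in>p' ` {-r..r}. norm y \<le> P" using compact_imp_bounded bounded_iff by metis
    then show thesis using that[of P] by (auto simp: abs_le_iff)
  qed
  have zero: "\<phi> x = 0" if "x \<in> A" "\<not> \<bar>x \<bullet> b\<bar> \<le> r" for x using van[OF that(1)] that(2) by simp
  obtain M R where M: "\<And>x. cmod (\<phi> x) \<le> M" and R: "\<And>x. norm x > R \<Longrightarrow> \<phi> x = 0"
    using compactly_supported_bounds[OF test_functions_compactly_supported[OF \<phi>]] by metis
  obtain M' where M': "\<And>x. cmod (?D x) \<le> M'"
    using compactly_supported_bounds[OF test_functions_compactly_supported[OF D\<phi>]] by metis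
  have M0: "0 \<le> M" "0 \<le> M'" using M[of 0] M'[of 0] norm_ge_zero order_trans by blast+
  have Fi: "integrable lborel F"
  proof (rule Bochner_Integration.integrable_bound)
    show "integrable lborel (\<lambda>x. \<bar>P\<bar> * (cmod (\<phi> x))\<^sup>2)" using compactly_supported_integrable[OF c1] by simp
    show "F \<in> borel_measurable lborel" unfolding F_def by measurable
    show "AE x in lborel. norm (F x) \<le> norm (\<bar>P\<bar> * (cmod (\<phi> x))\<^sup>2)"
    proof (rule AE_I2)
      fix x
      show "norm (F x) \<le> norm (\<bar>P\<bar> * (cmod (\<phi> x))\<^sup>2)"
        by (cases "x \<in> A"; cases "\<bar>x \<bullet> b\<bar> \<le> r")
           (use P[of "x \<bullet> b"] zero[of x] in \<open>auto simp: F_def abs_mult intro!: mult_right_mono\<close>)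
    qed
  qed
  have Gb: "\<bar>G x\<bar> \<le> \<bar>P'\<bar> * M\<^sup>2 + \<bar>P\<bar> * (2 * (M * M'))" for x
  proof (cases "x \<in> A \<and> \<bar>x \<bullet> b\<bar> \<le> r")
    case True
    have "\<bar>p' (x \<bullet> b) * (cmod (\<phi> x))\<^sup>2\<bar> \<le> \<bar>P'\<bar> * M\<^sup>2"
      unfolding abs_mult using P'[of "x \<bullet> b"] True M[of x] by (intro mult_mono) (auto intro!: power_mono)
    moreover have "\<bar>p (x \<bullet> b) * (2 * (\<phi> x \<bullet> ?D x))\<bar> \<le> \<bar>P\<bar> * (2 * (M * M'))"
    proof -
      have "\<bar>\<phi> x \<bullet> ?D x\<bar> \<le> cmod (\<phi> x) * cmod (?D x)" by (rule Cauchy_Schwarz_ineq2)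
      also have "\<dots> \<le> M * M'" using M M' M0 by (intro mult_mono) auto
      finally have "\<bar>2 * (\<phi> x \<bullet> ?D x)\<bar> \<le> 2 * (M * M')" by simp
      then show ?thesis unfolding abs_mult[of "p (x \<bullet> b)"] using P[of "x \<bullet> b"] True by (intro mult_mono) auto
    qed
    ultimately have "\<bar>p' (x \<bullet> b) * (cmod (\<phi> x))\<^sup>2 + p (x \<bullet> b) * (2 * (\<phi> x \<bullet> ?D x))\<bar> \<le> \<bar>P'\<bar> * M\<^sup>2 + \<bar>P\<bar> * (2 * (M * M'))"
      by linarith
    then show ?thesis using True by (simp add: G_def)
  next
    case False
    then have "G x = 0" using zero[of x] by (cases "x \<in> A") (auto simp: G_def)
    then show ?thesis using M0 by simp
  qed
  have GR: "G x = 0" if "norm x > R" for x using R[OF that] by (simp add: G_def)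
  \<comment> \<open>On a line inside A either |x . b| < r' and the product rule applies, or \<phi>
    vanishes at all points of the line within distance r' - r, where p is not under control.\<close>
  have deriv: "((\<lambda>t. F (x + t *\<^sub>R b)) has_real_derivative G x) (at 0)" for x
  proof (cases "x \<in> A")
    case False
    then show ?thesis using inv by (simp add: F_def G_def)
  next
    case True
    have bb: "b \<bullet> b = 1" using b by simp
    show ?thesis
    proof (cases "\<bar>x \<bullet> b\<bar> < r'")
      case lt: True
      have d1: "((\<lambda>t. p (x \<bullet> b + t)) has_real_derivative p' (x \<bullet> b)) (at 0)"
        using DERIV_shift[of p "p' (x \<bullet> b)" 0 "x \<bullet> b"] p[OF lt] by (simp add: add.commute)
      have d2: "((\<lambda>t. (cmod (\<phi> (x + t *\<^sub>R b)))\<^sup>2) has_real_derivative 2 * (\<phi> x \<bullet> ?D x)) (at 0)"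
      proof -
        have d: "((\<lambda>t. \<phi> (x + t *\<^sub>R b)) has_derivative (\<lambda>h. h *\<^sub>R ?D x)) (at 0)"
          using has_derivative_partial_line[OF test_functions_differentiable[OF \<phi>], of x b]
          by (simp add: has_vector_derivative_def)
        show ?thesis
          unfolding has_field_derivative_def power2_norm_eq_inner
          by (rule has_derivative_eq_rhs[OF has_derivative_inner[OF d d]]) (auto simp: inner_commute)
      qed
      have "((\<lambda>t. p (x \<bullet> b + t) * (cmod (\<phi> (x + t *\<^sub>R b)))\<^sup>2) has_real_derivative G x) (at 0)"
        using DERIV_mult[OF d1 d2] True by (simp add: G_def algebra_simps)
      then show ?thesis using True inv bb by (simp add: F_def inner_add_left)
    next
      case ge: False
      have "((\<lambda>t. 0) has_real_derivative 0) (at (0::real))" by simp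
      moreover have "open {- (r' - r)<..<r' - r}" "(0::real) \<in> {- (r' - r)<..<r' - r}" using r by auto
      moreover have "0 = F (x + t *\<^sub>R b)" if t: "t \<in> {- (r' - r)<..<r' - r}" for t
      proof -
        have "\<bar>(x + t *\<^sub>R b) \<bullet> b\<bar> \<ge> r" using ge t bb by (simp add: inner_add_left) linarith
        then show ?thesis using van[of "x + t *\<^sub>R b"] True inv by (simp add: F_def)
      qed
      ultimately have "((\<lambda>t. F (x + t *\<^sub>R b)) has_real_derivative 0) (at 0)"
        by (rule has_field_derivative_transform_within_open)
      moreover have "G x = 0" using zero[OF True] ge r by (simp add: G_def)
      ultimately show ?thesis by simp
    qed
  qed
  have Gm: "G \<in> borel_measurable borel" unfolding G_def by measurable
  have G0: "integral\<^sup>L lborel G = 0"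
    by (rule integral_directional_derivative[OF _ deriv Fi Gm Gb GR]) (use b in simp_all)
  have int_D: "integrable lborel (\<lambda>x. indicator A x * (cmod (?D x))\<^sup>2)"
    by (rule indicator_mult_compactly_supported_integrable[OF c2 A])
  show int_W: "integrable lborel (\<lambda>x. indicator A x * ((p' (x \<bullet> b) + (p (x \<bullet> b))\<^sup>2) * (cmod (\<phi> x))\<^sup>2))"
  proof (rule Bochner_Integration.integrable_bound)
    show "integrable lborel (\<lambda>x. (\<bar>P'\<bar> + P\<^sup>2) * (cmod (\<phi> x))\<^sup>2)" using compactly_supported_integrable[OF c1] by simp
    show "(\<lambda>x. indicator A x * ((p' (x \<bullet> b) + (p (x \<bullet> b))\<^sup>2) * (cmod (\<phi> x))\<^sup>2)) \<in> borel_measurable lborel" by measurable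
    show "AE x in lborel. norm (indicator A x * ((p' (x \<bullet> b) + (p (x \<bullet> b))\<^sup>2) * (cmod (\<phi> x))\<^sup>2)) \<le> norm ((\<bar>P'\<bar> + P\<^sup>2) * (cmod (\<phi> x))\<^sup>2)"
    proof (rule AE_I2)
      fix x
      show "norm (indicator A x * ((p' (x \<bullet> b) + (p (x \<bullet> b))\<^sup>2) * (cmod (\<phi> x))\<^sup>2)) \<le> norm ((\<bar>P'\<bar> + P\<^sup>2) * (cmod (\<phi> x))\<^sup>2)"
      proof (cases "x \<in> A \<and> \<bar>x \<bullet> b\<bar> \<le> r")
        case True
        have "(p (x \<bullet> b))\<^sup>2 \<le> P\<^sup>2" using P[of "x \<bullet> b"] True by (metis abs_le_square_iff abs_ge_self order_trans abs_of_nonneg abs_ge_zero)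
        then have "\<bar>p' (x \<bullet> b) + (p (x \<bullet> b))\<^sup>2\<bar> \<le> \<bar>P'\<bar> + P\<^sup>2" using P'[of "x \<bullet> b"] True by (smt (verit) zero_le_power2)
        then show ?thesis using True by (auto simp: abs_mult intro!: mult_right_mono)
      next
        case False
        then show ?thesis using zero[of x] by (auto simp: indicator_def)
      qed
    qed
  qed
  have int_G: "integrable lborel G"
  proof (rule Bochner_Integration.integrable_bound)
    show "integrable lborel (\<lambda>x. (\<bar>P'\<bar> * M\<^sup>2 + \<bar>P\<bar> * (2 * (M * M'))) * indicator (cball (0::'a) R) x)"
      using emeasure_bounded_finite[OF bounded_cball[of "0::'a" R]]
      by (intro integrable_mult_right integrable_real_indicator) auto
    show "AE x in lborel. norm (G x) \<le> norm ((\<bar>P'\<bar> * M\<^sup>2 + \<bar>P\<bar> * (2 * (M * M'))) * indicator (cball 0 R) x)"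
    proof (rule AE_I2)
      fix x show "norm (G x) \<le> norm ((\<bar>P'\<bar> * M\<^sup>2 + \<bar>P\<bar> * (2 * (M * M'))) * indicator (cball 0 R) x)"
      proof (cases "norm x \<le> R")
        case True
        have "\<bar>G x\<bar> \<le> \<bar>\<bar>P'\<bar> * M\<^sup>2 + \<bar>P\<bar> * (2 * (M * M'))\<bar>" using Gb[of x] abs_ge_self order_trans by blast
        then show ?thesis using True by simp
      next
        case False then show ?thesis using GR[of x] by simp
      qed
    qed
  qed (use Gm in simp)
  have pt: "G x - indicator A x * ((p' (x \<bullet> b) + (p (x \<bullet> b))\<^sup>2) * (cmod (\<phi> x))\<^sup>2) \<le> indicator A x * (cmod (?D x))\<^sup>2" for x
  proof (cases "x \<in> A")
    case True
    let ?p = "p (x \<bullet> b)"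
    have "0 \<le> (cmod (?D x - ?p *\<^sub>R \<phi> x))\<^sup>2" by simp
    also have "\<dots> = (cmod (?D x))\<^sup>2 - 2 * (?p * (\<phi> x \<bullet> ?D x)) + ?p\<^sup>2 * (cmod (\<phi> x))\<^sup>2"
      unfolding power2_norm_eq_inner
      by (simp add: inner_diff_left inner_diff_right inner_commute[of "?D x" "\<phi> x"] power2_eq_square algebra_simps)
    finally show ?thesis using True by (simp add: G_def algebra_simps)
  qed (simp add: G_def)
  have "integral\<^sup>L lborel G - (LINT x|lborel. indicator A x * ((p' (x \<bullet> b) + (p (x \<bullet> b))\<^sup>2) * (cmod (\<phi> x))\<^sup>2))
     = (LINT x|lborel. G x - indicator A x * ((p' (x \<bullet> b) + (p (x \<bullet> b))\<^sup>2) * (cmod (\<phi> x))\<^sup>2))"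
    using int_G int_W by simp
  also have "\<dots> \<le> (LINT x|lborel. indicator A x * (cmod (?D x))\<^sup>2)"
    using int_G int_W int_D pt by (intro integral_mono) auto
  finally show "- (LINT x|lborel. indicator A x * ((p' (x \<bullet> b) + (p (x \<bullet> b))\<^sup>2) * (cmod (\<phi> x))\<^sup>2))
      \<le> (LINT x|lborel. indicator A x * (cmod (?D x))\<^sup>2)" using G0 by simp
qed

text \<open>The function is the logarithmic derivative of cos (\<kappa> t), and the formula is its
  Riccati equation p' + p^2 = -\<kappa>^2, which makes the weight in
  \<open>picone_inequality\<close> constant.\<close>

lemma neg_tan_derivative:
  assumes "cos (\<kappa> * t) \<noteq> (0::real)"
  shows "((\<lambda>t. - \<kappa> * sin (\<kappa> * t) / cos (\<kappa> * t)) has_real_derivative (- \<kappa>\<^sup>2 - (- \<kappa> * sin (\<kappa> * t) / cos (\<kappa> * t))\<^sup>2)) (at t)"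
proof -
  have s: "((\<lambda>t. - \<kappa> * sin (\<kappa> * t)) has_real_derivative - \<kappa> * (cos (\<kappa> * t) * \<kappa>)) (at t)"
    by (auto intro!: derivative_eq_intros)
  have c: "((\<lambda>t. cos (\<kappa> * t)) has_real_derivative - sin (\<kappa> * t) * \<kappa>) (at t)"
    by (auto intro!: derivative_eq_intros)
  note DERIV_divide[OF s c assms]
  moreover have "((- \<kappa> * (cos (\<kappa> * t) * \<kappa>)) * cos (\<kappa> * t) - (- \<kappa> * sin (\<kappa> * t)) * (- sin (\<kappa> * t) * \<kappa>)) / (cos (\<kappa> * t) * cos (\<kappa> * t))
     = - \<kappa>\<^sup>2 - (- \<kappa> * sin (\<kappa> * t) / cos (\<kappa> * t))\<^sup>2"
    using assms by (simp add: field_simps power2_eq_square)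
  ultimately show ?thesis by simp
qed

lemma cos_pos_scaled:
  assumes "0 < \<kappa>" "\<bar>t\<bar> < pi / (2 * \<kappa>)"
  shows "cos (\<kappa> * t) > (0::real)"
proof (rule cos_gt_zero_pi)
  have "\<kappa> * \<bar>t\<bar> < pi / 2" using assms by (simp add: field_simps)
  then have "\<bar>\<kappa> * t\<bar> < pi / 2" using assms(1) by (simp add: abs_mult)
  then show "- (pi / 2) < \<kappa> * t" "\<kappa> * t < pi / 2" by linarith+
qed

text \<open>The ground state cos (pi t / d) vanishes at the ends of the interval, where its
  logarithmic derivative has poles. For z < 1 the cosine with \<kappa>^2 = z (pi / d)^2 stays
  positive on a larger interval; the sharp constant follows as z tends to 1.\<close>

lemma dirichlet_poincare:
  fixes \<phi> :: "'a::euclidean_space \<Rightarrow> complex"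
  assumes \<phi>: "\<phi> \<in> test_functions UNIV" and b: "b \<in> Basis"
    and A: "A \<in> sets borel" and inv: "\<And>x t. x + t *\<^sub>R b \<in> A \<longleftrightarrow> x \<in> A"
    and van: "\<And>x. x \<in> A \<Longrightarrow> \<bar>x \<bullet> b\<bar> \<ge> d / 2 \<Longrightarrow> \<phi> x = 0" and d: "0 < d"
  shows "(pi / d)\<^sup>2 * (LINT x|lborel. indicator A x * (cmod (\<phi> x))\<^sup>2)
      \<le> (LINT x|lborel. indicator A x * (cmod (partial_deriv b \<phi> x))\<^sup>2)"
proof (rule field_le_mult_one_interval)
  fix z :: real assume z: "0 < z" "z < 1"
  define \<kappa> where "\<kappa> = sqrt z * (pi / d)"
  have \<kappa>: "0 < \<kappa>" "\<kappa>\<^sup>2 = z * (pi / d)\<^sup>2" using z d unfolding \<kappa>_def power_mult_distrib by simp_all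
  have r: "d / 2 < pi / (2 * \<kappa>)"
  proof -
    have "sqrt z < 1" using z by simp
    then have "\<kappa> < pi / d" using d by (simp add: \<kappa>_def divide_strict_right_mono)
    then show ?thesis using \<kappa>(1) d by (simp add: field_simps)
  qed
  define p where "p t = - \<kappa> * sin (\<kappa> * t) / cos (\<kappa> * t)" for t
  define p' where "p' t = - \<kappa>\<^sup>2 - (p t)\<^sup>2" for t
  have cospos: "cos (\<kappa> * t) > 0" if "\<bar>t\<bar> < pi / (2 * \<kappa>)" for t using cos_pos_scaled[OF \<kappa>(1) that] .
  have pd: "(p has_real_derivative p' t) (at t)" if "\<bar>t\<bar> < pi / (2 * \<kappa>)" for t
    using neg_tan_derivative[of \<kappa> t] cospos[OF that] unfolding p_def p'_def by simp
  have pm: "p \<in> borel_measurable borel" unfolding p_def by measurable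
  then have pm': "p' \<in> borel_measurable borel" unfolding p'_def by measurable
  have "continuous_on {- (pi / (2 * \<kappa>))<..<pi / (2 * \<kappa>)} p"
    by (intro continuous_at_imp_continuous_on ballI DERIV_isCont[OF pd]) (auto simp: abs_less_iff)
  then have pc: "continuous_on {- (pi / (2 * \<kappa>))<..<pi / (2 * \<kappa>)} p'" unfolding p'_def by (intro continuous_intros)
  have "- (LINT x|lborel. indicator A x * ((p' (x \<bullet> b) + (p (x \<bullet> b))\<^sup>2) * (cmod (\<phi> x))\<^sup>2))
      \<le> (LINT x|lborel. indicator A x * (cmod (partial_deriv b \<phi> x))\<^sup>2)"
    by (rule picone_inequality(1)[OF \<phi> b A inv van r pd pc pm pm'])
  also have "(\<lambda>x. indicator A x * ((p' (x \<bullet> b) + (p (x \<bullet> b))\<^sup>2) * (cmod (\<phi> x))\<^sup>2)) = (\<lambda>x. - \<kappa>\<^sup>2 * (indicator A x * (cmod (\<phi> x))\<^sup>2))"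
    by (simp add: p'_def mult_ac)
  finally show "z * ((pi / d)\<^sup>2 * (LINT x|lborel. indicator A x * (cmod (\<phi> x))\<^sup>2))
      \<le> (LINT x|lborel. indicator A x * (cmod (partial_deriv b \<phi> x))\<^sup>2)"
    by (simp add: \<kappa>(2) mult.assoc)
qed

text \<open>The weight \<open>p t = - t / (1 + t\<^sup>2)\<close> in the Picone inequality transfers control from outside the
  slab \<open>\<bar>x \<bullet> b\<bar> \<le> 1/2\<close> into it.\<close>

lemma slab_inequality:
  fixes \<phi> :: "'a::euclidean_space \<Rightarrow> complex"
  assumes \<phi>: "\<phi> \<in> test_functions UNIV" and b: "b \<in> Basis"
  shows "8/25 * (LINT x|lborel. indicator {x. \<bar>x \<bullet> b\<bar> \<le> 1/2} x * (cmod (\<phi> x))\<^sup>2)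
      \<le> (LINT x|lborel. (cmod (partial_deriv b \<phi> x))\<^sup>2) + (LINT x|lborel. indicator {x. \<bar>x \<bullet> b\<bar> > 1/2} x * (cmod (\<phi> x))\<^sup>2)"
proof -
  \<comment> \<open>The logarithmic derivative of (1 + t^2) to the power -1/2, which is positive on
    the whole line and concave for t^2 \<le> 1/2.\<close>
  define p where "p t = - t / (1 + t\<^sup>2)" for t :: real
  define p' where "p' t = - (1 - t\<^sup>2) / (1 + t\<^sup>2)\<^sup>2" for t :: real
  have nz: "1 + t\<^sup>2 \<noteq> 0" for t :: real by (smt (verit) zero_le_power2)
  have pd: "(p has_real_derivative p' t) (at t)" for t
  proof -
    have s: "((\<lambda>t::real. - t) has_real_derivative - 1) (at t)" by (auto intro!: derivative_eq_intros)
    have c: "((\<lambda>t::real. 1 + t\<^sup>2) has_real_derivative 2 * t) (at t)" by (auto intro!: derivative_eq_intros)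
    note DERIV_divide[OF s c nz]
    moreover have "((- 1) * (1 + t\<^sup>2) - (- t) * (2 * t)) / ((1 + t\<^sup>2) * (1 + t\<^sup>2)) = - (1 - t\<^sup>2) / (1 + t\<^sup>2)\<^sup>2"
      by (simp add: power2_eq_square)
    ultimately show ?thesis by (simp add: p_def[abs_def] p'_def)
  qed
  have w: "- (p' t + (p t)\<^sup>2) = (1 - 2 * t\<^sup>2) / (1 + t\<^sup>2)\<^sup>2" for t
    using nz[of t] by (simp add: p_def p'_def power_divide field_simps)
  \<comment> \<open>The constant is the value of the weight at |t| = 1/2, namely (1/2) /
    (25/16).\<close>
  have w1: "- (p' t + (p t)\<^sup>2) \<ge> 8/25" if "\<bar>t\<bar> \<le> 1/2" for t
  proof -
    have t: "t\<^sup>2 \<le> 1/4" using power_mono[OF that, of 2] by (simp add: power2_eq_square)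
    have "8/25 * (1 + t\<^sup>2)\<^sup>2 \<le> 8/25 * (5/4)\<^sup>2" using t by (intro mult_left_mono power_mono) auto
    also have "\<dots> \<le> 1 - 2 * t\<^sup>2" using t by (simp add: power2_eq_square)
    finally show ?thesis unfolding w using nz[of t] by (simp add: pos_le_divide_eq)
  qed
  have w2: "- (p' t + (p t)\<^sup>2) \<ge> -1" for t
  proof -
    have "0 \<le> (t\<^sup>2)\<^sup>2" by simp
    moreover have "(1 + t\<^sup>2)\<^sup>2 = 1 + 2 * t\<^sup>2 + (t\<^sup>2)\<^sup>2" by (simp add: power2_sum)
    ultimately have "-1 * (1 + t\<^sup>2)\<^sup>2 \<le> 1 - 2 * t\<^sup>2" by linarith
    moreover have pos: "0 < (1 + t\<^sup>2)\<^sup>2" using nz[of t] by simp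
    ultimately show ?thesis unfolding w by (simp only: pos_le_divide_eq[OF pos])
  qed
  obtain R where R: "\<And>x. norm x > R \<Longrightarrow> \<phi> x = 0"
    using compactly_supported_bounds[OF test_functions_compactly_supported[OF \<phi>]] by metis
  have van: "\<phi> x = 0" if "\<bar>x \<bullet> b\<bar> \<ge> R + 1" for x
    using R[of x] that Basis_le_norm[OF b, of x] by linarith
  have pm: "p \<in> borel_measurable borel" "p' \<in> borel_measurable borel" unfolding p_def p'_def by measurable
  have pc: "continuous_on S p'" for S unfolding p'_def using nz by (auto intro!: continuous_intros)
  have "- (LINT x|lborel. indicator UNIV x * ((p' (x \<bullet> b) + (p (x \<bullet> b))\<^sup>2) * (cmod (\<phi> x))\<^sup>2))
      \<le> (LINT x|lborel. indicator UNIV x * (cmod (partial_deriv b \<phi> x))\<^sup>2)"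
    by (rule picone_inequality(1)[OF \<phi> b _ _ van, where r' = "R + 2"]) (use pd pc pm in auto)
  then have main: "(LINT x|lborel. - ((p' (x \<bullet> b) + (p (x \<bullet> b))\<^sup>2) * (cmod (\<phi> x))\<^sup>2)) \<le> (LINT x|lborel. (cmod (partial_deriv b \<phi> x))\<^sup>2)"
    by simp
  have "integrable lborel (\<lambda>x. indicator UNIV x * ((p' (x \<bullet> b) + (p (x \<bullet> b))\<^sup>2) * (cmod (\<phi> x))\<^sup>2))"
    by (rule picone_inequality(2)[OF \<phi> b _ _ van, where r' = "R + 2"]) (use pd pc pm in auto)
  then have i: "integrable lborel (\<lambda>x. - ((p' (x \<bullet> b) + (p (x \<bullet> b))\<^sup>2) * (cmod (\<phi> x))\<^sup>2))" by simp
  have c: "compactly_supported UNIV (\<lambda>x. (cmod (\<phi> x))\<^sup>2)"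
    by (intro compactly_supported_norm_sq test_functions_compactly_supported \<phi>)
  have i1: "integrable lborel (\<lambda>x. indicator {x. \<bar>x \<bullet> b\<bar> \<le> 1/2} x * (cmod (\<phi> x))\<^sup>2)"
    by (rule indicator_mult_compactly_supported_integrable[OF c]) measurable
  have i2: "integrable lborel (\<lambda>x. indicator {x. \<bar>x \<bullet> b\<bar> > 1/2} x * (cmod (\<phi> x))\<^sup>2)"
    by (rule indicator_mult_compactly_supported_integrable[OF c]) measurable
  have "8/25 * (LINT x|lborel. indicator {x. \<bar>x \<bullet> b\<bar> \<le> 1/2} x * (cmod (\<phi> x))\<^sup>2) - (LINT x|lborel. indicator {x. \<bar>x \<bullet> b\<bar> > 1/2} x * (cmod (\<phi> x))\<^sup>2)
     = (LINT x|lborel. 8/25 * (indicator {x. \<bar>x \<bullet> b\<bar> \<le> 1/2} x * (cmod (\<phi> x))\<^sup>2) - indicator {x. \<bar>x \<bullet> b\<bar> > 1/2} x * (cmod (\<phi> x))\<^sup>2)"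
    using i1 i2 by simp
  also have "\<dots> \<le> (LINT x|lborel. - ((p' (x \<bullet> b) + (p (x \<bullet> b))\<^sup>2) * (cmod (\<phi> x))\<^sup>2))"
  proof (rule integral_mono)
    fix x
    show "8/25 * (indicator {x. \<bar>x \<bullet> b\<bar> \<le> 1/2} x * (cmod (\<phi> x))\<^sup>2) - indicator {x. \<bar>x \<bullet> b\<bar> > 1/2} x * (cmod (\<phi> x))\<^sup>2
      \<le> - ((p' (x \<bullet> b) + (p (x \<bullet> b))\<^sup>2) * (cmod (\<phi> x))\<^sup>2)"
    proof (cases "\<bar>x \<bullet> b\<bar> \<le> 1/2")
      case True
      have "8/25 * (cmod (\<phi> x))\<^sup>2 \<le> - ((p' (x \<bullet> b) + (p (x \<bullet> b))\<^sup>2) * (cmod (\<phi> x))\<^sup>2)"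
        using mult_right_mono[OF w1[OF True], of "(cmod (\<phi> x))\<^sup>2"] by (simp only: mult_minus_left zero_le_power2)
      then show ?thesis using True by simp
    next
      case False
      have "- 1 * (cmod (\<phi> x))\<^sup>2 \<le> - ((p' (x \<bullet> b) + (p (x \<bullet> b))\<^sup>2) * (cmod (\<phi> x))\<^sup>2)"
        using mult_right_mono[OF w2[of "x \<bullet> b"], of "(cmod (\<phi> x))\<^sup>2"] by (simp only: mult_minus_left zero_le_power2)
      then show ?thesis using False by simp
    qed
  qed (use i i1 i2 in auto)
  finally show ?thesis using main by linarith
qed

text \<open>The completed square of \<open>dirichlet_poincare\<close> in one variable, with the
  tangent centred at the midpoint c. It serves for functions that are merely C^1 on a closed
  interval, such as the primitive of a mean-zero function.\<close>

lemma wirtinger_dirichlet: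
  fixes F F' :: "real \<Rightarrow> real"
  assumes pq: "p < q" and F: "\<And>x. x \<in> {p..q} \<Longrightarrow> (F has_real_derivative F' x) (at x within {p..q})"
    and F'c: "continuous_on {p..q} F'" and bd: "F p = 0" "F q = 0"
  shows "(pi / (q - p))\<^sup>2 * integral {p..q} (\<lambda>x. (F x)\<^sup>2) \<le> integral {p..q} (\<lambda>x. (F' x)\<^sup>2)"
proof (rule field_le_mult_one_interval)
  fix z :: real assume z: "0 < z" "z < 1"
  define c where "c = (p + q) / 2"
  define d where "d = q - p"
  have d: "d > 0" using pq by (simp add: d_def)
  define \<kappa> where "\<kappa> = sqrt z * (pi / d)"
  have \<kappa>: "0 < \<kappa>" "\<kappa>\<^sup>2 = z * (pi / d)\<^sup>2" using z d unfolding \<kappa>_def power_mult_distrib by simp_all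
  have r: "d / 2 < pi / (2 * \<kappa>)"
  proof -
    have "sqrt z < 1" using z by simp
    then have "\<kappa> < pi / d" using d by (simp add: \<kappa>_def divide_strict_right_mono)
    then show ?thesis using \<kappa>(1) d by (simp add: field_simps)
  qed
  define P where "P t = - \<kappa> * sin (\<kappa> * t) / cos (\<kappa> * t)" for t
  have Pd: "((\<lambda>x. P (x - c)) has_real_derivative (- \<kappa>\<^sup>2 - (P (x - c))\<^sup>2)) (at x within {p..q})" if x: "x \<in> {p..q}" for x
  proof -
    have "\<bar>x - c\<bar> \<le> d / 2" using x by (auto simp: c_def d_def abs_le_iff field_simps)
    then have "cos (\<kappa> * (x - c)) > 0" using cos_pos_scaled[OF \<kappa>(1), of "x - c"] r by simp
    then have "(P has_real_derivative (- \<kappa>\<^sup>2 - (P (x - c))\<^sup>2)) (at (x - c))"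
      using neg_tan_derivative[of \<kappa> "x - c"] unfolding P_def by simp
    then have "((\<lambda>x. P (x + - c)) has_real_derivative (- \<kappa>\<^sup>2 - (P (x - c))\<^sup>2)) (at x)"
      using DERIV_shift[of P _ x "- c"] by simp
    then have "((\<lambda>x. P (x - c)) has_real_derivative (- \<kappa>\<^sup>2 - (P (x - c))\<^sup>2)) (at x)" by simp
    then show ?thesis by (rule has_field_derivative_at_within)
  qed
  define G where "G x = (- \<kappa>\<^sup>2 - (P (x - c))\<^sup>2) * (F x)\<^sup>2 + P (x - c) * (2 * F x * F' x)" for x
  have "((\<lambda>x. P (x - c) * (F x)\<^sup>2) has_real_derivative G x) (at x within {p..q})" if x: "x \<in> {p..q}" for x
    unfolding G_def by (rule derivative_eq_intros Pd[OF x] F[OF x] refl | simp)+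
  then have "(G has_integral (P (q - c) * (F q)\<^sup>2 - P (p - c) * (F p)\<^sup>2)) {p..q}"
    using pq by (intro fundamental_theorem_of_calculus) (auto simp: has_real_derivative_iff_has_vector_derivative)
  then have G0: "(G has_integral 0) {p..q}" using bd by simp
  have Fc: "continuous_on {p..q} F" by (rule DERIV_continuous_on[OF F])
  have i1: "((\<lambda>x. (F x)\<^sup>2) has_integral integral {p..q} (\<lambda>x. (F x)\<^sup>2)) {p..q}"
    by (intro integrable_integral integrable_continuous_real continuous_intros Fc)
  have i2: "((\<lambda>x. (F' x)\<^sup>2) has_integral integral {p..q} (\<lambda>x. (F' x)\<^sup>2)) {p..q}"
    by (intro integrable_integral integrable_continuous_real continuous_intros F'c)
  have "0 + \<kappa>\<^sup>2 * integral {p..q} (\<lambda>x. (F x)\<^sup>2) \<le> integral {p..q} (\<lambda>x. (F' x)\<^sup>2)"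
  proof (rule has_integral_le[OF has_integral_add[OF G0 has_integral_mult_right[OF i1]] i2])
    fix x assume "x \<in> {p..q}"
    have "0 \<le> (F' x - P (x - c) * F x)\<^sup>2" by simp
    then show "G x + \<kappa>\<^sup>2 * (F x)\<^sup>2 \<le> (F' x)\<^sup>2" by (simp add: G_def power2_eq_square algebra_simps)
  qed
  then show "z * ((pi / (q - p))\<^sup>2 * integral {p..q} (\<lambda>x. (F x)\<^sup>2)) \<le> integral {p..q} (\<lambda>x. (F' x)\<^sup>2)"
    by (simp add: \<kappa>(2) d_def mult.assoc)
qed

text \<open>A primitive of a mean-zero function vanishes at both ends, which turns the Dirichlet inequality
  into the Neumann one with the same constant.\<close>

lemma wirtinger_neumann_real:
  fixes f f' :: "real \<Rightarrow> real"
  assumes pq: "p < q" and f: "\<And>x. x \<in> {p..q} \<Longrightarrow> (f has_real_derivative f' x) (at x within {p..q})"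
    and f'c: "continuous_on {p..q} f'"
  shows "(pi / (q - p))\<^sup>2 * ((q - p) * integral {p..q} (\<lambda>x. (f x)\<^sup>2) - (integral {p..q} f)\<^sup>2) \<le> (q - p) * integral {p..q} (\<lambda>x. (f' x)\<^sup>2)"
    "0 \<le> (q - p) * integral {p..q} (\<lambda>x. (f x)\<^sup>2) - (integral {p..q} f)\<^sup>2"
proof -
  define d where "d = q - p"
  have d: "d > 0" using pq by (simp add: d_def)
  define c where "c = (pi / d)\<^sup>2"
  have c: "c > 0" using d by (simp add: c_def)
  have fc: "continuous_on {p..q} f" by (rule DERIV_continuous_on[OF f])
  have fi: "(f has_integral integral {p..q} f) {p..q}" by (intro integrable_integral integrable_continuous_real fc)
  have ffi: "((\<lambda>x. (f x)\<^sup>2) has_integral integral {p..q} (\<lambda>x. (f x)\<^sup>2)) {p..q}"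
    by (intro integrable_integral integrable_continuous_real continuous_intros fc)
  define m where "m = integral {p..q} f / d"
  define h where "h x = f x - m" for x
  define X where "X = integral {p..q} (\<lambda>x. (h x)\<^sup>2)"
  define E where "E = integral {p..q} (\<lambda>x. (f' x)\<^sup>2)"
  have hc: "continuous_on {p..q} h" unfolding h_def by (intro continuous_intros fc)
  have hi: "(h has_integral 0) {p..q}"
  proof -
    have "((\<lambda>x. f x - m) has_integral (integral {p..q} f - (q - p) * m)) {p..q}"
      using has_integral_diff[OF fi has_integral_const_real[of m p q]] pq by simp
    then show ?thesis using d by (simp add: h_def[abs_def] m_def d_def)
  qed
  have X_eq: "X = integral {p..q} (\<lambda>x. (f x)\<^sup>2) - d * m\<^sup>2"
  proof -
    have "((\<lambda>x. (f x)\<^sup>2 + (-2 * m * f x + m\<^sup>2)) has_integral (integral {p..q} (\<lambda>x. (f x)\<^sup>2) + (-2 * m * integral {p..q} f + (q - p) * m\<^sup>2))) {p..q}"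
      using has_integral_add[OF ffi has_integral_add[OF has_integral_mult_right[OF fi, of "-2 * m"] has_integral_const_real[of "m\<^sup>2" p q]]] pq by simp
    moreover have "(\<lambda>x. (f x)\<^sup>2 + (-2 * m * f x + m\<^sup>2)) = (\<lambda>x. (h x)\<^sup>2)" by (auto simp: h_def power2_eq_square algebra_simps)
    ultimately have "X = integral {p..q} (\<lambda>x. (f x)\<^sup>2) + (-2 * m * integral {p..q} f + d * m\<^sup>2)"
      unfolding X_def d_def by (simp add: integral_unique)
    moreover have "integral {p..q} f = d * m" using d by (simp add: m_def)
    ultimately show ?thesis by (simp add: power2_eq_square algebra_simps)
  qed
  have dX: "d * X = d * integral {p..q} (\<lambda>x. (f x)\<^sup>2) - (integral {p..q} f)\<^sup>2"
    using d unfolding X_eq by (simp add: m_def power2_eq_square right_diff_distrib)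
  have X0: "0 \<le> X" unfolding X_def
    by (intro integral_nonneg integrable_continuous_real continuous_intros hc) simp
  define F where "F x = integral {p..x} h" for x
  have F: "(F has_real_derivative h x) (at x within {p..q})" if "x \<in> {p..q}" for x
    unfolding F_def[abs_def] using integral_has_real_derivative[OF hc that] .
  have Fc: "continuous_on {p..q} F" by (rule DERIV_continuous_on[OF F])
  have bd: "F p = 0" "F q = 0" using hi by (auto simp: F_def integral_unique)
  have W: "c * integral {p..q} (\<lambda>x. (F x)\<^sup>2) \<le> X"
    unfolding X_def c_def d_def by (rule wirtinger_dirichlet[OF pq F hc bd])
  have "((\<lambda>x. F x * h x) has_real_derivative (h x * h x + F x * f' x)) (at x within {p..q})" if x: "x \<in> {p..q}" for x
    using DERIV_mult[OF F[OF x] DERIV_diff[OF f[OF x] DERIV_const[of m]]] by (simp add: h_def mult_ac add.commute)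
  then have "((\<lambda>x. h x * h x + F x * f' x) has_integral (F q * h q - F p * h p)) {p..q}"
    using pq by (intro fundamental_theorem_of_calculus) (auto simp: has_real_derivative_iff_has_vector_derivative)
  then have I0: "((\<lambda>x. h x * h x + F x * f' x) has_integral 0) {p..q}" by (simp add: bd)
  have iF: "((\<lambda>x. (F x)\<^sup>2) has_integral integral {p..q} (\<lambda>x. (F x)\<^sup>2)) {p..q}"
    by (intro integrable_integral integrable_continuous_real continuous_intros Fc)
  have iE: "((\<lambda>x. (f' x)\<^sup>2) has_integral E) {p..q}" unfolding E_def
    by (intro integrable_integral integrable_continuous_real continuous_intros f'c)
  have iX: "((\<lambda>x. (h x)\<^sup>2) has_integral X) {p..q}" unfolding X_def
    by (intro integrable_integral integrable_continuous_real continuous_intros hc)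
  \<comment> \<open>As h is the derivative of F, integration by parts makes X minus the integral of
    F f'. Young's inequality with weight c splits this product so that the part with F is at most X
    / 2 by the Dirichlet inequality.\<close>
  have "X \<le> 0 + (c / 2 * integral {p..q} (\<lambda>x. (F x)\<^sup>2) + 1 / (2 * c) * E)"
  proof (rule has_integral_le[OF iX has_integral_add[OF I0 has_integral_add[OF has_integral_mult_right[OF iF] has_integral_mult_right[OF iE]]]])
    fix x assume "x \<in> {p..q}"
    have "0 \<le> (c * F x + f' x)\<^sup>2 / (2 * c)" using c by simp
    also have "\<dots> = F x * f' x + (c / 2 * (F x)\<^sup>2 + 1 / (2 * c) * (f' x)\<^sup>2)"
      using c by (simp add: power2_eq_square field_simps)
    finally show "(h x)\<^sup>2 \<le> h x * h x + F x * f' x + (c / 2 * (F x)\<^sup>2 + 1 / (2 * c) * (f' x)\<^sup>2)"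
      by (simp add: power2_eq_square)
  qed
  also have "\<dots> \<le> X / 2 + 1 / (2 * c) * E" using W by simp
  finally have "X \<le> E / c" using c by (simp add: field_simps)
  then have "c * X \<le> E" using c by (simp add: pos_le_divide_eq mult.commute)
  then have "c * (d * X) \<le> d * E" using d by (simp add: mult.left_commute)
  then show "(pi / (q - p))\<^sup>2 * ((q - p) * integral {p..q} (\<lambda>x. (f x)\<^sup>2) - (integral {p..q} f)\<^sup>2) \<le> (q - p) * integral {p..q} (\<lambda>x. (f' x)\<^sup>2)"
    unfolding dX by (simp add: c_def d_def E_def)
  show "0 \<le> (q - p) * integral {p..q} (\<lambda>x. (f x)\<^sup>2) - (integral {p..q} f)\<^sup>2"
    using mult_nonneg_nonneg[OF less_imp_le[OF d] X0] unfolding dX by (simp add: d_def)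
qed

section \<open>Neumann-Poincare inequalities on boxes\<close>

lemma cauchy_schwarz_integral_real:
  fixes u :: "real \<Rightarrow> real"
  assumes pq: "p < q" and uc: "continuous_on {p..q} u"
  shows "(integral {p..q} u)\<^sup>2 \<le> (q - p) * integral {p..q} (\<lambda>x. (u x)\<^sup>2)"
proof -
  define I where "I = integral {p..q} u"
  define J where "J = integral {p..q} (\<lambda>x. (u x)\<^sup>2)"
  have i: "(u has_integral I) {p..q}" unfolding I_def by (intro integrable_integral integrable_continuous_real uc)
  have j: "((\<lambda>x. (u x)\<^sup>2) has_integral J) {p..q}" unfolding J_def
    by (intro integrable_integral integrable_continuous_real continuous_intros uc)
  have "((\<lambda>x. (q - p) * (u x)\<^sup>2 + ((- 2 * I) * u x + I\<^sup>2 / (q - p))) has_integral ((q - p) * J + ((- 2 * I) * I + (q - p) * (I\<^sup>2 / (q - p))))) {p..q}"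
    using has_integral_add[OF has_integral_mult_right[OF j, of "q - p"]
        has_integral_add[OF has_integral_mult_right[OF i, of "- 2 * I"] has_integral_const_real[of "I\<^sup>2 / (q - p)" p q]]] pq by simp
  moreover have "0 \<le> (q - p) * (u x)\<^sup>2 + ((- 2 * I) * u x + I\<^sup>2 / (q - p))" for x
  proof -
    have "0 \<le> ((q - p) * u x - I)\<^sup>2 / (q - p)" using pq by simp
    also have "\<dots> = (q - p) * (u x)\<^sup>2 + ((- 2 * I) * u x + I\<^sup>2 / (q - p))"
      using pq by (simp add: power2_eq_square field_simps)
    finally show ?thesis .
  qed
  ultimately have "0 \<le> (q - p) * J + ((- 2 * I) * I + (q - p) * (I\<^sup>2 / (q - p)))"
    by (rule has_integral_nonneg)
  then show ?thesis unfolding I_def[symmetric] J_def[symmetric] using pq by (simp add: power2_eq_square)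
qed

lemma integral_Re_Im:
  fixes h :: "real \<Rightarrow> complex"
  assumes "continuous_on {p..q} h"
  shows "(cmod (integral {p..q} h))\<^sup>2 = (integral {p..q} (\<lambda>x. Re (h x)))\<^sup>2 + (integral {p..q} (\<lambda>x. Im (h x)))\<^sup>2"
    "integral {p..q} (\<lambda>x. (cmod (h x))\<^sup>2) = integral {p..q} (\<lambda>x. (Re (h x))\<^sup>2) + integral {p..q} (\<lambda>x. (Im (h x))\<^sup>2)"
proof -
  have i: "h integrable_on {p..q}" by (rule integrable_continuous_real[OF assms])
  show "(cmod (integral {p..q} h))\<^sup>2 = (integral {p..q} (\<lambda>x. Re (h x)))\<^sup>2 + (integral {p..q} (\<lambda>x. Im (h x)))\<^sup>2"
    using integral_linear[OF i bounded_linear_Re] integral_linear[OF i bounded_linear_Im] by (simp add: cmod_power2 o_def)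
  show "integral {p..q} (\<lambda>x. (cmod (h x))\<^sup>2) = integral {p..q} (\<lambda>x. (Re (h x))\<^sup>2) + integral {p..q} (\<lambda>x. (Im (h x))\<^sup>2)"
    unfolding cmod_power2
    by (intro Henstock_Kurzweil_Integration.integral_add integrable_continuous_real continuous_intros assms)
qed

lemma cauchy_schwarz_integral_complex:
  fixes h :: "real \<Rightarrow> complex"
  assumes pq: "p < q" and hc: "continuous_on {p..q} h"
  shows "(cmod (integral {p..q} h))\<^sup>2 \<le> (q - p) * integral {p..q} (\<lambda>x. (cmod (h x))\<^sup>2)"
  using cauchy_schwarz_integral_real[OF pq continuous_on_Re[OF hc]] cauchy_schwarz_integral_real[OF pq continuous_on_Im[OF hc]]
  unfolding integral_Re_Im[OF hc] distrib_left by linarith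

text \<open>The bracket on the left is the measure times the squared distance of f from its mean;
  carrying the measure along avoids a division. f and g are linked only by derivatives along
  coordinate lines, a class that is stable under integrating out one coordinate.\<close>

definition neumann_poincare :: "real \<Rightarrow> 'a::euclidean_space \<Rightarrow> 'a \<Rightarrow> bool" where
  "neumann_poincare c a b \<longleftrightarrow> (\<forall>(f :: 'a \<Rightarrow> complex) g. continuous_on UNIV f \<longrightarrow> (\<forall>i\<in>Basis. continuous_on UNIV (g i)) \<longrightarrow>
     (\<forall>i\<in>Basis. \<forall>x. ((\<lambda>t. f (x + t *\<^sub>R i)) has_vector_derivative g i x) (at 0)) \<longrightarrow>
     c * (measure lborel (cbox a b) * integral (cbox a b) (\<lambda>x. (cmod (f x))\<^sup>2) - (cmod (integral (cbox a b) f))\<^sup>2)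
       \<le> measure lborel (cbox a b) * (\<Sum>i\<in>Basis. integral (cbox a b) (\<lambda>x. (cmod (g i x))\<^sup>2)))"

lemma neumann_poincare_real:
  assumes pq: "p < q" and c: "c \<le> (pi / (q - p))\<^sup>2"
  shows "neumann_poincare c p q"
  unfolding neumann_poincare_def
proof (intro allI impI)
  fix f :: "real \<Rightarrow> complex" and g :: "real \<Rightarrow> real \<Rightarrow> complex"
  assume fc: "continuous_on UNIV f" and gc: "\<forall>i\<in>Basis. continuous_on UNIV (g i)"
    and d: "\<forall>i\<in>Basis. \<forall>x. ((\<lambda>t. f (x + t *\<^sub>R i)) has_vector_derivative g i x) (at 0)"
  have fc': "continuous_on {p..q} f" and gc': "continuous_on {p..q} (g 1)"
    using fc gc by (auto intro: continuous_on_subset)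
  have d1: "((\<lambda>t. f (x + t)) has_vector_derivative g 1 x) (at 0)" for x using d by simp
  have R: "((\<lambda>x. Re (f x)) has_real_derivative Re (g 1 x)) (at x within {p..q})" for x
  proof -
    have "((\<lambda>t. Re (f (t + x))) has_real_derivative Re (g 1 x)) (at 0)"
      using bounded_linear.has_vector_derivative[OF bounded_linear_Re d1[of x]]
      by (simp add: has_real_derivative_iff_has_vector_derivative add.commute)
    then show ?thesis using DERIV_shift[of "\<lambda>x. Re (f x)" "Re (g 1 x)" 0 x] by (simp add: has_field_derivative_at_within)
  qed
  have I: "((\<lambda>x. Im (f x)) has_real_derivative Im (g 1 x)) (at x within {p..q})" for x
  proof -
    have "((\<lambda>t. Im (f (t + x))) has_real_derivative Im (g 1 x)) (at 0)"
      using bounded_linear.has_vector_derivative[OF bounded_linear_Im d1[of x]]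
      by (simp add: has_real_derivative_iff_has_vector_derivative add.commute)
    then show ?thesis using DERIV_shift[of "\<lambda>x. Im (f x)" "Im (g 1 x)" 0 x] by (simp add: has_field_derivative_at_within)
  qed
  let ?X = "(q - p) * integral {p..q} (\<lambda>x. (cmod (f x))\<^sup>2) - (cmod (integral {p..q} f))\<^sup>2"
  have "(pi / (q - p))\<^sup>2 * ?X \<le> (q - p) * integral {p..q} (\<lambda>x. (cmod (g 1 x))\<^sup>2)"
    using wirtinger_neumann_real(1)[OF pq R continuous_on_Re[OF gc']] wirtinger_neumann_real(1)[OF pq I continuous_on_Im[OF gc']]
    unfolding integral_Re_Im[OF fc'] integral_Re_Im[OF gc'] by (simp add: algebra_simps)
  \<comment> \<open>Lowering the constant is legitimate because ?X is nonnegative, by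
    Cauchy-Schwarz.\<close>
  moreover have "c * ?X \<le> (pi / (q - p))\<^sup>2 * ?X"
    using cauchy_schwarz_integral_complex[OF pq fc'] c by (intro mult_right_mono) auto
  ultimately have "c * ?X \<le> (q - p) * integral {p..q} (\<lambda>x. (cmod (g 1 x))\<^sup>2)" by linarith
  then show "c * (measure lborel (cbox p q) * integral (cbox p q) (\<lambda>x. (cmod (f x))\<^sup>2) - (cmod (integral (cbox p q) f))\<^sup>2)
       \<le> measure lborel (cbox p q) * (\<Sum>i\<in>Basis. integral (cbox p q) (\<lambda>x. (cmod (g i x))\<^sup>2))"
    using pq by simp
qed

lemma sum_Basis_prod:
  fixes f :: "'a::euclidean_space \<times> 'b::euclidean_space \<Rightarrow> 'c::comm_monoid_add"
  shows "sum f Basis = (\<Sum>i\<in>Basis. f (i, 0)) + (\<Sum>i\<in>Basis. f (0, i))"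
  unfolding Basis_prod_def
  by (subst sum.union_disjoint) (auto simp: sum.reindex inj_on_def)

text \<open>The variance on the product splits into the variances along the lines in the first
  coordinate and the variance of the line integrals m on the second factor. The former are
  controlled by the derivative along the lines, the latter by the remaining derivatives, so nothing
  of the constant is lost.\<close>

lemma neumann_poincare_prod:
  fixes a b :: "'a::euclidean_space"
  assumes NP: "neumann_poincare c a b" and pq: "p < q" and c: "0 \<le> c" "c \<le> (pi / (q - p))\<^sup>2"
  shows "neumann_poincare c (p, a) (q, b)"
  unfolding neumann_poincare_def
proof (intro allI impI)
  fix f :: "real \<times> 'a \<Rightarrow> complex" and g :: "real \<times> 'a \<Rightarrow> real \<times> 'a \<Rightarrow> complex"
  assume fc: "continuous_on UNIV f" and gc: "\<forall>i\<in>Basis. continuous_on UNIV (g i)"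
    and d: "\<forall>i\<in>Basis. \<forall>x. ((\<lambda>t. f (x + t *\<^sub>R i)) has_vector_derivative g i x) (at 0)"
  define w where "w = q - p"
  have w: "w > 0" using pq by (simp add: w_def)
  define C where "C = measure lborel (cbox a b)"
  have C0: "C \<ge> 0" by (simp add: C_def)
  have pair_cont: "continuous_on UNIV (\<lambda>x. h (x, y))" "continuous_on UNIV (\<lambda>y. h (x, y))"
    if "continuous_on UNIV h" for h :: "real \<times> 'a \<Rightarrow> 'c::topological_space" and x y
    by (rule continuous_on_compose2[OF that], auto intro!: continuous_intros)+
  have par: "continuous_on UNIV (\<lambda>y. integral (cbox p q) (\<lambda>x. h (x, y)))"
    if "continuous_on UNIV h" for h :: "real \<times> 'a \<Rightarrow> 'c::banach"
  proof (rule integral_continuous_on_param)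
    show "continuous_on (UNIV \<times> cbox p q) (\<lambda>(y, x). h (x, y))"
      unfolding split_beta by (rule continuous_on_compose2[OF that]) (auto intro!: continuous_intros)
  qed
  have fub: "integral (cbox (p, a) (q, b)) h = integral (cbox a b) (\<lambda>y. integral (cbox p q) (\<lambda>x. h (x, y)))"
    if "continuous_on UNIV h" for h :: "real \<times> 'a \<Rightarrow> 'c::banach"
  proof -
    have "continuous_on (cbox (p, a) (q, b)) h" by (rule continuous_on_subset[OF that]) simp
    then show ?thesis using integral_swap_continuous[of p a q b "\<lambda>x y. h (x, y)"] integral_prod_continuous[of p a q b h] by simp
  qed
  have int: "h integrable_on cbox a b" if "continuous_on UNIV h" for h :: "'a \<Rightarrow> real"
    by (intro integrable_continuous continuous_on_subset[OF that]) simp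
  define m where "m y = integral (cbox p q) (\<lambda>x. f (x, y))" for y
  define gm where "gm i y = integral (cbox p q) (\<lambda>x. g (0, i) (x, y))" for i y
  have B1: "(1, 0) \<in> (Basis :: (real \<times> 'a) set)" and B2: "(0, i) \<in> (Basis :: (real \<times> 'a) set)" if "i \<in> Basis" for i
    using that by (auto simp: Basis_prod_def)
  have B1': "(1, 0) \<in> (Basis :: (real \<times> 'a) set)" by (auto simp: Basis_prod_def)
  have mc: "continuous_on UNIV m" unfolding m_def by (rule par[OF fc])
  have gmc: "continuous_on UNIV (gm i)" if "i \<in> Basis" for i
    unfolding gm_def using gc B2[OF that] by (intro par) auto
  have md: "((\<lambda>t. m (y + t *\<^sub>R i)) has_vector_derivative gm i y) (at 0)" if i: "i \<in> Basis" for i y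
  proof -
    have gci: "continuous_on UNIV (g (0, i))" using gc B2[OF i] by blast
    have "((\<lambda>t. integral (cbox p q) (\<lambda>x. f (x, y + t *\<^sub>R i))) has_vector_derivative
        integral (cbox p q) (\<lambda>x. g (0, i) (x, y + 0 *\<^sub>R i))) (at 0 within UNIV)"
    proof (rule leibniz_rule_vector_derivative[where fx = "\<lambda>t x. g (0, i) (x, y + t *\<^sub>R i)"])
      fix s x :: real
      have "((\<lambda>t. f ((x, y + s *\<^sub>R i) + t *\<^sub>R (0, i))) has_vector_derivative g (0, i) (x, y + s *\<^sub>R i)) (at (s - s))"
        using d[rule_format, OF B2[OF i], of "(x, y + s *\<^sub>R i)"] by simp
      then have "((\<lambda>t. f ((x, y + s *\<^sub>R i) + (t - s) *\<^sub>R (0, i))) has_vector_derivative 1 *\<^sub>R g (0, i) (x, y + s *\<^sub>R i)) (at s)"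
        by (intro vector_diff_chain_at[of "\<lambda>t. t - s" 1 s "\<lambda>t. f ((x, y + s *\<^sub>R i) + t *\<^sub>R (0, i))", unfolded o_def])
           (auto intro!: derivative_eq_intros)
      then show "((\<lambda>t. f (x, y + t *\<^sub>R i)) has_vector_derivative g (0, i) (x, y + s *\<^sub>R i)) (at s within UNIV)"
        by (simp add: algebra_simps)
    next
      show "(\<lambda>x. f (x, y + t *\<^sub>R i)) integrable_on cbox p q" for t
        by (intro integrable_continuous continuous_on_subset[OF pair_cont(1)[OF fc]]) simp
      show "continuous_on (UNIV \<times> cbox p q) (\<lambda>(t, x). g (0, i) (x, y + t *\<^sub>R i))"
        unfolding split_beta by (rule continuous_on_compose2[OF gci]) (auto intro!: continuous_intros)
    qed auto
    then show ?thesis by (simp add: m_def gm_def)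
  qed
  define I1 where "I1 = integral (cbox (p, a) (q, b)) (\<lambda>z. (cmod (f z))\<^sup>2)"
  define E1 where "E1 = integral (cbox (p, a) (q, b)) (\<lambda>z. (cmod (g (1, 0) z))\<^sup>2)"
  define E where "E i = integral (cbox (p, a) (q, b)) (\<lambda>z. (cmod (g (0, i) z))\<^sup>2)" for i
  define M2 where "M2 = integral (cbox a b) (\<lambda>y. (cmod (m y))\<^sup>2)"
  define K where "K = integral (cbox (p, a) (q, b)) f"
  have g1c: "continuous_on UNIV (g (1, 0))" using gc B1' by blast
  have f2c: "continuous_on UNIV (\<lambda>z. (cmod (f z))\<^sup>2)" by (intro continuous_intros fc)
  have g2c: "continuous_on UNIV (\<lambda>z. (cmod (g (1, 0) z))\<^sup>2)" by (intro continuous_intros g1c)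
  have m2c: "continuous_on UNIV (\<lambda>y. (cmod (m y))\<^sup>2)" by (intro continuous_intros mc)
  have line: "c * (w * integral (cbox p q) (\<lambda>x. (cmod (f (x, y)))\<^sup>2) - (cmod (m y))\<^sup>2)
      \<le> w * integral (cbox p q) (\<lambda>x. (cmod (g (1, 0) (x, y)))\<^sup>2)" for y
  proof -
    have "neumann_poincare c p q" by (rule neumann_poincare_real[OF pq c(2)])
    from this[unfolded neumann_poincare_def, rule_format, of "\<lambda>x. f (x, y)" "\<lambda>i x. g (1, 0) (x, y)"]
    moreover have "((\<lambda>t. f (x + t, y)) has_vector_derivative g (1, 0) (x, y)) (at 0)" for x
      using d[rule_format, OF B1', of "(x, y)"] by simp
    ultimately show ?thesis using pair_cont(1)[OF fc] pair_cont(1)[OF g1c] pq by (simp add: m_def w_def)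
  qed
  have L: "c * (w * I1 - M2) \<le> w * E1"
  proof -
    have "c * (w * I1 - M2) = integral (cbox a b) (\<lambda>y. c * (w * integral (cbox p q) (\<lambda>x. (cmod (f (x, y)))\<^sup>2) - (cmod (m y))\<^sup>2))"
      unfolding I1_def M2_def fub[OF f2c]
      by (rule integral_unique[OF has_integral_mult_right[OF has_integral_diff[OF
        has_integral_mult_right[OF integrable_integral[OF int[OF par[OF f2c]]], of w]
        integrable_integral[OF int[OF m2c]]], of c], symmetric])
    also have "\<dots> \<le> integral (cbox a b) (\<lambda>y. w * integral (cbox p q) (\<lambda>x. (cmod (g (1, 0) (x, y)))\<^sup>2))"
      by (intro integral_le int line continuous_intros par[OF f2c] par[OF g2c] mc)
    also have "\<dots> = w * E1" unfolding E1_def fub[OF g2c] by simp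
    finally show ?thesis .
  qed
  have S: "c * (C * M2 - (cmod K)\<^sup>2) \<le> C * (\<Sum>i\<in>Basis. integral (cbox a b) (\<lambda>y. (cmod (gm i y))\<^sup>2))"
    using NP[unfolded neumann_poincare_def, rule_format, of m gm] mc gmc md
    unfolding C_def M2_def K_def fub[OF fc] m_def[symmetric] by blast
  \<comment> \<open>The derivative of a line integral is the line integral of a derivative;
    Cauchy-Schwarz costs the length w, which is exactly the factor by which the measure of the
    product exceeds C.\<close>
  have G: "integral (cbox a b) (\<lambda>y. (cmod (gm i y))\<^sup>2) \<le> w * E i" if i: "i \<in> Basis" for i
  proof -
    have gci: "continuous_on UNIV (g (0, i))" using gc B2[OF i] by blast
    have g2ci: "continuous_on UNIV (\<lambda>z. (cmod (g (0, i) z))\<^sup>2)" by (intro continuous_intros gci)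
    have "integral (cbox a b) (\<lambda>y. (cmod (gm i y))\<^sup>2) \<le> integral (cbox a b) (\<lambda>y. w * integral (cbox p q) (\<lambda>x. (cmod (g (0, i) (x, y)))\<^sup>2))"
    proof (intro integral_le int continuous_intros par[OF g2ci] gmc[OF i])
      fix y
      have "continuous_on {p..q} (\<lambda>x. g (0, i) (x, y))" by (rule continuous_on_subset[OF pair_cont(1)[OF gci]]) simp
      from cauchy_schwarz_integral_complex[OF pq this]
      show "(cmod (gm i y))\<^sup>2 \<le> w * integral (cbox p q) (\<lambda>x. (cmod (g (0, i) (x, y)))\<^sup>2)" by (simp add: gm_def w_def)
    qed
    then show ?thesis unfolding E_def fub[OF g2ci] by simp
  qed
  have "c * (w * C * I1 - (cmod K)\<^sup>2) = C * (c * (w * I1 - M2)) + c * (C * M2 - (cmod K)\<^sup>2)"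
    by (simp add: algebra_simps)
  also have "\<dots> \<le> C * (w * E1) + C * (\<Sum>i\<in>Basis. w * E i)"
  proof -
    have "(\<Sum>i\<in>Basis. integral (cbox a b) (\<lambda>y. (cmod (gm i y))\<^sup>2)) \<le> (\<Sum>i\<in>Basis. w * E i)" by (rule sum_mono[OF G])
    from mult_left_mono[OF this C0] show ?thesis using S mult_left_mono[OF L C0] by linarith
  qed
  also have "\<dots> = w * C * (E1 + (\<Sum>i\<in>Basis. E i))" by (simp add: algebra_simps sum_distrib_left)
  finally have "c * (w * C * I1 - (cmod K)\<^sup>2) \<le> w * C * (E1 + (\<Sum>i\<in>Basis. E i))" .
  moreover have "measure lborel (cbox (p, a) (q, b)) = w * C" using pq by (simp add: content_Pair w_def C_def)
  ultimately show "c * (measure lborel (cbox (p, a) (q, b)) * integral (cbox (p, a) (q, b)) (\<lambda>x. (cmod (f x))\<^sup>2) - (cmod (integral (cbox (p, a) (q, b)) f))\<^sup>2)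
       \<le> measure lborel (cbox (p, a) (q, b)) * (\<Sum>i\<in>Basis. integral (cbox (p, a) (q, b)) (\<lambda>x. (cmod (g i x))\<^sup>2))"
  proof -
    have "(\<Sum>i\<in>Basis. integral (cbox (p, a) (q, b)) (\<lambda>x. (cmod (g i x))\<^sup>2)) = E1 + (\<Sum>i\<in>Basis. E i)"
      unfolding E1_def E_def
      using sum_Basis_prod[of "\<lambda>i. integral (cbox (p, a) (q, b)) (\<lambda>x. (cmod (g i x))\<^sup>2)"] by simp
    then show "c * (measure lborel (cbox (p, a) (q, b)) * integral (cbox (p, a) (q, b)) (\<lambda>x. (cmod (f x))\<^sup>2) - (cmod (integral (cbox (p, a) (q, b)) f))\<^sup>2)
       \<le> measure lborel (cbox (p, a) (q, b)) * (\<Sum>i\<in>Basis. integral (cbox (p, a) (q, b)) (\<lambda>x. (cmod (g i x))\<^sup>2))"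
      if "c * (w * C * I1 - (cmod K)\<^sup>2) \<le> w * C * (E1 + (\<Sum>i\<in>Basis. E i))"
        "measure lborel (cbox (p, a) (q, b)) = w * C"
      using that by (simp add: I1_def K_def)
  qed
qed

section \<open>Coordinate isomorphisms\<close>

text \<open>The types \<open>real^2\<close> and \<open>real^3\<close> are not products, while Fubini
  and the induction over boxes live on product types. A linear bijection that matches the standard
  bases carries integrals and partial derivatives over.\<close>

definition coord_iso :: "('b::euclidean_space \<Rightarrow> 'a::euclidean_space) \<Rightarrow> bool" where
  "coord_iso T \<longleftrightarrow> linear T \<and> bij_betw T Basis Basis"

lemma coord_iso_inner:
  fixes T :: "'b::euclidean_space \<Rightarrow> 'a::euclidean_space"
  assumes "coord_iso T" "i \<in> Basis"
  shows "T x \<bullet> T i = x \<bullet> i"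
proof -
  have T: "linear T" "bij_betw T Basis Basis" using assms by (auto simp: coord_iso_def)
  have "T x = (\<Sum>j\<in>Basis. (x \<bullet> j) *\<^sub>R T j)"
    by (subst euclidean_representation[of x, symmetric]) (simp add: linear_sum[OF T(1)] linear_cmul[OF T(1)])
  then have "T x \<bullet> T i = (\<Sum>j\<in>Basis. (x \<bullet> j) * (T j \<bullet> T i))" by (simp add: inner_sum_left)
  also have "\<dots> = (\<Sum>j\<in>Basis. if j = i then x \<bullet> i else 0)"
  proof (intro sum.cong refl)
    fix j :: 'b assume j: "j \<in> Basis"
    have "T j \<in> Basis" "T i \<in> Basis" "T j = T i \<longleftrightarrow> j = i"
      using T(2) j assms(2) by (auto simp: bij_betw_def inj_on_def)
    then show "(x \<bullet> j) * (T j \<bullet> T i) = (if j = i then x \<bullet> i else 0)" by (simp add: inner_Basis)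
  qed
  finally show ?thesis using assms(2) by simp
qed

lemma coord_iso_measurable: "coord_iso T \<Longrightarrow> T \<in> borel_measurable borel"
  unfolding coord_iso_def
  by (intro borel_measurable_continuous_onI linear_continuous_on) (simp add: linear_conv_bounded_linear)

text \<open>The preimage of a box is a box with the same side lengths in another order, and Lebesgue
  measure is determined by its values on boxes.\<close>

lemma coord_iso_lborel:
  fixes T :: "'b::euclidean_space \<Rightarrow> 'a::euclidean_space"
  assumes T: "coord_iso T"
  shows "distr lborel borel T = lborel"
proof (rule lborel_eqI[symmetric])
  have bij: "bij_betw T Basis Basis" using T by (simp add: coord_iso_def)
  have [measurable]: "T \<in> borel_measurable borel" by (rule coord_iso_measurable[OF T])
  fix l u :: 'a assume lu: "\<And>b. b \<in> Basis \<Longrightarrow> l \<bullet> b \<le> u \<bullet> b"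
  define pull :: "'a \<Rightarrow> 'b" where "pull x = (\<Sum>i\<in>Basis. (x \<bullet> T i) *\<^sub>R i)" for x
  have pull: "pull x \<bullet> i = x \<bullet> T i" if "i \<in> Basis" for x i
    using that by (simp add: pull_def inner_sum_left inner_Basis if_distrib[of "(*) _"] cong: if_cong)
  have "T -` box l u = box (pull l) (pull u)"
  proof -
    have "T x \<in> box l u \<longleftrightarrow> (\<forall>i\<in>Basis. l \<bullet> T i < T x \<bullet> T i \<and> T x \<bullet> T i < u \<bullet> T i)" for x
      using bij unfolding mem_box bij_betw_def by (metis image_iff)
    then show ?thesis using coord_iso_inner[OF T] pull by (auto simp: mem_box)
  qed
  then have "emeasure (distr lborel borel T) (box l u) = emeasure lborel (box (pull l) (pull u))"
    by (simp add: emeasure_distr)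
  also have "\<dots> = (\<Prod>i\<in>Basis. (pull u - pull l) \<bullet> i)"
  proof (rule emeasure_lborel_box)
    fix i :: 'b assume i: "i \<in> Basis"
    then have "T i \<in> Basis" using bij by (auto simp: bij_betw_def)
    then show "pull l \<bullet> i \<le> pull u \<bullet> i" using lu i by (simp add: pull)
  qed
  also have "(\<Prod>i\<in>Basis. (pull u - pull l) \<bullet> i) = (\<Prod>i\<in>Basis. (u - l) \<bullet> T i)"
    by (intro prod.cong) (auto simp: inner_diff_left pull)
  also have "\<dots> = (\<Prod>j\<in>Basis. (u - l) \<bullet> j)" by (rule prod.reindex_bij_betw[OF bij])
  finally show "emeasure (distr lborel borel T) (box l u) = ennreal (\<Prod>j\<in>Basis. (u - l) \<bullet> j)" .
qed simp

lemma coord_iso_integral: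
  fixes f :: "'a::euclidean_space \<Rightarrow> 'c::{banach, second_countable_topology}" and T :: "'b::euclidean_space \<Rightarrow> 'a"
  assumes "coord_iso T" "f \<in> borel_measurable borel"
  shows "integral\<^sup>L lborel f = (LINT x|lborel. f (T x))" "integrable lborel f \<longleftrightarrow> integrable lborel (\<lambda>x. f (T x))"
proof -
  have m: "T \<in> measurable lborel borel" using coord_iso_measurable[OF assms(1)] by simp
  show "integral\<^sup>L lborel f = (LINT x|lborel. f (T x))"
    using integral_distr[OF m assms(2)] unfolding coord_iso_lborel[OF assms(1)] .
  show "integrable lborel f \<longleftrightarrow> integrable lborel (\<lambda>x. f (T x))"
    using integrable_distr_eq[OF m assms(2)] unfolding coord_iso_lborel[OF assms(1)] .
qed

section \<open>Mass and energy restricted to a set\<close>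

definition mass_on :: "'a::euclidean_space set \<Rightarrow> ('a \<Rightarrow> complex) \<Rightarrow> real" where
  "mass_on S \<phi> = (LINT x|lborel. indicator S x * (cmod (\<phi> x))\<^sup>2)"

definition energy_on :: "'a::euclidean_space set \<Rightarrow> ('a \<Rightarrow> complex) \<Rightarrow> real" where
  "energy_on S \<phi> = (\<Sum>b\<in>Basis. mass_on S (partial_deriv b \<phi>))"

lemma mass_on_UNIV: "mass_on UNIV \<phi> = L2_mass \<phi>" "energy_on UNIV \<phi> = dirichlet_energy \<phi>"
  by (simp_all add: mass_on_def L2_mass_def energy_on_def dirichlet_energy_def)

lemma mass_on_integrable:
  assumes "\<phi> \<in> test_functions \<Omega>" "S \<in> sets borel"
  shows "integrable lborel (\<lambda>x. indicator S x * (cmod (\<phi> x))\<^sup>2)"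
  by (intro indicator_mult_compactly_supported_integrable[OF compactly_supported_norm_sq[OF test_functions_compactly_supported[OF assms(1)]] assms(2)])

lemma mass_on_nonneg: "0 \<le> mass_on S \<phi>"
  unfolding mass_on_def by (intro Bochner_Integration.integral_nonneg) auto

lemma energy_on_nonneg: "0 \<le> energy_on S \<phi>"
  unfolding energy_on_def by (intro sum_nonneg mass_on_nonneg)

text \<open>The indicators are compared almost everywhere and only where \<phi> does not vanish, so
  pieces count as disjoint if they overlap in a null set or outside the support.\<close>

lemma mass_on_add_le:
  assumes \<phi>: "\<phi> \<in> test_functions \<Omega>" and S: "S1 \<in> sets borel" "S2 \<in> sets borel" "S3 \<in> sets borel"
    and le: "AE x in lborel. \<phi> x \<noteq> 0 \<longrightarrow> indicator S1 x + indicator S2 x \<le> (indicator S3 x :: real)"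
  shows "mass_on S1 \<phi> + mass_on S2 \<phi> \<le> mass_on S3 \<phi>"
proof -
  note i = mass_on_integrable[OF \<phi>]
  have "mass_on S1 \<phi> + mass_on S2 \<phi> = (LINT x|lborel. indicator S1 x * (cmod (\<phi> x))\<^sup>2 + indicator S2 x * (cmod (\<phi> x))\<^sup>2)"
    using i[OF S(1)] i[OF S(2)] by (simp add: mass_on_def)
  also have "\<dots> \<le> mass_on S3 \<phi>" unfolding mass_on_def
  proof (rule integral_mono_AE)
    show "AE x in lborel. indicator S1 x * (cmod (\<phi> x))\<^sup>2 + indicator S2 x * (cmod (\<phi> x))\<^sup>2 \<le> indicator S3 x * (cmod (\<phi> x))\<^sup>2"
      using le
    proof eventually_elim
      fix x assume h: "\<phi> x \<noteq> 0 \<longrightarrow> indicator S1 x + indicator S2 x \<le> (indicator S3 x :: real)"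
      show "indicator S1 x * (cmod (\<phi> x))\<^sup>2 + indicator S2 x * (cmod (\<phi> x))\<^sup>2 \<le> indicator S3 x * (cmod (\<phi> x))\<^sup>2"
      proof (cases "\<phi> x = 0")
        case False
        then show ?thesis using mult_right_mono[of "indicator S1 x + indicator S2 x" "indicator S3 x" "(cmod (\<phi> x))\<^sup>2"] h
          by (simp add: distrib_right)
      qed simp
    qed
  qed (use i S in auto)
  finally show ?thesis .
qed

lemma mass_on_le_add:
  assumes \<phi>: "\<phi> \<in> test_functions \<Omega>" and S: "S1 \<in> sets borel" "S2 \<in> sets borel" "S3 \<in> sets borel"
    and le: "\<And>x. \<phi> x \<noteq> 0 \<Longrightarrow> x \<in> S3 \<Longrightarrow> x \<in> S1 \<union> S2"
  shows "mass_on S3 \<phi> \<le> mass_on S1 \<phi> + mass_on S2 \<phi>"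
proof -
  note i = mass_on_integrable[OF \<phi>]
  have "mass_on S3 \<phi> \<le> (LINT x|lborel. indicator S1 x * (cmod (\<phi> x))\<^sup>2 + indicator S2 x * (cmod (\<phi> x))\<^sup>2)"
    unfolding mass_on_def
  proof (rule integral_mono)
    show "indicator S3 x * (cmod (\<phi> x))\<^sup>2 \<le> indicator S1 x * (cmod (\<phi> x))\<^sup>2 + indicator S2 x * (cmod (\<phi> x))\<^sup>2" for x
      using le[of x] by (auto simp: indicator_def)
  qed (use i S in auto)
  also have "\<dots> = mass_on S1 \<phi> + mass_on S2 \<phi>" using i[OF S(1)] i[OF S(2)] by (simp add: mass_on_def)
  finally show ?thesis .
qed

lemma neumann_poincare_transfer:
  fixes T :: "'b::euclidean_space \<Rightarrow> 'a::euclidean_space" and \<phi> :: "'a \<Rightarrow> complex"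
  assumes T: "coord_iso T" and NP: "neumann_poincare c a b" and \<phi>: "\<phi> \<in> test_functions UNIV"
    and Q: "Q \<in> sets borel" "\<And>z. T z \<in> Q \<longleftrightarrow> z \<in> cbox a b"
  shows "c * (measure lborel (cbox a b) * mass_on Q \<phi> - (cmod (LINT x|lborel. \<phi> x * indicator Q x))\<^sup>2) \<le> measure lborel (cbox a b) * energy_on Q \<phi>"
proof -
  have lin: "linear T" and bij: "bij_betw T Basis Basis" using T by (auto simp: coord_iso_def)
  have Tc: "continuous_on UNIV T" using lin by (simp add: linear_continuous_on linear_conv_bounded_linear)
  have pull: "(LINT x|lborel. indicator Q x *\<^sub>R h x) = integral (cbox a b) (\<lambda>z. h (T z))"
    if h: "continuous_on UNIV h" for h :: "'a \<Rightarrow> 'c::euclidean_space"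
  proof -

    have hT: "continuous_on UNIV (\<lambda>z. h (T z))" by (rule continuous_on_compose2[OF h Tc]) simp
    have "(LINT x|lborel. indicator Q x *\<^sub>R h x) = (LINT z|lborel. indicator Q (T z) *\<^sub>R h (T z))"
      using Q(1) borel_measurable_continuous_onI[OF h] by (intro coord_iso_integral(1)[OF T]) simp
    also have "\<dots> = (LINT z:cbox a b|lborel. h (T z))"
      unfolding set_lebesgue_integral_def by (intro Bochner_Integration.integral_cong) (auto simp: indicator_def Q(2))
    also have "\<dots> = integral (cbox a b) (\<lambda>z. h (T z))"
    proof (rule set_borel_integral_eq_integral(2))
      show "set_integrable lborel (cbox a b) (\<lambda>z. h (T z))"
        unfolding set_integrable_def by (intro borel_integrable_compact continuous_on_subset[OF hT]) auto
    qed
    finally show ?thesis .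
  qed
  have \<phi>c: "continuous_on UNIV \<phi>" by (rule test_functions_continuous[OF \<phi>])
  have dc: "continuous_on UNIV (partial_deriv j \<phi>)" if "j \<in> Basis" for j
    by (rule test_functions_continuous[OF test_functions_partial_deriv[OF \<phi> that]])
  have TB: "T i \<in> Basis" if "i \<in> Basis" for i using bij that by (auto simp: bij_betw_def)
  have 1: "mass_on Q \<phi> = integral (cbox a b) (\<lambda>z. (cmod (\<phi> (T z)))\<^sup>2)"
    unfolding mass_on_def using pull[of "\<lambda>x. (cmod (\<phi> x))\<^sup>2"] by (simp add: continuous_intros \<phi>c)
  have 2: "(LINT x|lborel. \<phi> x * indicator Q x) = integral (cbox a b) (\<lambda>z. \<phi> (T z))"
  proof -
    have "(LINT x|lborel. \<phi> x * indicator Q x) = (LINT x|lborel. indicator Q x *\<^sub>R \<phi> x)"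
      by (intro Bochner_Integration.integral_cong) (auto simp: indicator_def)
    then show ?thesis using pull[OF \<phi>c] by simp
  qed
  have 3: "energy_on Q \<phi> = (\<Sum>i\<in>Basis. integral (cbox a b) (\<lambda>z. (cmod (partial_deriv (T i) \<phi> (T z)))\<^sup>2))"
  proof -
    have "energy_on Q \<phi> = (\<Sum>i\<in>Basis. mass_on Q (partial_deriv (T i) \<phi>))"
      unfolding energy_on_def by (rule sum.reindex_bij_betw[OF bij, symmetric])
    also have "\<dots> = (\<Sum>i\<in>Basis. integral (cbox a b) (\<lambda>z. (cmod (partial_deriv (T i) \<phi> (T z)))\<^sup>2))"
    proof (intro sum.cong refl)
      fix i :: 'b assume "i \<in> Basis"
      then have "continuous_on UNIV (\<lambda>x. (cmod (partial_deriv (T i) \<phi> x))\<^sup>2)" by (intro continuous_intros dc TB)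
      then show "mass_on Q (partial_deriv (T i) \<phi>) = integral (cbox a b) (\<lambda>z. (cmod (partial_deriv (T i) \<phi> (T z)))\<^sup>2)"
        unfolding mass_on_def using pull by fastforce
    qed
    finally show ?thesis .
  qed
  show ?thesis unfolding 1 2 3
  proof (rule NP[unfolded neumann_poincare_def, rule_format])
    show "continuous_on UNIV (\<lambda>z. \<phi> (T z))" by (rule continuous_on_compose2[OF \<phi>c Tc]) simp
    show "continuous_on UNIV (\<lambda>z. partial_deriv (T i) \<phi> (T z))" if "i \<in> Basis" for i
      by (rule continuous_on_compose2[OF dc[OF TB[OF that]] Tc]) simp
    show "((\<lambda>t. \<phi> (T (x + t *\<^sub>R i))) has_vector_derivative partial_deriv (T i) \<phi> (T x)) (at 0)" for i x
      using has_derivative_partial_line[OF test_functions_differentiable[OF \<phi>], of "T x" "T i"]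
      by (simp add: linear_add[OF lin] linear_cmul[OF lin])
  qed
qed

section \<open>Finitely many functionals\<close>

text \<open>The coefficient is real, so the conjugation in \<open>L2_inner\<close> leaves such a
  function unchanged, and the functional is the same integral over the whole space for every domain
  that contains the support of the test function.\<close>

definition is_box_fn :: "('a::euclidean_space \<Rightarrow> complex) \<Rightarrow> bool" where
  "is_box_fn f \<longleftrightarrow> (\<exists>\<alpha> a b. f = (\<lambda>x. of_real \<alpha> * indicator (cbox a b) x))"

lemma AE_lborel_not_in_negligible:
  assumes "negligible N"
  shows "AE x in lborel. x \<notin> N"
proof -
  have "AE x in lebesgue. x \<notin> N" using assms by (intro AE_not_in) (simp add: negligible_iff_null_sets)
  then show ?thesis by (simp add: AE_completion_iff)
qed

lemma mass_on_negligible: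
  assumes "negligible S" "S \<in> sets borel"
  shows "mass_on S \<phi> = 0"
proof -
  have "AE x in lborel. indicator S x * (cmod (\<phi> x))\<^sup>2 = 0"
    using AE_lborel_not_in_negligible[OF assms(1)] by eventually_elim simp
  then show ?thesis unfolding mass_on_def by (rule integral_eq_zero_AE)
qed

text \<open>On a small box the Neumann inequality costs one functional, the mean. In place of an
  explicit grid the bisection principle is used: the property passes to unions of sets with disjoint
  interiors and holds for all small boxes, hence for the large one.\<close>

lemma finite_functionals:
  fixes A B :: "'a::euclidean_space"
  assumes \<theta>: "\<theta> \<ge> 0" and \<delta>: "\<delta> > 0"
    and small: "\<And>(a::'a) b \<phi>. (\<And>i. i \<in> Basis \<Longrightarrow> a \<bullet> i < b \<bullet> i \<and> b \<bullet> i - a \<bullet> i \<le> \<delta>) \<Longrightarrow> \<phi> \<in> test_functions UNIV \<Longrightarrow>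
      \<theta> * (measure lborel (cbox a b) * mass_on (cbox a b) \<phi> - (cmod (LINT x|lborel. \<phi> x * indicator (cbox a b) x))\<^sup>2)
        \<le> measure lborel (cbox a b) * energy_on (cbox a b) \<phi>"
  shows "\<exists>fs. (\<forall>f\<in>set fs. is_box_fn f) \<and> (\<forall>\<phi>\<in>test_functions UNIV.
      \<theta> * mass_on (cbox A B) \<phi> \<le> energy_on (cbox A B) \<phi> + (\<Sum>f\<leftarrow>fs. (cmod (LINT x|lborel. \<phi> x * f x))\<^sup>2))"
proof -
  define Q where "Q S fs \<longleftrightarrow> (\<forall>f\<in>set fs. is_box_fn f) \<and> (\<forall>\<phi>\<in>test_functions UNIV.
      \<theta> * mass_on S \<phi> \<le> energy_on S \<phi> + (\<Sum>f\<leftarrow>fs. (cmod (LINT x|lborel. \<phi> x * f x))\<^sup>2))" for S :: "'a set" and fs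
  \<comment> \<open>Closedness and a null boundary make the overlap of two sets with disjoint
    interiors a null set.\<close>
  define P where "P S \<longleftrightarrow> closed S \<and> negligible (frontier S) \<and> (\<exists>fs. Q S fs)" for S
  have P0: "P {}" unfolding P_def
    by (auto simp: Q_def mass_on_def energy_on_def intro!: exI[of _ "[]"])
  have PUn: "P (S \<union> T)" if S: "P S" and T: "P T" and int: "interior S \<inter> interior T = {}" for S T
  proof -
    have cl: "closed S" "closed T" and b: "S \<in> sets borel" "T \<in> sets borel" and neg: "negligible (frontier S)" "negligible (frontier T)"
      using S T by (auto simp: P_def)
    obtain fs gs where fg: "Q S fs" "Q T gs" using S T by (auto simp: P_def)
    have "S \<inter> T \<subseteq> frontier S \<union> frontier T" using cl int by (auto simp: frontier_def)
    then have "negligible (S \<inter> T)" using neg negligible_Un negligible_subset by blast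
    note AE = AE_lborel_not_in_negligible[OF this]
    have add: "mass_on S \<psi> + mass_on T \<psi> \<le> mass_on (S \<union> T) \<psi>" if "\<psi> \<in> test_functions UNIV" for \<psi>
    proof (rule mass_on_add_le[OF that b])
      show "AE x in lborel. \<psi> x \<noteq> 0 \<longrightarrow> indicator S x + indicator T x \<le> (indicator (S \<union> T) x :: real)"
        using AE by eventually_elim (auto simp: indicator_def)
    qed (use b in auto)
    have "Q (S \<union> T) (fs @ gs)" unfolding Q_def
    proof (intro conjI ballI)
      fix \<phi> :: "'a \<Rightarrow> complex" assume \<phi>: "\<phi> \<in> test_functions UNIV"
      have "\<theta> * mass_on (S \<union> T) \<phi> \<le> \<theta> * (mass_on S \<phi> + mass_on T \<phi>)"
        by (intro mult_left_mono \<theta> mass_on_le_add[OF \<phi> b]) (use b in auto)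
      also have "\<dots> \<le> energy_on S \<phi> + (\<Sum>f\<leftarrow>fs. (cmod (LINT x|lborel. \<phi> x * f x))\<^sup>2) + (energy_on T \<phi> + (\<Sum>f\<leftarrow>gs. (cmod (LINT x|lborel. \<phi> x * f x))\<^sup>2))"
        using fg \<phi> by (auto simp: Q_def distrib_left intro!: add_mono)
      finally have "\<theta> * mass_on (S \<union> T) \<phi> \<le> energy_on S \<phi> + (\<Sum>f\<leftarrow>fs. (cmod (LINT x|lborel. \<phi> x * f x))\<^sup>2)
         + (energy_on T \<phi> + (\<Sum>f\<leftarrow>gs. (cmod (LINT x|lborel. \<phi> x * f x))\<^sup>2))" .
      moreover have "energy_on S \<phi> + energy_on T \<phi> \<le> energy_on (S \<union> T) \<phi>"
        unfolding energy_on_def sum.distrib[symmetric]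
        by (intro sum_mono add test_functions_partial_deriv[OF \<phi>])
      ultimately show "\<theta> * mass_on (S \<union> T) \<phi> \<le> energy_on (S \<union> T) \<phi> + (\<Sum>f\<leftarrow>fs @ gs. (cmod (LINT x|lborel. \<phi> x * f x))\<^sup>2)"
        by simp
    qed (use fg in \<open>auto simp: Q_def\<close>)
    moreover have "negligible (frontier (S \<union> T))"
      by (rule negligible_subset[OF negligible_Un[OF neg] frontier_Un_subset])
    ultimately show ?thesis using cl by (auto simp: P_def)
  qed
  have "P (cbox A B)"
  proof (rule ccontr)
    assume "\<not> P (cbox A B)"
    have "\<exists>x. \<forall>e>0. \<exists>c d. x \<in> cbox c d \<and> cbox c d \<subseteq> ball x e \<and> cbox c d \<subseteq> cbox A B \<and> \<not> P (cbox c d)"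
    proof (rule interval_bisection[of P A B])
      show "P {}" by (rule P0)
      show "P (S \<union> T)" if "P S" "P T" "interior S \<inter> interior T = {}" for S T by (rule PUn[OF that])
      show "\<not> P (cbox A B)" by fact
    qed (rule exI)
    then obtain x where
      x: "\<forall>e>0. \<exists>c d. x \<in> cbox c d \<and> cbox c d \<subseteq> ball x e \<and> cbox c d \<subseteq> cbox A B \<and> \<not> P (cbox c d)" ..
    obtain c d where cd: "x \<in> cbox c d" "cbox c d \<subseteq> ball x (\<delta>/2)" "\<not> P (cbox c d)"
      using x[rule_format, of "\<delta>/2"] \<delta> by auto
    have ne: "cbox c d \<noteq> {}" using cd(1) by auto
    then have le: "c \<bullet> i \<le> d \<bullet> i" if "i \<in> Basis" for i using that by (simp add: box_ne_empty)
    have cb: "closed (cbox c d)" "negligible (frontier (cbox c d))"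
      using negligible_frontier_interval[of c d] by (auto simp: frontier_cbox)
    have "\<exists>fs. Q (cbox c d) fs"
    proof (cases "\<forall>i\<in>Basis. c \<bullet> i < d \<bullet> i")
      case True
      have "c \<in> cbox c d" "d \<in> cbox c d" using ne le by (auto simp: mem_box)
      then have "c \<in> ball x (\<delta>/2)" "d \<in> ball x (\<delta>/2)" using cd(2) by blast+
      then have "dist c d < \<delta>" using dist_triangle_half_r[of x c \<delta> d] by (simp add: dist_commute)
      then have s: "d \<bullet> i - c \<bullet> i \<le> \<delta>" if "i \<in> Basis" for i
        using Basis_le_norm[OF that, of "d - c"] by (simp add: dist_norm norm_minus_commute inner_diff_left)
      define M where "M = measure lborel (cbox c d)"
      have M: "M > 0" using True unfolding M_def by (subst content_pos_lt_eq) auto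
      \<comment> \<open>The factor makes the squared functional equal to \<theta> / M times the
        squared integral, which is the term subtracted in the Neumann inequality after division by
        the measure M.\<close>
      define f :: "'a \<Rightarrow> complex" where "f = (\<lambda>x. of_real (sqrt (\<theta> / M)) * indicator (cbox c d) x)"
      have "Q (cbox c d) [f]" unfolding Q_def
      proof (intro conjI ballI)
        show "is_box_fn g" if "g \<in> set [f]" for g
          unfolding is_box_fn_def by (rule exI[of _ "sqrt (\<theta> / M)"]) (use that in \<open>auto simp: f_def\<close>)
        fix \<phi> :: "'a \<Rightarrow> complex" assume \<phi>: "\<phi> \<in> test_functions UNIV"
        let ?I = "LINT x|lborel. \<phi> x * indicator (cbox c d) x"
        have "(LINT x|lborel. \<phi> x * f x) = of_real (sqrt (\<theta> / M)) * ?I"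
          unfolding f_def mult.left_commute[of "\<phi> _"] by simp
        then have I: "(cmod (LINT x|lborel. \<phi> x * f x))\<^sup>2 = \<theta> / M * (cmod ?I)\<^sup>2"
          using \<theta> M by (simp add: norm_mult power_mult_distrib)
        have "\<theta> * (M * mass_on (cbox c d) \<phi> - (cmod ?I)\<^sup>2) \<le> M * energy_on (cbox c d) \<phi>"
          unfolding M_def by (rule small[OF _ \<phi>]) (use True s in blast)
        then have "M * (\<theta> * mass_on (cbox c d) \<phi>) \<le> M * (energy_on (cbox c d) \<phi> + \<theta> / M * (cmod ?I)\<^sup>2)"
          using M by (simp add: distrib_left right_diff_distrib mult.left_commute)
        then show "\<theta> * mass_on (cbox c d) \<phi> \<le> energy_on (cbox c d) \<phi> + (\<Sum>f\<leftarrow>[f]. (cmod (LINT x|lborel. \<phi> x * f x))\<^sup>2)"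
          using M I by (simp add: mult_le_cancel_left_pos)
      qed
      then show ?thesis by blast
    next
      \<comment> \<open>A box with empty interior is a null set, so the inequality is trivial and no
        functional is spent.\<close>
      case False
      then have "box c d = {}" by (force simp: box_eq_empty)
      then have "negligible (cbox c d)" using negligible_interval(1) by blast
      then have "mass_on (cbox c d) \<psi> = 0" for \<psi> by (intro mass_on_negligible) auto
      then have "Q (cbox c d) []" by (simp add: Q_def energy_on_def)
      then show ?thesis by blast
    qed
    then have "P (cbox c d)" using cb by (simp add: P_def)
    then show False using cd(3) by simp
  qed
  then show ?thesis unfolding P_def Q_def by blast
qed

lemma L2_inner_box_fn:
  assumes \<phi>: "\<phi> \<in> test_functions \<Omega>" and \<Omega>: "open \<Omega>" and f: "is_box_fn f"
  shows "L2_inner \<Omega> \<phi> f = (LINT x|lborel. \<phi> x * f x)" "f \<in> L2 \<Omega>"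
proof -
  obtain \<alpha> a b where fe: "f = (\<lambda>x. of_real \<alpha> * indicator (cbox a b) x)" using f by (auto simp: is_box_fn_def)
  have \<Omega>s: "\<Omega> \<in> sets lebesgue" using \<Omega> by simp
  show "f \<in> L2 \<Omega>" unfolding fe by (intro L2.scale_closed indicator_L2 \<Omega>s) simp
  have [measurable]: "\<phi> \<in> borel_measurable borel" using test_functions_continuous[OF \<phi>] by (rule borel_measurable_continuous_onI)
  have cf: "cnj (f x) = f x" for x by (simp add: fe indicator_def)
  have "L2_inner \<Omega> \<phi> f = (LINT x|lebesgue. indicator \<Omega> x *\<^sub>R (\<phi> x * f x))"
    unfolding L2_inner_def cf using \<Omega>s by (subst integral_restrict_space) auto
  also have "(\<lambda>x. indicator \<Omega> x *\<^sub>R (\<phi> x * f x)) = (\<lambda>x. \<phi> x * f x)"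
    using test_functions_vanish[OF \<phi>] by (auto simp: indicator_def fun_eq_iff)
  also have "(LINT x|lebesgue. \<phi> x * f x) = (LINT x|lborel. \<phi> x * f x)"
    unfolding fe by (rule integral_completion) measurable
  finally show "L2_inner \<Omega> \<phi> f = (LINT x|lborel. \<phi> x * f x)" .
qed

lemma dirichlet_domainI:
  assumes \<Omega>: "open \<Omega>" and c0: "c0 > 0" and fs: "\<And>f. f \<in> set fs \<Longrightarrow> is_box_fn f"
    and coerc: "\<And>\<phi>. \<phi> \<in> test_functions \<Omega> \<Longrightarrow> c0 * L2_mass \<phi> \<le> dirichlet_energy \<phi>"
    and gard: "\<And>\<phi>. \<phi> \<in> test_functions \<Omega> \<Longrightarrow>
      \<theta> * L2_mass \<phi> \<le> dirichlet_energy \<phi> + (\<Sum>f\<leftarrow>fs. (cmod (LINT x|lborel. \<phi> x * f x))\<^sup>2)"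
  shows "dirichlet_domain \<Omega> (length fs) (\<lambda>i. fs ! i) \<theta> c0"
proof
  show "fs ! i \<in> L2 \<Omega>" if "i < length fs" for i
    using L2_inner_box_fn(2)[OF test_functions_zero \<Omega> fs] that by simp
  show "\<theta> * L2_mass \<phi> \<le> dirichlet_energy \<phi> + (\<Sum>i<length fs. (cmod (L2_inner \<Omega> \<phi> (fs ! i)))\<^sup>2)"
    if \<phi>: "\<phi> \<in> test_functions \<Omega>" for \<phi>
    using gard[OF \<phi>] L2_inner_box_fn(1)[OF \<phi> \<Omega> fs] by (simp add: sum_list_sum_nth atLeast0LessThan)
qed (use assms in auto)

section \<open>Coordinates in two and three dimensions\<close>

definition vec2_of :: "real \<times> real \<Rightarrow> real^2" where "vec2_of z = vector [fst z, snd z]"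
definition vec3_of :: "real \<times> (real \<times> real) \<Rightarrow> real^3" where "vec3_of z = vector [fst z, fst (snd z), snd (snd z)]"

lemma Basis_2: "(Basis :: (real^2) set) = {axis 1 1, axis 2 1}"
  by (auto simp: Basis_vec_def UNIV_2)

lemma Basis_3: "(Basis :: (real^3) set) = {axis 1 1, axis 2 1, axis 3 1}"
  by (auto simp: Basis_vec_def UNIV_3)

lemma sum_Basis_2: "sum f (Basis :: (real^2) set) = f (axis 1 1) + f (axis 2 1)"
  by (simp add: Basis_2 axis_eq_axis)

lemma sum_Basis_3: "sum f (Basis :: (real^3) set) = f (axis 1 1) + f (axis 2 1) + f (axis 3 1)"
  by (simp add: Basis_3 axis_eq_axis add.assoc)

lemma coord_isoI:
  fixes T :: "'b::euclidean_space \<Rightarrow> 'a::euclidean_space"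
  assumes "linear T" "T ` Basis = Basis" "DIM('b) = DIM('a)"
  shows "coord_iso T"
  using assms eq_card_imp_inj_on[of "Basis :: 'b set" T] by (simp add: coord_iso_def bij_betw_def)

lemma vec2_of_iso: "coord_iso vec2_of"
proof (rule coord_isoI)
  show "linear vec2_of" by (rule linearI) (auto simp: vec2_of_def vec_eq_iff forall_2)
  show "vec2_of ` Basis = Basis"
    by (auto simp: Basis_2 Basis_prod_def vec2_of_def vec_eq_iff forall_2 axis_def image_Un)
qed simp

lemma vec3_of_iso: "coord_iso vec3_of"
proof (rule coord_isoI)
  show "linear vec3_of" by (rule linearI) (auto simp: vec3_of_def vec_eq_iff forall_3)
  show "vec3_of ` Basis = Basis"
    by (auto simp: Basis_3 Basis_prod_def vec3_of_def vec_eq_iff forall_3 axis_def image_Un)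
qed simp

lemma neumann_poincare_box2:
  fixes a b :: "real^2"
  assumes lt: "a$1 < b$1" "a$2 < b$2" and c: "0 \<le> c" "c \<le> (pi / (b$1 - a$1))\<^sup>2" "c \<le> (pi / (b$2 - a$2))\<^sup>2"
    and \<phi>: "\<phi> \<in> test_functions UNIV"
  shows "c * (measure lborel (cbox a b) * mass_on (cbox a b) \<phi> - (cmod (LINT x|lborel. \<phi> x * indicator (cbox a b) x))\<^sup>2)
        \<le> measure lborel (cbox a b) * energy_on (cbox a b) \<phi>"
proof -
  have NP: "neumann_poincare c (a$1, a$2) (b$1, b$2)"
    by (intro neumann_poincare_prod neumann_poincare_real lt c)
  have "cbox a b \<noteq> {}" using lt by (simp add: interval_ne_empty_cart forall_2 less_imp_le)
  from content_cbox_cart[OF this] have "measure lborel (cbox a b) = (b$1 - a$1) * (b$2 - a$2)"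
    by (simp add: UNIV_2)
  then have "measure lborel (cbox a b) = measure lborel (cbox (a$1, a$2) (b$1, b$2))" using lt by (simp add: content_Pair)
  then show ?thesis
    using neumann_poincare_transfer[OF vec2_of_iso NP \<phi>, of "cbox a b"]
    by (simp add: mem_box_cart forall_2 vec2_of_def cbox_Pair_eq) (auto simp: mem_Times_iff)
qed

lemma neumann_poincare_box3:
  fixes a b :: "real^3"
  assumes lt: "a$1 < b$1" "a$2 < b$2" "a$3 < b$3"
    and c: "0 \<le> c" "c \<le> (pi / (b$1 - a$1))\<^sup>2" "c \<le> (pi / (b$2 - a$2))\<^sup>2" "c \<le> (pi / (b$3 - a$3))\<^sup>2"
    and \<phi>: "\<phi> \<in> test_functions UNIV"
  shows "c * (measure lborel (cbox a b) * mass_on (cbox a b) \<phi> - (cmod (LINT x|lborel. \<phi> x * indicator (cbox a b) x))\<^sup>2)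
        \<le> measure lborel (cbox a b) * energy_on (cbox a b) \<phi>"
proof -
  have NP: "neumann_poincare c (a$1, (a$2, a$3)) (b$1, (b$2, b$3))"
    by (intro neumann_poincare_prod neumann_poincare_real lt c)
  have "cbox a b \<noteq> {}" using lt by (simp add: interval_ne_empty_cart forall_3 less_imp_le)
  from content_cbox_cart[OF this] have "measure lborel (cbox a b) = (b$1 - a$1) * ((b$2 - a$2) * (b$3 - a$3))"
    unfolding UNIV_3 by simp
  then have "measure lborel (cbox a b) = measure lborel (cbox (a$1, (a$2, a$3)) (b$1, (b$2, b$3)))" using lt by (simp add: content_Pair)
  then show ?thesis
    using neumann_poincare_transfer[OF vec3_of_iso NP \<phi>, of "cbox a b"]
    by (simp add: mem_box_cart forall_3 vec3_of_def cbox_Pair_eq) (auto simp: mem_Times_iff)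
qed

lemma small_interval_constant:
  assumes \<theta>: "\<theta> > 0" and d: "0 < d" "d \<le> pi / sqrt \<theta>"
  shows "\<theta> \<le> (pi / d)\<^sup>2"
proof -
  have "sqrt \<theta> * d \<le> pi" using d \<theta> by (simp add: field_simps)
  then have "sqrt \<theta> \<le> pi / d" using d by (simp add: field_simps)
  then have "(sqrt \<theta>)\<^sup>2 \<le> (pi / d)\<^sup>2" using \<theta> by (intro power_mono) auto
  then show ?thesis using \<theta> by simp
qed

lemma finite_functionals_2:
  fixes A B :: "real^2"
  assumes \<theta>: "\<theta> > 0"
  shows "\<exists>fs. (\<forall>f\<in>set fs. is_box_fn f) \<and> (\<forall>\<phi>\<in>test_functions UNIV.
      \<theta> * mass_on (cbox A B) \<phi> \<le> energy_on (cbox A B) \<phi> + (\<Sum>f\<leftarrow>fs. (cmod (LINT x|lborel. \<phi> x * f x))\<^sup>2))"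
\<comment> \<open>Sides up to pi / sqrt \<theta> have Neumann constant (pi / side)^2 \<ge>
  \<theta>.\<close>
proof (rule finite_functionals[of \<theta> "pi / sqrt \<theta>"])
  fix a b :: "real^2" and \<phi> :: "real^2 \<Rightarrow> complex"
  assume h: "\<And>i. i \<in> Basis \<Longrightarrow> a \<bullet> i < b \<bullet> i \<and> b \<bullet> i - a \<bullet> i \<le> pi / sqrt \<theta>" and \<phi>: "\<phi> \<in> test_functions UNIV"
  have "a$j < b$j \<and> b$j - a$j \<le> pi / sqrt \<theta>" for j using h[of "axis j 1"] by (simp add: inner_axis)
  then show "\<theta> * (measure lborel (cbox a b) * mass_on (cbox a b) \<phi> - (cmod (LINT x|lborel. \<phi> x * indicator (cbox a b) x))\<^sup>2)
        \<le> measure lborel (cbox a b) * energy_on (cbox a b) \<phi>"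
    using \<theta> by (intro neumann_poincare_box2 \<phi> small_interval_constant) auto
qed (use \<theta> in auto)

lemma finite_functionals_3:
  fixes A B :: "real^3"
  assumes \<theta>: "\<theta> > 0"
  shows "\<exists>fs. (\<forall>f\<in>set fs. is_box_fn f) \<and> (\<forall>\<phi>\<in>test_functions UNIV.
      \<theta> * mass_on (cbox A B) \<phi> \<le> energy_on (cbox A B) \<phi> + (\<Sum>f\<leftarrow>fs. (cmod (LINT x|lborel. \<phi> x * f x))\<^sup>2))"
proof (rule finite_functionals[of \<theta> "pi / sqrt \<theta>"])
  fix a b :: "real^3" and \<phi> :: "real^3 \<Rightarrow> complex"
  assume h: "\<And>i. i \<in> Basis \<Longrightarrow> a \<bullet> i < b \<bullet> i \<and> b \<bullet> i - a \<bullet> i \<le> pi / sqrt \<theta>" and \<phi>: "\<phi> \<in> test_functions UNIV"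
  have "a$j < b$j \<and> b$j - a$j \<le> pi / sqrt \<theta>" for j using h[of "axis j 1"] by (simp add: inner_axis)
  then show "\<theta> * (measure lborel (cbox a b) * mass_on (cbox a b) \<phi> - (cmod (LINT x|lborel. \<phi> x * indicator (cbox a b) x))\<^sup>2)
        \<le> measure lborel (cbox a b) * energy_on (cbox a b) \<phi>"
    using \<theta> by (intro neumann_poincare_box3 \<phi> small_interval_constant) auto
qed (use \<theta> in auto)

section \<open>Poincare inequalities for crossing strips\<close>

lemma test_functions_UNIV: "\<phi> \<in> test_functions \<Omega> \<Longrightarrow> \<phi> \<in> test_functions UNIV"
  using test_functions_mono[of \<Omega> UNIV] by auto

text \<open>Beyond |x . b1| = 1/2 the function is confined to unit width in direction b2, and pi^2
  is the Dirichlet constant of that width.\<close>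

lemma strip_poincare:
  fixes \<phi> :: "'a::euclidean_space \<Rightarrow> complex"
  assumes \<phi>: "\<phi> \<in> test_functions UNIV" and b: "b1 \<in> Basis" "b2 \<in> Basis" "b1 \<noteq> b2"
    and van: "\<And>x. \<bar>x \<bullet> b1\<bar> > 1/2 \<Longrightarrow> \<bar>x \<bullet> b2\<bar> \<ge> 1/2 \<Longrightarrow> \<phi> x = 0"
  shows "pi\<^sup>2 * mass_on {x. \<bar>x \<bullet> b1\<bar> > 1/2} \<phi> \<le> mass_on {x. \<bar>x \<bullet> b1\<bar> > 1/2} (partial_deriv b2 \<phi>)"
proof -
  have "(pi / 1)\<^sup>2 * (LINT x|lborel. indicator {x. \<bar>x \<bullet> b1\<bar> > 1/2} x * (cmod (\<phi> x))\<^sup>2)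
      \<le> (LINT x|lborel. indicator {x. \<bar>x \<bullet> b1\<bar> > 1/2} x * (cmod (partial_deriv b2 \<phi> x))\<^sup>2)"
  proof (rule dirichlet_poincare[OF \<phi> b(2)])
    show "x + t *\<^sub>R b2 \<in> {x. \<bar>x \<bullet> b1\<bar> > 1/2} \<longleftrightarrow> x \<in> {x. \<bar>x \<bullet> b1\<bar> > 1/2}" for x t
      using b by (simp add: inner_add_left inner_not_same_Basis)
  qed (use van in auto)
  then show ?thesis by (simp add: mass_on_def)
qed

lemma mass_on_le_mass: "\<phi> \<in> test_functions \<Omega> \<Longrightarrow> S \<in> sets borel \<Longrightarrow> mass_on S \<phi> \<le> L2_mass \<phi>"
  unfolding mass_on_UNIV(1)[symmetric] mass_on_def
  by (intro integral_mono mass_on_integrable) (auto simp: indicator_def)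

lemma L2_mass_le_energy: "b \<in> Basis \<Longrightarrow> L2_mass (partial_deriv b \<phi>) \<le> dirichlet_energy \<phi>"
  unfolding mass_on_UNIV[symmetric] energy_on_def by (rule member_le_sum) (auto simp: mass_on_nonneg)

text \<open>This supplies the positive c0 of \<open>dirichlet_domain\<close>. The strips control the
  mass outside the slab |x . b1| \<le> 1/2 with constant pi^2 \<ge> 9, and
  \<open>slab_inequality\<close> carries the control into it; taking half of its constant 8/25
  leaves room for adding the two bounds.\<close>

lemma cross_coercive:
  fixes \<phi> :: "'a::euclidean_space \<Rightarrow> complex"
  assumes \<phi>: "\<phi> \<in> test_functions UNIV" and b: "b1 \<in> Basis" "b2 \<in> Basis" "b1 \<noteq> b2"
    and van: "\<And>x. \<bar>x \<bullet> b1\<bar> > 1/2 \<Longrightarrow> \<bar>x \<bullet> b2\<bar> \<ge> 1/2 \<Longrightarrow> \<phi> x = 0"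
  shows "4/25 * L2_mass \<phi> \<le> dirichlet_energy \<phi>"
proof -
  let ?A = "{x::'a. \<bar>x \<bullet> b1\<bar> > 1/2}" and ?S = "{x::'a. \<bar>x \<bullet> b1\<bar> \<le> 1/2}"
  have m [measurable]: "?A \<in> sets borel" "?S \<in> sets borel" by measurable
  have "pi\<^sup>2 * mass_on ?A \<phi> \<le> mass_on ?A (partial_deriv b2 \<phi>)" by (rule strip_poincare[OF \<phi> b van])
  also have "\<dots> \<le> L2_mass (partial_deriv b2 \<phi>)"
    by (rule mass_on_le_mass[OF test_functions_partial_deriv[OF \<phi> b(2)] m(1)])
  also have "\<dots> \<le> dirichlet_energy \<phi>" by (rule L2_mass_le_energy[OF b(2)])
  finally have 1: "pi\<^sup>2 * mass_on ?A \<phi> \<le> dirichlet_energy \<phi>" .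
  have "3\<^sup>2 \<le> pi\<^sup>2" using pi_gt3 by (intro power_mono) auto
  then have "9 * mass_on ?A \<phi> \<le> pi\<^sup>2 * mass_on ?A \<phi>" by (intro mult_right_mono mass_on_nonneg) simp
  then have 2: "9 * mass_on ?A \<phi> \<le> dirichlet_energy \<phi>" using 1 by simp
  have 3: "8/25 * mass_on ?S \<phi> \<le> L2_mass (partial_deriv b1 \<phi>) + mass_on ?A \<phi>"
    using slab_inequality[OF \<phi> b(1)] by (simp add: mass_on_def L2_mass_def)
  have 4: "L2_mass (partial_deriv b1 \<phi>) \<le> dirichlet_energy \<phi>" by (rule L2_mass_le_energy[OF b(1)])
  have 5: "L2_mass \<phi> \<le> mass_on ?S \<phi> + mass_on ?A \<phi>"
    unfolding mass_on_UNIV(1)[symmetric] by (rule mass_on_le_add[OF \<phi>]) auto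
  show ?thesis using 2 3 4 5 mass_on_nonneg[of ?A \<phi>] by linarith
qed

section \<open>The planar cross\<close>

lemma open_planar_cross: "open planar_cross"
  unfolding planar_cross_def by (intro open_Collect_disj open_Collect_less continuous_intros)

text \<open>The cross is cut into the closed unit square and four arms. In an arm only the
  transverse derivative is used, with constant pi^2 for width 1; the square has Neumann constant
  pi^2, at the cost of its mean. As the two constants coincide, one functional suffices right up to
  the threshold.\<close>

lemma planar_cross_garding:
  assumes \<phi>: "\<phi> \<in> test_functions planar_cross"
  shows "pi\<^sup>2 * L2_mass \<phi> \<le> dirichlet_energy \<phi> + (cmod (LINT x|lborel. \<phi> x * (of_real pi * indicator (cbox (\<chi> i. -1/2) (\<chi> i. 1/2)) x)))\<^sup>2"
proof -
  let ?K = "cbox (\<chi> i. -1/2) (\<chi> i. 1/2) :: (real^2) set"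
  let ?e1 = "axis 1 1 :: real^2" and ?e2 = "axis 2 1 :: real^2"
  let ?A1 = "{x :: real^2. \<bar>x \<bullet> ?e1\<bar> > 1/2}" and ?A2 = "{x :: real^2. \<bar>x \<bullet> ?e2\<bar> > 1/2}"
  note U = test_functions_UNIV[OF \<phi>]
  have B: "?e1 \<in> Basis" "?e2 \<in> Basis" "?e1 \<noteq> ?e2" "?e2 \<noteq> ?e1" by (auto simp: Basis_2 axis_eq_axis)
  have m: "?A1 \<in> sets borel" "?A2 \<in> sets borel" by measurable
  have out: "x \<notin> planar_cross" if "\<bar>x \<bullet> ?e1\<bar> \<ge> 1/2" "\<bar>x \<bullet> ?e2\<bar> \<ge> 1/2" for x
    using that by (simp add: planar_cross_def inner_axis)
  note dom = test_functions_vanish[OF \<phi> out]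
  have 1: "pi\<^sup>2 * mass_on ?A1 \<phi> \<le> mass_on ?A1 (partial_deriv ?e2 \<phi>)"
    by (rule strip_poincare[OF U B(1,2,3)]) (use dom in auto)
  have 2: "pi\<^sup>2 * mass_on ?A2 \<phi> \<le> mass_on ?A2 (partial_deriv ?e1 \<phi>)"
    by (rule strip_poincare[OF U B(2,1,4)]) (use dom in auto)
  let ?I = "LINT x|lborel. \<phi> x * indicator ?K x"
  have c1: "measure lborel ?K = 1"
    by (subst content_cbox_cart) (auto simp: interval_ne_empty_cart)
  have "pi\<^sup>2 * (measure lborel ?K * mass_on ?K \<phi> - (cmod ?I)\<^sup>2) \<le> measure lborel ?K * energy_on ?K \<phi>"
    by (intro neumann_poincare_box2 U) auto
  then have 3: "pi\<^sup>2 * mass_on ?K \<phi> \<le> energy_on ?K \<phi> + pi\<^sup>2 * (cmod ?I)\<^sup>2"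
    unfolding c1 by (simp add: right_diff_distrib)
  have I: "(cmod (LINT x|lborel. \<phi> x * (of_real pi * indicator ?K x)))\<^sup>2 = pi\<^sup>2 * (cmod ?I)\<^sup>2"
  proof -
    have "(LINT x|lborel. \<phi> x * (of_real pi * indicator ?K x)) = of_real pi * ?I"
      unfolding mult.left_commute[of "\<phi> _"] by simp
    then show ?thesis by (simp add: norm_mult power_mult_distrib)
  qed
  have K: "x \<in> ?K \<longleftrightarrow> \<bar>x \<bullet> ?e1\<bar> \<le> 1/2 \<and> \<bar>x \<bullet> ?e2\<bar> \<le> 1/2" for x
    by (auto simp: mem_box_cart forall_2 inner_axis abs_le_iff)
  have bK: "?K \<in> sets borel" by simp
  have cov: "x \<in> ?K \<union> (?A1 \<union> ?A2)" for x unfolding Un_iff K mem_Collect_eq by linarith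
  have disj: "indicator ?K x + indicator ?A1 x \<le> (indicator UNIV x :: real)"
    "indicator ?K x + indicator ?A2 x \<le> (indicator UNIV x :: real)" for x
    unfolding indicator_def K mem_Collect_eq by auto
  have "L2_mass \<phi> \<le> mass_on ?K \<phi> + mass_on (?A1 \<union> ?A2) \<phi>"
    unfolding mass_on_UNIV(1)[symmetric] by (rule mass_on_le_add[OF \<phi> bK sets.Un[OF m] _ cov]) simp
  moreover have "mass_on (?A1 \<union> ?A2) \<phi> \<le> mass_on ?A1 \<phi> + mass_on ?A2 \<phi>"
    by (rule mass_on_le_add[OF \<phi> m sets.Un[OF m]])
  ultimately have "L2_mass \<phi> \<le> mass_on ?K \<phi> + mass_on ?A1 \<phi> + mass_on ?A2 \<phi>" by simp
  then have 4: "pi\<^sup>2 * L2_mass \<phi> \<le> pi\<^sup>2 * mass_on ?K \<phi> + pi\<^sup>2 * mass_on ?A1 \<phi> + pi\<^sup>2 * mass_on ?A2 \<phi>"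
    using mult_left_mono[of "L2_mass \<phi>" "mass_on ?K \<phi> + mass_on ?A1 \<phi> + mass_on ?A2 \<phi>" "pi\<^sup>2"] by (simp add: distrib_left)
  have 5: "mass_on ?K (partial_deriv ?e2 \<phi>) + mass_on ?A1 (partial_deriv ?e2 \<phi>) \<le> L2_mass (partial_deriv ?e2 \<phi>)"
    unfolding mass_on_UNIV(1)[symmetric]
    by (rule mass_on_add_le[OF test_functions_partial_deriv[OF \<phi> B(2)] bK m(1) _ AE_I2[OF impI[OF disj(1)]]]) simp
  have 6: "mass_on ?K (partial_deriv ?e1 \<phi>) + mass_on ?A2 (partial_deriv ?e1 \<phi>) \<le> L2_mass (partial_deriv ?e1 \<phi>)"
    unfolding mass_on_UNIV(1)[symmetric]
    by (rule mass_on_add_le[OF test_functions_partial_deriv[OF \<phi> B(1)] bK m(2) _ AE_I2[OF impI[OF disj(2)]]]) simp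
  have "dirichlet_energy \<phi> = L2_mass (partial_deriv ?e1 \<phi>) + L2_mass (partial_deriv ?e2 \<phi>)"
    by (simp add: dirichlet_energy_def sum_Basis_2 L2_mass_def)
  moreover have "energy_on ?K \<phi> = mass_on ?K (partial_deriv ?e1 \<phi>) + mass_on ?K (partial_deriv ?e2 \<phi>)"
    by (simp add: energy_on_def sum_Basis_2)
  ultimately show ?thesis unfolding I using 1 2 3 4 5 6 by linarith
qed

definition cross_functional :: "nat \<Rightarrow> real^2 \<Rightarrow> complex" where
  "cross_functional i = [\<lambda>x. of_real pi * indicator (cbox (\<chi> i. -1/2) (\<chi> i. 1/2)) x] ! i"

lemma planar_cross_domain: "dirichlet_domain planar_cross 1 cross_functional (pi\<^sup>2) (4/25)"
proof -
  let ?f = "\<lambda>x :: real^2. of_real pi * indicator (cbox (\<chi> i. -1/2) (\<chi> i. 1/2)) x :: complex"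
  have "dirichlet_domain planar_cross (length [?f]) (\<lambda>i. [?f] ! i) (pi\<^sup>2) (4/25)"
  proof (rule dirichlet_domainI[OF open_planar_cross])
    show "is_box_fn f" if "f \<in> set [?f]" for f
      using that unfolding is_box_fn_def by auto
    fix \<phi> :: "real^2 \<Rightarrow> complex" assume \<phi>: "\<phi> \<in> test_functions planar_cross"
    show "4/25 * L2_mass \<phi> \<le> dirichlet_energy \<phi>"
    proof (rule cross_coercive[OF test_functions_UNIV[OF \<phi>], of "axis 1 1" "axis 2 1"])
      show "\<phi> x = 0" if "\<bar>x \<bullet> axis 1 1\<bar> > 1/2" "\<bar>x \<bullet> axis 2 1\<bar> \<ge> 1/2" for x
        using that by (intro test_functions_vanish[OF \<phi>]) (auto simp: planar_cross_def inner_axis)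
    qed (auto simp: Basis_2 axis_eq_axis)
    show "pi\<^sup>2 * L2_mass \<phi> \<le> dirichlet_energy \<phi> + (\<Sum>f\<leftarrow>[?f]. (cmod (LINT x|lborel. \<phi> x * f x))\<^sup>2)"
      using planar_cross_garding[OF \<phi>] by simp
  qed auto
  then show ?thesis by (simp add: cross_functional_def[abs_def])
qed

section \<open>Bounded sections\<close>

text \<open>The hypothesis provides functionals for every threshold \<theta>. Taking \<theta> above
  the quotient of some test function leaves a finite nonempty set of eigenvalues below it, and its
  minimum is the \<open>LEAST\<close>. Below or at every quotient of a test function there is an
  eigenvalue, which gives the inequality.\<close>

lemma first_eigenvalue_variational:
  fixes \<Omega> :: "'a::euclidean_space set"
  assumes dom: "\<And>\<theta>. \<theta> > 0 \<Longrightarrow> \<exists>k f. dirichlet_domain \<Omega> k f \<theta> c0"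
    and \<phi>0: "\<phi>0 \<in> test_functions \<Omega>" "L2_mass \<phi>0 > 0"
  shows "c0 \<le> first_eigenvalue \<Omega>"
    and "\<And>\<phi>. \<phi> \<in> test_functions \<Omega> \<Longrightarrow> first_eigenvalue \<Omega> * L2_mass \<phi> \<le> dirichlet_energy \<phi>"
proof -
  have en: "0 \<le> dirichlet_energy \<phi>" for \<phi> :: "'a \<Rightarrow> complex" using energy_on_nonneg[of UNIV \<phi>] by (simp add: mass_on_UNIV)
  have ex: "\<exists>\<mu>. is_eigenvalue \<Omega> \<mu> \<and> \<mu> \<le> dirichlet_energy \<phi> / L2_mass \<phi>"
    if \<phi>: "\<phi> \<in> test_functions \<Omega>" "L2_mass \<phi> > 0" for \<phi>
  proof -
    define R where "R = dirichlet_energy \<phi> / L2_mass \<phi>"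
    have "0 \<le> R" using \<phi> en by (simp add: R_def)
    then obtain k f where D: "dirichlet_domain \<Omega> k f (R + 1) c0" using dom[of "R + 1"] by auto
    have "dirichlet_energy \<phi> \<le> R * L2_mass \<phi>" using \<phi> by (simp add: R_def)
    then show ?thesis using dirichlet_domain.exists_eigenvalue_le[OF D \<phi>, of R] by (auto simp: R_def discrete_spectrum_def)
  qed
  define \<theta> where "\<theta> = dirichlet_energy \<phi>0 / L2_mass \<phi>0 + 1"
  have \<theta>: "\<theta> > 0" using \<phi>0 en[of \<phi>0] by (simp add: \<theta>_def add_nonneg_pos)
  then obtain k f where D: "dirichlet_domain \<Omega> k f \<theta> c0" using dom by blast
  have lb: "c0 \<le> \<mu>" if "is_eigenvalue \<Omega> \<mu>" for \<mu> using dirichlet_domain.is_eigenvalue_lower_bound[OF D that] .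
  have c0: "c0 > 0" using dirichlet_domain.c0_pos[OF D] .
  let ?S = "discrete_spectrum \<Omega> \<theta>"
  have fin: "finite ?S" by (rule dirichlet_domain.discrete_spectrum_finite(1)[OF D])
  obtain \<mu>0 where "is_eigenvalue \<Omega> \<mu>0" "\<mu>0 < \<theta>" using ex[OF \<phi>0] by (force simp: \<theta>_def)
  then have "\<mu>0 \<in> ?S" using lb[of \<mu>0] c0 by (simp add: discrete_spectrum_def)
  then have "?S \<noteq> {}" by blast
  then have min: "Min ?S \<in> ?S" "\<And>\<mu>. \<mu> \<in> ?S \<Longrightarrow> Min ?S \<le> \<mu>" using Min_in[OF fin] Min_le[OF fin] by auto
  have least: "Min ?S \<le> \<mu>" if "is_eigenvalue \<Omega> \<mu>" for \<mu>
  proof (cases "\<mu> < \<theta>")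
    case True then show ?thesis using min(2)[of \<mu>] lb[OF that] c0 that by (simp add: discrete_spectrum_def)
  next
    case False then show ?thesis using min(1) by (simp add: discrete_spectrum_def)
  qed
  have eig: "is_eigenvalue \<Omega> (Min ?S)" using min(1) by (simp add: discrete_spectrum_def)
  have F: "first_eigenvalue \<Omega> = Min ?S"
    unfolding first_eigenvalue_def by (rule Least_equality) (rule eig, rule least)
  show "c0 \<le> first_eigenvalue \<Omega>" using lb[OF eig] F by simp
  show "first_eigenvalue \<Omega> * L2_mass \<phi> \<le> dirichlet_energy \<phi>" if \<phi>: "\<phi> \<in> test_functions \<Omega>" for \<phi>
  proof (cases "L2_mass \<phi> > 0")
    case True
    obtain \<mu> where "is_eigenvalue \<Omega> \<mu>" "\<mu> \<le> dirichlet_energy \<phi> / L2_mass \<phi>" using ex[OF \<phi> True] by blast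
    then have "first_eigenvalue \<Omega> \<le> dirichlet_energy \<phi> / L2_mass \<phi>" using least F by fastforce
    then show ?thesis using True by (simp add: pos_le_divide_eq)
  next
    case False
    then have "L2_mass \<phi> = 0" using mass_on_nonneg[of UNIV \<phi>] by (simp add: mass_on_UNIV)
    then show ?thesis using en by simp
  qed
qed

lemma exists_test_function:
  fixes \<Omega> :: "'a::euclidean_space set"
  assumes "open \<Omega>" "x0 \<in> \<Omega>"
  obtains \<phi> where "\<phi> \<in> test_functions \<Omega>" "L2_mass \<phi> > 0"
proof -
  obtain a b where ab: "x0 \<in> box a b" "cbox a b \<subseteq> \<Omega>"
    using open_contains_cbox[OF assms] by metis
  let ?\<phi> = "box_bump 1 a b"
  have \<phi>: "?\<phi> \<in> test_functions \<Omega>" by (rule box_bump_test[OF ab(2)]) simp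
  have "L2_mass ?\<phi> \<noteq> 0"
  proof
    assume z: "L2_mass ?\<phi> = 0"
    have "integrable lborel (\<lambda>x. (cmod (?\<phi> x))\<^sup>2)"
      by (rule compactly_supported_integrable[OF compactly_supported_norm_sq[OF test_functions_compactly_supported[OF \<phi>]]])
    then have "AE x in lborel. (cmod (?\<phi> x))\<^sup>2 = 0"
      using z by (subst (asm) L2_mass_def, subst (asm) integral_nonneg_eq_0_iff_AE) auto
    then have "AE x in lborel. x \<notin> box a b"
    proof eventually_elim
      fix x assume "(cmod (?\<phi> x))\<^sup>2 = 0"
      then obtain i where i: "i \<in> Basis" "smooth_bump 1 (a \<bullet> i) (b \<bullet> i) (x \<bullet> i) = 0"
        by (auto simp: box_bump_def)
      show "x \<notin> box a b"
      proof
        assume "x \<in> box a b"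
        then have "smooth_bump 1 (a \<bullet> i) (b \<bullet> i) (x \<bullet> i) > 0"
          using i(1) unfolding smooth_bump_def by (intro mult_pos_pos smooth_step_pos) (auto simp: mem_box)
        then show False using i(2) by simp
      qed
    qed
    then have "box a b \<in> null_sets lborel" by (simp add: AE_iff_null_sets)
    then have "negligible (box a b)" by (simp add: negligible_iff_null_sets null_sets_completionI)
    then show False using ab(1) by (simp add: negligible_interval)
  qed
  then have "L2_mass ?\<phi> > 0" using mass_on_nonneg[of UNIV ?\<phi>] by (simp add: mass_on_UNIV)
  then show thesis using \<phi> that by blast
qed

text \<open>The functionals are those of the enclosing rectangle with sides 1 and H, which contains
  all of D, so \<theta> is arbitrary. The constant adds the Dirichlet constants of the two sides;
  its second term is what places \<open>lambda_dagger\<close> strictly above pi^2.\<close>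

lemma bounded_section_domain:
  fixes D :: "(real^2) set"
  assumes D: "open D" "\<And>x. x \<in> D \<Longrightarrow> \<bar>x$1\<bar> < 1/2 \<and> \<bar>x$2\<bar> < H/2" and H: "H > 0" and \<theta>: "\<theta> > 0"
  shows "\<exists>k f. dirichlet_domain D k f \<theta> (pi\<^sup>2 + (pi / H)\<^sup>2)"
proof -
  let ?B = "(\<chi> i. if i = 1 then 1/2 else H/2) :: real^2"
  obtain fs where fs: "\<And>f. f \<in> set fs \<Longrightarrow> is_box_fn f"
    "\<And>\<phi>. \<phi> \<in> test_functions UNIV \<Longrightarrow> \<theta> * mass_on (cbox (- ?B) ?B) \<phi> \<le> energy_on (cbox (- ?B) ?B) \<phi>
       + (\<Sum>f\<leftarrow>fs. (cmod (LINT x|lborel. \<phi> x * f x))\<^sup>2)"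
    using finite_functionals_2[OF \<theta>, of "- ?B" ?B] by blast
  have sub: "x \<in> cbox (- ?B) ?B" if "x \<in> D" for x
    using D(2)[OF that] by (auto simp: mem_box_cart forall_2)
  have "dirichlet_domain D (length fs) (\<lambda>i. fs ! i) \<theta> (pi\<^sup>2 + (pi / H)\<^sup>2)"
  proof (rule dirichlet_domainI[OF D(1) _ fs(1)])
    show "0 < pi\<^sup>2 + (pi / H)\<^sup>2" by (simp add: add_pos_nonneg)
    fix \<phi> assume \<phi>: "\<phi> \<in> test_functions D"
    note U = test_functions_UNIV[OF \<phi>]
    have 1: "(pi / 1)\<^sup>2 * mass_on UNIV \<phi> \<le> mass_on UNIV (partial_deriv (axis 1 1) \<phi>)"
      unfolding mass_on_def
    proof (rule dirichlet_poincare[OF U])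
      show "\<phi> x = 0" if "1/2 \<le> \<bar>x \<bullet> axis 1 1\<bar>" for x
        using D(2)[of x] that by (intro test_functions_vanish[OF \<phi>]) (auto simp: inner_axis)
    qed (auto simp: Basis_2)
    have 2: "(pi / H)\<^sup>2 * mass_on UNIV \<phi> \<le> mass_on UNIV (partial_deriv (axis 2 1) \<phi>)"
      unfolding mass_on_def
    proof (rule dirichlet_poincare[OF U])
      show "\<phi> x = 0" if "H/2 \<le> \<bar>x \<bullet> axis 2 1\<bar>" for x
        using D(2)[of x] that by (intro test_functions_vanish[OF \<phi>]) (auto simp: inner_axis)
    qed (use H in \<open>auto simp: Basis_2\<close>)
    show "(pi\<^sup>2 + (pi / H)\<^sup>2) * L2_mass \<phi> \<le> dirichlet_energy \<phi>"
      using 1 2 unfolding mass_on_UNIV[symmetric] energy_on_def by (simp add: sum_Basis_2 distrib_right)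
    have "\<theta> * L2_mass \<phi> \<le> \<theta> * mass_on (cbox (- ?B) ?B) \<phi>"
    proof -
      have "mass_on UNIV \<phi> \<le> mass_on (cbox (- ?B) ?B) \<phi> + mass_on {} \<phi>"
      proof (rule mass_on_le_add[OF \<phi>])
        show "x \<in> cbox (- ?B) ?B \<union> {}" if "\<phi> x \<noteq> 0" for x
          using sub[of x] test_functions_vanish[OF \<phi>, of x] that by blast
      qed simp_all
      then show ?thesis using \<theta> by (intro mult_left_mono) (auto simp: mass_on_UNIV mass_on_def[of "{}"])
    qed
    also have "\<dots> \<le> energy_on (cbox (- ?B) ?B) \<phi> + (\<Sum>f\<leftarrow>fs. (cmod (LINT x|lborel. \<phi> x * f x))\<^sup>2)" by (rule fs(2)[OF U])
    also have "energy_on (cbox (- ?B) ?B) \<phi> \<le> dirichlet_energy \<phi>"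
      unfolding mass_on_UNIV(2)[symmetric] energy_on_def mass_on_UNIV(1)
      by (intro sum_mono mass_on_le_mass[OF test_functions_partial_deriv[OF \<phi>]]) auto
    finally show "\<theta> * L2_mass \<phi> \<le> dirichlet_energy \<phi> + (\<Sum>f\<leftarrow>fs. (cmod (LINT x|lborel. \<phi> x * f x))\<^sup>2)" by simp
  qed
  then show ?thesis by blast
qed

section \<open>Tensor products\<close>

lemma integral_tensor:
  fixes T :: "'b::euclidean_space \<times> 'c::euclidean_space \<Rightarrow> 'a::euclidean_space"
    and f :: "'b \<Rightarrow> real" and g :: "'c \<Rightarrow> real"
  assumes T: "coord_iso T" and PQ: "\<And>p t. P (T (p, t)) = p" "\<And>p t. Q (T (p, t)) = t"
    "P \<in> borel_measurable borel" "Q \<in> borel_measurable borel"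
    and f: "compactly_supported UNIV f" and g: "compactly_supported UNIV g"
  shows "(LINT x|lborel. f (P x) * g (Q x)) = integral\<^sup>L lborel f * integral\<^sup>L lborel g"
    and "integrable lborel (\<lambda>x. f (P x) * g (Q x))"
proof -
  have fc: "continuous_on UNIV f" and gc: "continuous_on UNIV g" using f g by (auto simp: compactly_supported_def)
  note [measurable] = borel_measurable_continuous_onI[OF fc] borel_measurable_continuous_onI[OF gc] PQ(3,4)
  have m: "(\<lambda>x. f (P x) * g (Q x)) \<in> borel_measurable borel" by measurable
  define h where "h z = f (fst z) * g (snd z)" for z
  have "compactly_supported UNIV h"
  proof -
    obtain K1 where K1: "compact K1" "\<forall>x. x \<notin> K1 \<longrightarrow> f x = 0" using f by (auto simp: compactly_supported_def)
    obtain K2 where K2: "compact K2" "\<forall>x. x \<notin> K2 \<longrightarrow> g x = 0" using g by (auto simp: compactly_supported_def)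
    have "continuous_on UNIV h" unfolding h_def
      by (intro continuous_on_mult continuous_on_compose2[OF fc] continuous_on_compose2[OF gc] continuous_intros) auto
    then show ?thesis unfolding compactly_supported_def
      using compact_Times[OF K1(1) K2(1)] K1(2) K2(2) by (intro conjI exI[of _ "K1 \<times> K2"]) (auto simp: h_def)
  qed
  then have hi: "integrable lborel h" by (rule compactly_supported_integrable)
  have e: "(\<lambda>z. f (P (T z)) * g (Q (T z))) = h"
    unfolding h_def by (rule ext) (metis PQ(1,2) prod.collapse)
  show "integrable lborel (\<lambda>x. f (P x) * g (Q x))"
    using hi unfolding coord_iso_integral(2)[OF T m] e .
  have "(LINT x|lborel. f (P x) * g (Q x)) = integral\<^sup>L lborel h"
    unfolding coord_iso_integral(1)[OF T m] e ..
  also have "\<dots> = integral\<^sup>L (lborel \<Otimes>\<^sub>M lborel) h" by (simp add: lborel_prod)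
  also have "\<dots> = (LINT x|lborel. LINT y|lborel. h (x, y))"
    by (rule lborel_pair.integral_fst'[symmetric]) (simp add: lborel_prod hi)
  also have "\<dots> = integral\<^sup>L lborel f * integral\<^sup>L lborel g" by (simp add: h_def)
  finally show "(LINT x|lborel. f (P x) * g (Q x)) = integral\<^sup>L lborel f * integral\<^sup>L lborel g" .
qed

lemma partial_deriv_affine:
  fixes f :: "'a::euclidean_space \<Rightarrow> complex" and l :: "'b::euclidean_space \<Rightarrow> 'a"
  assumes "f differentiable (at (c + l x))" "linear l"
  shows "partial_deriv v (\<lambda>x. f (c + l x)) x = partial_deriv (l v) f (c + l x)"
proof -
  let ?D = "frechet_derivative f (at (c + l x))"
  have D: "(f has_derivative ?D) (at (c + l x))" using assms(1) by (simp add: frechet_derivative_works)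
  have bl: "bounded_linear l" using assms(2) by (simp add: linear_conv_bounded_linear)
  have "((\<lambda>x. c + l x) has_derivative l) (at x)"
    using bounded_linear.has_derivative[OF bl has_derivative_ident] by (auto intro!: derivative_eq_intros)
  then have "((\<lambda>x. f (c + l x)) has_derivative (\<lambda>h. ?D (l h))) (at x)"
    using has_derivative_compose[of "\<lambda>x. c + l x" l x UNIV f ?D] D by simp
  then show ?thesis using partial_deriv_eqI by (fastforce simp: partial_deriv_def)
qed

lemma partial_deriv_zero: "f differentiable (at x) \<Longrightarrow> partial_deriv 0 f x = 0"
  unfolding partial_deriv_def
  by (intro linear_0 has_derivative_linear) (auto simp: frechet_derivative_works)

text \<open>Each coordinate direction lies in one of the two factors, so a partial derivative falls
  on one factor only and the energy is a sum of two products.\<close>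

lemma tensor_test_function:
  fixes T :: "'b::euclidean_space \<times> 'c::euclidean_space \<Rightarrow> 'a::euclidean_space"
  assumes T: "coord_iso T" and PQ: "\<And>p t. P (T (p, t)) = p" "\<And>p t. Q (T (p, t)) = t" "\<And>x. T (P x, Q x) = x"
    and lin: "linear P" "linear Q"
    and \<psi>: "\<psi> \<in> test_functions A" and \<eta>: "\<eta> \<in> test_functions B"
    and sub: "\<And>p t. p \<in> A \<Longrightarrow> t \<in> B \<Longrightarrow> T (p, t) \<in> \<Omega>"
  shows "(\<lambda>x. \<psi> (P x) * \<eta> (Q x)) \<in> test_functions \<Omega>"
    and "L2_mass (\<lambda>x. \<psi> (P x) * \<eta> (Q x)) = L2_mass \<psi> * L2_mass \<eta>"
    and "dirichlet_energy (\<lambda>x. \<psi> (P x) * \<eta> (Q x)) = dirichlet_energy \<psi> * L2_mass \<eta> + L2_mass \<psi> * dirichlet_energy \<eta>"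
proof -
  let ?F = "\<lambda>x. \<psi> (P x) * \<eta> (Q x)"
  have linT: "linear T" and bij: "bij_betw T Basis Basis" using T by (auto simp: coord_iso_def)
  have Tc: "continuous_on UNIV T" using linT by (simp add: linear_continuous_on linear_conv_bounded_linear)
  have PQm: "P \<in> borel_measurable borel" "Q \<in> borel_measurable borel"
    using lin by (auto intro!: borel_measurable_continuous_onI simp: linear_continuous_on linear_conv_bounded_linear)
  obtain K1 where K1: "compact K1" "K1 \<subseteq> A" "\<And>x. x \<notin> K1 \<Longrightarrow> \<psi> x = 0"
    by (rule test_functionsE[OF \<psi>]) blast
  obtain K2 where K2: "compact K2" "K2 \<subseteq> B" "\<And>x. x \<notin> K2 \<Longrightarrow> \<eta> x = 0"
    by (rule test_functionsE[OF \<eta>]) blast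
  show "?F \<in> test_functions \<Omega>"
  proof (rule test_functionsI[of _ "T ` (K1 \<times> K2)"])
    show "C_k k ?F" for k
      by (rule C_k_mult[OF C_k_comp_linear[OF test_functions_C_k[OF \<psi>] lin(1)] C_k_comp_linear[OF test_functions_C_k[OF \<eta>] lin(2)]])
    show "compact (T ` (K1 \<times> K2))"
      by (intro compact_continuous_image compact_Times K1 K2 continuous_on_subset[OF Tc]) simp
    show "T ` (K1 \<times> K2) \<subseteq> \<Omega>" using K1(2) K2(2) sub by blast
    show "?F x = 0" if "x \<notin> T ` (K1 \<times> K2)" for x
    proof -
      have "(P x, Q x) \<notin> K1 \<times> K2" using that PQ(3)[of x] by force
      then show ?thesis using K1(3)[of "P x"] K2(3)[of "Q x"] by auto
    qed
  qed
  have mass: "L2_mass (\<lambda>x. u (P x) * v (Q x)) = L2_mass u * L2_mass v"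
    if "u \<in> test_functions A" "v \<in> test_functions B" for u v
  proof -
    have c: "compactly_supported UNIV (\<lambda>x. (cmod (u x))\<^sup>2)" "compactly_supported UNIV (\<lambda>x. (cmod (v x))\<^sup>2)"
      by (intro compactly_supported_norm_sq test_functions_compactly_supported that[THEN test_functions_UNIV])+
    show ?thesis
      unfolding L2_mass_def norm_mult power_mult_distrib
      by (rule integral_tensor(1)[OF T PQ(1,2) PQm c])
  qed
  show "L2_mass ?F = L2_mass \<psi> * L2_mass \<eta>" by (rule mass[OF \<psi> \<eta>])
  have d: "partial_deriv v ?F x = \<psi> (P x) * partial_deriv (Q v) \<eta> (Q x) + partial_deriv (P v) \<psi> (P x) * \<eta> (Q x)" for v x
  proof -
    have dp: "\<psi> differentiable (at (0 + P x))" and dq: "\<eta> differentiable (at (0 + Q x))"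
      using test_functions_differentiable[OF \<psi>] test_functions_differentiable[OF \<eta>] by auto
    have "(\<lambda>x. \<psi> (0 + P x)) differentiable (at x)" "(\<lambda>x. \<eta> (0 + Q x)) differentiable (at x)"
      using has_derivative_comp_affine[OF dp lin(1)] has_derivative_comp_affine[OF dq lin(2)] differentiableI by blast+
    then have "partial_deriv v ?F x = \<psi> (P x) * partial_deriv v (\<lambda>x. \<eta> (Q x)) x + partial_deriv v (\<lambda>x. \<psi> (P x)) x * \<eta> (Q x)"
      by (intro partial_deriv_mult) simp_all
    then show ?thesis using partial_deriv_affine[OF dp lin(1), of v] partial_deriv_affine[OF dq lin(2), of v] by simp
  qed
  have z: "partial_deriv 0 \<psi> p = 0" "partial_deriv 0 \<eta> t = 0" for p t
    using test_functions_differentiable[OF \<psi>] test_functions_differentiable[OF \<eta>] by (auto intro: partial_deriv_zero)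
  have "dirichlet_energy ?F = (\<Sum>i\<in>Basis. L2_mass (partial_deriv i ?F))"
    by (simp add: dirichlet_energy_def L2_mass_def)
  also have "\<dots> = (\<Sum>i\<in>Basis. L2_mass (partial_deriv (T i) ?F))" by (rule sum.reindex_bij_betw[OF bij, symmetric])
  also have "\<dots> = (\<Sum>i\<in>Basis. L2_mass (partial_deriv (T (i, 0)) ?F)) + (\<Sum>i\<in>Basis. L2_mass (partial_deriv (T (0, i)) ?F))"
    by (rule sum_Basis_prod)
  also have "(\<Sum>i\<in>Basis. L2_mass (partial_deriv (T (i, 0)) ?F)) = (\<Sum>i\<in>Basis. L2_mass (partial_deriv i \<psi>) * L2_mass \<eta>)"
  proof (intro sum.cong refl)
    fix i :: 'b assume i: "i \<in> Basis"
    have "partial_deriv (T (i, 0)) ?F = (\<lambda>x. partial_deriv i \<psi> (P x) * \<eta> (Q x))" by (auto simp: d PQ(1,2) z)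
    then show "L2_mass (partial_deriv (T (i, 0)) ?F) = L2_mass (partial_deriv i \<psi>) * L2_mass \<eta>"
      using mass[OF test_functions_partial_deriv[OF \<psi> i] \<eta>] by simp
  qed
  also have "(\<Sum>i\<in>Basis. L2_mass (partial_deriv (T (0, i)) ?F)) = (\<Sum>i\<in>Basis. L2_mass \<psi> * L2_mass (partial_deriv i \<eta>))"
  proof (intro sum.cong refl)
    fix i :: 'c assume i: "i \<in> Basis"
    have "partial_deriv (T (0, i)) ?F = (\<lambda>x. \<psi> (P x) * partial_deriv i \<eta> (Q x))" by (auto simp: d PQ(1,2) z)
    then show "L2_mass (partial_deriv (T (0, i)) ?F) = L2_mass \<psi> * L2_mass (partial_deriv i \<eta>)"
      using mass[OF \<psi> test_functions_partial_deriv[OF \<eta> i]] by simp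
  qed
  finally show "dirichlet_energy ?F = dirichlet_energy \<psi> * L2_mass \<eta> + L2_mass \<psi> * dirichlet_energy \<eta>"
    by (simp add: sum_distrib_left sum_distrib_right dirichlet_energy_def L2_mass_def)
qed

section \<open>Scaling and disjoint supports\<close>

lemma integral_lborel_affine:
  fixes f :: "'a::euclidean_space \<Rightarrow> real"
  assumes c: "c > 0" and f: "f \<in> borel_measurable borel"
  shows "(LINT x|lborel. f (t + c *\<^sub>R x)) = integral\<^sup>L lborel f / c ^ DIM('a)"
proof -
  have m: "(\<lambda>x::'a. t + c *\<^sub>R x) \<in> measurable lborel borel" by simp
  have "integral\<^sup>L lborel f = integral\<^sup>L (density (distr lborel borel (\<lambda>x. t + c *\<^sub>R x)) (\<lambda>_. \<bar>c\<bar> ^ DIM('a))) f"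
    using lborel_affine[of c t] c by simp
  also have "\<dots> = (LINT x|distr lborel borel (\<lambda>x. t + c *\<^sub>R x). c ^ DIM('a) * f x)"
    using f c by (subst integral_density) auto
  also have "\<dots> = (LINT x|lborel. c ^ DIM('a) * f (t + c *\<^sub>R x))"
    using f by (intro integral_distr m) auto
  finally show ?thesis using c by (simp add: field_simps)
qed

lemma scaled_test_function:
  fixes \<phi> :: "'a::euclidean_space \<Rightarrow> complex"
  assumes c: "c > 0" and \<phi>: "\<phi> \<in> test_functions \<Omega>"
  shows "(\<lambda>x. \<phi> (t + c *\<^sub>R x)) \<in> test_functions {x. t + c *\<^sub>R x \<in> \<Omega>}"
    and "L2_mass (\<lambda>x. \<phi> (t + c *\<^sub>R x)) = L2_mass \<phi> / c ^ DIM('a)"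
    and "dirichlet_energy (\<lambda>x. \<phi> (t + c *\<^sub>R x)) = c\<^sup>2 * dirichlet_energy \<phi> / c ^ DIM('a)"
proof -
  have lin: "linear (\<lambda>x::'a. c *\<^sub>R x)" by (simp add: linear_iff algebra_simps)
  obtain K where K: "compact K" "K \<subseteq> \<Omega>" "\<And>x. x \<notin> K \<Longrightarrow> \<phi> x = 0"
    by (rule test_functionsE[OF \<phi>]) blast
  let ?g = "\<lambda>y. (1 / c) *\<^sub>R (y - t)"
  have inv: "t + c *\<^sub>R ?g y = y" "?g (t + c *\<^sub>R y) = y" for y using c by auto
  show "(\<lambda>x. \<phi> (t + c *\<^sub>R x)) \<in> test_functions {x. t + c *\<^sub>R x \<in> \<Omega>}"
  proof (rule test_functionsI[of _ "?g ` K"])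
    show "C_k k (\<lambda>x. \<phi> (t + c *\<^sub>R x))" for k by (rule C_k_comp_affine[OF test_functions_C_k[OF \<phi>] lin])
    show "compact (?g ` K)" by (intro compact_continuous_image K continuous_intros)
    show "?g ` K \<subseteq> {x. t + c *\<^sub>R x \<in> \<Omega>}" using K(2) inv(1) by auto
    show "\<phi> (t + c *\<^sub>R x) = 0" if "x \<notin> ?g ` K" for x
      using that inv(2)[of x] by (intro K(3)) force
  qed
  have mass: "L2_mass (\<lambda>x. \<psi> (t + c *\<^sub>R x)) = L2_mass \<psi> / c ^ DIM('a)" if "\<psi> \<in> test_functions \<Omega>" for \<psi> :: "'a \<Rightarrow> complex"
  proof -
    have [measurable]: "\<psi> \<in> borel_measurable borel" by (rule borel_measurable_continuous_onI[OF test_functions_continuous[OF that]])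
    show ?thesis unfolding L2_mass_def by (rule integral_lborel_affine[OF c, of "\<lambda>x. (cmod (\<psi> x))\<^sup>2"]) measurable
  qed
  show "L2_mass (\<lambda>x. \<phi> (t + c *\<^sub>R x)) = L2_mass \<phi> / c ^ DIM('a)" by (rule mass[OF \<phi>])
  have "L2_mass (partial_deriv i (\<lambda>x. \<phi> (t + c *\<^sub>R x))) = c\<^sup>2 * L2_mass (partial_deriv i \<phi>) / c ^ DIM('a)" if i: "i \<in> Basis" for i
  proof -
    have "partial_deriv i (\<lambda>x. \<phi> (t + c *\<^sub>R x)) x = of_real c * partial_deriv i \<phi> (t + c *\<^sub>R x)" for x
    proof -
      have D: "\<phi> differentiable (at (t + c *\<^sub>R x))" by (rule test_functions_differentiable[OF \<phi>])
      have "linear (frechet_derivative \<phi> (at (t + c *\<^sub>R x)))"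
        using D by (intro has_derivative_linear) (simp add: frechet_derivative_works)
      then show ?thesis
        using partial_deriv_affine[OF D lin, of i] by (simp add: partial_deriv_def linear_cmul scaleR_conv_of_real)
    qed
    then have "L2_mass (partial_deriv i (\<lambda>x. \<phi> (t + c *\<^sub>R x))) = L2_mass (\<lambda>x. of_real c * partial_deriv i \<phi> (t + c *\<^sub>R x))"
      by presburger
    also have "\<dots> = c\<^sup>2 * L2_mass (\<lambda>x. partial_deriv i \<phi> (t + c *\<^sub>R x))"
      by (simp add: L2_mass_def norm_mult power_mult_distrib)
    also have "\<dots> = c\<^sup>2 * L2_mass (partial_deriv i \<phi>) / c ^ DIM('a)"
      by (simp add: mass[OF test_functions_partial_deriv[OF \<phi> i]])
    finally show ?thesis .
  qed
  then show "dirichlet_energy (\<lambda>x. \<phi> (t + c *\<^sub>R x)) = c\<^sup>2 * dirichlet_energy \<phi> / c ^ DIM('a)"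
    by (simp add: dirichlet_energy_def L2_mass_def sum_distrib_left sum_divide_distrib)
qed

lemma norm_sum_disjoint:
  fixes z :: "nat \<Rightarrow> complex"
  assumes "\<And>i j. i < N \<Longrightarrow> j < N \<Longrightarrow> i \<noteq> j \<Longrightarrow> z i = 0 \<or> z j = 0"
  shows "(cmod (\<Sum>i<N. c i * z i))\<^sup>2 = (\<Sum>i<N. (cmod (c i))\<^sup>2 * (cmod (z i))\<^sup>2)"
proof (cases "\<exists>i<N. z i \<noteq> 0")
  case True
  then obtain i where i: "i < N" "z i \<noteq> 0" by blast
  then have 0: "z j = 0" if "j < N" "j \<noteq> i" for j using assms[OF i(1) that(1)] that by auto
  have "(\<Sum>j<N. c j * z j) = (\<Sum>j<N. if j = i then c i * z i else 0)" by (intro sum.cong) (auto simp: 0)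
  moreover have "(\<Sum>j<N. (cmod (c j))\<^sup>2 * (cmod (z j))\<^sup>2) = (\<Sum>j<N. if j = i then (cmod (c i))\<^sup>2 * (cmod (z i))\<^sup>2 else 0)"
    by (intro sum.cong) (auto simp: 0)
  ultimately show ?thesis using i(1) by (simp add: norm_mult power_mult_distrib)
qed auto

lemma partial_deriv_sum:
  fixes f :: "nat \<Rightarrow> 'a::euclidean_space \<Rightarrow> complex"
  assumes "\<And>j. j < N \<Longrightarrow> f j differentiable (at x)"
  shows "partial_deriv b (\<lambda>x. \<Sum>j<N. c j * f j x) x = (\<Sum>j<N. c j * partial_deriv b (f j) x)"
proof (rule partial_deriv_eqI)
  have "(f j has_derivative frechet_derivative (f j) (at x)) (at x)" if "j < N" for j
    using assms[OF that] by (simp add: frechet_derivative_works)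
  then show "((\<lambda>x. \<Sum>j<N. c j * f j x) has_derivative (\<lambda>b. \<Sum>j<N. c j * partial_deriv b (f j) x)) (at x)"
    unfolding partial_deriv_def by (intro has_derivative_sum has_derivative_mult_right) auto
qed

text \<open>Disjoint supports leave no cross terms, neither in the functions nor in their
  derivatives. Both forms are diagonal in the coefficients, so a common bound for the quotients
  passes to the span.\<close>

lemma L2_mass_disjoint:
  fixes f :: "nat \<Rightarrow> 'a::euclidean_space \<Rightarrow> complex"
  assumes f: "\<And>j. j < N \<Longrightarrow> f j \<in> test_functions (I j)"
    and dis: "\<And>i j. i < N \<Longrightarrow> j < N \<Longrightarrow> i \<noteq> j \<Longrightarrow> I i \<inter> I j = {}"
  shows "L2_mass (\<lambda>x. \<Sum>j<N. c j * f j x) = (\<Sum>j<N. (cmod (c j))\<^sup>2 * L2_mass (f j))"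
    and "dirichlet_energy (\<lambda>x. \<Sum>j<N. c j * f j x) = (\<Sum>j<N. (cmod (c j))\<^sup>2 * dirichlet_energy (f j))"
proof -
  have mass: "L2_mass (\<lambda>x. \<Sum>j<N. c j * g j x) = (\<Sum>j<N. (cmod (c j))\<^sup>2 * L2_mass (g j))"
    if g: "\<And>j. j < N \<Longrightarrow> g j \<in> test_functions (I j)" for g
  proof -
    have i: "integrable lborel (\<lambda>x. (cmod (g j x))\<^sup>2)" if "j < N" for j
      by (rule compactly_supported_integrable[OF compactly_supported_norm_sq[OF test_functions_compactly_supported[OF g[OF that]]]])
    have "(cmod (\<Sum>j<N. c j * g j x))\<^sup>2 = (\<Sum>j<N. (cmod (c j))\<^sup>2 * (cmod (g j x))\<^sup>2)" for x
    proof (rule norm_sum_disjoint)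
      fix i j assume ij: "i < N" "j < N" "i \<noteq> j"
      have "x \<notin> I i \<or> x \<notin> I j" using dis[OF ij] by blast
      then show "g i x = 0 \<or> g j x = 0" using test_functions_vanish[OF g] ij by blast
    qed
    then show ?thesis using i by (simp add: L2_mass_def)
  qed
  show "L2_mass (\<lambda>x. \<Sum>j<N. c j * f j x) = (\<Sum>j<N. (cmod (c j))\<^sup>2 * L2_mass (f j))" by (rule mass[OF f])
  have "L2_mass (partial_deriv b (\<lambda>x. \<Sum>j<N. c j * f j x)) = (\<Sum>j<N. (cmod (c j))\<^sup>2 * L2_mass (partial_deriv b (f j)))"
    if b: "b \<in> Basis" for b
  proof -
    have "partial_deriv b (\<lambda>x. \<Sum>j<N. c j * f j x) = (\<lambda>x. \<Sum>j<N. c j * partial_deriv b (f j) x)"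
      by (intro ext partial_deriv_sum test_functions_differentiable[OF f])
    then show ?thesis using mass[OF test_functions_partial_deriv[OF f b]] by simp
  qed
  then have "(\<Sum>b\<in>Basis. L2_mass (partial_deriv b (\<lambda>x. \<Sum>j<N. c j * f j x)))
      = (\<Sum>j<N. (cmod (c j))\<^sup>2 * (\<Sum>b\<in>Basis. L2_mass (partial_deriv b (f j))))"
    by (simp add: sum_distrib_left sum.swap[of _ Basis])
  then show "dirichlet_energy (\<lambda>x. \<Sum>j<N. c j * f j x) = (\<Sum>j<N. (cmod (c j))\<^sup>2 * dirichlet_energy (f j))"
    by (simp add: dirichlet_energy_def L2_mass_def)
qed

section \<open>The bound state of the planar cross\<close>

lemma smooth_step_derivative:
  obtains s' S where "\<And>t. (smooth_step has_real_derivative s' t) (at t)" "continuous_on UNIV s'" "\<And>t. \<bar>s' t\<bar> \<le> S" "S > 0"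
proof -
  let ?f = "\<lambda>t. of_real (smooth_step t) :: complex"
  define s' where "s' t = Re (partial_deriv 1 ?f t)" for t
  have C: "C_k (Suc 0) ?f" by (rule C_k_smooth_step)
  then have d: "?f differentiable (at t)" for t by simp
  have D: "(smooth_step has_real_derivative s' t) (at t)" for t
  proof -
    have "((\<lambda>h. ?f (t + h *\<^sub>R 1)) has_vector_derivative partial_deriv 1 ?f t) (at 0)"
      by (rule has_derivative_partial_line[OF d])
    from bounded_linear.has_vector_derivative[OF bounded_linear_Re this]
    have "((\<lambda>h. smooth_step (h + t)) has_real_derivative s' t) (at 0)"
      by (simp add: has_real_derivative_iff_has_vector_derivative s'_def add.commute)
    then show ?thesis using DERIV_shift[of smooth_step "s' t" 0 t] by simp
  qed
  have c: "continuous_on UNIV s'" unfolding s'_def using C by (auto intro!: continuous_intros)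
  have zero: "s' t = 0" if "t \<notin> {0..1}" for t
  proof -
    have "((\<lambda>_. smooth_step t) has_real_derivative 0) (at t)" by simp
    moreover have "open (- {0..1::real})" "t \<in> - {0..1}" using that by auto
    moreover have "open (if t < 0 then {..<0} else {1<..} :: real set)" "t \<in> (if t < 0 then {..<0} else {1<..})" using that by auto
    moreover have "smooth_step t = smooth_step x" if "x \<in> (if t < 0 then {..<0} else {1<..})" for x
      using that \<open>t \<notin> {0..1}\<close> by (auto simp: smooth_step_zero smooth_step_one split: if_splits)
    ultimately have "(smooth_step has_real_derivative 0) (at t)"
      using has_field_derivative_transform_within_open by blast
    then show ?thesis using D DERIV_unique by blast
  qed
  have "compact (s' ` {0..1})" by (intro compact_continuous_image continuous_on_subset[OF c]) auto
  then obtain S where S: "\<forall>y\<in>s' ` {0..1}. norm y \<le> S" using compact_imp_bounded bounded_iff by metis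
  have "\<bar>s' t\<bar> \<le> \<bar>S\<bar> + 1" for t
  proof (cases "t \<in> {0..1}")
    case True
    then have "\<bar>s' t\<bar> \<le> S" using S by auto
    then show ?thesis by linarith
  next
    case False
    then show ?thesis using zero[of t] by simp
  qed
  then show thesis using that[OF D c, of "\<bar>S\<bar> + 1"] by simp
qed

lemma smooth_bump_derivative:
  obtains S where "S > 0" "\<And>n a b. n > 0 \<Longrightarrow> \<exists>d. continuous_on UNIV d \<and> (\<forall>t. (smooth_bump n a b has_real_derivative d t) (at t)) \<and> (\<forall>t. \<bar>d t\<bar> \<le> n * S)"
proof -
  obtain s' S where s: "\<And>t. (smooth_step has_real_derivative s' t) (at t)" "continuous_on UNIV s'" "\<And>t. \<bar>s' t\<bar> \<le> S" "S > 0"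
    using smooth_step_derivative by metis
  have cs: "continuous_on UNIV smooth_step" by (intro continuous_at_imp_continuous_on ballI DERIV_isCont[OF s(1)])
  have "\<exists>d. continuous_on UNIV d \<and> (\<forall>t. (smooth_bump n a b has_real_derivative d t) (at t)) \<and> (\<forall>t. \<bar>d t\<bar> \<le> n * (2 * S))"
    if n: "n > 0" for n a b
  proof -
    define d where "d t = (s' (n * (t - a)) * n) * smooth_step (n * (b - t)) + (s' (n * (b - t)) * (- n)) * smooth_step (n * (t - a))" for t
    have "(smooth_bump n a b has_real_derivative d t) (at t)" for t
    proof -
      have 1: "((\<lambda>t. smooth_step (n * (t - a))) has_real_derivative s' (n * (t - a)) * n) (at t)"
        by (rule DERIV_chain2[OF s(1)]) (auto intro!: derivative_eq_intros)
      have 2: "((\<lambda>t. smooth_step (n * (b - t))) has_real_derivative s' (n * (b - t)) * (- n)) (at t)"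
        by (rule DERIV_chain2[OF s(1)]) (auto intro!: derivative_eq_intros)
      show ?thesis using DERIV_mult[OF 1 2] by (simp add: smooth_bump_def[abs_def] d_def)
    qed
    moreover have "continuous_on UNIV d" unfolding d_def
      by (intro continuous_intros continuous_on_compose2[OF s(2)] continuous_on_compose2[OF cs]) auto
    moreover have "\<bar>d t\<bar> \<le> n * (2 * S)" for t
    proof -
      have *: "\<bar>(s' x * m) * smooth_step y\<bar> \<le> S * n" if "\<bar>m\<bar> = n" for x y m
      proof -
        have "\<bar>(s' x * m) * smooth_step y\<bar> = \<bar>s' x\<bar> * n * smooth_step y"
          using that n smooth_step_nonneg[of y] by (simp add: abs_mult)
        also have "\<dots> \<le> S * n * 1"
          using s(3)[of x] s(4) n smooth_step_nonneg[of y] smooth_step_le_one[of y] by (intro mult_mono) auto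
        finally show ?thesis by simp
      qed
      have "\<bar>d t\<bar> \<le> S * n + S * n" unfolding d_def
        by (rule order_trans[OF abs_triangle_ineq add_mono[OF * *]]) (use n in auto)
      then show ?thesis by (simp add: mult.commute mult.left_commute)
    qed
    ultimately show ?thesis by blast
  qed
  then show thesis using that[of "2 * S"] s(4) by simp
qed

section \<open>One-dimensional profiles and the symmetric trial function on the planar cross\<close>

definition smooth_real :: "real set \<Rightarrow> (real \<Rightarrow> real) \<Rightarrow> bool" where
  "smooth_real I f \<longleftrightarrow> (\<lambda>t. of_real (f t)) \<in> test_functions I"

lemma smooth_real_deriv:
  assumes f: "smooth_real I f" and d: "\<And>t. (f has_real_derivative f' t) (at t)"
  shows "smooth_real I f'" "partial_deriv b (\<lambda>t. of_real (f t)) t = of_real b * of_real (f' t)"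
proof -
  have e: "partial_deriv b (\<lambda>t. of_real (f t)) t = of_real b * of_real (f' t)" for b t
    by (rule partial_deriv_real) (intro has_vector_derivative_of_real d)
  then show "partial_deriv b (\<lambda>t. of_real (f t)) t = of_real b * of_real (f' t)" .
  have "partial_deriv 1 (\<lambda>t. complex_of_real (f t)) = (\<lambda>t. of_real (f' t))" by (rule ext) (simp add: e)
  then show "smooth_real I f'"
    using test_functions_partial_deriv[OF f[unfolded smooth_real_def], of 1] by (simp add: smooth_real_def)
qed

lemma smooth_real_compactly_supported:
  assumes "smooth_real I f"
  shows "compactly_supported I f"
proof -
  obtain K where K: "compact K" "K \<subseteq> I" "\<And>x. x \<notin> K \<Longrightarrow> of_real (f x) = (0::complex)"
    by (rule test_functionsE[OF assms[unfolded smooth_real_def]]) blast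
  have "continuous_on UNIV (\<lambda>t. Re (of_real (f t)))"
    by (intro continuous_on_Re test_functions_continuous[OF assms[unfolded smooth_real_def]])
  then show ?thesis unfolding compactly_supported_def using K by auto
qed

lemma compactly_supported_mult_real:
  fixes f g :: "'a::euclidean_space \<Rightarrow> real"
  assumes "compactly_supported \<Omega> f" "continuous_on UNIV g"
  shows "compactly_supported \<Omega> (\<lambda>x. f x * g x)"
proof -
  obtain K where "compact K" "K \<subseteq> \<Omega>" "\<forall>x. x \<notin> K \<longrightarrow> f x = 0" "continuous_on UNIV f"
    using assms(1) unfolding compactly_supported_def by blast
  then show ?thesis unfolding compactly_supported_def using assms(2)
    by (intro conjI exI[of _ K]) (auto intro!: continuous_intros)
qed

lemma compactly_supported_UNIV: "compactly_supported I f \<Longrightarrow> compactly_supported UNIV f"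
  by (auto simp: compactly_supported_def)

lemma integral_sum_of_tensors:
  fixes u v w z :: "real \<Rightarrow> real"
  assumes c: "compactly_supported UNIV u" "compactly_supported UNIV v" "compactly_supported UNIV w" "compactly_supported UNIV z"
  shows "(LINT x|lborel. (u ((x::real^2)$1) * v (x$2) + w (x$1) * z (x$2))\<^sup>2 :: real)
    = (LINT t|lborel. (u t)\<^sup>2) * (LINT t|lborel. (v t)\<^sup>2) + (LINT t|lborel. (w t)\<^sup>2) * (LINT t|lborel. (z t)\<^sup>2)
      + 2 * ((LINT t|lborel. u t * w t) * (LINT t|lborel. v t * z t))"
proof -
  have PQ: "vec2_of (p, t) $ 1 = p" "vec2_of (p, t) $ 2 = t" for p t by (auto simp: vec2_of_def)
  have m: "(\<lambda>x::real^2. x$1) \<in> borel_measurable borel" "(\<lambda>x::real^2. x$2) \<in> borel_measurable borel"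
    by (intro borel_measurable_continuous_onI continuous_intros)+
  have cm: "compactly_supported UNIV (\<lambda>t. f t * g t)" if "compactly_supported UNIV f" "compactly_supported UNIV g" for f g :: "real \<Rightarrow> real"
    using compactly_supported_mult_real[OF that(1)] that(2) by (auto simp: compactly_supported_def)
  note I = integral_tensor[OF vec2_of_iso PQ m cm cm]
  have e: "(u (x$1) * v (x$2) + w (x$1) * z (x$2))\<^sup>2 = (u (x$1) * u (x$1)) * (v (x$2) * v (x$2)) + (w (x$1) * w (x$1)) * (z (x$2) * z (x$2))
      + 2 * ((u (x$1) * w (x$1)) * (v (x$2) * z (x$2)))" for x :: "real^2"
    by (simp add: power2_eq_square algebra_simps)
  show ?thesis unfolding e
    using I[OF c(1) c(1) c(2) c(2)] I[OF c(3) c(3) c(4) c(4)] I[OF c(1) c(3) c(2) c(4)]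
    by (simp add: power2_eq_square)
qed

text \<open>f is to be a transverse ground state and g a long plateau, so each product describes a
  wave along one strip. The overlap of the two at the crossing adds twice the square of the integral
  of f g to the mass, but nothing to the energy, as f' g' = 0. This surplus of mass pushes the
  quotient below pi^2.\<close>

lemma symmetric_trial_function:
  fixes f g f' g' :: "real \<Rightarrow> real"
  assumes f: "smooth_real {-1/2<..<1/2} f" "\<And>t. (f has_real_derivative f' t) (at t)"
    and g: "smooth_real UNIV g" "\<And>t. (g has_real_derivative g' t) (at t)"
    and g0: "\<And>t. f' t * g' t = 0"
  defines "\<phi> \<equiv> (\<lambda>x::real^2. of_real (f (x$1) * g (x$2) + g (x$1) * f (x$2)))"
  shows "\<phi> \<in> test_functions planar_cross"
    and "L2_mass \<phi> = 2 * ((LINT t|lborel. (f t)\<^sup>2) * (LINT t|lborel. (g t)\<^sup>2)) + 2 * (LINT t|lborel. f t * g t)\<^sup>2"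
    and "dirichlet_energy \<phi> = 2 * ((LINT t|lborel. (f' t)\<^sup>2) * (LINT t|lborel. (g t)\<^sup>2) + (LINT t|lborel. (f t)\<^sup>2) * (LINT t|lborel. (g' t)\<^sup>2))"
proof -
  let ?f = "\<lambda>t. of_real (f t) :: complex" and ?g = "\<lambda>t. of_real (g t) :: complex"
  have lin: "linear (\<lambda>x::real^2. x$i)" for i by (simp add: linear_iff)
  have tf: "?f \<in> test_functions {-1/2<..<1/2}" and tg: "?g \<in> test_functions UNIV" using f(1) g(1) by (auto simp: smooth_real_def)
  have PQ: "vec2_of (p, t) $ 1 = p" "vec2_of (p, t) $ 2 = t" "vec2_of (x$1, x$2) = x" for p t x
    by (auto simp: vec2_of_def vec_eq_iff forall_2)
  have t1: "(\<lambda>x::real^2. ?f (x$1) * ?g (x$2)) \<in> test_functions planar_cross"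
    by (rule tensor_test_function(1)[OF vec2_of_iso PQ lin lin tf tg]) (auto simp: planar_cross_def vec2_of_def abs_less_iff)
  have t2: "(\<lambda>x::real^2. ?g (x$1) * ?f (x$2)) \<in> test_functions planar_cross"
    by (rule tensor_test_function(1)[OF vec2_of_iso PQ lin lin tg tf]) (auto simp: planar_cross_def vec2_of_def abs_less_iff)
  show "\<phi> \<in> test_functions planar_cross"
    unfolding \<phi>_def using test_functions_lin[OF t1 t2, of 1 1] by simp
  have cs: "compactly_supported UNIV f" "compactly_supported UNIV g" "compactly_supported UNIV f'" "compactly_supported UNIV g'"
    using smooth_real_compactly_supported[OF f(1)] smooth_real_compactly_supported[OF g(1)]
      smooth_real_compactly_supported[OF smooth_real_deriv(1)[OF f]] smooth_real_compactly_supported[OF smooth_real_deriv(1)[OF g]]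
    by (auto intro: compactly_supported_UNIV)
  have "L2_mass \<phi> = (LINT x|lborel. (f ((x::real^2)$1) * g (x$2) + g (x$1) * f (x$2))\<^sup>2 :: real)"
    by (simp add: L2_mass_def \<phi>_def del: of_real_add of_real_mult)
  also have "\<dots> = 2 * ((LINT t|lborel. (f t)\<^sup>2) * (LINT t|lborel. (g t)\<^sup>2)) + 2 * (LINT t|lborel. f t * g t)\<^sup>2"
    unfolding integral_sum_of_tensors[OF cs(1,2,2,1)] by (simp add: power2_eq_square mult.commute)
  finally show "L2_mass \<phi> = 2 * ((LINT t|lborel. (f t)\<^sup>2) * (LINT t|lborel. (g t)\<^sup>2)) + 2 * (LINT t|lborel. f t * g t)\<^sup>2" .
  have df: "(f has_derivative (\<lambda>h. h * f' t)) (at t)" and dg: "(g has_derivative (\<lambda>h. h * g' t)) (at t)" for t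
    using f(2)[of t] g(2)[of t] by (simp_all add: has_field_derivative_def mult.commute[of _ "f' t"] mult.commute[of _ "g' t"])
  have comp: "((\<lambda>x::real^2. h (x$i)) has_derivative (\<lambda>v. v$i * h' (x$i))) (at x)"
    if "\<And>t. (h has_derivative (\<lambda>v. v * h' t)) (at t)" for h h' i and x :: "real^2"
    by (rule has_derivative_compose[OF _ that]) (rule bounded_linear_imp_has_derivative, rule bounded_linear_vec_nth)
  have d: "(\<phi> has_derivative (\<lambda>v. of_real (f (x$1) * (v$2 * g' (x$2)) + (v$1 * f' (x$1)) * g (x$2)
      + (g (x$1) * (v$2 * f' (x$2)) + (v$1 * g' (x$1)) * f (x$2))))) (at x)" for x
    unfolding \<phi>_def
    by (intro has_derivative_of_real has_derivative_add has_derivative_mult comp df dg)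
  have d1: "partial_deriv (axis 1 1) \<phi> x = of_real (f' (x$1) * g (x$2) + g' (x$1) * f (x$2))" for x
    using partial_deriv_eqI[OF d, of "axis 1 1" x] by (simp add: axis_def)
  have d2: "partial_deriv (axis 2 1) \<phi> x = of_real (f (x$1) * g' (x$2) + g (x$1) * f' (x$2))" for x
    using partial_deriv_eqI[OF d, of "axis 2 1" x] by (simp add: axis_def)
  have z: "(LINT t|lborel. f' t * g' t) = 0" "(LINT t|lborel. g' t * f' t) = 0"
  proof -
    have e: "(\<lambda>t. f' t * g' t) = (\<lambda>t. 0)" "(\<lambda>t. g' t * f' t) = (\<lambda>t. 0)" using g0 by (auto simp: fun_eq_iff)
    show "(LINT t|lborel. f' t * g' t) = 0" "(LINT t|lborel. g' t * f' t) = 0" unfolding e by simp_all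
  qed
  have "(LINT x|lborel. (cmod (partial_deriv (axis 1 1) \<phi> x))\<^sup>2) = (LINT x|lborel. (f' ((x::real^2)$1) * g (x$2) + g' (x$1) * f (x$2))\<^sup>2 :: real)"
    by (simp add: d1 del: of_real_add of_real_mult)
  also have "\<dots> = (LINT t|lborel. (f' t)\<^sup>2) * (LINT t|lborel. (g t)\<^sup>2) + (LINT t|lborel. (g' t)\<^sup>2) * (LINT t|lborel. (f t)\<^sup>2)"
    unfolding integral_sum_of_tensors[OF cs(3,2,4,1)] using z by simp
  finally have e1: "(LINT x|lborel. (cmod (partial_deriv (axis 1 1) \<phi> x))\<^sup>2)
     = (LINT t|lborel. (f' t)\<^sup>2) * (LINT t|lborel. (g t)\<^sup>2) + (LINT t|lborel. (g' t)\<^sup>2) * (LINT t|lborel. (f t)\<^sup>2)" .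
  have "(LINT x|lborel. (cmod (partial_deriv (axis 2 1) \<phi> x))\<^sup>2) = (LINT x|lborel. (f ((x::real^2)$1) * g' (x$2) + g (x$1) * f' (x$2))\<^sup>2 :: real)"
    by (simp add: d2 del: of_real_add of_real_mult)
  also have "\<dots> = (LINT t|lborel. (f t)\<^sup>2) * (LINT t|lborel. (g' t)\<^sup>2) + (LINT t|lborel. (g t)\<^sup>2) * (LINT t|lborel. (f' t)\<^sup>2)"
    unfolding integral_sum_of_tensors[OF cs(1,4,2,3)] using z by simp
  finally show "dirichlet_energy \<phi> = 2 * ((LINT t|lborel. (f' t)\<^sup>2) * (LINT t|lborel. (g t)\<^sup>2) + (LINT t|lborel. (f t)\<^sup>2) * (LINT t|lborel. (g' t)\<^sup>2))"
    unfolding dirichlet_energy_def sum_Basis_2 e1 by (simp add: mult.commute)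
qed

lemma integral_bounded_support_le:
  fixes f :: "real \<Rightarrow> real"
  assumes "compactly_supported UNIV f" "\<And>t. f t \<le> M" "\<And>t. t \<notin> {a..b} \<Longrightarrow> f t \<le> 0" "a \<le> b"
  shows "integral\<^sup>L lborel f \<le> M * (b - a)"
proof -
  have "integral\<^sup>L lborel f \<le> (LINT t|lborel. M * indicator {a..b} t)"
    using assms by (intro integral_mono compactly_supported_integrable[OF assms(1)] integrable_mult_right integrable_real_indicator)
       (auto simp: indicator_def)
  then show ?thesis using assms(4) by simp
qed

lemma plateau_function:
  assumes "\<epsilon> > 0"
  obtains g g' where "smooth_real UNIV g" "\<And>t. (g has_real_derivative g' t) (at t)" "\<And>t. \<bar>t\<bar> \<le> 1/2 \<Longrightarrow> g t = 1"
    "\<And>t. \<bar>t\<bar> < 1/2 \<Longrightarrow> g' t = 0" "(LINT t|lborel. (g' t)\<^sup>2) \<le> \<epsilon>"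
proof -
  obtain S where S: "S > 0" "\<And>n a b. n > 0 \<Longrightarrow> \<exists>d. continuous_on UNIV d \<and> (\<forall>t. (smooth_bump n a b has_real_derivative d t) (at t)) \<and> (\<forall>t. \<bar>d t\<bar> \<le> n * S)"
    using smooth_bump_derivative by metis
  \<comment> \<open>Both ramps have length L and slope at most S / L, so the energy is of order S^2
    / L; the choice makes the bound 3 S^2 / L at most \<epsilon>.\<close>
  define L where "L = max 1 (3 * S\<^sup>2 / \<epsilon>)"
  have L: "L \<ge> 1" "3 * S\<^sup>2 \<le> L * \<epsilon>" using assms by (auto simp: L_def max_def field_simps)
  define n a b where "n = 1 / L" and "a = - 1/2 - L" and "b = 1/2 + L"
  have n: "n > 0" using L by (simp add: n_def)
  let ?g = "smooth_bump n a b"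
  obtain d where d: "continuous_on UNIV d" "\<And>t. (?g has_real_derivative d t) (at t)" "\<And>t. \<bar>d t\<bar> \<le> n * S" using S(2)[OF n] by metis
  have sm: "smooth_real UNIV ?g" unfolding smooth_real_def
  proof (rule test_functionsI[of _ "{a..b}"])
    show "C_k k (\<lambda>t. of_real (?g t))" for k using smooth_bump_C_k[of k n a b "1::real"] by simp
    show "of_real (?g t) = (0::complex)" if "t \<notin> {a..b}" for t using that n by (auto simp: smooth_bump_zero)
  qed auto
  have one: "?g t = 1" if "\<bar>t\<bar> \<le> 1/2" for t
    using that L by (intro smooth_bump_one n) (auto simp: n_def a_def b_def abs_le_iff)
  have d0: "d t = 0" if t: "\<bar>t\<bar> < 1/2" for t
  proof -
    have "((\<lambda>_. 1) has_real_derivative 0) (at t)" by simp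
    then have "(?g has_real_derivative 0) (at t)"
      by (rule has_field_derivative_transform_within_open[of _ _ _ "{-1/2<..<1/2}"]) (use t one in \<open>auto simp: abs_less_iff\<close>)
    then show ?thesis using d(2) DERIV_unique by blast
  qed
  have dz: "d t = 0" if t: "t \<notin> {a..b}" for t
  proof -
    have "((\<lambda>_. 0) has_real_derivative 0) (at t)" by simp
    then have "(?g has_real_derivative 0) (at t)"
      by (rule has_field_derivative_transform_within_open[of _ _ _ "- {a..b}"]) (use t n in \<open>auto simp: smooth_bump_zero\<close>)
    then show ?thesis using d(2) DERIV_unique by blast
  qed
  have cd: "compactly_supported UNIV d"
    by (rule smooth_real_compactly_supported[OF smooth_real_deriv(1)[OF sm d(2)]])
  have "(LINT t|lborel. (d t)\<^sup>2) \<le> (n * S)\<^sup>2 * (b - a)"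
  proof (rule integral_bounded_support_le)
    show "compactly_supported UNIV (\<lambda>t. (d t)\<^sup>2)" unfolding power2_eq_square by (rule compactly_supported_mult_real[OF cd d(1)])
    show "(d t)\<^sup>2 \<le> (n * S)\<^sup>2" for t using d(3)[of t] by (metis abs_ge_zero power2_abs power_mono)
    show "(d t)\<^sup>2 \<le> 0" if "t \<notin> {a..b}" for t using dz[OF that] by simp
  qed (use L in \<open>simp add: a_def b_def\<close>)
  also have "\<dots> = S\<^sup>2 * (1 + 2 * L) / L\<^sup>2" by (simp add: n_def a_def b_def power_divide)
  also have "\<dots> \<le> S\<^sup>2 * (3 * L) / L\<^sup>2" using L by (intro divide_right_mono mult_left_mono) auto
  also have "\<dots> = 3 * S\<^sup>2 / L" using L by (simp add: power2_eq_square)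
  also have "\<dots> \<le> \<epsilon>" using L by (simp add: pos_divide_le_eq mult.commute)
  finally have "(LINT t|lborel. (d t)\<^sup>2) \<le> \<epsilon>" .
  then show thesis using that[OF sm d(2) one d0] by blast
qed

text \<open>On the interval cos (pi t) has quotient pi^2, but its support reaches the ends. After
  the cutoff by \<xi> the only error is the integral of the square of cos (pi t) times the slope of
  \<xi>. The slope is of order 1 / h on layers of width of order h, but there the cosine is of order
  h, so the integrand stays bounded and the error is O(h).\<close>

lemma cosine_cutoff:
  assumes "\<epsilon> > 0"
  obtains f f' where "smooth_real {-1/2<..<1/2} f" "\<And>t. (f has_real_derivative f' t) (at t)"
    "(LINT t|lborel. (f' t)\<^sup>2) - pi\<^sup>2 * (LINT t|lborel. (f t)\<^sup>2) \<le> \<epsilon>"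
    "(LINT t|lborel. (f t)\<^sup>2) \<le> 1" "1/8 \<le> (LINT t|lborel. f t)\<^sup>2"
proof -
  obtain S where S: "S > 0" "\<And>n a b. n > 0 \<Longrightarrow> \<exists>d. continuous_on UNIV d \<and> (\<forall>t. (smooth_bump n a b has_real_derivative d t) (at t)) \<and> (\<forall>t. \<bar>d t\<bar> \<le> n * S)"
    using smooth_bump_derivative by metis
  define K where "K = (2 * pi * S)\<^sup>2"
  have K: "K > 0" using S by (simp add: K_def)
  \<comment> \<open>The two layers have total length 4 h and the integrand there is at most
    \<open>K\<close>, so h \<le> \<epsilon> / (4 K) gives the error bound; h \<le> 1/8 keeps \<xi> =
    1 on |t| \<le> 1/4.\<close>
  define h where "h = min (1/8) (\<epsilon> / (4 * K))"
  have h: "h > 0" "h \<le> 1/8" "4 * h * K \<le> \<epsilon>"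
    using assms K by (auto simp: h_def min_def field_simps)
  define n a b where "n = 1 / h" and "a = - 1/2 + h" and "b = 1/2 - h"
  have n: "n > 0" using h by (simp add: n_def)
  define \<xi> where "\<xi> = smooth_bump n a b"
  obtain d where d: "continuous_on UNIV d" "\<And>t. (\<xi> has_real_derivative d t) (at t)" "\<And>t. \<bar>d t\<bar> \<le> n * S" using S(2)[OF n] unfolding \<xi>_def by metis
  have \<xi>r: "0 \<le> \<xi> t" "\<xi> t \<le> 1" for t by (auto simp: \<xi>_def smooth_bump_range)
  have \<xi>0: "\<xi> t = 0" if "t \<notin> {a<..<b}" for t using that n by (simp add: \<xi>_def smooth_bump_zero)
  have \<xi>1: "\<xi> t = 1" if "\<bar>t\<bar> \<le> 1/2 - 2 * h" for t
    unfolding \<xi>_def using that by (intro smooth_bump_one n) (auto simp: n_def a_def b_def abs_le_iff)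
  have \<xi>c: "continuous_on UNIV \<xi>" by (intro continuous_at_imp_continuous_on ballI DERIV_isCont[OF d(2)])
  define f where "f t = cos (pi * t) * \<xi> t" for t
  define f' where "f' t = - (pi * sin (pi * t)) * \<xi> t + cos (pi * t) * d t" for t
  have fd: "(f has_real_derivative f' t) (at t)" for t
  proof -
    have "((\<lambda>t. cos (pi * t)) has_real_derivative - (pi * sin (pi * t))) (at t)" by (auto intro!: derivative_eq_intros)
    from DERIV_mult[OF this d(2)] show ?thesis by (simp add: f_def[abs_def] f'_def algebra_simps)
  qed
  have Ck\<xi>: "C_k k (\<lambda>t. of_real (\<xi> t))" for k unfolding \<xi>_def using smooth_bump_C_k[of k n a b "1::real"] by simp
  have sm: "smooth_real {-1/2<..<1/2} f" unfolding smooth_real_def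
  proof (rule test_functionsI[of _ "{a..b}"])
    show "C_k k (\<lambda>t. of_real (f t))" for k unfolding f_def of_real_mult by (intro C_k_mult C_k_cos Ck\<xi>)
    show "of_real (f t) = (0::complex)" if "t \<notin> {a..b}" for t using that \<xi>0[of t] by (auto simp: f_def)
  qed (use h in \<open>auto simp: a_def b_def\<close>)
  have csf: "compactly_supported UNIV f" "compactly_supported UNIV f'"
    using smooth_real_compactly_supported[OF sm] smooth_real_compactly_supported[OF smooth_real_deriv(1)[OF sm fd]]
    by (auto intro: compactly_supported_UNIV)
  have csf2: "compactly_supported UNIV (\<lambda>t. (f t)\<^sup>2)" "compactly_supported UNIV (\<lambda>t. (f' t)\<^sup>2)"
    unfolding power2_eq_square
    by (intro compactly_supported_mult_real csf csf[unfolded compactly_supported_def, THEN conjunct1])+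
  text \<open>\<open>f'\<^sup>2 - pi\<^sup>2 f\<^sup>2 = G' + (cos (pi t) d t)\<^sup>2\<close> with \<open>G\<close> compactly supported.\<close>
  define G where "G t = - (pi * sin (pi * t)) * cos (pi * t) * (\<xi> t)\<^sup>2" for t
  define G' where "G' t = (f' t)\<^sup>2 - pi\<^sup>2 * (f t)\<^sup>2 - (cos (pi * t) * d t)\<^sup>2" for t
  have Gd: "(G has_real_derivative G' t) (at t)" for t
  proof -
    have s: "((\<lambda>t. - (pi * sin (pi * t)) * cos (pi * t)) has_real_derivative - (pi * (cos (pi * t) * pi)) * cos (pi * t) + (- sin (pi * t) * pi) * (- (pi * sin (pi * t)))) (at t)"
      by (rule DERIV_mult) (auto intro!: derivative_eq_intros)
    have x: "((\<lambda>t. (\<xi> t)\<^sup>2) has_real_derivative 2 * \<xi> t * d t) (at t)"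
      using DERIV_power[OF d(2)[of t], of 2] by (simp add: mult_ac)
    from DERIV_mult[OF s x] show ?thesis
      by (simp add: G_def[abs_def] G'_def f_def f'_def power2_eq_square algebra_simps)
  qed
  have smG: "smooth_real UNIV G" unfolding smooth_real_def
  proof (rule test_functionsI[of _ "{a..b}"])
    \<comment> \<open>The sine is written as a shifted cosine, so that \<open>C_k_cos\<close> covers
      it.\<close>
    have e: "complex_of_real (G t) = (of_real (- pi) * (of_real (cos (pi * t + (- pi/2))))) * (of_real (cos (pi * t)) * (of_real (\<xi> t) * of_real (\<xi> t)))" for t
      by (simp add: G_def power2_eq_square cos_diff flip: minus_divide_left)
    have "C_k k (\<lambda>t. complex_of_real (cos (pi * ((-1/2) + t))))" for k
      by (rule C_k_comp_affine[OF C_k_cos]) (simp add: linear_iff)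
    then have "C_k k (\<lambda>t. complex_of_real (cos (pi * t + (- pi/2))))" for k by (simp add: algebra_simps)
    then show "C_k k (\<lambda>t. of_real (G t))" for k unfolding e by (intro C_k_mult C_k_const C_k_cos Ck\<xi>)
    show "of_real (G t) = (0::complex)" if "t \<notin> {a..b}" for t using that \<xi>0[of t] by (auto simp: G_def)
  qed auto
  have G0: "(LINT t|lborel. G' t) = 0"
  proof -
    have "integral\<^sup>L lborel (partial_deriv 1 (\<lambda>t. complex_of_real (G t))) = 0"
      by (rule integral_partial_deriv) (use smG in \<open>simp_all add: smooth_real_def\<close>)
    moreover have "partial_deriv 1 (\<lambda>t. complex_of_real (G t)) = (\<lambda>t. of_real (G' t))"
      by (rule ext) (simp only: smooth_real_deriv(2)[OF smG Gd] of_real_1 mult_1_left)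
    ultimately have "complex_of_real (integral\<^sup>L lborel G') = 0" by (simp only: integral_complex_of_real[symmetric])
    then show ?thesis by (simp only: of_real_eq_0_iff)
  qed
  have csG': "compactly_supported UNIV G'" by (rule smooth_real_compactly_supported[OF smooth_real_deriv(1)[OF smG Gd]])
  define r where "r t = (cos (pi * t) * d t)\<^sup>2" for t
  have r_eq: "r t = (f' t)\<^sup>2 - pi\<^sup>2 * (f t)\<^sup>2 - G' t" for t by (simp add: r_def G'_def)
  have ir: "integrable lborel r"
    unfolding r_eq[abs_def]
    by (intro Bochner_Integration.integrable_diff integrable_mult_right compactly_supported_integrable[OF csf2(1)]
        compactly_supported_integrable[OF csf2(2)] compactly_supported_integrable[OF csG'])
  have ir_eq: "integral\<^sup>L lborel r = (LINT t|lborel. (f' t)\<^sup>2) - pi\<^sup>2 * (LINT t|lborel. (f t)\<^sup>2)"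
    unfolding r_eq[abs_def]
    using compactly_supported_integrable[OF csf2(1)] compactly_supported_integrable[OF csf2(2)] compactly_supported_integrable[OF csG'] G0
    by simp
  have d0: "d t = 0" if "t \<in> U" "open U" "\<And>x. x \<in> U \<Longrightarrow> \<xi> x = k" for t U k
  proof -
    have "((\<lambda>_. k) has_real_derivative 0) (at t)" by simp
    then have "(\<xi> has_real_derivative 0) (at t)"
      by (rule has_field_derivative_transform_within_open[of _ _ _ U]) (use that in auto)
    then show ?thesis using d(2) DERIV_unique by blast
  qed
  have r_le: "r t \<le> K * (indicator {-1/2..-1/2+2*h} t + indicator {1/2-2*h..1/2} t)" for t
  proof (cases "t \<in> {-1/2..-1/2+2*h} \<union> {1/2-2*h..1/2}")
    case True
    have "\<bar>cos (pi * t)\<bar> \<le> 2 * pi * h"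
    proof -
      have *: "\<bar>cos (pi * s)\<bar> \<le> 2 * pi * h" if "1/2 - 2*h \<le> s" "s \<le> 1/2" for s
      proof -
        have "cos (pi * s) = sin (pi * (1/2 - s))" using sin_cos_eq[of "pi * (1/2 - s)"] by (simp add: algebra_simps)
        moreover have "\<bar>sin (pi * (1/2 - s))\<bar> \<le> \<bar>pi * (1/2 - s)\<bar>" by (rule abs_sin_x_le_abs_x)
        moreover have "\<bar>pi * (1/2 - s)\<bar> \<le> pi * (2 * h)" using that by (simp add: abs_mult)
        ultimately show ?thesis by simp
      qed
      show ?thesis using True *[of t] *[of "- t"] by auto
    qed
    then have "\<bar>cos (pi * t) * d t\<bar> \<le> (2 * pi * h) * (n * S)" unfolding abs_mult using d(3)[of t] h by (intro mult_mono) auto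
    also have "\<dots> = 2 * pi * S" using h by (simp add: n_def)
    finally have "\<bar>cos (pi * t) * d t\<bar>\<^sup>2 \<le> (2 * pi * S)\<^sup>2" by (intro power_mono) auto
    then have rK: "r t \<le> K" by (simp add: r_def K_def)
    have ind: "1 \<le> (indicator {-1/2..-1/2+2*h} t + indicator {1/2-2*h..1/2} t :: real)" using True by (auto simp: indicator_def)
    from ind have "K * 1 \<le> K * (indicator {-1/2..-1/2+2*h} t + indicator {1/2-2*h..1/2} t)"
      using K by (intro mult_left_mono) auto
    with rK show ?thesis by linarith
  next
    case False
    then have "t < -1/2 \<or> \<bar>t\<bar> < 1/2 - 2*h \<or> t > 1/2" by auto
    then have "d t = 0"
    proof (elim disjE)
      assume "t < -1/2"
      then show ?thesis using h by (intro d0[of t "{..<-1/2}" 0]) (auto intro!: \<xi>0 simp: a_def)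
    next
      assume "\<bar>t\<bar> < 1/2 - 2*h"
      then show ?thesis by (intro d0[of t "{- (1/2 - 2*h)<..<1/2 - 2*h}" 1]) (auto intro!: \<xi>1 simp: abs_less_iff)
    next
      assume "t > 1/2"
      then show ?thesis using h by (intro d0[of t "{1/2<..}" 0]) (auto intro!: \<xi>0 simp: b_def)
    qed
    then show ?thesis using K by (simp add: r_def)
  qed
  have "integral\<^sup>L lborel r \<le> (LINT t|lborel. K * (indicator {-1/2..-1/2+2*h} t + indicator {1/2-2*h..1/2} t))"
    by (intro integral_mono ir r_le integrable_mult_right Bochner_Integration.integrable_add integrable_real_indicator)
       (auto simp: emeasure_lborel_Icc_eq)
  also have "\<dots> = K * ((LINT t|lborel. indicator {-1/2..-1/2+2*h} t) + (LINT t|lborel. indicator {1/2-2*h..1/2} t))"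
    by (subst integral_mult_right_zero, subst Bochner_Integration.integral_add)
       (auto intro!: integrable_real_indicator simp: emeasure_lborel_Icc_eq)
  also have "\<dots> = K * (2 * h + 2 * h)" using h by simp
  also have "\<dots> \<le> \<epsilon>" using h(3) by (simp add: algebra_simps)
  finally have E: "(LINT t|lborel. (f' t)\<^sup>2) - pi\<^sup>2 * (LINT t|lborel. (f t)\<^sup>2) \<le> \<epsilon>" using ir_eq by simp
  have "\<bar>f t\<bar> \<le> 1" for t unfolding f_def abs_mult using \<xi>r[of t] by (intro mult_le_one) auto
  then have f2: "(f t)\<^sup>2 \<le> 1" for t by (simp add: abs_square_le_1)
  have "(LINT t|lborel. (f t)\<^sup>2) \<le> 1 * (1/2 - (-1/2))"
    by (rule integral_bounded_support_le[OF csf2(1) f2]) (use \<xi>0 h in \<open>auto simp: f_def a_def b_def\<close>)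
  then have M: "(LINT t|lborel. (f t)\<^sup>2) \<le> 1" by simp
  \<comment> \<open>On |t| \<le> 1/4 the cosine is at least sqrt 2 / 2 and \<xi> = 1, and f \<ge> 0
    elsewhere; so the integral is at least sqrt 2 / 4, whose square is 1/8.\<close>
  have "sqrt 2 / 2 * indicator {-1/4..1/4} t \<le> f t" for t
  proof (cases "\<bar>t\<bar> \<le> 1/4")
    case True
    have "cos (pi / 4) \<le> cos \<bar>pi * t\<bar>" using True by (intro cos_monotone_0_pi_le) (auto simp: abs_mult)
    then have "sqrt 2 / 2 \<le> cos (pi * t)" by (simp add: cos_45 cos_abs_real)
    moreover have "\<xi> t = 1" using True h by (intro \<xi>1) simp
    moreover have "t \<in> {-1/4..1/4}" using True by (auto simp: abs_le_iff)
    ultimately show ?thesis by (simp only: f_def indicator_simps mult_1_right)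
  next
    case False
    have "0 \<le> f t"
    proof (cases "\<bar>t\<bar> \<le> 1/2")
      case True
      then have "pi * \<bar>t\<bar> \<le> pi * (1/2)" by (intro mult_left_mono) auto
      then have "\<bar>pi * t\<bar> \<le> pi / 2" by (simp add: abs_mult)
      then have "0 \<le> cos (pi * t)" by (intro cos_ge_zero) linarith+
      then show ?thesis using \<xi>r[of t] by (simp add: f_def)
    next
      case False
      then have "\<xi> t = 0" using h by (intro \<xi>0) (auto simp: a_def b_def)
      then show ?thesis by (simp add: f_def)
    qed
    then show ?thesis using False by (auto simp: indicator_def)
  qed
  then have "(LINT t|lborel. sqrt 2 / 2 * indicator {-1/4..1/4::real} t) \<le> (LINT t|lborel. f t)"
    by (intro integral_mono compactly_supported_integrable[OF csf(1)] integrable_mult_right integrable_real_indicator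
        emeasure_compact_finite[OF compact_Icc]) auto
  then have "sqrt 2 / 4 \<le> (LINT t|lborel. f t)" by simp
  then have "(sqrt 2 / 4)\<^sup>2 \<le> (LINT t|lborel. f t)\<^sup>2" by (intro power_mono) auto
  then have I: "1/8 \<le> (LINT t|lborel. f t)\<^sup>2" by (simp add: power_divide)
  show thesis by (rule that[OF sm fd E M I])
qed

text \<open>The plateau g is fixed before f because the error of f is multiplied by the mass \<beta>
  of g. The energy minus pi^2 times the mass is then at most 2 (1/2 + 1/2 - pi^2 / 8), which is
  negative since pi > 3.\<close>

lemma planar_cross_trial:
  obtains \<phi> where "\<phi> \<in> test_functions planar_cross" "L2_mass \<phi> > 0" "dirichlet_energy \<phi> < pi\<^sup>2 * L2_mass \<phi>"
proof -
  obtain g g' where g: "smooth_real UNIV g" "\<And>t. (g has_real_derivative g' t) (at t)" "\<And>t. \<bar>t\<bar> \<le> 1/2 \<Longrightarrow> g t = 1"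
    "\<And>t. \<bar>t\<bar> < 1/2 \<Longrightarrow> g' t = 0" "(LINT t|lborel. (g' t)\<^sup>2) \<le> 1/2" using plateau_function[of "1/2"] by auto
  define \<beta> where "\<beta> = (LINT t|lborel. (g t)\<^sup>2)"
  have \<beta>: "\<beta> \<ge> 0" by (simp add: \<beta>_def)
  obtain f f' where f: "smooth_real {-1/2<..<1/2} f" "\<And>t. (f has_real_derivative f' t) (at t)"
    "(LINT t|lborel. (f' t)\<^sup>2) - pi\<^sup>2 * (LINT t|lborel. (f t)\<^sup>2) \<le> 1 / (2 * (\<beta> + 1))"
    "(LINT t|lborel. (f t)\<^sup>2) \<le> 1" "1/8 \<le> (LINT t|lborel. f t)\<^sup>2" using cosine_cutoff[of "1 / (2 * (\<beta> + 1))"] \<beta> by auto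
  have f0: "f t = 0" "f' t = 0" if "t \<notin> {-1/2<..<1/2}" for t
  proof -
    show "f t = 0" using test_functions_vanish[OF f(1)[unfolded smooth_real_def] that] by simp
    show "f' t = 0" using test_functions_vanish[OF smooth_real_deriv(1)[OF f(1,2), unfolded smooth_real_def] that] by simp
  qed
  have fg: "f' t * g' t = 0" and fg1: "f t * g t = f t" for t
  proof -
    have "t \<notin> {-1/2<..<1/2} \<or> \<bar>t\<bar> < 1/2" by auto
    then show "f' t * g' t = 0" "f t * g t = f t" using f0[of t] g(3,4)[of t] by auto
  qed
  let ?\<phi> = "\<lambda>x::real^2. of_real (f (x$1) * g (x$2) + g (x$1) * f (x$2)) :: complex"
  note T = symmetric_trial_function[OF f(1,2) g(1,2) fg]
  define \<alpha> \<alpha>' \<beta>' \<gamma> where "\<alpha> = (LINT t|lborel. (f t)\<^sup>2)" and "\<alpha>' = (LINT t|lborel. (f' t)\<^sup>2)"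
    and "\<beta>' = (LINT t|lborel. (g' t)\<^sup>2)" and "\<gamma> = (LINT t|lborel. f t)"
  have mass: "L2_mass ?\<phi> = 2 * (\<alpha> * \<beta>) + 2 * \<gamma>\<^sup>2" using T(2) by (simp add: fg1 \<alpha>_def \<beta>_def \<gamma>_def)
  have en: "dirichlet_energy ?\<phi> = 2 * (\<alpha>' * \<beta> + \<alpha> * \<beta>')" using T(3) by (simp add: \<alpha>_def \<alpha>'_def \<beta>_def \<beta>'_def)
  have \<alpha>: "0 \<le> \<alpha>" "\<alpha> \<le> 1" "0 \<le> \<beta>'" "\<beta>' \<le> 1/2" "1/8 \<le> \<gamma>\<^sup>2" using f g by (auto simp: \<alpha>_def \<beta>'_def \<gamma>_def)
  have "(\<alpha>' - pi\<^sup>2 * \<alpha>) * \<beta> \<le> 1 / (2 * (\<beta> + 1)) * \<beta>" using f(3) \<beta> by (intro mult_right_mono) (auto simp: \<alpha>_def \<alpha>'_def)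
  also have "\<dots> \<le> 1/2" using \<beta> by (simp add: field_simps)
  finally have 1: "\<alpha>' * \<beta> \<le> pi\<^sup>2 * (\<alpha> * \<beta>) + 1/2" by (simp add: algebra_simps)
  have "\<alpha> * \<beta>' \<le> 1 * (1/2)" using \<alpha> by (intro mult_mono) auto
  then have 2: "\<alpha> * \<beta>' \<le> 1/2" by simp
  have "3\<^sup>2 \<le> pi\<^sup>2" using pi_gt3 by (intro power_mono) auto
  then have "9 * (1/8) \<le> pi\<^sup>2 * \<gamma>\<^sup>2" using \<alpha>(5) by (intro mult_mono) auto
  then have 3: "1 < pi\<^sup>2 * \<gamma>\<^sup>2" by simp
  have "dirichlet_energy ?\<phi> < pi\<^sup>2 * L2_mass ?\<phi>"
    unfolding mass en using 1 2 3 by (simp add: distrib_left)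
  moreover have "L2_mass ?\<phi> > 0" unfolding mass using \<alpha> \<beta> by (intro add_nonneg_pos) auto
  ultimately show thesis using T(1) that by blast
qed

text \<open>Existence comes from the trial function, uniqueness from the single functional in
  \<open>planar_cross_domain\<close>, which bounds the number of eigenvalues by 1. Together they
  make the definite description denote.\<close>

lemma Lambda_Pi_eigenvalue: "Lambda_Pi \<in> discrete_spectrum planar_cross (pi\<^sup>2)"
proof -
  interpret P: dirichlet_domain planar_cross 1 cross_functional "pi\<^sup>2" "4/25" by (rule planar_cross_domain)
  obtain \<phi> where \<phi>: "\<phi> \<in> test_functions planar_cross" "L2_mass \<phi> > 0" "dirichlet_energy \<phi> < pi\<^sup>2 * L2_mass \<phi>"
    by (rule planar_cross_trial)
  define m where "m = dirichlet_energy \<phi> / L2_mass \<phi>"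
  have "dirichlet_energy \<phi> \<le> m * L2_mass \<phi>" "m < pi\<^sup>2" using \<phi>(2,3) by (auto simp: m_def pos_divide_less_eq)
  then obtain \<mu> where \<mu>: "\<mu> \<in> discrete_spectrum planar_cross (pi\<^sup>2)"
    using P.exists_eigenvalue_le[OF \<phi>(1,2)] by blast
  have "\<nu> = \<mu>" if "\<nu> \<in> discrete_spectrum planar_cross (pi\<^sup>2)" for \<nu>
    using P.discrete_spectrum_finite that \<mu> card_le_Suc0_iff_eq by (metis One_nat_def)
  then show ?thesis unfolding Lambda_Pi_def using \<mu> by (metis theI)
qed

section \<open>Slices\<close>

lemma mass_on_slices:
  fixes T :: "real \<times> 'b::euclidean_space \<Rightarrow> 'a::euclidean_space"
  assumes T: "coord_iso T" and \<phi>: "\<phi> \<in> test_functions \<Omega>" and S: "S \<in> sets borel"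
  shows "mass_on {x. x \<bullet> T (1, 0) \<in> S} \<phi> = (LINT s|lborel. indicator S s * L2_mass (\<lambda>p. \<phi> (T (s, p))))"
    and "integrable lborel (\<lambda>s. indicator S s * L2_mass (\<lambda>p. \<phi> (T (s, p))))"
proof -
  let ?A = "{x. x \<bullet> T (1, 0) \<in> S}"
  let ?f = "\<lambda>x. indicator ?A x * (cmod (\<phi> x))\<^sup>2"
  have "(\<lambda>x. x \<bullet> T (1, 0)) -` S \<in> sets borel"
    using measurable_sets[of "\<lambda>x. x \<bullet> T (1, 0)" borel borel S] S by simp
  then have A: "?A \<in> sets borel" by (simp add: vimage_def)
  note i = mass_on_integrable[OF \<phi> A]
  then have m: "?f \<in> borel_measurable borel" by (simp add: borel_measurable_integrable)
  have mem: "T (s, p) \<in> ?A \<longleftrightarrow> s \<in> S" for s p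
    using coord_iso_inner[OF T, of "(1, 0)" "(s, p)"] by (simp add: Basis_prod_def)
  have e: "?f (T (s, p)) = indicator S s * (cmod (\<phi> (T (s, p))))\<^sup>2" for s p
    by (simp only: indicator_def mem)
  have I: "integrable (lborel \<Otimes>\<^sub>M lborel) (\<lambda>z. ?f (T z))"
    using i unfolding coord_iso_integral(2)[OF T m] lborel_prod .
  have inner: "(LINT p|lborel. ?f (T (s, p))) = indicator S s * L2_mass (\<lambda>p. \<phi> (T (s, p)))" for s
    unfolding e by (simp add: L2_mass_def)
  have "mass_on ?A \<phi> = integral\<^sup>L (lborel \<Otimes>\<^sub>M lborel) (\<lambda>z. ?f (T z))"
    unfolding mass_on_def coord_iso_integral(1)[OF T m] lborel_prod ..
  also have "\<dots> = (LINT s|lborel. LINT p|lborel. ?f (T (s, p)))"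
    by (rule lborel_pair.integral_fst'[OF I, symmetric])
  finally show "mass_on ?A \<phi> = (LINT s|lborel. indicator S s * L2_mass (\<lambda>p. \<phi> (T (s, p))))"
    unfolding inner .
  show "integrable lborel (\<lambda>s. indicator S s * L2_mass (\<lambda>p. \<phi> (T (s, p))))"
    using lborel_pair.integrable_fst'[OF I] unfolding inner .
qed

text \<open>A crude constant is enough: the bound serves to show that the slices of a compact set
  are bounded.\<close>

lemma coord_iso_norm_le:
  fixes T :: "'b::euclidean_space \<Rightarrow> 'a::euclidean_space"
  assumes T: "coord_iso T"
  shows "norm z \<le> of_nat DIM('b) * norm (T z)"
proof -
  have "\<bar>z \<bullet> i\<bar> \<le> norm (T z)" if "i \<in> Basis" for i
  proof -
    have "T i \<in> Basis" using T that by (auto simp: coord_iso_def bij_betw_def)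
    then show ?thesis using Basis_le_norm[of "T i" "T z"] coord_iso_inner[OF T that] by simp
  qed
  then have "(\<Sum>i\<in>Basis. \<bar>z \<bullet> i\<bar>) \<le> (\<Sum>i\<in>(Basis :: 'b set). norm (T z))" by (rule sum_mono)
  then show ?thesis using norm_le_l1[of z] by simp
qed

lemma slice_test_function:
  fixes T :: "real \<times> 'b::euclidean_space \<Rightarrow> 'a::euclidean_space"
  assumes T: "coord_iso T" and \<phi>: "\<phi> \<in> test_functions \<Omega>" and sl: "\<And>p. T (s, p) \<in> \<Omega> \<Longrightarrow> p \<in> D"
  shows "(\<lambda>p. \<phi> (T (s, p))) \<in> test_functions D"
    and "partial_deriv v (\<lambda>p. \<phi> (T (s, p))) = (\<lambda>p. partial_deriv (T (0, v)) \<phi> (T (s, p)))"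
proof -
  have linT: "linear T" using T by (simp add: coord_iso_def)
  have lin: "linear (\<lambda>p. T (0, p))"
    using linear_add[OF linT, of "(0, _)" "(0, _)"] linear_cmul[OF linT, of _ "(0, _)"] by (intro linearI) auto
  have e: "T (s, 0) + T (0, p) = T (s, p)" for p using linear_add[OF linT, of "(s, 0)" "(0, p)"] by simp
  obtain K where K: "compact K" "K \<subseteq> \<Omega>" "\<And>x. x \<notin> K \<Longrightarrow> \<phi> x = 0"
    by (rule test_functionsE[OF \<phi>]) blast
  show "(\<lambda>p. \<phi> (T (s, p))) \<in> test_functions D"
  proof (rule test_functionsI[of _ "{p. T (s, p) \<in> K}"])
    show "C_k k (\<lambda>p. \<phi> (T (s, p)))" for k
      using C_k_comp_affine[OF test_functions_C_k[OF \<phi>] lin, of k "T (s, 0)"] unfolding e .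
    have cont: "continuous_on UNIV (\<lambda>p. T (s, p))"
    proof -
      have "continuous_on UNIV (\<lambda>p. T (s, 0) + T (0, p))"
        using lin by (intro continuous_intros linear_continuous_on) (simp add: linear_conv_bounded_linear)
      then show ?thesis unfolding e .
    qed
    have "closed {p. T (s, p) \<in> K}"
      using continuous_closed_vimage[OF compact_imp_closed[OF K(1)], of "\<lambda>p. T (s, p)"] cont
      by (simp add: vimage_def continuous_on_eq_continuous_at)
    moreover have "bounded {p. T (s, p) \<in> K}"
    proof -
      obtain B where B: "\<And>x. x \<in> K \<Longrightarrow> norm x \<le> B" using compact_imp_bounded[OF K(1)] by (auto simp: bounded_iff)
      have "norm p \<le> of_nat DIM(real \<times> 'b) * B" if "T (s, p) \<in> K" for p
      proof -
        have "norm p \<le> norm (s, p)" by (simp add: norm_Pair)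
        also have "\<dots> \<le> of_nat DIM(real \<times> 'b) * norm (T (s, p))" by (rule coord_iso_norm_le[OF T])
        also have "\<dots> \<le> of_nat DIM(real \<times> 'b) * B" by (intro mult_left_mono B that) simp
        finally show ?thesis .
      qed
      then show ?thesis by (auto simp: bounded_iff)
    qed
    ultimately show "compact {p. T (s, p) \<in> K}" by (simp add: compact_eq_bounded_closed)
    show "{p. T (s, p) \<in> K} \<subseteq> D" using K(2) sl by blast
  qed (use K(3) in auto)
  show "partial_deriv v (\<lambda>p. \<phi> (T (s, p))) = (\<lambda>p. partial_deriv (T (0, v)) \<phi> (T (s, p)))"
    using partial_deriv_affine[OF test_functions_differentiable[OF \<phi>] lin, of v "T (s, 0)"] unfolding e by (rule ext)
qed

text \<open>A slice of \<phi> at s in S is a test function of D, so the inequality for D holds on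
  every such slice, and Fubini integrates it over S. On the right there are only derivatives
  transverse to the axis T (1, 0).\<close>

lemma slice_poincare:
  fixes T :: "real \<times> 'b::euclidean_space \<Rightarrow> 'a::euclidean_space"
  assumes T: "coord_iso T" and \<phi>: "\<phi> \<in> test_functions \<Omega>" and S: "S \<in> sets borel"
    and c: "\<And>\<psi>. \<psi> \<in> test_functions D \<Longrightarrow> c * L2_mass \<psi> \<le> dirichlet_energy \<psi>"
    and sl: "\<And>s p. s \<in> S \<Longrightarrow> T (s, p) \<in> \<Omega> \<Longrightarrow> p \<in> D"
  shows "c * mass_on {x. x \<bullet> T (1, 0) \<in> S} \<phi> \<le> (\<Sum>i\<in>Basis. mass_on {x. x \<bullet> T (1, 0) \<in> S} (partial_deriv (T (0, i)) \<phi>))"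
proof -
  have B: "T (0, i) \<in> Basis" if "i \<in> Basis" for i
    using T that by (auto simp: coord_iso_def bij_betw_def Basis_prod_def)
  note M = mass_on_slices[OF T _ S]
  note D = M[OF test_functions_partial_deriv[OF \<phi> B]]
  have "c * mass_on {x. x \<bullet> T (1, 0) \<in> S} \<phi> = (LINT s|lborel. c * (indicator S s * L2_mass (\<lambda>p. \<phi> (T (s, p)))))"
    unfolding M(1)[OF \<phi>] by simp
  also have "\<dots> \<le> (LINT s|lborel. (\<Sum>i\<in>Basis. indicator S s * L2_mass (\<lambda>p. partial_deriv (T (0, i)) \<phi> (T (s, p)))))"
  proof (rule integral_mono)
    show "integrable lborel (\<lambda>s. c * (indicator S s * L2_mass (\<lambda>p. \<phi> (T (s, p)))))"
      by (intro integrable_mult_right M(2)[OF \<phi>])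
    show "integrable lborel (\<lambda>s. \<Sum>i\<in>Basis. indicator S s * L2_mass (\<lambda>p. partial_deriv (T (0, i)) \<phi> (T (s, p))))"
      by (intro Bochner_Integration.integrable_sum D(2))
    show "c * (indicator S s * L2_mass (\<lambda>p. \<phi> (T (s, p))))
        \<le> (\<Sum>i\<in>Basis. indicator S s * L2_mass (\<lambda>p. partial_deriv (T (0, i)) \<phi> (T (s, p))))" for s
    proof (cases "s \<in> S")
      case True
      have st: "(\<lambda>p. \<phi> (T (s, p))) \<in> test_functions D"
        by (rule slice_test_function(1)[OF T \<phi> sl[OF True]])
      have "dirichlet_energy (\<lambda>p. \<phi> (T (s, p))) = (\<Sum>i\<in>Basis. L2_mass (partial_deriv i (\<lambda>p. \<phi> (T (s, p)))))"
        by (simp add: dirichlet_energy_def L2_mass_def)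
      then show ?thesis using c[OF st] True by (simp add: slice_test_function(2)[OF T \<phi> sl[OF True]])
    qed simp
  qed
  also have "\<dots> = (\<Sum>i\<in>Basis. (LINT s|lborel. indicator S s * L2_mass (\<lambda>p. partial_deriv (T (0, i)) \<phi> (T (s, p)))))"
    by (intro Bochner_Integration.integral_sum D(2))
  also have "\<dots> = (\<Sum>i\<in>Basis. mass_on {x. x \<bullet> T (1, 0) \<in> S} (partial_deriv (T (0, i)) \<phi>))"
    by (intro sum.cong refl D(1)[symmetric])
  finally show ?thesis .
qed

section \<open>Cross-sections\<close>

text \<open>What the two sections share: the rhombus inside makes room for the trial functions; the
  unit square outside bounds \<open>lambda_dagger\<close> from below and confines the arms.\<close>

locale section_domain =
  fixes \<omega> :: "(real^2) set" and H :: real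
  assumes open_\<omega>: "open \<omega>" and rhombus: "omega_rhombus \<subseteq> \<omega>"
    and bounds: "p \<in> \<omega> \<Longrightarrow> \<bar>p$1\<bar> < 1/2 \<and> \<bar>p$2\<bar> < 1/2" and H_pos: "H > 0"
begin

lemma open_stretched: "open {x::real^'n. vector [x$i, inverse H * x$j] \<in> \<omega>}"
proof -
  have "linear (\<lambda>x::real^'n. vector [x$i, inverse H * x$j] :: real^2)"
    by (rule linearI) (auto simp: vec_eq_iff forall_2 algebra_simps)
  then have "continuous_on UNIV (\<lambda>x::real^'n. vector [x$i, inverse H * x$j] :: real^2)"
    by (simp add: linear_continuous_on linear_conv_bounded_linear)
  from open_vimage[OF open_\<omega> this] show ?thesis by (simp add: vimage_def)
qed

lemma stretched_bounds: "vector [a, inverse H * b] \<in> \<omega> \<Longrightarrow> \<bar>a\<bar> < 1/2 \<and> \<bar>b\<bar> < H/2"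
  using bounds[of "vector [a, inverse H * b]"] H_pos by (auto simp: abs_mult field_simps)

lemma lambda_dagger_ge: "pi\<^sup>2 + (pi / H)\<^sup>2 \<le> lambda_dagger \<omega> H"
  and section_poincare: "\<psi> \<in> test_functions (stretched_section \<omega> H) \<Longrightarrow> lambda_dagger \<omega> H * L2_mass \<psi> \<le> dirichlet_energy \<psi>"
proof -
  have o: "open (stretched_section \<omega> H)" unfolding stretched_section_def by (rule open_stretched)
  have "0 \<in> stretched_section \<omega> H" using rhombus by (auto simp: stretched_section_def omega_rhombus_def)
  then obtain \<phi> where \<phi>: "\<phi> \<in> test_functions (stretched_section \<omega> H)" "L2_mass \<phi> > 0"
    by (rule exists_test_function[OF o])
  have dom: "\<exists>k f. dirichlet_domain (stretched_section \<omega> H) k f \<theta> (pi\<^sup>2 + (pi / H)\<^sup>2)" if "\<theta> > 0" for \<theta>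
    using stretched_bounds by (intro bounded_section_domain[OF o _ H_pos that]) (auto simp: stretched_section_def)
  note V = first_eigenvalue_variational[OF dom \<phi>]
  show "pi\<^sup>2 + (pi / H)\<^sup>2 \<le> lambda_dagger \<omega> H" using V(1) by (simp add: lambda_dagger_def)
  show "lambda_dagger \<omega> H * L2_mass \<psi> \<le> dirichlet_energy \<psi>" if "\<psi> \<in> test_functions (stretched_section \<omega> H)"
    unfolding lambda_dagger_def by (rule V(2)[OF _ that])
qed

lemma lambda_dagger_gt: "pi\<^sup>2 < lambda_dagger \<omega> H"
proof -
  have "0 < (pi / H)\<^sup>2" using H_pos by simp
  then show ?thesis using lambda_dagger_ge by linarith
qed

end

section \<open>The rhombus and the disc as sections\<close>

lemma section_domain_rhombus: "H > 0 \<Longrightarrow> section_domain omega_rhombus H"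
proof
  show "open omega_rhombus" unfolding omega_rhombus_def by (intro open_Collect_less continuous_intros)
qed (auto simp: omega_rhombus_def)

lemma section_domain_disc: "H > 0 \<Longrightarrow> section_domain omega_disc H"
proof
  show "open omega_disc" unfolding omega_disc_def by (intro open_Collect_less continuous_intros)
  show "omega_rhombus \<subseteq> omega_disc"
  proof
    fix p :: "real^2" assume "p \<in> omega_rhombus"
    then have "(\<bar>p$1\<bar> + \<bar>p$2\<bar>)\<^sup>2 < (1/2)\<^sup>2" by (intro power_strict_mono) (auto simp: omega_rhombus_def)
    then have "\<bar>p$1\<bar>\<^sup>2 + \<bar>p$2\<bar>\<^sup>2 + 2 * \<bar>p$1\<bar> * \<bar>p$2\<bar> < 1/4" unfolding power2_sum power_divide by simp
    moreover have "0 \<le> 2 * \<bar>p$1\<bar> * \<bar>p$2\<bar>" by simp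
    ultimately have "\<bar>p$1\<bar>\<^sup>2 + \<bar>p$2\<bar>\<^sup>2 < 1/4" by linarith
    then show "p \<in> omega_disc" by (simp add: omega_disc_def)
  qed
  show "\<bar>p$1\<bar> < 1/2 \<and> \<bar>p$2\<bar> < 1/2" if "p \<in> omega_disc" for p
  proof -
    have "\<bar>p$1\<bar>\<^sup>2 + \<bar>p$2\<bar>\<^sup>2 < (1/2)\<^sup>2" using that by (simp add: omega_disc_def power_divide)
    then have "\<bar>p$1\<bar>\<^sup>2 < (1/2)\<^sup>2" "\<bar>p$2\<bar>\<^sup>2 < (1/2)\<^sup>2" using zero_le_power2[of "\<bar>p$1\<bar>"] zero_le_power2[of "\<bar>p$2\<bar>"]
      by linarith+
    then show ?thesis using power_less_imp_less_base[of "\<bar>p$1\<bar>" 2 "1/2"] power_less_imp_less_base[of "\<bar>p$2\<bar>" 2 "1/2"] by simp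
  qed
qed auto

section \<open>The spatial cross\<close>

text \<open>The first component is the axial variable of the arm and the second runs through its
  cross-section; \<open>layer\<close> singles out the vertical variable instead, for products of a
  planar function with a vertical profile.\<close>

definition arm_1 :: "real \<times> (real^2) \<Rightarrow> real^3" where "arm_1 z = vector [fst z, snd z $ 1, snd z $ 2]"
definition arm_2 :: "real \<times> (real^2) \<Rightarrow> real^3" where "arm_2 z = vector [snd z $ 1, fst z, snd z $ 2]"
definition layer :: "(real^2) \<times> real \<Rightarrow> real^3" where "layer z = vector [fst z $ 1, fst z $ 2, snd z]"

lemma arm_1_iso: "coord_iso arm_1"
proof (rule coord_isoI)
  show "linear arm_1" by (rule linearI) (auto simp: arm_1_def vec_eq_iff forall_3)
  show "arm_1 ` Basis = Basis"
    by (auto simp: Basis_3 Basis_2 Basis_prod_def arm_1_def vec_eq_iff forall_3 axis_def image_Un)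
qed simp

lemma arm_2_iso: "coord_iso arm_2"
proof (rule coord_isoI)
  show "linear arm_2" by (rule linearI) (auto simp: arm_2_def vec_eq_iff forall_3)
  show "arm_2 ` Basis = Basis"
    by (auto simp: Basis_3 Basis_2 Basis_prod_def arm_2_def vec_eq_iff forall_3 axis_def image_Un)
qed simp

lemma layer_iso: "coord_iso layer"
proof (rule coord_isoI)
  show "linear layer" by (rule linearI) (auto simp: layer_def vec_eq_iff forall_3)
  show "layer ` Basis = Basis"
    by (auto simp: Basis_3 Basis_2 Basis_prod_def layer_def vec_eq_iff forall_3 axis_def image_Un)
qed simp

context section_domain
begin

lemma open_cross: "open (cross_waveguide \<omega> H)"
  unfolding cross_waveguide_def waveguide_1_def waveguide_2_def by (intro open_Un open_stretched)

lemma cross_memD: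
  assumes "x \<in> cross_waveguide \<omega> H"
  shows "\<bar>x$1\<bar> < 1/2 \<or> \<bar>x$2\<bar> < 1/2" "\<bar>x$3\<bar> < H/2"
  using assms stretched_bounds by (auto simp: cross_waveguide_def waveguide_1_def waveguide_2_def)

text \<open>A point of the cross with |x_1| > 1/2 can only belong to \<open>waveguide_1\<close>,
  since \<open>waveguide_2\<close> confines x_1 to |x_1| < 1/2. Hence the slice at fixed x_1 lies in
  the stretched section, for which \<open>section_poincare\<close> has the constant
  \<open>lambda_dagger\<close>; likewise with the two indices exchanged.\<close>

lemma arm_inequality:
  assumes \<phi>: "\<phi> \<in> test_functions (cross_waveguide \<omega> H)"
  defines "lam \<equiv> lambda_dagger \<omega> H"
  shows "lam * mass_on {x. \<bar>x$1\<bar> > 1/2} \<phi> \<le> mass_on {x. \<bar>x$1\<bar> > 1/2} (partial_deriv (axis 2 1) \<phi>) + mass_on {x. \<bar>x$1\<bar> > 1/2} (partial_deriv (axis 3 1) \<phi>)"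
    and "lam * mass_on {x. \<bar>x$2\<bar> > 1/2} \<phi> \<le> mass_on {x. \<bar>x$2\<bar> > 1/2} (partial_deriv (axis 1 1) \<phi>) + mass_on {x. \<bar>x$2\<bar> > 1/2} (partial_deriv (axis 3 1) \<phi>)"
proof -
  let ?S = "{s::real. \<bar>s\<bar> > 1/2}"
  have S: "?S \<in> sets borel" by measurable
  have ax1: "arm_1 (1, 0) = axis 1 1" "arm_1 (0, axis 1 1) = axis 2 1" "arm_1 (0, axis 2 1) = axis 3 1"
    by (auto simp: arm_1_def vec_eq_iff forall_3 axis_def)
  have ax2: "arm_2 (1, 0) = axis 2 1" "arm_2 (0, axis 1 1) = axis 1 1" "arm_2 (0, axis 2 1) = axis 3 1"
    by (auto simp: arm_2_def vec_eq_iff forall_3 axis_def)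
  have "lam * mass_on {x. x \<bullet> arm_1 (1, 0) \<in> ?S} \<phi> \<le> (\<Sum>i\<in>Basis. mass_on {x. x \<bullet> arm_1 (1, 0) \<in> ?S} (partial_deriv (arm_1 (0, i)) \<phi>))"
    unfolding lam_def
  proof (rule slice_poincare[OF arm_1_iso \<phi> S section_poincare])
    show "p \<in> stretched_section \<omega> H" if "s \<in> ?S" "arm_1 (s, p) \<in> cross_waveguide \<omega> H" for s p
      using that stretched_bounds by (force simp: cross_waveguide_def waveguide_1_def waveguide_2_def stretched_section_def arm_1_def)
  qed
  then show "lam * mass_on {x. \<bar>x$1\<bar> > 1/2} \<phi> \<le> mass_on {x. \<bar>x$1\<bar> > 1/2} (partial_deriv (axis 2 1) \<phi>) + mass_on {x. \<bar>x$1\<bar> > 1/2} (partial_deriv (axis 3 1) \<phi>)"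
    by (simp add: sum_Basis_2 ax1 inner_axis)
  have "lam * mass_on {x. x \<bullet> arm_2 (1, 0) \<in> ?S} \<phi> \<le> (\<Sum>i\<in>Basis. mass_on {x. x \<bullet> arm_2 (1, 0) \<in> ?S} (partial_deriv (arm_2 (0, i)) \<phi>))"
    unfolding lam_def
  proof (rule slice_poincare[OF arm_2_iso \<phi> S section_poincare])
    show "p \<in> stretched_section \<omega> H" if "s \<in> ?S" "arm_2 (s, p) \<in> cross_waveguide \<omega> H" for s p
      using that stretched_bounds by (force simp: cross_waveguide_def waveguide_1_def waveguide_2_def stretched_section_def arm_2_def)
  qed
  then show "lam * mass_on {x. \<bar>x$2\<bar> > 1/2} \<phi> \<le> mass_on {x. \<bar>x$2\<bar> > 1/2} (partial_deriv (axis 1 1) \<phi>) + mass_on {x. \<bar>x$2\<bar> > 1/2} (partial_deriv (axis 3 1) \<phi>)"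
    by (simp add: sum_Basis_2 ax2 inner_axis)
qed

text \<open>The threshold is exactly the constant of the arms, and the bounded junction is paid for
  by finitely many functionals. The vertical derivative is used in the junction and in both pairs of
  arms, so these must not overlap on the support.\<close>

lemma cross_domain: "\<exists>k f. dirichlet_domain (cross_waveguide \<omega> H) k f (lambda_dagger \<omega> H) (4/25)"
proof -
  define lam where "lam = lambda_dagger \<omega> H"
  have lam: "lam > 0" using lambda_dagger_gt pi_gt_zero zero_le_power2[of pi] unfolding lam_def by linarith
  let ?B = "(\<chi> i. if i = 3 then H/2 else 1/2) :: real^3"
  let ?K = "cbox (- ?B) ?B"
  obtain fs where fs: "\<And>f. f \<in> set fs \<Longrightarrow> is_box_fn f"
    "\<And>\<phi>. \<phi> \<in> test_functions UNIV \<Longrightarrow> lam * mass_on ?K \<phi> \<le> energy_on ?K \<phi> + (\<Sum>f\<leftarrow>fs. (cmod (LINT x|lborel. \<phi> x * f x))\<^sup>2)"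
    using finite_functionals_3[OF lam, of "- ?B" ?B] by blast
  let ?e1 = "axis 1 1 :: real^3" and ?e2 = "axis 2 1 :: real^3" and ?e3 = "axis 3 1 :: real^3"
  have B: "?e1 \<in> Basis" "?e2 \<in> Basis" "?e3 \<in> Basis" "?e1 \<noteq> ?e2" by (auto simp: Basis_3 axis_eq_axis)
  let ?A1 = "{x :: real^3. \<bar>x$1\<bar> > 1/2}" and ?A2 = "{x :: real^3. \<bar>x$2\<bar> > 1/2}"
  have "open ?A1" "open ?A2" by (intro open_Collect_less continuous_intros)+
  then have m: "?A1 \<in> sets borel" "?A2 \<in> sets borel" "?K \<in> sets borel" by auto
  have K: "x \<in> ?K \<longleftrightarrow> \<bar>x$1\<bar> \<le> 1/2 \<and> \<bar>x$2\<bar> \<le> 1/2 \<and> \<bar>x$3\<bar> \<le> H/2" for x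
    by (auto simp: mem_box_cart forall_3 abs_le_iff)
  have "dirichlet_domain (cross_waveguide \<omega> H) (length fs) (\<lambda>i. fs ! i) lam (4/25)"
  proof (rule dirichlet_domainI[OF open_cross _ fs(1)])
    fix \<phi> assume \<phi>: "\<phi> \<in> test_functions (cross_waveguide \<omega> H)"
    note U = test_functions_UNIV[OF \<phi>]
    have van: "\<psi> x = 0" if "\<psi> \<in> test_functions (cross_waveguide \<omega> H)" "\<bar>x$1\<bar> \<ge> 1/2" "\<bar>x$2\<bar> \<ge> 1/2" for \<psi> x
      using cross_memD(1)[of x] that by (intro test_functions_vanish[OF that(1)]) auto
    show "4/25 * L2_mass \<phi> \<le> dirichlet_energy \<phi>"
      by (rule cross_coercive[OF U B(1,2,4)]) (use van[OF \<phi>] in \<open>auto simp: inner_axis\<close>)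
    note D = test_functions_partial_deriv[OF \<phi>]
    have 1: "L2_mass \<phi> \<le> mass_on ?K \<phi> + mass_on (?A1 \<union> ?A2) \<phi>"
      unfolding mass_on_UNIV(1)[symmetric]
    proof (rule mass_on_le_add[OF \<phi> m(3) sets.Un[OF m(1,2)]])
      show "x \<in> ?K \<union> (?A1 \<union> ?A2)" if "\<phi> x \<noteq> 0" for x
      proof -
        have "x \<in> cross_waveguide \<omega> H" using that test_functions_vanish[OF \<phi>] by blast
        then have "\<bar>x$3\<bar> < H/2" by (rule cross_memD)
        then show ?thesis unfolding Un_iff K mem_Collect_eq by linarith
      qed
    qed simp
    have 2: "mass_on (?A1 \<union> ?A2) \<phi> \<le> mass_on ?A1 \<phi> + mass_on ?A2 \<phi>"
      by (rule mass_on_le_add[OF \<phi> m(1,2) sets.Un[OF m(1,2)]])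
    have "lam * L2_mass \<phi> \<le> lam * (mass_on ?K \<phi> + mass_on ?A1 \<phi> + mass_on ?A2 \<phi>)"
      using 1 2 lam by (intro mult_left_mono) auto
    then have 3: "lam * L2_mass \<phi> \<le> lam * mass_on ?K \<phi> + lam * mass_on ?A1 \<phi> + lam * mass_on ?A2 \<phi>"
      by (simp add: distrib_left)
    have sub: "mass_on ?K \<psi> + mass_on S \<psi> \<le> L2_mass \<psi>"
      if "\<psi> \<in> test_functions (cross_waveguide \<omega> H)" "S \<in> sets borel" "S \<subseteq> ?A1 \<union> ?A2" for \<psi> S
      unfolding mass_on_UNIV(1)[symmetric]
    proof (rule mass_on_add_le[OF that(1) m(3) that(2)])
      have "indicator ?K x + indicator S x \<le> (indicator UNIV x :: real)" for x
      proof -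
        have "x \<in> ?K \<Longrightarrow> x \<notin> S" using that(3) unfolding K by fastforce
        then show ?thesis by (auto simp: indicator_def)
      qed
      then show "AE x in lborel. \<psi> x \<noteq> 0 \<longrightarrow> indicator ?K x + indicator S x \<le> (indicator UNIV x :: real)" by simp
    qed simp
    have 4: "mass_on ?K (partial_deriv ?e1 \<phi>) + mass_on ?A2 (partial_deriv ?e1 \<phi>) \<le> L2_mass (partial_deriv ?e1 \<phi>)"
      by (rule sub[OF D[OF B(1)] m(2)]) auto
    have 5: "mass_on ?K (partial_deriv ?e2 \<phi>) + mass_on ?A1 (partial_deriv ?e2 \<phi>) \<le> L2_mass (partial_deriv ?e2 \<phi>)"
      by (rule sub[OF D[OF B(2)] m(1)]) auto
    have 6: "mass_on ?K (partial_deriv ?e3 \<phi>) + mass_on (?A1 \<union> ?A2) (partial_deriv ?e3 \<phi>) \<le> L2_mass (partial_deriv ?e3 \<phi>)"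
      by (rule sub[OF D[OF B(3)] sets.Un[OF m(1,2)]]) auto
    \<comment> \<open>|x_1| > 1/2 and |x_2| > 1/2 hold together only outside the cross, where the
      derivative vanishes.\<close>
    have 7: "mass_on ?A1 (partial_deriv ?e3 \<phi>) + mass_on ?A2 (partial_deriv ?e3 \<phi>) \<le> mass_on (?A1 \<union> ?A2) (partial_deriv ?e3 \<phi>)"
    proof (rule mass_on_add_le[OF D[OF B(3)] m(1,2) sets.Un[OF m(1,2)]])
      have "indicator ?A1 x + indicator ?A2 x \<le> (indicator (?A1 \<union> ?A2) x :: real)" if "partial_deriv ?e3 \<phi> x \<noteq> 0" for x
      proof -
        have "\<not> (x \<in> ?A1 \<and> x \<in> ?A2)" using van[OF D[OF B(3)], of x] that by auto
        then show ?thesis by (auto simp: indicator_def)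
      qed
      then show "AE x in lborel. partial_deriv ?e3 \<phi> x \<noteq> 0 \<longrightarrow> indicator ?A1 x + indicator ?A2 x \<le> (indicator (?A1 \<union> ?A2) x :: real)"
        by simp
    qed
    have "dirichlet_energy \<phi> = L2_mass (partial_deriv ?e1 \<phi>) + L2_mass (partial_deriv ?e2 \<phi>) + L2_mass (partial_deriv ?e3 \<phi>)"
      by (simp add: dirichlet_energy_def sum_Basis_3 L2_mass_def)
    moreover have "energy_on ?K \<phi> = mass_on ?K (partial_deriv ?e1 \<phi>) + mass_on ?K (partial_deriv ?e2 \<phi>) + mass_on ?K (partial_deriv ?e3 \<phi>)"
      by (simp add: energy_on_def sum_Basis_3)
    ultimately show "lam * L2_mass \<phi> \<le> dirichlet_energy \<phi> + (\<Sum>f\<leftarrow>fs. (cmod (LINT x|lborel. \<phi> x * f x))\<^sup>2)"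
      using 3 4 5 6 7 fs(2)[OF U] arm_inequality[OF \<phi>, folded lam_def] by linarith
  qed simp
  then show ?thesis unfolding lam_def by blast
qed

end

section \<open>Trial functions on the spatial cross\<close>

text \<open>Makes the loss from shrinking a planar function to width 1 - 2 x linear in x, with a
  constant that depends on no other parameter.\<close>

lemma rescaled_energy_bound:
  fixes \<Lambda> x :: real
  assumes "0 \<le> \<Lambda>" "\<Lambda> \<le> pi\<^sup>2" "0 \<le> x" "x \<le> 1/4"
  shows "(\<Lambda> + x) / (1 - 2 * x)\<^sup>2 \<le> \<Lambda> + (13 + 12 * pi\<^sup>2) * x"
proof -
  \<comment> \<open>The product equals (1 + 12 x) (1 - 2 x)^2 - 1; its zero at x = 1/4 is the reason
    for the 12. The 13 arises as 1 + 12, from x + 12 x^2 with x \<le> 1.\<close>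
  have "0 \<le> 4 * x * ((1 - 4 * x) * (2 - 3 * x))" using assms by (intro mult_nonneg_nonneg) auto
  then have "1 \<le> (1 + 12 * x) * (1 - 2 * x)\<^sup>2" by (simp add: power2_eq_square algebra_simps)
  then have "(\<Lambda> + x) * 1 \<le> (\<Lambda> + x) * ((1 + 12 * x) * (1 - 2 * x)\<^sup>2)" using assms by (intro mult_left_mono) auto
  moreover have "(1 - 2 * x)\<^sup>2 > 0" using assms by (intro zero_less_power) auto
  ultimately have "(\<Lambda> + x) / (1 - 2 * x)\<^sup>2 \<le> (\<Lambda> + x) * (1 + 12 * x)" by (simp add: pos_divide_le_eq mult.assoc)
  also have "\<dots> = \<Lambda> + x + 12 * (\<Lambda> * x) + 12 * (x * x)" by (simp add: algebra_simps)
  also have "\<dots> \<le> \<Lambda> + x + 12 * (pi\<^sup>2 * x) + 12 * (1 * x)" using assms by (intro add_mono mult_left_mono mult_right_mono) auto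
  finally show ?thesis by (simp add: algebra_simps)
qed

context section_domain
begin

text \<open>At height t the stretched rhombus has half-width 1/2 - t / H, so the planar cross of
  half-width w / 2 = 1/2 - L / H fits at every level below L. Shrinking divides the planar quotient
  by w^2, and the vertical profiles contribute \<kappa> (N / L)^2. As the supports are disjoint, the
  bound for one product holds on the span.\<close>

lemma trial_functions:
  fixes L \<kappa> :: real and \<beta> :: "real \<Rightarrow> complex"
  assumes HL: "H = L ^ 3" and L: "L \<ge> 2" and N: "N \<ge> 1"
    and \<beta>: "\<beta> \<in> test_functions {0<..<1}" "L2_mass \<beta> > 0" "dirichlet_energy \<beta> = \<kappa> * L2_mass \<beta>"
    and \<kappa>: "\<kappa> \<ge> 0"
    and m: "m = Lambda_Pi + (13 + 12 * pi\<^sup>2 + \<kappa> * (real N)\<^sup>2) / L\<^sup>2" "m < lambda_dagger \<omega> H"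
  shows "enat N \<le> total_multiplicity (cross_waveguide \<omega> H) {\<nu> \<in> discrete_spectrum (cross_waveguide \<omega> H) (lambda_dagger \<omega> H). \<nu> \<le> m}"
proof -
  \<comment> \<open>With H = L^3 this is also L / H. Besides measuring the loss of width it is the
    tolerance with which the planar eigenfunction is approximated.\<close>
  define x where "x = 1 / L\<^sup>2"
  define w where "w = 1 - 2 * x"
  \<comment> \<open>Scaling factor of the vertical profile: the j-th bump occupies the interval from
    j / d to (j + 1) / d, and N of them reach up to N / d = L.\<close>
  define d where "d = real N / L"
  have L0: "L > 0" using L by simp
  have "2\<^sup>2 \<le> L\<^sup>2" using L by (intro power_mono) auto
  then have x: "0 < x" "x \<le> 1/4" using L0 by (auto simp: x_def field_simps)
  then have w: "w > 0" by (simp add: w_def)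
  have d: "d > 0" using N L0 by (simp add: d_def)
  have LH: "L / H = x" using L0 by (simp add: HL x_def power3_eq_cube power2_eq_square)
  have \<Lambda>: "0 < Lambda_Pi" "Lambda_Pi < pi\<^sup>2" "is_eigenvalue planar_cross Lambda_Pi"
    using Lambda_Pi_eigenvalue by (auto simp: discrete_spectrum_def)
  obtain \<psi> where \<psi>: "\<psi> \<in> test_functions planar_cross" "L2_mass \<psi> > 0" "dirichlet_energy \<psi> \<le> (Lambda_Pi + x) * L2_mass \<psi>"
    by (rule dirichlet_domain.eigenvalue_approx[OF planar_cross_domain \<Lambda>(3) x(1)])
  let ?\<psi> = "\<lambda>p. \<psi> (0 + (1/w) *\<^sub>R p)" and ?D = "{p. 0 + (1/w) *\<^sub>R p \<in> planar_cross}"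
  have w1: "1/w > 0" using w by simp
  note sc = scaled_test_function[OF w1 \<psi>(1), of 0]
  let ?\<eta> = "\<lambda>j t. \<beta> (- real j + d *\<^sub>R t)" and ?I = "\<lambda>j. {t. - real j + d *\<^sub>R t \<in> {0<..<1}}"
  note sb = scaled_test_function[OF d \<beta>(1)]
  let ?P = "\<lambda>y::real^3. vector [y$1, y$2] :: real^2" and ?Q = "\<lambda>y::real^3. y$3"
  have PQ: "?P (layer (p, t)) = p" "?Q (layer (p, t)) = t" "layer (?P y, ?Q y) = y" for p t y
    by (auto simp: layer_def vec_eq_iff forall_2 forall_3)
  have lin: "linear ?P" "linear ?Q" by (auto intro!: linearI simp: vec_eq_iff forall_2)
  let ?v = "\<lambda>j y. ?\<psi> (?P y) * ?\<eta> j (?Q y)"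
  \<comment> \<open>The condition on the vertical coordinate is kept in the set, so that the N sets
    are pairwise disjoint while each lies in the cross.\<close>
  let ?J = "\<lambda>j. cross_waveguide \<omega> H \<inter> {y. ?Q y \<in> ?I j}"
  have mem: "layer (p, t) \<in> ?J j" if p: "p \<in> ?D" and t: "t \<in> ?I j" and j: "j < N" for p t j
  proof -
    have t1: "real j < d * t" "d * t < real j + 1" using t by auto
    then have "0 < d * t" by (intro order.strict_trans1[OF _ t1(1)]) simp
    then have t0: "t > 0" using d by (simp add: zero_less_mult_iff)
    have "real j + 1 \<le> real N" using j by linarith
    then have "d * t < real N" using t1(2) by linarith
    then have "t < L" using L0 N by (simp add: d_def field_simps)
    then have "inverse H * t < L / H" using H_pos by (simp add: field_simps)
    then have th: "\<bar>inverse H * t\<bar> < x" using t0 H_pos LH by (simp add: abs_mult)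
    have "\<bar>p$1\<bar> < w/2 \<or> \<bar>p$2\<bar> < w/2" using p w by (auto simp: planar_cross_def abs_mult field_simps)
    \<comment> \<open>The two coordinates are below w / 2 and x in absolute value, and w / 2 + x =
      1/2.\<close>
    then have "vector [p$1, inverse H * t] \<in> omega_rhombus \<or> vector [p$2, inverse H * t] \<in> omega_rhombus"
      using th by (auto simp: omega_rhombus_def w_def)
    then show ?thesis using rhombus t
      by (auto simp: cross_waveguide_def waveguide_1_def waveguide_2_def layer_def)
  qed
  have te: "?v j \<in> test_functions (?J j)" "L2_mass (?v j) = L2_mass ?\<psi> * L2_mass (?\<eta> j)"
    "dirichlet_energy (?v j) = dirichlet_energy ?\<psi> * L2_mass (?\<eta> j) + L2_mass ?\<psi> * dirichlet_energy (?\<eta> j)" if "j < N" for j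
    using tensor_test_function[OF layer_iso PQ lin sc(1) sb(1)[of "- real j"] mem[OF _ _ that]] by blast+
  have dis: "?J i \<inter> ?J j = {}" if "i \<noteq> j" for i j :: nat
  proof -
    have "False" if "real i < s" "s < real i + 1" "real j < s" "s < real j + 1" for s :: real
    proof -
      have "real i < real j + 1" "real j < real i + 1" using that by linarith+
      then show False using \<open>i \<noteq> j\<close> by linarith
    qed
    then show ?thesis by fastforce
  qed
  define a where "a = L2_mass \<psi>" define b where "b = L2_mass \<beta>"
  \<comment> \<open>The common mass of all N functions: shrinking the plane by w gives w^2,
    compressing the profile by d gives 1 / d, and the shift by j changes nothing.\<close>
  define M where "M = a * w\<^sup>2 * (b / d)"
  have ab: "a > 0" "b > 0" using \<psi> \<beta> by (auto simp: a_def b_def)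
  have M: "M > 0" using ab w d by (simp add: M_def)
  have mass: "L2_mass (?v j) = M" if "j < N" for j
    unfolding te(2)[OF that] sc(2) sb(2) M_def a_def b_def using w by (simp add: power_divide)
  have energy: "dirichlet_energy (?v j) \<le> m * M" if "j < N" for j
  proof -
    have "dirichlet_energy (?v j) = dirichlet_energy \<psi> * (b / d) + a * w\<^sup>2 * (d\<^sup>2 * (\<kappa> * b) / d)"
      unfolding te(3)[OF that] sc(2,3) sb(2,3) a_def b_def \<beta>(3) using w by (simp add: power_divide)
    also have "\<dots> \<le> ((Lambda_Pi + x) * a) * (b / d) + a * w\<^sup>2 * (d\<^sup>2 * (\<kappa> * b) / d)"
      using \<psi>(3) ab d by (intro add_right_mono mult_right_mono) (auto simp: a_def)
    also have "\<dots> = ((Lambda_Pi + x) / w\<^sup>2 + d\<^sup>2 * \<kappa>) * M"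
      using w d by (simp add: M_def field_simps)
    also have "\<dots> \<le> m * M"
    proof (rule mult_right_mono)
      have "(Lambda_Pi + x) / w\<^sup>2 \<le> Lambda_Pi + (13 + 12 * pi\<^sup>2) * x"
        unfolding w_def using \<Lambda> x by (intro rescaled_energy_bound) auto
      moreover have "d\<^sup>2 * \<kappa> = \<kappa> * (real N)\<^sup>2 * x" by (simp add: d_def x_def power_divide)
      moreover have "m = Lambda_Pi + (13 + 12 * pi\<^sup>2) * x + \<kappa> * (real N)\<^sup>2 * x" by (simp add: m(1) x_def add_divide_distrib)
      ultimately show "(Lambda_Pi + x) / w\<^sup>2 + d\<^sup>2 * \<kappa> \<le> m" by linarith
    qed (use M in simp)
    finally show ?thesis .
  qed
  have S: "L2_mass (\<lambda>y. \<Sum>j<N. c j * ?v j y) = (\<Sum>j<N. (cmod (c j))\<^sup>2 * L2_mass (?v j))"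
    "dirichlet_energy (\<lambda>y. \<Sum>j<N. c j * ?v j y) = (\<Sum>j<N. (cmod (c j))\<^sup>2 * dirichlet_energy (?v j))" for c
    by (rule L2_mass_disjoint[of N ?v ?J c]; use te(1) dis in blast)+
  obtain k f where D: "dirichlet_domain (cross_waveguide \<omega> H) k f (lambda_dagger \<omega> H) (4/25)" using cross_domain by blast
  show ?thesis
  proof (rule dirichlet_domain.total_multiplicity_ge[OF D])
    show "?v j \<in> test_functions (cross_waveguide \<omega> H)" if "j < N" for j
      using te(1)[OF that] test_functions_mono[of "?J j" "cross_waveguide \<omega> H"] by blast
    show "L2_mass (\<lambda>y. \<Sum>j<N. c j * ?v j y) > 0" if nz: "\<exists>j<N. c j \<noteq> 0" for c
    proof -
      have "(\<Sum>j<N. (cmod (c j))\<^sup>2 * L2_mass (?v j)) > 0"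
      proof -
        obtain i where i: "i < N" "c i \<noteq> 0" using nz by blast
        show ?thesis
        proof (rule sum_pos2[of _ i])
          show "0 < (cmod (c i))\<^sup>2 * L2_mass (?v i)" using i M mass by simp
          show "0 \<le> (cmod (c j))\<^sup>2 * L2_mass (?v j)" if "j \<in> {..<N}" for j using that M mass by simp
        qed (use i in auto)
      qed
      then show ?thesis unfolding S(1) .
    qed
    show "dirichlet_energy (\<lambda>y. \<Sum>j<N. c j * ?v j y) \<le> m * L2_mass (\<lambda>y. \<Sum>j<N. c j * ?v j y)" for c
    proof -
      have "(\<Sum>j<N. (cmod (c j))\<^sup>2 * dirichlet_energy (?v j)) \<le> (\<Sum>j<N. m * ((cmod (c j))\<^sup>2 * L2_mass (?v j)))"
        using mult_left_mono[OF energy, of _ "(cmod (c _))\<^sup>2"] mass by (intro sum_mono) (simp add: mult_ac)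
      then show ?thesis unfolding S sum_distrib_left .
    qed
  qed (rule m(2))
qed

end

theorem theorem2p1:
  fixes \<omega> :: "(real^2) set" and \<alpha> :: real and N :: nat
  assumes "(\<omega> = omega_rhombus \<and> \<alpha> = 2/3) \<or> (\<omega> = omega_disc \<and> \<alpha> = 1/2)"
    and "N \<ge> 1"
  shows "\<exists>H\<^sub>N>0. \<exists>C\<^sub>N>0. \<forall>H>H\<^sub>N.
           number_discrete \<omega> H \<ge> enat N \<and>
           lambda_H \<omega> H N < Lambda_Pi + C\<^sub>N * H powr (-\<alpha>) \<and>
           Lambda_Pi + C\<^sub>N * H powr (-\<alpha>) < pi\<^sup>2 \<and>
           pi\<^sup>2 < lambda_dagger \<omega> H"
proof -
  have \<alpha>: "0 < \<alpha>" "\<alpha> \<le> 2/3" using assms(1) by auto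
  have gap: "0 < pi\<^sup>2 - Lambda_Pi" using Lambda_Pi_eigenvalue by (simp add: discrete_spectrum_def)
  obtain \<beta> :: "real \<Rightarrow> complex" where \<beta>: "\<beta> \<in> test_functions {0<..<1}" "L2_mass \<beta> > 0"
    using exists_test_function[of "{0<..<1::real}" "1/2"] by auto
  define \<kappa> where "\<kappa> = dirichlet_energy \<beta> / L2_mass \<beta>"
  have \<kappa>: "\<kappa> \<ge> 0" "dirichlet_energy \<beta> = \<kappa> * L2_mass \<beta>"
    using \<beta> energy_on_nonneg[of UNIV \<beta>] by (simp_all add: \<kappa>_def mass_on_UNIV)
  \<comment> \<open>The total coefficient of 1 / L^2 in the bound for the trial space. The
    conclusion is proved with C + 1, where the extra 1 makes the inequality for the N-th eigenvalue
    strict.\<close>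
  define C where "C = 13 + 12 * pi\<^sup>2 + \<kappa> * (real N)\<^sup>2"
  have C: "C > 0" using \<kappa>(1) by (simp add: C_def add_pos_nonneg)
  \<comment> \<open>The 8 makes L = H powr (1/3) at least 2, hence 1 / L^2 \<le> 1/4; the other
    bound makes the correction with C + 1 smaller than the gap between \<open>Lambda_Pi\<close> and
    pi^2.\<close>
  define H0 where "H0 = max 8 (((C + 1) / (pi\<^sup>2 - Lambda_Pi)) powr (1 / \<alpha>))"
  have concl: "number_discrete \<omega> H \<ge> enat N \<and> lambda_H \<omega> H N < Lambda_Pi + (C + 1) * H powr (-\<alpha>) \<and>
           Lambda_Pi + (C + 1) * H powr (-\<alpha>) < pi\<^sup>2 \<and> pi\<^sup>2 < lambda_dagger \<omega> H" if H: "H > H0" for H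
  proof -
    have H8: "H > 8" using H by (simp add: H0_def)
    have "section_domain \<omega> H" using assms(1) H8 section_domain_rhombus section_domain_disc by auto
    then interpret section_domain \<omega> H .
    define L where "L = H powr (1/3)"
    have L3: "H = L ^ 3" using H8 by (simp add: L_def powr_power)
    have L2: "L \<ge> 2"
    proof (rule ccontr)
      assume "\<not> L \<ge> 2"
      then have "L ^ 3 \<le> 2 ^ 3" by (intro power_mono) (auto simp: L_def)
      then show False using H8 L3 by simp
    qed
    have "1 / L\<^sup>2 = H powr (- (2/3))" using H8 by (simp add: L_def powr_power powr_minus_divide)
    \<comment> \<open>For H > 1 a smaller exponent gives a larger right-hand side, so both values of
      \<alpha> are covered.\<close>
    also have "\<dots> \<le> H powr (- \<alpha>)" using \<alpha> H8 by (intro powr_mono) auto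
    finally have x: "1 / L\<^sup>2 \<le> H powr (- \<alpha>)" .
    have "((C + 1) / (pi\<^sup>2 - Lambda_Pi)) powr (1 / \<alpha>) < H" using H by (simp add: H0_def)
    then have "(((C + 1) / (pi\<^sup>2 - Lambda_Pi)) powr (1 / \<alpha>)) powr \<alpha> < H powr \<alpha>"
      using \<alpha> by (intro powr_less_mono2) auto
    then have "(C + 1) / (pi\<^sup>2 - Lambda_Pi) < H powr \<alpha>" using \<alpha> C gap by (simp add: powr_powr)
    then have "(C + 1) < H powr \<alpha> * (pi\<^sup>2 - Lambda_Pi)" using gap by (simp add: pos_divide_less_eq)
    then have gap': "(C + 1) * H powr (- \<alpha>) < pi\<^sup>2 - Lambda_Pi"
      using H8 by (simp add: powr_minus_divide pos_divide_less_eq mult.commute)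
    define m where "m = Lambda_Pi + C / L\<^sup>2"
    have "C / L\<^sup>2 \<le> C * H powr (- \<alpha>)" using mult_left_mono[OF x, of C] C by simp
    moreover have "0 < H powr (- \<alpha>)" using H8 by simp
    ultimately have m: "m < Lambda_Pi + (C + 1) * H powr (- \<alpha>)" unfolding m_def distrib_right by linarith
    \<comment> \<open>m lies below pi^2 and thus below \<open>lambda_dagger\<close>, so the N
      eigenvalues provided by the trial space belong to the discrete spectrum.\<close>
    then have mlam: "m < lambda_dagger \<omega> H" using gap' lambda_dagger_gt by linarith
    have T: "enat N \<le> total_multiplicity (cross_waveguide \<omega> H) {\<nu> \<in> discrete_spectrum (cross_waveguide \<omega> H) (lambda_dagger \<omega> H). \<nu> \<le> m}"
      by (rule trial_functions[OF L3 L2 assms(2) \<beta> \<kappa>(2,1) _ mlam]) (simp add: m_def C_def)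
    obtain k f where D: "dirichlet_domain (cross_waveguide \<omega> H) k f (lambda_dagger \<omega> H) (4/25)" using cross_domain by blast
    have "enat N \<le> number_discrete \<omega> H"
      unfolding number_discrete_def by (rule order_trans[OF T dirichlet_domain.total_multiplicity_mono[OF D]]) auto
    moreover have "lambda_H \<omega> H N \<le> m"
      unfolding lambda_H_def by (rule dirichlet_domain.nth_discrete_eigenvalue_le[OF D assms(2) T])
    ultimately show ?thesis using m gap' lambda_dagger_gt by auto
  qed
  have "H0 > 0" "C + 1 > 0" using C by (auto simp: H0_def)
  then show ?thesis using concl by blast
qed

end
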